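(* Let $d\in\mathbb{N}_{>0}$, $\beta>0$, $K>0$, and for each $n\ge2$ and $p^\star\in\mathcal{F}_\beta$ let $(X_1,\dots,X_n)$ be an i.i.d. sample of law $p^\star$. Let $\hat g$ be the GAN estimator $$\hat g\in\operatorname*{arg\,min}_{g\in\mathcal{G}}\ d_{\mathcal{D}}(p^\star_n,g_{\#}\gamma_d),\qquad p^\star_n=\frac1n\sum_{i=1}^n\delta_{X_i},$$ with the generator class $\mathcal{G}$ and the discriminator class $\mathcal{D}=\mathcal{H}^{d/2}_1(\mathbb{R}^d,\mathbb{R})$ given in the context. Then for every $\gamma>0$ the estimator is minimax optimal up to logarithmic factors for the IPM $d_{\mathcal{H}^\gamma_1}$, i.e. there are constants $C,C_2>0$ not depending on $n$ such that for all $n\ge2$ $$\sup_{p^\star\in\mathcal{F}_\beta}\mathbb{E}_{X_i}\big[d_{\mathcal{H}^\gamma_1}(\hat g_{\#}\gamma_d,p^\star)\big]\le C\log(n)^{C_2}\ \inf_{\hat\theta\in\Theta}\ \sup_{p^\star\in\mathcal{F}_\beta}\mathbb{E}_{X_i}\big[d_{\mathcal{H}^\gamma_1}(\hat\theta,p^\star)\big],$$ where $\Theta$ denotes the set of all possible estimators of $p^\star$ based on an $n$-sample.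
   Context: $\gamma_d$ is the standard Gaussian measure on $\mathbb{R}^d$ (and its density). $T_{\#}\mu$ is the push-forward of $\mu$ by $T$; a measure and its Lebesgue density are denoted by the same letter. $\lfloor\eta\rfloor=\max\{k\in\mathbb{N}_0: k\le\eta\}$. Hölder spaces: for $\eta\ge0$, $\alpha\ge 0$ and a real function $g$, put $$\|g\|_{\eta-\lfloor\eta\rfloor,\alpha}=\sup_{x\ne y}\frac{|g(x)-g(y)|}{\|x-y\|^{\eta-\lfloor\eta\rfloor}}\log\Big(\big(\|x-y\|\wedge\tfrac12\big)^{-1}\Big)^{\alpha}.$$ For open subsets $\mathcal{X},\mathcal{Y}$ of Euclidean spaces and $K>0$, $\mathcal{H}^{\eta,\alpha}_K(\mathcal{X},\mathcal{Y})$ is the set of $f=(f_1,\dots,f_m):\mathcal{X}\to\mathcal{Y}$ in $C^{\lfloor\eta\rfloor}(\mathcal{X},\mathcal{Y})$ (the $\lfloor\eta\rfloor$ times differentiable functions, almost everywhere) with $$\max_i\Big(\sum_{|\nu|\le\lfloor\eta\rfloor}\|\partial^\nu f_i\|_{L^\infty}+\sum_{|\nu|=\lfloor\eta\rfloor}\|\partial^\nu f_i\|_{\eta-\lfloor\eta\rfloor,\alpha}\Big)\le K,$$ $\nu$ ranging over multi-indices. $\mathcal{H}^{\eta}_K:=\mathcal{H}^{\eta,0}_K$; matrix-valued maps are treated through their components. Integral probability metrics: for a class $\mathcal{D}$ of functions $\mathbb{R}^d\to\mathbb{R}$, $d_{\mathcal{D}}(\mu,\nu)=\sup_{D\in\mathcal{D}}(\mathbb{E}_\mu[D]-\mathbb{E}_\nu[D])$;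 $d_{\mathcal{H}^\gamma_1}$ is the case $\mathcal{D}=\mathcal{H}^\gamma_1(\mathbb{R}^d,\mathbb{R})$. Density class: with $\mathbb{M}$ the set of symmetric $d\times d$ matrices $M$ with $K^{-1}\mathrm{Id}\preceq M\preceq K\mathrm{Id}$, $$\mathcal{F}_\beta=\Big\{p:\mathbb{R}^d\to\mathbb{R}\ \Big|\ p(x)=\gamma_d(\Sigma^{-1/2}x)\exp(a(x)),\ \Sigma\in\mathbb{M},\ \int p=1,\ a\in\mathcal{H}^{\beta,2}_K(\mathbb{R}^d,\mathbb{R})\Big\}.$$ Generator class: $$\mathcal{G}=\Big\{g\in C^{\lfloor\beta\rfloor+1}(\mathbb{R}^d,\mathbb{R}^d)\ \Big|\ \|g(0)\|\le C_0,\ \nabla g\in\mathcal{H}^\beta_{C_0}(\mathbb{R}^d),\ \inf_{x\in\mathbb{R}^d}\min_{v\in\mathbb{S}^{d-1}}\|\nabla g(x)v\|\ge L^{-1}\Big\},$$ where $L,C_0>0$ are fixed constants depending only on $\beta,d,K$, chosen large enough that every $p\in\mathcal{F}_\beta$ can be written $p=T_{\#}\gamma_d$ with a diffeomorphism $T\in\mathcal{G}$ satisfying $\nabla T^{-1}\in\mathcal{H}^\beta_L$ (such constants exist). It is assumed that $\hat g$ is a (measurable) minimizer. *)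

theory Defs
  imports "HOL-Probability.Probability"
begin

section \<open>Hoelder classes\<close>

definition mi_order :: "('n::finite \<Rightarrow> nat) \<Rightarrow> nat" where
  "mi_order \<nu> = (\<Sum>i\<in>UNIV. \<nu> i)"

text \<open>
  \<open>is_jet k f D\<close> says that \<open>f\<close> is \<open>k\<close> times differentiable with partial derivatives
  \<open>\<partial>\<^sup>\<nu> f = D \<nu>\<close> for \<open>|\<nu>| \<le> k\<close>, where the derivatives of order \<open>k\<close> are only asked to exist
  almost everywhere. For that to be a meaningful condition the derivatives of order \<open>k - 1\<close>
  are required to be locally Lipschitz: a merely almost everywhere differentiable function is
  not controlled by its derivative (step functions, Cantor functions).
  The values of \<open>D \<nu>\<close> for \<open>|\<nu>| > k\<close> are irrelevant; for \<open>|\<nu>| = k \<ge> 1\<close> the function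
  \<open>D \<nu>\<close> is a version of an almost everywhere defined function.
\<close>

definition is_jet ::
  "nat \<Rightarrow> (real^'n \<Rightarrow> real) \<Rightarrow> (('n::finite \<Rightarrow> nat) \<Rightarrow> real^'n \<Rightarrow> real) \<Rightarrow> bool" where
  "is_jet k f D \<longleftrightarrow>
     D (\<lambda>_. 0) = f \<and>
     (\<forall>\<nu>. mi_order \<nu> + 1 < k \<longrightarrow>
        (\<forall>x. (D \<nu> has_derivative (\<lambda>h. \<Sum>i\<in>UNIV. D (\<nu>(i := \<nu> i + 1)) x * h $ i)) (at x))) \<and>
     (\<forall>\<nu>. mi_order \<nu> + 1 = k \<longrightarrow>
        (\<forall>x. \<exists>r>0. \<exists>B. B-lipschitz_on (ball x r) (D \<nu>)) \<and>
        (AE x in lebesgue.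
           (D \<nu> has_derivative (\<lambda>h. \<Sum>i\<in>UNIV. D (\<nu>(i := \<nu> i + 1)) x * h $ i)) (at x)))"

definition times_differentiable :: "nat \<Rightarrow> (real^'n::finite \<Rightarrow> real) \<Rightarrow> bool" where
  "times_differentiable k f \<longleftrightarrow> (\<exists>D. is_jet k f D)"

definition Linf_norm :: "(real^'n::finite \<Rightarrow> real) \<Rightarrow> ennreal" where
  "Linf_norm f = esssup lebesgue (\<lambda>x. ennreal \<bar>f x\<bar>)"

definition holder_seminorm :: "real \<Rightarrow> real \<Rightarrow> (real^'n::finite \<Rightarrow> real) \<Rightarrow> ennreal" where
  "holder_seminorm s \<alpha> f =
     (SUP (x, y)\<in>{(x, y). x \<noteq> y}.
        ennreal (\<bar>f x - f y\<bar> / norm (x - y) powr s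
                 * ln (inverse (min (norm (x - y)) (1/2))) powr \<alpha>))"

definition holder_class :: "real \<Rightarrow> real \<Rightarrow> real \<Rightarrow> (real^'n::finite \<Rightarrow> real) set" where
  "holder_class \<eta> \<alpha> K = {f. \<exists>D.
     is_jet (nat \<lfloor>\<eta>\<rfloor>) f D \<and>
     (\<Sum>\<nu> | mi_order \<nu> \<le> nat \<lfloor>\<eta>\<rfloor>. Linf_norm (D \<nu>))
     + (\<Sum>\<nu> | mi_order \<nu> = nat \<lfloor>\<eta>\<rfloor>. holder_seminorm (\<eta> - of_int \<lfloor>\<eta>\<rfloor>) \<alpha> (D \<nu>)) \<le> ennreal K}"

text \<open>Both the maximum over components in the norm and the treatment of matrix-valued maps
  amount to a componentwise condition.\<close>

definition jacobian_holder ::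
  "real \<Rightarrow> real \<Rightarrow> (real^'n::finite \<Rightarrow> real^'m::finite) \<Rightarrow> bool" where
  "jacobian_holder \<eta> K g \<longleftrightarrow>
     (\<forall>x. g differentiable (at x)) \<and>
     (\<forall>i j. (\<lambda>x. jacobian g (at x) $ i $ j) \<in> holder_class \<eta> 0 K)"

section \<open>Integral probability metrics\<close>

definition ipm :: "('a \<Rightarrow> real) set \<Rightarrow> 'a measure \<Rightarrow> 'a measure \<Rightarrow> real" where
  "ipm \<D> \<mu> \<nu> = (SUP D\<in>\<D>. integral\<^sup>L \<mu> D - integral\<^sup>L \<nu> D)"

section \<open>The density class\<close>

definition gauss_density :: "real^'n::finite \<Rightarrow> real" where
  "gauss_density x = (\<Prod>i\<in>UNIV. std_normal_density (x $ i))"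

definition gauss_measure :: "(real^'n::finite) measure" where
  "gauss_measure = density lborel (\<lambda>x. ennreal (gauss_density x))"

definition prob_of_density :: "(real^'n::finite \<Rightarrow> real) \<Rightarrow> (real^'n) measure" where
  "prob_of_density p = density lborel (\<lambda>x. ennreal (p x))"

definition loewner_le :: "real^'n^'n \<Rightarrow> real^'n^'n::finite \<Rightarrow> bool" where
  "loewner_le A B \<longleftrightarrow> (\<forall>x. x \<bullet> (A *v x) \<le> x \<bullet> (B *v x))"

definition sym_between :: "real \<Rightarrow> (real^'n^'n::finite) set" where
  "sym_between K = {M. transpose M = M \<and> loewner_le (mat (inverse K)) M \<and> loewner_le M (mat K)}"

definition is_inverse_sqrt :: "real^'n^'n \<Rightarrow> real^'n^'n::finite \<Rightarrow> bool" where
  "is_inverse_sqrt S M \<longleftrightarrow> transpose S = S \<and> loewner_le 0 S \<and> S ** S = matrix_inv M"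

definition density_class :: "real \<Rightarrow> real \<Rightarrow> (real^'n::finite \<Rightarrow> real) set" where
  "density_class \<beta> K = {p. \<exists>M S a.
     M \<in> sym_between K \<and> is_inverse_sqrt S M \<and> a \<in> holder_class \<beta> 2 K \<and>
     p = (\<lambda>x. gauss_density (S *v x) * exp (a x)) \<and> integral\<^sup>L lborel p = 1}"

section \<open>The generator class\<close>

definition generator_class :: "real \<Rightarrow> real \<Rightarrow> real \<Rightarrow> (real^'n::finite \<Rightarrow> real^'n) set" where
  "generator_class \<beta> L C0 = {g.
     (\<forall>i. times_differentiable (nat \<lfloor>\<beta>\<rfloor> + 1) (\<lambda>x. g x $ i)) \<and>
     norm (g 0) \<le> C0 \<and>
     jacobian_holder \<beta> C0 g \<and>
     (INF x. INF v\<in>sphere 0 1. norm (jacobian g (at x) *v v)) \<ge> inverse L}"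

definition diffeomorphism :: "(real^'n::finite \<Rightarrow> real^'n) \<Rightarrow> bool" where
  "diffeomorphism T \<longleftrightarrow> bij T \<and>
     (\<forall>F\<in>{T, inv T}. (\<forall>x. F differentiable (at x)) \<and> continuous_on UNIV (\<lambda>x. jacobian F (at x)))"

definition admissible_constants :: "'n::finite itself \<Rightarrow> real \<Rightarrow> real \<Rightarrow> real \<Rightarrow> real \<Rightarrow> bool" where
  "admissible_constants _ \<beta> K L C0 \<longleftrightarrow> L > 0 \<and> C0 > 0 \<and>
     (\<forall>p\<in>(density_class \<beta> K :: (real^'n \<Rightarrow> real) set).
        \<exists>T\<in>generator_class \<beta> L C0. diffeomorphism T \<and> jacobian_holder \<beta> L (inv T) \<and>
           prob_of_density p = distr gauss_measure borel T)"

section \<open>Estimators\<close>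

text \<open>An \<open>n\<close>-sample is a point of the product space \<open>PiM {..<n}\<close>.\<close>

abbreviation sample_space :: "nat \<Rightarrow> (nat \<Rightarrow> real^'n::finite) measure" where
  "sample_space n \<equiv> PiM {..<n} (\<lambda>_. borel)"

definition sample_law :: "nat \<Rightarrow> (real^'n::finite \<Rightarrow> real) \<Rightarrow> (nat \<Rightarrow> real^'n) measure" where
  "sample_law n p = PiM {..<n} (\<lambda>_. prob_of_density p)"

definition empirical :: "nat \<Rightarrow> (nat \<Rightarrow> real^'n::finite) \<Rightarrow> (real^'n) measure" where
  "empirical n X = distr (uniform_count_measure {..<n}) borel X"

definition estimators :: "nat \<Rightarrow> ((nat \<Rightarrow> real^'n::finite) \<Rightarrow> (real^'n) measure) set" where
  "estimators n = sample_space n \<rightarrow>\<^sub>M prob_algebra borel"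

definition max_risk ::
  "real \<Rightarrow> real \<Rightarrow> real \<Rightarrow> nat \<Rightarrow> ((nat \<Rightarrow> real^'n::finite) \<Rightarrow> (real^'n) measure) \<Rightarrow> ennreal" where
  "max_risk \<beta> K \<gamma> n \<theta> =
     (SUP p\<in>density_class \<beta> K.
        \<integral>\<^sup>+X. ennreal (ipm (holder_class \<gamma> 0 1) (\<theta> X) (prob_of_density p)) \<partial>sample_law n p)"

text \<open>Measurability of the random map \<open>X \<mapsto> g X\<close> is that of all its evaluations; since
  generators are continuous, this is the same as joint measurability in \<open>(X, z)\<close>.\<close>

definition is_gan_estimator ::
  "real \<Rightarrow> real \<Rightarrow> real \<Rightarrow> nat \<Rightarrow> ((nat \<Rightarrow> real^'n::finite) \<Rightarrow> real^'n \<Rightarrow> real^'n) \<Rightarrow> bool" where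
  "is_gan_estimator \<beta> L C0 n g \<longleftrightarrow>
     (\<forall>z. (\<lambda>X. g X z) \<in> borel_measurable (sample_space n)) \<and>
     (\<forall>X\<in>space (sample_space n).
        is_arg_min
          (\<lambda>h. ipm (holder_class (real CARD('n) / 2) 0 1) (empirical n X) (distr gauss_measure borel h))
          (\<lambda>h. h \<in> generator_class \<beta> L C0)
          (g X))"

end

theory Submission
 imports Defs
begin

text \<open>
 Write \<open>r\<close> for the maximum of \<open>n powr (- 1/2)\<close> and \<open>n powr (- (\<beta> + \<gamma>) / (2 * \<beta> + d))\<close>.

 Upper bound: at scale \<open>bw = n powr (- 1 / (2 * \<beta> + d))\<close> split a test function of smoothness
 \<open>\<gamma>\<close> into a mollification and a remainder. The mollification is a multiple of a discriminator,
 so on it the GAN distance is controlled by the minimality of the estimator and by the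
 empirical process over discriminators, which a multiscale smoothing argument bounds by
 \<open>n powr (- 1/2)\<close> up to a logarithm: smoothness \<open>d / 2\<close> is exactly critical. The remainder is
 an average of iterated differences of the test function. Half of them can be moved onto
 the law of the generator by changing variables, because every generator has a bounded
 inverse Jacobian, hence a density of smoothness \<open>\<beta>\<close>; this gains \<open>bw powr (\<beta> + \<gamma>)\<close>.

 Lower bound: Assouad's method with Gaussian densities tilted by bumps on a grid. Each bump sits
 either at a grid point or at its reflection through the origin, so that all hypotheses share
 one normalising constant.
\<close>

section \<open>Families bounded in a Hoelder space\<close>

text \<open>Every constant has to be uniform over generators and over test functions. Estimates are
  therefore stated for indexed families, with each bound quantified before the index, so that
  uniformity never requires explicit constants.

  Space is unbounded, and the pointwise bound on differences of a density cannot be integrated over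
  it. A uniform exponential moment of \<open>l1norm\<close> under all generated laws pays for the
  tails.

  In the upper bound the density class enters only through \<open>admissible_constants\<close>: the
  target is itself the law of a generator, so one smoothness estimate serves estimator and target
  alike, and minimality can be tested against the target. In the lower bound only identity
  covariance is used, which needs \<open>K \<ge> 1\<close>; for smaller \<open>K\<close> the class
  is empty.

  The logarithms have three sources: the number of dyadic scales in the empirical process, the
  truncation radius for the tails, and the squared logarithmic weight in the norm of the exponent
  \<open>a\<close>, which lowers the admissible height of the bumps.\<close>

abbreviation bmeas :: "('a::topological_space => 'b::topological_space) set" where
 "bmeas \<equiv> borel_measurable borel"

text \<open>A whole family bounded in the Hoelder space of order \<open>k + s\<close>, meant for
  \<open>0 < s \<le> 1\<close>. Each bound comes before the index \<open>i\<close> and is thus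
  uniform over \<open>I\<close>; derivatives exist everywhere. Above level 0 no Hoelder condition is
  put on \<open>F\<close> itself, since bounded derivatives imply it
  (\<open>holder_bdd_pred\<close>).\<close>

primrec holder_bdd ::
 "nat => real => 'i set => ('i => real^'n::finite => real) => bool" where
 "holder_bdd 0 s I F \<longleftrightarrow> (\<exists>B. \<forall>i\<in>I. \<forall>x. \<bar>F i x\<bar> \<le> B) \<and>
 (\<exists>B. \<forall>i\<in>I. \<forall>x y. \<bar>F i x - F i y\<bar> \<le> B * norm (x - y) powr s)"
| "holder_bdd (Suc k) s I F \<longleftrightarrow> (\<exists>B. \<forall>i\<in>I. \<forall>x. \<bar>F i x\<bar> \<le> B) \<and>
 (\<exists>F'. (\<forall>i\<in>I. \<forall>x. (F i has_derivative (%h. \<Sum>j\<in>UNIV. F' j i x * h $ j)) (at x)) \<and>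
 (\<forall>j. holder_bdd k s I (F' j)))"

lemma holder_bdd_bounded:
 fixes F :: "'i => real^'n::finite => real"
 assumes "holder_bdd k s I F"
 obtains B where "B > 0" "!!i x. i \<in> I ==> \<bar>F i x\<bar> \<le> B"
proof -
 obtain B where "\<forall>i\<in>I. \<forall>x. \<bar>F i x\<bar> \<le> B" using assms by (cases k) auto
 then show ?thesis by (intro that[of "max B 1"]) (auto simp: le_max_iff_disj)
qed

lemma holder_bdd_SucE:
 assumes "holder_bdd (Suc k) s I F"
 obtains F' where "!!i x. i \<in> I ==> (F i has_derivative (%h. \<Sum>j\<in>UNIV. F' j i x * h $ j)) (at x)"
 "!!j. holder_bdd k s I (F' j)"
 using assms unfolding holder_bdd.simps by blast

lemma holder_bdd_reindex:
 "holder_bdd k s I F ==> (!!j. j \<in> J ==> h j \<in> I) ==> (!!j x. j \<in> J ==> G j x = F (h j) x) ==>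
 holder_bdd k s J G"
proof (induction k arbitrary: F G)
 case 0
 then show ?case by simp metis
next
 case (Suc k)
 obtain F' where F': "!!i x. i \<in> I ==> (F i has_derivative (%h. \<Sum>j\<in>UNIV. F' j i x * h $ j)) (at x)"
 "!!j. holder_bdd k s I (F' j)" by (rule holder_bdd_SucE[OF Suc.prems(1)], rule that)
 have G: "G j = F (h j)" if "j \<in> J" for j using Suc.prems(3)[OF that] by auto
 show ?case
 unfolding holder_bdd.simps
 proof (intro conjI exI[of _ "%l j. F' l (h j)"] ballI allI)
 show "\<exists>B. \<forall>i\<in>J. \<forall>x. \<bar>G i x\<bar> \<le> B" using Suc.prems by simp metis
 show "(G i has_derivative (%v. \<Sum>j\<in>UNIV. F' j (h i) x * v $ j)) (at x)" if "i \<in> J" for i x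
 using F'(1)[OF Suc.prems(2)[OF that]] by (simp add: G[OF that])
 show "holder_bdd k s J (%i. F' j (h i))" for j
 by (rule Suc.IH[OF F'(2) Suc.prems(2)]) auto
 qed
qed

lemma holder_bdd_cong:
 assumes "!!i x. i \<in> I ==> F i x = G i x"
 shows "holder_bdd k s I F \<longleftrightarrow> holder_bdd k s I G"
 using holder_bdd_reindex[of k s I F I "%i. i" G] holder_bdd_reindex[of k s I G I "%i. i" F] assms by auto

lemma abs_comp_le_norm: "\<bar>h $ j\<bar> \<le> norm (h :: real^'n::finite)"
 by (simp add: component_le_norm_cart)

lemma abs_sum_comp_le:
 fixes h :: "real^'n::finite" and B :: real
 assumes "!!j. \<bar>c j\<bar> \<le> B"
 shows "\<bar>\<Sum>j\<in>UNIV. c j * h $ j\<bar> \<le> CARD('n) * B * norm h"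
proof -
 have "\<bar>\<Sum>j\<in>UNIV. c j * h $ j\<bar> \<le> (\<Sum>j\<in>(UNIV::'n set). B * norm h)"
 by (rule order_trans[OF sum_abs], rule sum_mono, unfold abs_mult, rule mult_mono)
 (use assms abs_comp_le_norm order_trans[OF abs_ge_zero assms] in auto)
 then show ?thesis by simp
qed

lemma grad_bound_imp_lipschitz:
 fixes f :: "real^'n::finite => real" and B :: real
 assumes "!!x. (f has_derivative (%h. \<Sum>j\<in>UNIV. f' j x * h $ j)) (at x)" "!!j x. \<bar>f' j x\<bar> \<le> B"
 shows "\<bar>f x - f y\<bar> \<le> CARD('n) * B * norm (x - y)"
proof -
 have "norm (f x - f y) \<le> (CARD('n) * B) * norm (x - y)"
 proof (rule differentiable_bound[of UNIV])
 show "onorm (%h. \<Sum>j\<in>UNIV. f' j z * h $ j) \<le> CARD('n) * B" for z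
 by (rule onorm_le) (use abs_sum_comp_le[of "%j. f' j z" B] assms(2) in auto)
 qed (use assms(1) in \<open>auto intro: has_derivative_at_withinI\<close>)
 then show ?thesis by simp
qed

text \<open>Interpolation between a trivial bound and a Lipschitz bound:
  \<open>r \<le> r powr s\<close> as long as \<open>r \<le> 1\<close>, and
  \<open>1 \<le> r powr s\<close> beyond. In this way a bounded function with bounded gradient gets
  every Hoelder exponent up to 1.\<close>

lemma le_min_powr:
 fixes r :: real
 assumes "a \<le> B" "a \<le> C * r" "0 \<le> r" "0 < s" "s \<le> 1" "0 \<le> B" "0 \<le> C"
 shows "a \<le> (B + C) * r powr s"
proof (cases "r \<le> 1")
 case True
 have "r \<le> r powr s" using True assms powr_mono'[of s 1 r] by (cases "r = 0") auto
 then have "C * r \<le> C * r powr s" using assms by (auto intro!: mult_left_mono)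
 moreover have "0 \<le> B * r powr s" using assms by simp
 ultimately show ?thesis unfolding distrib_right using assms by linarith
next
 case False
 then have "1 \<le> r powr s" using assms by (simp add: ge_one_powr_ge_zero)
 then have "B \<le> B * r powr s" using assms mult_left_mono[of 1 "r powr s" B] by auto
 moreover have "0 \<le> C * r powr s" using assms by simp
 ultimately show ?thesis unfolding distrib_right using assms by linarith
qed

text \<open>Only the bottom level has content: there a gradient bound is interpolated with the bound
  on the function. Higher levels pass the claim on to the derivatives.\<close>

lemma holder_bdd_pred:
 assumes "0 < s" "s \<le> 1"
 shows "holder_bdd (Suc k) s I F ==> holder_bdd k s I F"
proof (induction k arbitrary: F)
 case 0
 obtain F' where F': "!!i x. i \<in> I ==> (F i has_derivative (%h. \<Sum>j\<in>UNIV. F' j i x * h $ j)) (at x)"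
 "!!j. holder_bdd 0 s I (F' j)" by (rule holder_bdd_SucE[OF 0], rule that)
 have "\<forall>j. \<exists>B. \<forall>i\<in>I. \<forall>x. \<bar>F' j i x\<bar> \<le> B" using F'(2) by simp
 then obtain Bj where Bj: "!!j i x. i \<in> I ==> \<bar>F' j i x\<bar> \<le> Bj j" by metis
 define B where "B = (\<Sum>j\<in>UNIV. \<bar>Bj j\<bar>)"
 have B: "\<bar>F' j i x\<bar> \<le> B" if "i \<in> I" for i j x
 proof -
 have "\<bar>Bj j\<bar> \<le> B" unfolding B_def by (rule member_le_sum) auto
 then show ?thesis using Bj[OF that, of j x] by linarith
 qed
 have B0: "0 \<le> B" by (auto simp: B_def intro: sum_nonneg)
 obtain B1 where B1: "B1 > 0" "!!i x. i \<in> I ==> \<bar>F i x\<bar> \<le> B1" by (rule holder_bdd_bounded[OF 0], rule that)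
 have "\<bar>F i x - F i y\<bar> \<le> (2 * B1 + CARD('b) * B) * norm (x - y) powr s" if "i \<in> I" for i x y
 proof (rule le_min_powr)
 show "\<bar>F i x - F i y\<bar> \<le> 2 * B1" using B1(2)[OF that, of x] B1(2)[OF that, of y] by linarith
 show "\<bar>F i x - F i y\<bar> \<le> real CARD('b) * B * norm (x - y)"
 by (rule grad_bound_imp_lipschitz[OF F'(1)[OF that] B[OF that]])
 qed (use assms B0 B1 in auto)
 then show ?case using B1(2) unfolding holder_bdd.simps by blast
next
 case (Suc k)
 obtain F' where F': "!!i x. i \<in> I ==> (F i has_derivative (%h. \<Sum>j\<in>UNIV. F' j i x * h $ j)) (at x)"
 "!!j. holder_bdd (Suc k) s I (F' j)" by (rule holder_bdd_SucE[OF Suc.prems], rule that)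
 show ?case unfolding holder_bdd.simps(2)[of k]
 using Suc.prems F' Suc.IH[OF F'(2)] by (intro conjI exI[of _ F']) auto
qed

lemma holder_bdd_mono:
 assumes "0 < s" "s \<le> 1" "holder_bdd k s I F" "l \<le> k"
 shows "holder_bdd l s I F"
 using assms(4,3) by (induction rule: inc_induct) (use holder_bdd_pred[OF assms(1,2)] in auto)

lemma holder_bdd_holder0:
 fixes F :: "'i => real^'n::finite => real" and s :: real
 assumes "holder_bdd k s I F" "0 < s" "s \<le> 1"
 obtains B where "B > 0" "!!i x y. i \<in> I ==> \<bar>F i x - F i y\<bar> \<le> B * norm (x - y) powr s"
proof -
 have "holder_bdd 0 s I F" by (rule holder_bdd_mono[OF assms(2,3,1)]) simp
 then obtain B where B: "!!i x y. i \<in> I ==> \<bar>F i x - F i y\<bar> \<le> B * norm (x - y) powr s"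
 unfolding holder_bdd.simps by blast
 show ?thesis
 proof (rule that[of "\<bar>B\<bar> + 1"])
 fix i and x y :: "real^'n" assume "i \<in> I"
 have "B * norm (x - y) powr s \<le> (\<bar>B\<bar> + 1) * norm (x - y) powr s" by (rule mult_right_mono) auto
 with B[OF \<open>i \<in> I\<close>, of x y] show "\<bar>F i x - F i y\<bar> \<le> (\<bar>B\<bar> + 1) * norm (x - y) powr s" by linarith
 qed auto
qed

lemma continuous_of_holder:
 fixes f :: "real^'n::finite => real"
 assumes "!!x y. \<bar>f x - f y\<bar> \<le> B * norm (x - y) powr s" "s > 0"
 shows "continuous_on A f"
proof (rule continuous_at_imp_continuous_on, intro ballI)
 fix x :: "real^'n"
 have "((%y. B * norm (y - x) powr s) \<longlongrightarrow> B * norm (x - x) powr s) (at x)"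
 using assms(2) by (intro tendsto_intros) auto
 then have "((%y. f y - f x) \<longlongrightarrow> 0) (at x)"
 by (intro Lim_null_comparison[of "%y. f y - f x" "%y. B * norm (y - x) powr s"])
 (use assms in auto)
 then show "isCont f x" unfolding isCont_def by (simp add: LIM_zero_iff)
qed

lemma holder_bdd_continuous:
 fixes F :: "'i => real^'n::finite => real"
 assumes "holder_bdd k s I F" "0 < s" "s \<le> 1" "i \<in> I"
 shows "continuous_on A (F i)"
proof -
 obtain B where B: "B > 0" "!!i x y. i \<in> I ==> \<bar>F i x - F i y\<bar> \<le> B * norm (x - y) powr s"
 by (rule holder_bdd_holder0[OF assms(1-3)], rule that)
 from continuous_of_holder[OF B(2)[OF assms(4)] assms(2)] show ?thesis by simp
qed

lemma holder_bdd_const: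
 fixes c :: "'i => real"
 assumes "!!i. i \<in> I ==> \<bar>c i\<bar> \<le> B"
 shows "holder_bdd k s I (%i (x :: real^'n::finite). c i)"
 using assms
proof (induction k arbitrary: c B)
 case 0
 then show ?case unfolding holder_bdd.simps by (intro conjI exI[of _ B] exI[of _ 0]) auto
next
 case (Suc k)
 show ?case unfolding holder_bdd.simps
 using Suc.prems Suc.IH[of "%_. 0" 0] by (intro conjI exI[of _ "%_ _ _. 0"]) auto
qed

lemma holder_bdd_add:
 assumes "holder_bdd k s I F" "holder_bdd k s I G"
 shows "holder_bdd k s I (%i x. F i x + G i x)"
 using assms
proof (induction k arbitrary: F G)
 case 0
 obtain B1 B2 where 1: "\<forall>i\<in>I. \<forall>x. \<bar>F i x\<bar> \<le> B1" "\<forall>i\<in>I. \<forall>x. \<bar>G i x\<bar> \<le> B2" using 0 by auto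
 obtain C1 C2 where 2: "\<forall>i\<in>I. \<forall>x y. \<bar>F i x - F i y\<bar> \<le> C1 * norm (x - y) powr s"
 "\<forall>i\<in>I. \<forall>x y. \<bar>G i x - G i y\<bar> \<le> C2 * norm (x - y) powr s" using 0 by auto
 have "\<bar>F i x + G i x\<bar> \<le> B1 + B2" if "i \<in> I" for i x using 1 that by (meson abs_triangle_ineq add_mono order_trans)
 moreover have "\<bar>F i x + G i x - (F i y + G i y)\<bar> \<le> (C1 + C2) * norm (x - y) powr s" if "i \<in> I" for i x y
 using 2(1)[rule_format, OF that, of x y] 2(2)[rule_format, OF that, of x y] by (simp add: algebra_simps)
 ultimately show ?case unfolding holder_bdd.simps by blast
next
 case (Suc k)
 obtain F' where F': "!!i x. i \<in> I ==> (F i has_derivative (%h. \<Sum>j\<in>UNIV. F' j i x * h $ j)) (at x)"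
 "!!j. holder_bdd k s I (F' j)" by (rule holder_bdd_SucE[OF Suc.prems(1)], rule that)
 obtain G' where G': "!!i x. i \<in> I ==> (G i has_derivative (%h. \<Sum>j\<in>UNIV. G' j i x * h $ j)) (at x)"
 "!!j. holder_bdd k s I (G' j)" by (rule holder_bdd_SucE[OF Suc.prems(2)], rule that)
 obtain B1 where 1: "B1 > 0" "!!i x. i\<in>I ==> \<bar>F i x\<bar> \<le> B1" by (rule holder_bdd_bounded[OF Suc.prems(1)], rule that)
 obtain B2 where 2: "B2 > 0" "!!i x. i\<in>I ==> \<bar>G i x\<bar> \<le> B2" by (rule holder_bdd_bounded[OF Suc.prems(2)], rule that)
 have "\<bar>F i x + G i x\<bar> \<le> B1 + B2" if "i \<in> I" for i x using 1(2)[OF that, of x] 2(2)[OF that, of x] by linarith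
 moreover have "((%x. F i x + G i x) has_derivative (%h. \<Sum>j\<in>UNIV. (F' j i x + G' j i x) * h $ j)) (at x)"
 if "i \<in> I" for i x
 using has_derivative_add[OF F'(1)[OF that, of x] G'(1)[OF that, of x]] by (simp add: sum.distrib algebra_simps)
 ultimately show ?case unfolding holder_bdd.simps
 using Suc.IH[OF F'(2) G'(2)] by (intro conjI exI[of _ "%j i x. F' j i x + G' j i x"]) auto
qed

lemma holder_bdd_mult:
 assumes s: "0 < s" "s \<le> 1"
 assumes "holder_bdd k s I F" "holder_bdd k s I G"
 shows "holder_bdd k s I (%i x. F i x * G i x)"
 using assms(3-)
proof (induction k arbitrary: F G)
 case 0
 obtain B1 where 1: "B1 > 0" "!!i x. i\<in>I ==> \<bar>F i x\<bar> \<le> B1" by (rule holder_bdd_bounded[OF 0(1)], rule that)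
 obtain B2 where 2: "B2 > 0" "!!i x. i\<in>I ==> \<bar>G i x\<bar> \<le> B2" by (rule holder_bdd_bounded[OF 0(2)], rule that)
 obtain C1 where 3: "C1 > 0" "!!i x y. i\<in>I ==> \<bar>F i x - F i y\<bar> \<le> C1 * norm (x - y) powr s"
 by (rule holder_bdd_holder0[OF 0(1) s], rule that)
 obtain C2 where 4: "C2 > 0" "!!i x y. i\<in>I ==> \<bar>G i x - G i y\<bar> \<le> C2 * norm (x - y) powr s"
 by (rule holder_bdd_holder0[OF 0(2) s], rule that)
 have "\<bar>F i x * G i x\<bar> \<le> B1 * B2" if "i \<in> I" for i x
 unfolding abs_mult using 1 2 that by (intro mult_mono) auto
 moreover have "\<bar>F i x * G i x - F i y * G i y\<bar> \<le> (B1 * C2 + B2 * C1) * norm (x - y) powr s" if "i \<in> I" for i x y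
 proof -
 have "F i x * G i x - F i y * G i y = F i x * (G i x - G i y) + (F i x - F i y) * G i y" by (simp add: algebra_simps)
 also have "\<bar>...\<bar> \<le> B1 * (C2 * norm (x - y) powr s) + (C1 * norm (x - y) powr s) * B2"
 by (rule order_trans[OF abs_triangle_ineq], unfold abs_mult, intro add_mono mult_mono)
 (use 1 2 3 4 that in auto)
 finally show ?thesis by (simp add: algebra_simps)
 qed
 ultimately show ?case unfolding holder_bdd.simps by blast
next
 case (Suc k)
 obtain F' where F': "!!i x. i \<in> I ==> (F i has_derivative (%h. \<Sum>j\<in>UNIV. F' j i x * h $ j)) (at x)"
 "!!j. holder_bdd k s I (F' j)" by (rule holder_bdd_SucE[OF Suc.prems(1)], rule that)
 obtain G' where G': "!!i x. i \<in> I ==> (G i has_derivative (%h. \<Sum>j\<in>UNIV. G' j i x * h $ j)) (at x)"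
 "!!j. holder_bdd k s I (G' j)" by (rule holder_bdd_SucE[OF Suc.prems(2)], rule that)
 obtain B1 where 1: "B1 > 0" "!!i x. i\<in>I ==> \<bar>F i x\<bar> \<le> B1" by (rule holder_bdd_bounded[OF Suc.prems(1)], rule that)
 obtain B2 where 2: "B2 > 0" "!!i x. i\<in>I ==> \<bar>G i x\<bar> \<le> B2" by (rule holder_bdd_bounded[OF Suc.prems(2)], rule that)
 have "\<bar>F i x * G i x\<bar> \<le> B1 * B2" if "i \<in> I" for i x
 unfolding abs_mult using 1 2 that by (intro mult_mono) auto
 moreover have "((%x. F i x * G i x) has_derivative (%h. \<Sum>j\<in>UNIV. (F i x * G' j i x + F' j i x * G i x) * h $ j)) (at x)"
 if "i \<in> I" for i x
 using has_derivative_mult[OF F'(1)[OF that, of x] G'(1)[OF that, of x]]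
 by (simp add: sum.distrib algebra_simps sum_distrib_left)
 moreover have "holder_bdd k s I (%i x. F i x * G' j i x + F' j i x * G i x)" for j
 by (rule holder_bdd_add[OF Suc.IH[OF holder_bdd_pred[OF s Suc.prems(1)] G'(2)] Suc.IH[OF F'(2) holder_bdd_pred[OF s Suc.prems(2)]]])
 ultimately show ?case unfolding holder_bdd.simps
 by (intro conjI exI[of _ "%j i x. F i x * G' j i x + F' j i x * G i x"]) auto
qed

lemma holder_bdd_cmult:
 assumes "holder_bdd k s I F" "0 < s" "s \<le> 1"
 shows "holder_bdd k s I (%i x. c * F i x)"
 by (rule holder_bdd_mult[OF assms(2,3) holder_bdd_const[of I "%_. c" "\<bar>c\<bar>"] assms(1)]) simp

lemma holder_bdd_sum:
 assumes "!!a. a \<in> A ==> holder_bdd k s I (F a)"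
 shows "holder_bdd k s I (%i x. \<Sum>a\<in>A. F a i x)"
 using assms holder_bdd_const[of I "%_. 0" 0 k s]
 by (induction A rule: infinite_finite_induct) (auto intro!: holder_bdd_add)

lemma holder_bdd_prod:
 assumes s: "0 < s" "s \<le> 1"
 assumes "!!a. a \<in> A ==> holder_bdd k s I (F a)"
 shows "holder_bdd k s I (%i x. \<Prod>a\<in>A. F a i x)"
 using assms(3) holder_bdd_const[of I "%_. 1" 1 k s]
 by (induction A rule: infinite_finite_induct) (auto intro!: holder_bdd_mult[OF s])

text \<open>Merges separate bounds for finitely many components, such as coordinates or matrix
  entries, into one. Monotonicity of \<open>P\<close> in the bound allows the sum of all of them;
  the extra 1 makes it positive.\<close>

lemma finite_family_bound:
 fixes P :: "'a::finite => real => bool"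
 assumes "!!a. \<exists>B. P a B" "!!a B C. P a B ==> B \<le> C ==> P a C"
 obtains B where "B > 0" "!!a. P a B"
proof -
 obtain f where f: "!!a. P a (f a)" using assms(1) by metis
 have "P a ((\<Sum>a\<in>UNIV. \<bar>f a\<bar>) + 1)" for a
 proof (rule assms(2)[OF f])
 have "\<bar>f a\<bar> \<le> (\<Sum>a\<in>UNIV. \<bar>f a\<bar>)" by (rule member_le_sum) auto
 then show "f a \<le> (\<Sum>a\<in>UNIV. \<bar>f a\<bar>) + 1" by linarith
 qed
 moreover have "(\<Sum>a\<in>UNIV. \<bar>f a\<bar>) + 1 > 0" by (intro add_nonneg_pos sum_nonneg) auto
 ultimately show ?thesis using that by blast
qed

lemma bound_weaken: "x \<le> B * v ==> B \<le> C ==> 0 \<le> v ==> x \<le> C * (v::real)"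
 using mult_right_mono[of B C v] by linarith

lemma holder_bdd_components_bounded:
 fixes F :: "'a::finite => 'i => real^'n::finite => real"
 assumes "!!j. holder_bdd k s I (F j)"
 obtains B where "B > 0" "!!j i x. i \<in> I ==> \<bar>F j i x\<bar> \<le> B"
proof -
 have 1: "\<exists>B. \<forall>i\<in>I. \<forall>x. \<bar>F j i x\<bar> \<le> B" for j using assms[of j] by (cases k) auto
 obtain B where "B > 0" "!!j. \<forall>i\<in>I. \<forall>x. \<bar>F j i x\<bar> \<le> B"
 proof (rule finite_family_bound[of "%j B. \<forall>i\<in>I. \<forall>x. \<bar>F j i x\<bar> \<le> B", OF 1])
 show "\<forall>i\<in>I. \<forall>x. \<bar>F j i x\<bar> \<le> C" if "\<forall>i\<in>I. \<forall>x. \<bar>F j i x\<bar> \<le> B" "B \<le> C" for j B C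
 using that by (meson order_trans)
 qed blast
 then show ?thesis using that by blast
qed

lemma holder_bdd_components_holder0:
 fixes F :: "'a::finite => 'i => real^'n::finite => real"
 assumes "!!j. holder_bdd k s I (F j)" "0 < s" "s \<le> 1"
 obtains B where "B > 0" "!!j i x y. i \<in> I ==> \<bar>F j i x - F j i y\<bar> \<le> B * norm (x - y) powr s"
proof -
 have 1: "\<exists>B. \<forall>i\<in>I. \<forall>x y. \<bar>F j i x - F j i y\<bar> \<le> B * norm (x - y) powr s" for j
 by (rule holder_bdd_holder0[OF assms(1)[of j] assms(2,3)]) auto
 obtain B where B: "B > 0" "!!j. \<forall>i\<in>I. \<forall>x y. \<bar>F j i x - F j i y\<bar> \<le> B * norm (x - y) powr s"
 proof (rule finite_family_bound[of "%j B. \<forall>i\<in>I. \<forall>x y. \<bar>F j i x - F j i y\<bar> \<le> B * norm (x - y) powr s", OF 1])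
 show "\<forall>i\<in>I. \<forall>x y. \<bar>F j i x - F j i y\<bar> \<le> C * norm (x - y) powr s"
 if "\<forall>i\<in>I. \<forall>x y. \<bar>F j i x - F j i y\<bar> \<le> B * norm (x - y) powr s" "B \<le> C" for j B C
 by (intro ballI allI bound_weaken[OF _ that(2)]) (use that(1) in auto)
 qed auto
 show ?thesis by (rule that[OF B(1)]) (use B(2) in auto)
qed

lemma sum_nth_bound:
 fixes v :: "real^'n::finite" and B :: real
 assumes "!!j. \<bar>v $ j\<bar> \<le> B"
 shows "norm v \<le> CARD('n) * B"
proof -
 have "norm v \<le> (\<Sum>j\<in>UNIV. \<bar>v $ j\<bar>)" by (rule norm_le_l1_cart)
 also have "... \<le> (\<Sum>j\<in>(UNIV::'n set). B)" by (intro sum_mono assms)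
 finally show ?thesis by simp
qed

text \<open>The inner map may be unbounded; only its Jacobian is controlled, and with one order less
  than \<open>F\<close>, because the chain rule multiplies derivatives of \<open>F\<close> by first
  derivatives of \<open>G\<close>. At \<open>k = 0\<close> the truncated \<open>k - 1\<close> is
  still 0, which supplies the bounded Jacobian that makes \<open>G\<close> Lipschitz.\<close>

lemma holder_bdd_compose:
 fixes F :: "'i => real^'n::finite => real" and G :: "'i => real^'m::finite => real^'n"
 assumes s: "0 < s" "s \<le> 1"
 and dG: "!!i x l. i \<in> I ==> ((%x. G i x $ l) has_derivative (%h. \<Sum>j\<in>UNIV. J j l i x * h $ j)) (at x)"
 and J: "!!j l. holder_bdd (k - 1) s I (J j l)"
 and F: "holder_bdd k s I F"
 shows "holder_bdd k s I (%i x. F i (G i x))"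
 using J F
proof (induction k arbitrary: F)
 case 0
 obtain B1 where 1: "B1 > 0" "!!i x. i\<in>I ==> \<bar>F i x\<bar> \<le> B1" by (rule holder_bdd_bounded[OF 0(2)], rule that)
 obtain C1 where 3: "C1 > 0" "!!i x y. i\<in>I ==> \<bar>F i x - F i y\<bar> \<le> C1 * norm (x - y) powr s"
 by (rule holder_bdd_holder0[OF 0(2) s], rule that)
 obtain B where B: "B > 0" "!!p i x. i \<in> I ==> \<bar>J (fst p) (snd p) i x\<bar> \<le> B"
 using holder_bdd_components_bounded[of 0 s I "%p. J (fst p) (snd p)"] 0 by auto
 have L: "norm (G i x - G i y) \<le> CARD('n) * (CARD('m) * B * norm (x - y))" if "i \<in> I" for i x y
 by (rule sum_nth_bound) (use grad_bound_imp_lipschitz[OF dG[OF that] B(2)[OF that, of "(_, _)", simplified]] in auto)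
 have "\<bar>F i (G i x) - F i (G i y)\<bar> \<le> (C1 * (CARD('n) * CARD('m) * B) powr s) * norm (x - y) powr s" if "i \<in> I" for i x y
 proof -
 have "\<bar>F i (G i x) - F i (G i y)\<bar> \<le> C1 * norm (G i x - G i y) powr s" by (rule 3(2)[OF that])
 also have "... \<le> C1 * (CARD('n) * CARD('m) * B * norm (x - y)) powr s"
 using L[OF that, of x y] 3 s by (intro mult_left_mono powr_mono2) (auto simp: algebra_simps)
 also have "... = (C1 * (CARD('n) * CARD('m) * B) powr s) * norm (x - y) powr s"
 using B by (simp add: powr_mult)
 finally show ?thesis .
 qed
 then show ?case using 1 unfolding holder_bdd.simps by blast
next
 case (Suc k)
 obtain F' where F': "!!i x. i \<in> I ==> (F i has_derivative (%h. \<Sum>j\<in>UNIV. F' j i x * h $ j)) (at x)"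
 "!!j. holder_bdd k s I (F' j)" by (rule holder_bdd_SucE[OF Suc.prems(2)], rule that)
 obtain B1 where 1: "B1 > 0" "!!i x. i\<in>I ==> \<bar>F i x\<bar> \<le> B1" by (rule holder_bdd_bounded[OF Suc.prems(2)], rule that)
 have "((%x. F i (G i x)) has_derivative (%h. \<Sum>j\<in>UNIV. (\<Sum>l\<in>UNIV. F' l i (G i x) * J j l i x) * h $ j)) (at x)"
 if "i \<in> I" for i x
 proof -
 have "(G i has_derivative (%h. \<chi> l. \<Sum>j\<in>UNIV. J j l i x * h $ j)) (at x)"
 using dG[OF that] by (subst has_derivative_componentwise_within) (auto simp: Basis_vec_def inner_axis)
 from has_derivative_compose[OF this F'(1)[OF that]]
 show ?thesis by (simp add: sum_distrib_left sum_distrib_right) (subst sum.swap, simp add: mult_ac)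
 qed
 moreover have "holder_bdd k s I (%i x. \<Sum>l\<in>UNIV. F' l i (G i x) * J j l i x)" for j
 proof (intro holder_bdd_sum holder_bdd_mult[OF s])
 show "holder_bdd k s I (J j l)" for l using Suc.prems(1) by simp
 show "holder_bdd k s I (%i x. F' l i (G i x))" for l
 proof (rule Suc.IH[OF _ F'(2)])
 have "holder_bdd k s I (J j l)" for j l using Suc.prems(1) by simp
 then show "holder_bdd (k - 1) s I (J j l)" for j l by (rule holder_bdd_mono[OF s]) simp
 qed
 qed
 ultimately show ?case unfolding holder_bdd.simps using 1(2)
 by (intro conjI exI[of _ B1] exI[of _ "%j i x. \<Sum>l\<in>UNIV. F' l i (G i x) * J j l i x"]) auto
qed

section \<open>Iterated finite differences\<close>

definition fdiff :: "'a::real_vector => ('a => real) => 'a => real" where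
 "fdiff u f x = f (x + u) - f x"

lemma fdiff_pow_add: "(fdiff u ^^ (m + n)) f = (fdiff u ^^ m) ((fdiff u ^^ n) f)"
 by (simp add: funpow_add)

lemma fdiff_bounded:
 assumes "!!x. \<bar>f x\<bar> \<le> B"
 shows "\<bar>(fdiff u ^^ m) f x\<bar> \<le> 2 ^ m * B"
proof (induction m arbitrary: x)
 case (Suc m)
 have "\<bar>(fdiff u ^^ Suc m) f x\<bar> \<le> \<bar>(fdiff u ^^ m) f (x + u)\<bar> + \<bar>(fdiff u ^^ m) f x\<bar>"
 by (simp add: fdiff_def)
 then show ?case using Suc[of x] Suc[of "x + u"] by simp
qed (use assms in auto)

lemma fdiff_has_derivative:
 fixes f :: "real^'n::finite => real"
 assumes "!!x. (f has_derivative (%h. \<Sum>j\<in>UNIV. f' j x * h $ j)) (at x)"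
 shows "((fdiff u ^^ m) f has_derivative (%h. \<Sum>j\<in>UNIV. (fdiff u ^^ m) (f' j) x * h $ j)) (at x)"
proof (induction m arbitrary: x)
 case (Suc m)
 have "((%x. (fdiff u ^^ m) f (x + u)) has_derivative (%h. \<Sum>j\<in>UNIV. (fdiff u ^^ m) (f' j) (x + u) * h $ j)) (at x)"
 by (rule has_derivative_compose[where f = "%x. x + u" and f' = "%h. h"])
 (auto intro!: derivative_eq_intros Suc)
 from has_derivative_diff[OF this Suc[of x]]
 show ?case by (simp add: fdiff_def[abs_def] sum_subtractf algebra_simps)
qed (use assms in auto)

text \<open>Differences commute with derivatives, so by the gradient bound each of \<open>k\<close>
  differences trades one derivative for a factor \<open>norm u\<close>; one further difference gains
  \<open>norm u powr s\<close>. Surplus differences only cost a factor 2 each.\<close>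

lemma holder_bdd_fdiff:
 assumes s: "0 < s" "s \<le> 1" and "holder_bdd k s I F" "m \<ge> k + 1"
 shows "\<exists>C>0. \<forall>i\<in>I. \<forall>u x. \<bar>(fdiff u ^^ m) (F i) x\<bar> \<le> C * norm u powr (k + s)"
proof -
 have base: "\<exists>C>0. \<forall>i\<in>I. \<forall>u x. \<bar>(fdiff u ^^ (k + 1)) (F i) x\<bar> \<le> C * norm u powr (k + s)"
 using assms(3)
 proof (induction k arbitrary: F)
 case 0
 obtain B where B: "B > 0" "!!i x y. i\<in>I ==> \<bar>F i x - F i y\<bar> \<le> B * norm (x - y) powr s"
 by (rule holder_bdd_holder0[OF 0 s], rule that)
 have "\<bar>F i (x + u) - F i x\<bar> \<le> B * norm u powr s" if "i \<in> I" for i x u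
 using B(2)[OF that, of "x + u" x] by simp
 then show ?case using B(1) by (auto simp: fdiff_def)
 next
 case (Suc k)
 obtain F' where F': "!!i x. i \<in> I ==> (F i has_derivative (%h. \<Sum>j\<in>UNIV. F' j i x * h $ j)) (at x)"
 "!!j. holder_bdd k s I (F' j)" by (rule holder_bdd_SucE[OF Suc.prems], rule that)
 obtain C where C: "C > 0" "!!j. \<forall>i\<in>I. \<forall>u x. \<bar>(fdiff u ^^ (k + 1)) (F' j i) x\<bar> \<le> C * norm u powr (k + s)"
 proof (rule finite_family_bound[of "%j C. \<forall>i\<in>I. \<forall>u x. \<bar>(fdiff u ^^ (k + 1)) (F' j i) x\<bar> \<le> C * norm u powr (k + s)"])
 show "\<exists>B. \<forall>i\<in>I. \<forall>u x. \<bar>(fdiff u ^^ (k + 1)) (F' j i) x\<bar> \<le> B * norm u powr (real k + s)" for j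
 using Suc.IH[OF F'(2)] by blast
 show "\<forall>i\<in>I. \<forall>u x. \<bar>(fdiff u ^^ (k + 1)) (F' j i) x\<bar> \<le> B' * norm u powr (k + s)"
 if "\<forall>i\<in>I. \<forall>u x. \<bar>(fdiff u ^^ (k + 1)) (F' j i) x\<bar> \<le> B * norm u powr (k + s)" "B \<le> B'" for j B B'
 by (intro ballI allI bound_weaken[OF _ that(2)]) (use that(1) in auto)
 qed blast
 show ?case
 proof (intro exI[of _ "CARD('b) * C"] conjI ballI allI)
 fix i :: 'a and u x :: "real^'b" assume i: "i \<in> I"
 have "\<bar>(fdiff u ^^ (Suc k + 1)) (F i) x\<bar> = \<bar>(fdiff u ^^ (k + 1)) (F i) (x + u) - (fdiff u ^^ (k + 1)) (F i) x\<bar>"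
 by (simp add: fdiff_def)
 also have "... \<le> CARD('b) * (C * norm u powr (k + s)) * norm ((x + u) - x)"
 by (rule grad_bound_imp_lipschitz[OF fdiff_has_derivative[OF F'(1)[OF i]]]) (use C(2) i in blast)
 also have "... = CARD('b) * C * norm u powr (Suc k + s)"
 by (cases "u = 0") (simp_all add: powr_add add.commute algebra_simps)
 finally show "\<bar>(fdiff u ^^ (Suc k + 1)) (F i) x\<bar> \<le> CARD('b) * C * norm u powr (Suc k + s)" .
 qed (use C in auto)
 qed
 then obtain C where C: "C > 0" "!!i u x. i \<in> I ==> \<bar>(fdiff u ^^ (k + 1)) (F i) x\<bar> \<le> C * norm u powr (k + s)" by blast
 obtain l where l: "m = l + (k + 1)" using assms(4) by (metis le_add_diff_inverse2)
 have "\<bar>(fdiff u ^^ m) (F i) x\<bar> \<le> 2 ^ l * (C * norm u powr (k + s))" if "i \<in> I" for i u x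
 unfolding l fdiff_pow_add[where m = l and n = "k + 1"] by (rule fdiff_bounded[OF C(2)[OF that]])
 then show ?thesis using C(1) by (intro exI[of _ "2 ^ l * C"]) (auto simp: mult.assoc)
qed

text \<open>The segment from \<open>x\<close> to \<open>x + h\<close> may lie entirely inside the
  null set where nothing is known about the derivative. The increment is therefore averaged over
  parallel segments, shifted by \<open>z\<close> in a small ball: almost every shifted point is
  good. The Lipschitz property supplies domination, and bounds the cost of the averaging by a
  multiple of the radius.\<close>

lemma ae_mean_value:
 fixes f :: "real^'n::finite => real"
 assumes lip: "B-lipschitz_on (ball a R) f"
 and ae: "AE y in lborel. y \<in> ball a R --> (f has_derivative L y) (at y) \<and> \<bar>L y h - c\<bar> \<le> ep"
 and x: "x \<in> ball a R" "x + h \<in> ball a R"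
 shows "\<bar>f (x + h) - f x - c\<bar> \<le> ep"
proof -
 have B0: "0 \<le> B" using lip lipschitz_on_nonneg by blast
 have cont: "continuous_on (ball a R) f" using lip by (rule lipschitz_on_continuous_on)
 have Lip: "\<bar>f y - f z\<bar> \<le> B * norm (y - z)" if "y \<in> ball a R" "z \<in> ball a R" for y z
 using lipschitz_onD[OF lip that] by (simp add: dist_norm)
 obtain r0 where r0: "r0 > 0" "ball x r0 \<subseteq> ball a R" "ball (x + h) r0 \<subseteq> ball a R"
 proof -
 obtain r1 where "r1 > 0" "ball x r1 \<subseteq> ball a R" using x(1) open_ball open_contains_ball by metis
 moreover obtain r2 where "r2 > 0" "ball (x + h) r2 \<subseteq> ball a R" using x(2) open_ball open_contains_ball by metis
 ultimately show ?thesis by (intro that[of "min r1 r2"]) auto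
 qed
 have inb: "x + t *\<^sub>R h + z \<in> ball a R" if "0 \<le> t" "t \<le> 1" "norm z < r0" for t z
 proof -
 have "(1 - t) *\<^sub>R (x + z) + t *\<^sub>R (x + h + z) \<in> ball a R"
 by (rule convexD[OF convex_ball]) (use that r0 in \<open>auto simp: subset_iff dist_norm\<close>)
 then show ?thesis by (simp add: algebra_simps)
 qed
 \<comment> \<open>The radius \<open>r\<close> of the averaging and the slack \<open>et\<close> both
   tend to 0 at the end.\<close>
 have main: "\<bar>f (x + h) - f x - c\<bar> \<le> ep + et + 2 * B * r" if r: "0 < r" "r < r0" and et: "et > 0" for r et
 proof -
 define M where "M = restrict_space lborel (ball (0 :: real^'n) r)"
 have [simp]: "space M = ball 0 r" by (simp add: M_def space_restrict_space)
 have emM: "emeasure M (space M) = emeasure lborel (ball (0 :: real^'n) r)"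
 by (simp add: M_def emeasure_restrict_space)
 interpret finite_measure M
 by (rule finite_measureI) (use emeasure_lborel_ball_finite[of "0 :: real^'n" r] in \<open>auto simp: emM[simplified]\<close>)
 define m where "m = measure M (space M)"
 have m: "m > 0"
 using content_ball_pos[of r "0 :: real^'n"] r by (simp add: m_def measure_def emM[simplified])
 have meas: "(%z. g z) \<in> borel_measurable M" if "continuous_on (ball 0 r) g" for g :: "real^'n => real"
 using borel_measurable_continuous_on_restrict[OF that]
 by (simp add: M_def measurable_def sets_restrict_space space_restrict_space)
 have cont_t: "continuous_on (ball 0 r) (%z. f (x + t *\<^sub>R h + z))" if "0 \<le> t" "t \<le> 1" for t
 proof (rule continuous_on_compose2[OF cont])
 show "(%z. x + t *\<^sub>R h + z) ` ball 0 r \<subseteq> ball a R"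
 using inb[OF that] r by (intro image_subsetI) (metis mem_ball_0 order_less_trans)
 qed (intro continuous_intros)
 have inz: "x + t *\<^sub>R h + z \<in> ball a R" if "0 \<le> t" "t \<le> 1" "z \<in> ball 0 r" for t z
 using inb[OF that(1,2), of z] that(3) r by auto
 have int_t: "integrable M (%z. f (x + t *\<^sub>R h + z))" if t: "0 \<le> t" "t \<le> 1" for t
 proof (rule integrable_const_bound[where B = "\<bar>f x\<bar> + B * (norm h + r)"])
 have "\<bar>f (x + t *\<^sub>R h + z)\<bar> \<le> \<bar>f x\<bar> + B * (norm h + r)" if "z \<in> ball 0 r" for z
 proof -
 have "\<bar>f (x + t *\<^sub>R h + z) - f x\<bar> \<le> B * norm (t *\<^sub>R h + z)"
 using Lip[OF inz[OF t that] x(1)] by (simp add: algebra_simps)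
 also have "... \<le> B * (norm h + r)"
 proof (intro mult_left_mono B0)
 have "norm (t *\<^sub>R h + z) \<le> t * norm h + norm z" using norm_triangle_ineq[of "t *\<^sub>R h" z] t by simp
 also have "... \<le> norm h + r" using t that mult_right_mono[of t 1 "norm h"] by auto
 finally show "norm (t *\<^sub>R h + z) \<le> norm h + r" .
 qed
 finally show ?thesis by linarith
 qed
 then show "AE z in M. norm (f (x + t *\<^sub>R h + z)) \<le> \<bar>f x\<bar> + B * (norm h + r)" by (intro AE_I2) auto
 qed (rule meas[OF cont_t[OF t]])
 \<comment> \<open>The averaged function along the segment, with the expected linear growth
   \<open>t * c\<close> removed; the increment from 0 to 1 is what has to be small.\<close>
 define \<phi> where "\<phi> t = (\<integral>z. f (x + t *\<^sub>R h + z) \<partial>M) - t * c * m" for t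
 have \<phi>_lip: "\<bar>\<phi> t - \<phi> u\<bar> \<le> (B * norm h + \<bar>c\<bar>) * m * \<bar>t - u\<bar>" if t: "0 \<le> t" "t \<le> 1" and u: "0 \<le> u" "u \<le> 1" for t u
 proof -
 have "\<bar>(\<integral>z. f (x + t *\<^sub>R h + z) \<partial>M) - (\<integral>z. f (x + u *\<^sub>R h + z) \<partial>M)\<bar> = \<bar>\<integral>z. f (x + t *\<^sub>R h + z) - f (x + u *\<^sub>R h + z) \<partial>M\<bar>"
 by (simp add: Bochner_Integration.integral_diff int_t t u)
 also have "... \<le> (\<integral>z. B * norm h * \<bar>t - u\<bar> \<partial>M)"
 proof (rule integral_abs_bound[THEN order_trans], rule integral_mono)
 show "\<bar>f (x + t *\<^sub>R h + z) - f (x + u *\<^sub>R h + z)\<bar> \<le> B * norm h * \<bar>t - u\<bar>" if "z \<in> space M" for z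
 proof -
 have "x + t *\<^sub>R h + z - (x + u *\<^sub>R h + z) = (t - u) *\<^sub>R h" by (simp add: algebra_simps)
 then show ?thesis using Lip[OF inz[OF t, of z] inz[OF u, of z]] that by (simp add: mult_ac)
 qed
 qed (auto intro!: integrable_abs Bochner_Integration.integrable_diff int_t t u)
 finally have 1: "\<bar>(\<integral>z. f (x + t *\<^sub>R h + z) \<partial>M) - (\<integral>z. f (x + u *\<^sub>R h + z) \<partial>M)\<bar> \<le> B * norm h * \<bar>t - u\<bar> * m"
 by (simp add: m_def mult_ac)
 have "\<phi> t - \<phi> u = ((\<integral>z. f (x + t *\<^sub>R h + z) \<partial>M) - (\<integral>z. f (x + u *\<^sub>R h + z) \<partial>M)) + - ((t - u) * c * m)"
 by (simp add: \<phi>_def algebra_simps)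
 also have "\<bar>...\<bar> \<le> B * norm h * \<bar>t - u\<bar> * m + \<bar>t - u\<bar> * \<bar>c\<bar> * m"
 using 1 m by (intro order_trans[OF abs_triangle_ineq] add_mono) (auto simp: abs_mult)
 finally show ?thesis by (simp add: algebra_simps)
 qed
 \<comment> \<open>It is enough that from every \<open>t\<close> some later time is reached with
   slope at most \<open>(ep + et) * m\<close>. For almost all \<open>z\<close> the quotients
   \<open>D k z\<close> have a limit of absolute value at most \<open>ep\<close>, so by dominated
   convergence the mean of their excess over \<open>ep\<close> falls below \<open>et * m\<close> for
   some \<open>k\<close>.\<close>
 have step: "\<exists>y\<in>{t<..1}. dist (\<phi> y) (\<phi> t) \<le> ((ep + et) * m) * (y - t)" if t: "t \<in> {0..<1}" for t
 proof -
 define ta where "ta k = (1 - t) / (1 + real k)" for k :: nat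
 have ta: "ta k > 0" "t + ta k \<le> 1" "0 \<le> t + ta k" for k
 proof -
 show "ta k > 0" "0 \<le> t + ta k" using t by (auto simp: ta_def)
 have "(1 - t) / (1 + real k) \<le> (1 - t) / 1" by (rule divide_left_mono) (use t in auto)
 then show "t + ta k \<le> 1" by (simp add: ta_def)
 qed
 have ta0: "ta \<longlonglongrightarrow> 0" unfolding ta_def by real_asymp
 have "ta k \<noteq> 0" for k using ta(1)[of k] by simp
 then have taat: "filterlim ta (at 0) sequentially"
 unfolding filterlim_at using ta0 by simp
 define D where "D k z = (f (x + (t + ta k) *\<^sub>R h + z) - f (x + t *\<^sub>R h + z)) / ta k - c" for k z
 have Dint: "integrable M (D k)" for k
 unfolding D_def using int_t[OF ta(3) ta(2)] int_t[of t] t by (auto intro!: Bochner_Integration.integrable_diff integrable_divide)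
 have Dbd: "\<bar>D k z\<bar> \<le> B * norm h + \<bar>c\<bar>" if "z \<in> ball 0 r" for k z
 proof -
 have "\<bar>f (x + (t + ta k) *\<^sub>R h + z) - f (x + t *\<^sub>R h + z)\<bar> \<le> B * norm ((x + (t + ta k) *\<^sub>R h + z) - (x + t *\<^sub>R h + z))"
 by (rule Lip[OF inz[OF ta(3) ta(2) that] inz[of t z]]) (use t that in auto)
 also have "(x + (t + ta k) *\<^sub>R h + z) - (x + t *\<^sub>R h + z) = ta k *\<^sub>R h" by (simp add: algebra_simps)
 finally have "\<bar>f (x + (t + ta k) *\<^sub>R h + z) - f (x + t *\<^sub>R h + z)\<bar> / ta k \<le> B * norm h"
 using ta(1)[of k] by (simp add: field_simps)
 then have "\<bar>(f (x + (t + ta k) *\<^sub>R h + z) - f (x + t *\<^sub>R h + z)) / ta k\<bar> \<le> B * norm h"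
 using ta(1)[of k] by (simp add: abs_divide)
 then show ?thesis unfolding D_def by linarith
 qed
 have ae': "AE z in M. x + t *\<^sub>R h + z \<in> ball a R --> (f has_derivative L (x + t *\<^sub>R h + z)) (at (x + t *\<^sub>R h + z)) \<and> \<bar>L (x + t *\<^sub>R h + z) h - c\<bar> \<le> ep"
 proof -
 have "AE y in distr lborel borel ((+) (x + t *\<^sub>R h)). y \<in> ball a R --> (f has_derivative L y) (at y) \<and> \<bar>L y h - c\<bar> \<le> ep"
 unfolding lborel_distr_plus by (rule ae)
 from AE_distrD[OF _ this] show ?thesis
 unfolding M_def by (subst AE_restrict_space_iff) auto
 qed
 have "(%k. \<integral>z. max (\<bar>D k z\<bar> - ep) 0 \<partial>M) \<longlonglongrightarrow> (\<integral>z. 0 \<partial>M)"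
 proof (rule integral_dominated_convergence[where w = "%_. B * norm h + \<bar>c\<bar> + \<bar>ep\<bar>"])
 show "AE z in M. (%k. max (\<bar>D k z\<bar> - ep) 0) \<longlonglongrightarrow> 0"
 using ae' AE_space
 proof eventually_elim
 case (elim z)
 have z: "x + t *\<^sub>R h + z \<in> ball a R" using elim inz[of t z] t by auto
 then have d: "(f has_derivative L (x + t *\<^sub>R h + z)) (at (x + t *\<^sub>R h + z))" "\<bar>L (x + t *\<^sub>R h + z) h - c\<bar> \<le> ep"
 using elim by auto
 have "((%u. x + t *\<^sub>R h + z + u *\<^sub>R h) has_derivative (%u. u *\<^sub>R h)) (at 0)"
 by (auto intro!: derivative_eq_intros)
 from has_derivative_compose[OF this, of f "L (x + t *\<^sub>R h + z)"] d(1)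
 have "((%u. f (x + t *\<^sub>R h + z + u *\<^sub>R h)) has_derivative (%u. L (x + t *\<^sub>R h + z) (u *\<^sub>R h))) (at 0)" by simp
 then have "((%u. f (x + t *\<^sub>R h + z + u *\<^sub>R h)) has_real_derivative L (x + t *\<^sub>R h + z) h) (at 0)"
 unfolding has_field_derivative_def
 by (simp add: linear_scale[OF has_derivative_linear[OF d(1)]] mult.commute[of "L (x + t *\<^sub>R h + z) h"] mult_commute_abs)
 then have "((%u. (f (x + t *\<^sub>R h + z + u *\<^sub>R h) - f (x + t *\<^sub>R h + z)) / u) \<longlongrightarrow> L (x + t *\<^sub>R h + z) h) (at 0)"
 by (simp add: DERIV_def)
 then have "(%k. (f (x + t *\<^sub>R h + z + ta k *\<^sub>R h) - f (x + t *\<^sub>R h + z)) / ta k) \<longlonglongrightarrow> L (x + t *\<^sub>R h + z) h"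
 by (rule filterlim_compose[OF _ taat])
 moreover have "f (x + (t + ta k) *\<^sub>R h + z) = f (x + t *\<^sub>R h + z + ta k *\<^sub>R h)" for k
 by (simp add: algebra_simps)
 ultimately have "(%k. D k z) \<longlonglongrightarrow> L (x + t *\<^sub>R h + z) h - c"
 unfolding D_def by (auto intro!: tendsto_diff)
 then have "(%k. max (\<bar>D k z\<bar> - ep) 0) \<longlonglongrightarrow> max (\<bar>L (x + t *\<^sub>R h + z) h - c\<bar> - ep) 0"
 by (intro tendsto_intros)
 then show ?case using d(2) by simp
 qed
 have "norm (max (\<bar>D k z\<bar> - ep) 0) \<le> B * norm h + \<bar>c\<bar> + \<bar>ep\<bar>" if "z \<in> space M" for k z
 using Dbd[of z k] that by auto
 then show "AE z in M. norm (max (\<bar>D k z\<bar> - ep) 0) \<le> B * norm h + \<bar>c\<bar> + \<bar>ep\<bar>" for k by (intro AE_I2)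
 qed (use borel_measurable_integrable[OF Dint] in auto)
 then have "eventually (%k. (\<integral>z. max (\<bar>D k z\<bar> - ep) 0 \<partial>M) < et * m) sequentially"
 using order_tendstoD(2)[of _ 0 sequentially "et * m"] et m by simp
 then obtain k where k: "(\<integral>z. max (\<bar>D k z\<bar> - ep) 0 \<partial>M) < et * m" by (auto simp: eventually_sequentially)
 have "(\<integral>z. D k z \<partial>M) = ((\<integral>z. f (x + (t + ta k) *\<^sub>R h + z) \<partial>M) - (\<integral>z. f (x + t *\<^sub>R h + z) \<partial>M)) / ta k - c * m"
 unfolding D_def m_def using int_t[OF ta(3) ta(2)] int_t[of t] t
 by (simp add: Bochner_Integration.integral_diff integrable_divide)
 then have "\<phi> (t + ta k) - \<phi> t = ta k * (\<integral>z. D k z \<partial>M)"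
 using ta(1)[of k] by (simp add: \<phi>_def field_simps)
 moreover have "\<bar>\<integral>z. D k z \<partial>M\<bar> \<le> (ep + et) * m"
 proof -
 have "\<bar>\<integral>z. D k z \<partial>M\<bar> \<le> (\<integral>z. ep + max (\<bar>D k z\<bar> - ep) 0 \<partial>M)"
 by (rule integral_abs_bound[THEN order_trans], rule integral_mono)
 (auto intro!: Dint integrable_abs Bochner_Integration.integrable_add Bochner_Integration.integrable_diff integrable_max)
 also have "... = ep * m + (\<integral>z. max (\<bar>D k z\<bar> - ep) 0 \<partial>M)"
 unfolding m_def by (subst Bochner_Integration.integral_add)
 (auto intro!: Dint integrable_abs Bochner_Integration.integrable_diff integrable_max)
 finally show ?thesis using k by (simp add: algebra_simps)
 qed
 ultimately have "\<bar>\<phi> (t + ta k) - \<phi> t\<bar> \<le> ((ep + et) * m) * ta k"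
 using ta(1)[of k] by (simp add: abs_mult mult_ac)
 then show ?thesis using ta[of k] by (intro bexI[of _ "t + ta k"]) (auto simp: dist_real_def)
 qed
 have "continuous_on {0..1} \<phi>"
 proof (rule lipschitz_on_continuous_on[of "(B * norm h + \<bar>c\<bar>) * m"], rule lipschitz_onI)
 show "dist (\<phi> t) (\<phi> u) \<le> (B * norm h + \<bar>c\<bar>) * m * dist t u" if "t \<in> {0..1}" "u \<in> {0..1}" for t u
 using \<phi>_lip[of t u] that by (simp add: dist_real_def)
 qed (use B0 m in auto)
 then have "dist (\<phi> 1) (\<phi> 0) \<le> ((ep + et) * m) * (1 - 0)"
 by (intro locally_lipschitz_imp_lipschitz_aux step) auto
 then have \<phi>01: "\<bar>\<phi> 1 - \<phi> 0\<bar> \<le> (ep + et) * m" by (simp add: dist_real_def)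
 have near: "\<bar>(\<integral>z. f (x + t *\<^sub>R h + z) \<partial>M) - f (x + t *\<^sub>R h) * m\<bar> \<le> B * r * m" if t: "0 \<le> t" "t \<le> 1" for t
 proof -
 have "(\<integral>z. f (x + t *\<^sub>R h + z) \<partial>M) - f (x + t *\<^sub>R h) * m = (\<integral>z. f (x + t *\<^sub>R h + z) - f (x + t *\<^sub>R h) \<partial>M)"
 by (simp add: Bochner_Integration.integral_diff int_t t m_def)
 also have "\<bar>...\<bar> \<le> (\<integral>z. B * r \<partial>M)"
 proof (rule integral_abs_bound[THEN order_trans], rule integral_mono)
 show "\<bar>f (x + t *\<^sub>R h + z) - f (x + t *\<^sub>R h)\<bar> \<le> B * r" if "z \<in> space M" for z
 proof -
 have "\<bar>f (x + t *\<^sub>R h + z) - f (x + t *\<^sub>R h)\<bar> \<le> B * norm z"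
 using Lip[OF inz[OF t, of z] inb[OF t, of 0]] that r0 r by (simp add: algebra_simps)
 also have "... \<le> B * r" using that B0 by (intro mult_left_mono) auto
 finally show ?thesis .
 qed
 qed (auto intro!: integrable_abs Bochner_Integration.integrable_diff int_t t)
 finally show ?thesis by (simp add: m_def mult_ac)
 qed
 have "(f (x + h) - f x - c) * m = (\<phi> 1 - \<phi> 0) - ((\<integral>z. f (x + 1 *\<^sub>R h + z) \<partial>M) - f (x + 1 *\<^sub>R h) * m)
 + ((\<integral>z. f (x + 0 *\<^sub>R h + z) \<partial>M) - f (x + 0 *\<^sub>R h) * m)"
 by (simp add: \<phi>_def algebra_simps)
 then have "\<bar>(f (x + h) - f x - c) * m\<bar> \<le> (ep + et) * m + B * r * m + B * r * m"
 using \<phi>01 near[of 1] near[of 0] by linarith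
 moreover have "\<bar>(f (x + h) - f x - c) * m\<bar> = \<bar>f (x + h) - f x - c\<bar> * m" using m by (simp add: abs_mult)
 moreover have "(ep + et) * m + B * r * m + B * r * m = (ep + et + 2 * B * r) * m" by (simp add: algebra_simps)
 ultimately have "\<bar>f (x + h) - f x - c\<bar> * m \<le> (ep + et + 2 * B * r) * m" by linarith
 then show ?thesis using m by (simp add: mult_le_cancel_right)
 qed
 show ?thesis
 proof (rule field_le_epsilon)
 fix e :: real assume e: "e > 0"
 define r where "r = min (r0 / 2) (e / (4 * (B + 1)))"
 have "r > 0" "r < r0" using r0 e B0 by (auto simp: r_def min_less_iff_disj)
 have "r \<le> e / (4 * (B + 1))" by (simp add: r_def)
 then have "4 * (B + 1) * r \<le> e" using B0 by (simp add: field_simps)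
 then have "2 * B * r \<le> e / 2" using \<open>r > 0\<close> B0 by (simp add: algebra_simps)
 then show "\<bar>f (x + h) - f x - c\<bar> \<le> ep + e"
 using main[OF \<open>r > 0\<close> \<open>r < r0\<close>, of "e / 2"] e by linarith
 qed
qed

lemma AE_lebesgue_imp_lborel: "AE x in lebesgue. P x ==> AE x in lborel. P x"
 for P :: "'a::euclidean_space => bool"
 by (simp add: AE_completion_iff)

text \<open>The mean value estimate with \<open>c = 0\<close> gives the stated constant on small
  balls, whatever the local constants in \<open>lip\<close> are. Walking along the segment from
  \<open>y\<close> to \<open>x\<close> makes it global.\<close>

lemma lipschitz_of_ae_gradient:
 fixes f :: "real^'n::finite => real" and K :: real
 assumes lip: "!!x. \<exists>r>0. \<exists>B. B-lipschitz_on (ball x r) f"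
 and ae: "AE y in lborel. (f has_derivative (%h. \<Sum>i\<in>UNIV. V i y * h $ i)) (at y)"
 and bd: "AE y in lborel. \<forall>i. \<bar>V i y\<bar> \<le> K"
 shows "\<bar>f x - f y\<bar> \<le> CARD('n) * K * norm (x - y)"
proof -
 define M where "M = CARD('n) * K * norm (x - y)"
 have loc: "\<exists>r>0. \<forall>u v. u \<in> ball z r --> u + v \<in> ball z r --> \<bar>f (u + v) - f u\<bar> \<le> CARD('n) * K * norm v" for z
 proof -
 obtain r B where r: "r > 0" "B-lipschitz_on (ball z r) f" using lip by blast
 show ?thesis
 proof (intro exI[of _ r] conjI allI impI r(1))
 fix u v assume uv: "u \<in> ball z r" "u + v \<in> ball z r"
 have "\<bar>f (u + v) - f u - 0\<bar> \<le> CARD('n) * K * norm v"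
 proof (rule ae_mean_value[OF r(2) _ uv])
 show "AE y in lborel. y \<in> ball z r --> (f has_derivative (%h. \<Sum>i\<in>UNIV. V i y * h $ i)) (at y)
 \<and> \<bar>(\<Sum>i\<in>UNIV. V i y * v $ i) - 0\<bar> \<le> CARD('n) * K * norm v"
 using ae bd by eventually_elim (simp add: abs_sum_comp_le)
 qed
 then show "\<bar>f (u + v) - f u\<bar> \<le> CARD('n) * K * norm v" by simp
 qed
 qed
 have cont: "continuous_on UNIV f"
 proof (rule continuous_at_imp_continuous_on, intro ballI)
 fix z
 obtain r B where r: "r > 0" "B-lipschitz_on (ball z r) f" using lip by blast
 have "continuous_on (ball z r) f" by (rule lipschitz_on_continuous_on[OF r(2)])
 then show "isCont f z" using r(1) by (simp add: continuous_on_eq_continuous_at)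
 qed
 define \<phi> where "\<phi> t = f (y + t *\<^sub>R (x - y))" for t :: real
 have "dist (\<phi> 1) (\<phi> 0) \<le> M * (1 - 0)"
 proof (rule locally_lipschitz_imp_lipschitz_aux)
 show "continuous_on {0..1} \<phi>" unfolding \<phi>_def
 by (rule continuous_on_compose2[OF cont]) (auto intro!: continuous_intros)
 fix t :: real assume t: "t \<in> {0..<1}"
 obtain r where r: "r > 0" "!!u v. u \<in> ball (y + t *\<^sub>R (x - y)) r ==> u + v \<in> ball (y + t *\<^sub>R (x - y)) r ==>
 \<bar>f (u + v) - f u\<bar> \<le> CARD('n) * K * norm v"
 using loc[of "y + t *\<^sub>R (x - y)"] by blast
 define ta where "ta = min (1 - t) (r / (2 * (norm (x - y) + 1)))"
 have n0: "norm (x - y) + 1 > 0" by (simp add: add_nonneg_pos)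
 have ta: "ta > 0" "ta \<le> 1 - t" "ta \<le> r / (2 * (norm (x - y) + 1))"
 using t r n0 by (auto simp: ta_def)
 have "ta * norm (x - y) < r"
 proof -
 have "ta * (2 * (norm (x - y) + 1)) \<le> r" using ta(3) n0 by (simp add: field_simps)
 moreover have "ta * norm (x - y) < ta * (2 * (norm (x - y) + 1))" using ta(1) by (intro mult_strict_left_mono) (auto simp: add_nonneg_pos)
 ultimately show ?thesis by linarith
 qed
 then have "\<bar>f (y + t *\<^sub>R (x - y) + ta *\<^sub>R (x - y)) - f (y + t *\<^sub>R (x - y))\<bar> \<le> CARD('n) * K * norm (ta *\<^sub>R (x - y))"
 using r ta by (intro r(2)) (auto simp: dist_norm)
 moreover have "y + (t + ta) *\<^sub>R (x - y) = y + t *\<^sub>R (x - y) + ta *\<^sub>R (x - y)"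
 by (simp only: scaleR_add_left add.assoc)
 ultimately have "dist (\<phi> (t + ta)) (\<phi> t) \<le> M * ((t + ta) - t)"
 using ta by (simp add: \<phi>_def dist_real_def M_def mult_ac add.assoc)
 then show "\<exists>s\<in>{t<..1}. dist (\<phi> s) (\<phi> t) \<le> M * (s - t)"
 using ta by (intro bexI[of _ "t + ta"]) auto
 qed auto
 then show ?thesis by (simp add: \<phi>_def dist_real_def M_def)
qed

text \<open>Near \<open>x\<close> the almost everywhere gradient differs little from
  \<open>V\<close> at \<open>x\<close>, so \<open>ae_mean_value\<close>, with \<open>c\<close> the
  value of the candidate derivative on the increment, bounds the first-order error. Continuity of
  the chosen version at \<open>x\<close> thus yields a genuine derivative there.\<close>

lemma derivative_of_ae_gradient:
 fixes f :: "real^'n::finite => real"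
 assumes lip: "!!x. \<exists>r>0. \<exists>B. B-lipschitz_on (ball x r) f"
 and ae: "AE y in lborel. (f has_derivative (%h. \<Sum>i\<in>UNIV. V i y * h $ i)) (at y)"
 and cont: "!!i. isCont (V i) x"
 shows "(f has_derivative (%h. \<Sum>i\<in>UNIV. V i x * h $ i)) (at x)"
 unfolding has_derivative_at_alt
proof (intro conjI allI impI)
 show "bounded_linear (%h. \<Sum>i\<in>UNIV. V i x * h $ i)"
 by (intro bounded_linear_sum bounded_linear_const_mult bounded_linear_vec_nth)
 fix e :: real assume e: "e > 0"
 have "\<forall>i. \<exists>d>0. \<forall>y. dist y x < d --> \<bar>V i y - V i x\<bar> < e / CARD('n)"
 proof
 fix i
 have "0 < e / CARD('n)" using e by simp
 then show "\<exists>d>0. \<forall>y. dist y x < d --> \<bar>V i y - V i x\<bar> < e / CARD('n)"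
 using cont[of i] unfolding continuous_at_eps_delta dist_real_def by blast
 qed
 then obtain d where d: "!!i. d i > 0" "!!i y. dist y x < d i ==> \<bar>V i y - V i x\<bar> < e / CARD('n)" by metis
 obtain r B where r: "r > 0" "B-lipschitz_on (ball x r) f" using lip by blast
 define rh where "rh = min r (Min (range d))"
 have rh: "rh > 0" "rh \<le> r" "!!i. rh \<le> d i"
 using r d by (auto simp: rh_def min.coboundedI2)
 have L: "B-lipschitz_on (ball x rh) f" by (rule lipschitz_on_subset[OF r(2)]) (use rh(2) in auto)
 show "\<exists>d>0. \<forall>y. norm (y - x) < d --> norm (f y - f x - (\<Sum>i\<in>UNIV. V i x * (y - x) $ i)) \<le> e * norm (y - x)"
 proof (intro exI[of _ rh] conjI rh(1) allI impI)
 fix y assume y: "norm (y - x) < rh"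
 have "\<bar>f (x + (y - x)) - f x - (\<Sum>i\<in>UNIV. V i x * (y - x) $ i)\<bar> \<le> e * norm (y - x)"
 proof (rule ae_mean_value[OF L])
 show "AE z in lborel. z \<in> ball x rh --> (f has_derivative (%h. \<Sum>i\<in>UNIV. V i z * h $ i)) (at z) \<and>
 \<bar>(\<Sum>i\<in>UNIV. V i z * (y - x) $ i) - (\<Sum>i\<in>UNIV. V i x * (y - x) $ i)\<bar> \<le> e * norm (y - x)"
 using ae
 proof eventually_elim
 case (elim z)
 have "\<bar>\<Sum>i\<in>UNIV. (V i z - V i x) * (y - x) $ i\<bar> \<le> CARD('n) * (e / CARD('n)) * norm (y - x)"
 if "z \<in> ball x rh"
 by (rule abs_sum_comp_le) (use d(2)[of z] that rh(3) in \<open>force simp: dist_commute intro: less_imp_le order_less_le_trans\<close>)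
 then show ?case using elim by (simp add: left_diff_distrib sum_subtractf)
 qed
 qed (use y rh in \<open>auto simp: dist_norm norm_minus_commute\<close>)
 then show "norm (f y - f x - (\<Sum>i\<in>UNIV. V i x * (y - x) $ i)) \<le> e * norm (y - x)" by simp
 qed
qed

text \<open>The set where the bound fails is open, and a nonempty open set has positive
  measure.\<close>

lemma continuous_AE_bound:
 fixes f :: "real^'n::finite => real"
 assumes "continuous_on UNIV f" "AE x in lborel. \<bar>f x\<bar> \<le> K"
 shows "\<bar>f x\<bar> \<le> K"
proof (rule ccontr)
 assume "\<not> \<bar>f x\<bar> \<le> K"
 define S where "S = {x. \<bar>f x\<bar> > K}"
 have op: "open S" unfolding S_def by (intro open_Collect_less continuous_intros assms)
 have "AE x in lborel. x \<notin> S" using assms(2) by (simp add: S_def not_less)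
 then have "emeasure lborel S = 0"
 using AE_iff_measurable[of S lborel "%x. x \<notin> S"] op by auto
 moreover have "x \<in> S" using \<open>\<not> \<bar>f x\<bar> \<le> K\<close> by (simp add: S_def)
 then obtain r where r: "r > 0" "ball x r \<subseteq> S" using op open_contains_ball by blast
 then have "emeasure lborel (ball x r) \<le> emeasure lborel S"
 using op by (intro emeasure_mono) auto
 moreover have "emeasure lborel (ball x r) > 0"
 using content_ball_pos[OF r(1), of x] by (simp add: measure_def enn2real_positive_iff)
 ultimately show False by simp
qed

section \<open>From \<open>holder_class\<close> to \<open>holder_bdd\<close>\<close>

lemma finite_mi_order_le: "finite {nu :: 'n::finite => nat. mi_order nu \<le> k}"
proof (rule finite_subset)
 have "nu i \<le> mi_order nu" for nu :: "'n => nat" and i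
 unfolding mi_order_def by (rule member_le_sum) auto
 then show "{nu :: 'n => nat. mi_order nu \<le> k} \<subseteq> {f. \<forall>i. (i \<in> UNIV --> f i \<in> {..k}) \<and> (i \<notin> UNIV --> f i = 0)}"
 by (auto intro: order_trans)
 show "finite {f :: 'n => nat. \<forall>i. (i \<in> UNIV --> f i \<in> {..k}) \<and> (i \<notin> UNIV --> f i = 0)}"
 by (rule finite_set_of_finite_funs) auto
qed

lemma finite_mi_order_eq: "finite {nu :: 'n::finite => nat. mi_order nu = k}"
 by (rule finite_subset[OF _ finite_mi_order_le[of k]]) auto

lemma mi_order_upd: "mi_order (nu(i := nu i + 1)) = mi_order nu + 1"
proof -
 have "mi_order (nu(i := nu i + 1)) = (\<Sum>j\<in>UNIV. nu j + (if j = i then 1 else 0))"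
 unfolding mi_order_def by (rule sum.cong) auto
 also have "... = mi_order nu + 1" by (simp add: sum.distrib mi_order_def)
 finally show ?thesis .
qed

lemma mi_order_0 [simp]: "mi_order (%_. 0) = 0"
 by (simp add: mi_order_def)

lemma holder_weight_ge: "(r::real) > 0 ==> ln (inverse (min r (1/2))) \<ge> ln 2"
proof -
 assume "r > 0"
 then have "inverse (min r (1/2)) \<ge> inverse (1/2 :: real)" by (intro le_imp_inverse_le) auto
 then show ?thesis using \<open>r > 0\<close> by (subst ln_le_cancel_iff) auto
qed

text \<open>Each summand of the norm is at most the whole norm, so the bound holds for every
  derivative separately. The absolute value of \<open>K\<close> is there because
  \<open>ennreal K\<close> is 0 for negative \<open>K\<close>.\<close>

lemma holder_classE:
 fixes f :: "real^'n::finite => real"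
 assumes "f \<in> holder_class et 0 K"
 obtains D where "is_jet (nat \<lfloor>et\<rfloor>) f D"
 "!!nu. mi_order nu \<le> nat \<lfloor>et\<rfloor> ==> AE x in lborel. \<bar>D nu x\<bar> \<le> \<bar>K\<bar>"
 "!!nu x y. mi_order nu = nat \<lfloor>et\<rfloor> ==> \<bar>D nu x - D nu y\<bar> \<le> \<bar>K\<bar> * norm (x - y) powr (et - of_int \<lfloor>et\<rfloor>)"
proof -
 obtain D where D: "is_jet (nat \<lfloor>et\<rfloor>) f D" and
 le: "(\<Sum>nu | mi_order nu \<le> nat \<lfloor>et\<rfloor>. Linf_norm (D nu))
 + (\<Sum>nu | mi_order nu = nat \<lfloor>et\<rfloor>. holder_seminorm (et - of_int \<lfloor>et\<rfloor>) 0 (D nu)) \<le> ennreal K"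
 using assms unfolding holder_class_def by blast
 have K: "ennreal K \<le> ennreal \<bar>K\<bar>" by (intro ennreal_leI) auto
 have 1: "Linf_norm (D nu) \<le> ennreal \<bar>K\<bar>" if "mi_order nu \<le> nat \<lfloor>et\<rfloor>" for nu
 proof -
 have "Linf_norm (D nu) \<le> (\<Sum>nu | mi_order nu \<le> nat \<lfloor>et\<rfloor>. Linf_norm (D nu))"
 using that by (intro member_le_sum finite_mi_order_le) auto
 also have "... \<le> ennreal K" using le by (rule order_trans[rotated]) simp
 finally show ?thesis using K by (rule order_trans)
 qed
 have 2: "holder_seminorm (et - of_int \<lfloor>et\<rfloor>) 0 (D nu) \<le> ennreal \<bar>K\<bar>" if "mi_order nu = nat \<lfloor>et\<rfloor>" for nu
 proof -
 have "holder_seminorm (et - of_int \<lfloor>et\<rfloor>) 0 (D nu) \<le> (\<Sum>nu | mi_order nu = nat \<lfloor>et\<rfloor>. holder_seminorm (et - of_int \<lfloor>et\<rfloor>) 0 (D nu))"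
 using that by (intro member_le_sum finite_mi_order_eq) auto
 also have "... \<le> ennreal K" using le by (rule order_trans[rotated]) simp
 finally show ?thesis using K by (rule order_trans)
 qed
 show ?thesis
 proof (rule that[OF D])
 fix nu :: "'n => nat" assume nu: "mi_order nu \<le> nat \<lfloor>et\<rfloor>"
 have "AE x in lebesgue. ennreal \<bar>D nu x\<bar> \<le> ennreal \<bar>K\<bar>"
 by (rule eventually_mono[OF esssup_AE[of "%x. ennreal \<bar>D nu x\<bar>" lebesgue]])
 (erule order_trans[OF _ 1[OF nu, unfolded Linf_norm_def]])
 then show "AE x in lborel. \<bar>D nu x\<bar> \<le> \<bar>K\<bar>" by (intro AE_lebesgue_imp_lborel) simp
 next
 fix nu :: "'n => nat" and x y :: "real^'n" assume nu: "mi_order nu = nat \<lfloor>et\<rfloor>"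
 show "\<bar>D nu x - D nu y\<bar> \<le> \<bar>K\<bar> * norm (x - y) powr (et - of_int \<lfloor>et\<rfloor>)"
 proof (cases "x = y")
 case False
 have "ennreal (\<bar>D nu x - D nu y\<bar> / norm (x - y) powr (et - of_int \<lfloor>et\<rfloor>) * ln (inverse (min (norm (x - y)) (1/2))) powr 0)
 \<le> holder_seminorm (et - of_int \<lfloor>et\<rfloor>) 0 (D nu)"
 unfolding holder_seminorm_def by (rule SUP_upper2[of "(x, y)"]) (use False in auto)
 \<comment> \<open>Since \<open>0 powr 0\<close> is 0, the weight must be known to be nonzero before
   its power 0 becomes 1.\<close>
 also have "ln (inverse (min (norm (x - y)) (1/2))) powr 0 = 1"
 proof -
 have "0 < ln (2::real)" by simp
 also have "... \<le> ln (inverse (min (norm (x - y)) (1/2)))" using holder_weight_ge[of "norm (x - y)"] False by simp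
 finally show ?thesis by simp
 qed
 also note 2[OF nu]
 finally have "\<bar>D nu x - D nu y\<bar> / norm (x - y) powr (et - of_int \<lfloor>et\<rfloor>) \<le> \<bar>K\<bar>" by simp
 then show ?thesis using False by (simp add: pos_divide_le_eq)
 qed simp
 qed
qed

text \<open>The classical smoothness index: the largest integer strictly below \<open>et\<close>. With it an integer
 \<open>et\<close> becomes the Lipschitz case, in which no derivative is only defined almost everywhere.\<close>

definition hidx :: "real => nat" where "hidx et = nat (\<lceil>et\<rceil> - 1)"
definition hexp :: "real => real" where "hexp et = et - real (hidx et)"

lemma hidx_hexp:
 assumes "et > 0"
 shows "0 < hexp et" "hexp et \<le> 1" "real (hidx et) + hexp et = et" "hidx et \<le> nat \<lfloor>et\<rfloor>"
 "hidx et \<noteq> nat \<lfloor>et\<rfloor> ==> nat \<lfloor>et\<rfloor> = hidx et + 1 \<and> hexp et = 1"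
 "hidx et = nat \<lfloor>et\<rfloor> ==> hexp et = et - of_int \<lfloor>et\<rfloor>"
proof -
 have c: "\<lceil>et\<rceil> \<ge> 1" using assms by (simp add: less_ceiling_iff le_ceiling_iff)
 then have r: "real (hidx et) = of_int \<lceil>et\<rceil> - 1" by (simp add: hidx_def)
 show "0 < hexp et" "hexp et \<le> 1" "real (hidx et) + hexp et = et"
 unfolding hexp_def r using ceiling_correct[of et] by linarith+
 have f: "\<lfloor>et\<rfloor> \<ge> 0" using assms by simp
 have le: "\<lceil>et\<rceil> \<le> \<lfloor>et\<rfloor> + 1" using ceiling_diff_floor_le_1[of et] by linarith
 then show "hidx et \<le> nat \<lfloor>et\<rfloor>" unfolding hidx_def by (intro nat_mono) simp
 show "nat \<lfloor>et\<rfloor> = hidx et + 1 \<and> hexp et = 1" if "hidx et \<noteq> nat \<lfloor>et\<rfloor>"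
 proof -
 have "\<lceil>et\<rceil> \<noteq> \<lfloor>et\<rfloor> + 1" using that by (auto simp: hidx_def)
 then have e: "\<lceil>et\<rceil> = \<lfloor>et\<rfloor>" using le floor_le_ceiling[of et] by linarith
 have h: "nat \<lfloor>et\<rfloor> = hidx et + 1" using c unfolding hidx_def e by linarith
 have "hexp et = et - (of_int \<lceil>et\<rceil> - 1)" unfolding hexp_def r ..
 also have "... = 1" using e of_int_floor_le[of et] le_of_int_ceiling[of et] by linarith
 finally show ?thesis using h by simp
 qed
 show "hexp et = et - of_int \<lfloor>et\<rfloor>" if "hidx et = nat \<lfloor>et\<rfloor>"
 using that f unfolding hexp_def by simp
qed

text \<open>For non-integer \<open>et\<close> the derivatives of top order are Hoelder with positive
  exponent, hence continuous, and \<open>derivative_of_ae_gradient\<close> turns them into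
  derivatives everywhere. For integer \<open>et\<close> the top order is given up: its essential
  bound makes the derivatives one order below Lipschitz.\<close>

theorem holder_class_imp_holder_bdd:
 assumes "et > 0"
 shows "holder_bdd (hidx et) (hexp et) (holder_class et 0 K :: (real^'n::finite => real) set) (%f. f)"
proof -
 define k0 where "k0 = nat \<lfloor>et\<rfloor>"
 define k where "k = hidx et"
 define s where "s = hexp et"
 let ?H = "holder_class et 0 K :: (real^'n => real) set"
 note hh = hidx_hexp[OF assms, folded k0_def k_def s_def]
 have "\<forall>f\<in>?H. \<exists>D. is_jet k0 f D \<and> (\<forall>nu. mi_order nu \<le> k0 --> (AE x in lborel. \<bar>D nu x\<bar> \<le> \<bar>K\<bar>)) \<and>
 (\<forall>nu x y. mi_order nu = k0 --> \<bar>D nu x - D nu y\<bar> \<le> \<bar>K\<bar> * norm (x - y) powr (et - of_int \<lfloor>et\<rfloor>))"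
 proof
 fix f assume "f \<in> ?H"
 from holder_classE[OF this, folded k0_def]
 show "\<exists>D. is_jet k0 f D \<and> (\<forall>nu. mi_order nu \<le> k0 --> (AE x in lborel. \<bar>D nu x\<bar> \<le> \<bar>K\<bar>)) \<and>
 (\<forall>nu x y. mi_order nu = k0 --> \<bar>D nu x - D nu y\<bar> \<le> \<bar>K\<bar> * norm (x - y) powr (et - of_int \<lfloor>et\<rfloor>))"
 by metis
 qed
 from bchoice[OF this] obtain D where D: "!!f. f \<in> ?H ==> is_jet k0 f (D f)"
 "!!f nu. f \<in> ?H ==> mi_order nu \<le> k0 ==> AE x in lborel. \<bar>D f nu x\<bar> \<le> \<bar>K\<bar>"
 "!!f nu x y. f \<in> ?H ==> mi_order nu = k0 ==> \<bar>D f nu x - D f nu y\<bar> \<le> \<bar>K\<bar> * norm (x - y) powr (et - of_int \<lfloor>et\<rfloor>)"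
 by blast
 have lip: "\<exists>r>0. \<exists>B. B-lipschitz_on (ball x r) (D f nu)" if "f \<in> ?H" "mi_order nu + 1 = k0" for f nu x
 using D(1)[OF that(1)] that(2) unfolding is_jet_def by blast
 have aed: "AE x in lborel. (D f nu has_derivative (%h. \<Sum>i\<in>UNIV. D f (nu(i := nu i + 1)) x * h $ i)) (at x)"
 if "f \<in> ?H" "mi_order nu + 1 = k0" for f nu
 using D(1)[OF that(1)] that(2) unfolding is_jet_def by (blast intro: AE_lebesgue_imp_lborel)
 have der: "(D f nu has_derivative (%h. \<Sum>i\<in>UNIV. D f (nu(i := nu i + 1)) x * h $ i)) (at x)"
 if "f \<in> ?H" "mi_order nu + 1 < k0" for f nu x
 using D(1)[OF that(1)] that(2) unfolding is_jet_def by blast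
 \<comment> \<open>Three sources of continuity: differentiability below order \<open>k0 - 1\<close>,
   the local Lipschitz condition of \<open>is_jet\<close> at order \<open>k0 - 1\<close>, and the
   Hoelder bound at order \<open>k0\<close>, which is reached only if \<open>k = k0\<close>.\<close>
 have cont: "continuous_on UNIV (D f nu)" if fm: "f \<in> ?H" "mi_order nu \<le> k" for f nu
 proof (rule continuous_at_imp_continuous_on, intro ballI)
 fix x
 have "mi_order nu + 1 < k0 \<or> mi_order nu + 1 = k0 \<or> mi_order nu = k0 \<and> k = k0" using fm hh(4) by linarith
 then consider "mi_order nu + 1 < k0" | "mi_order nu + 1 = k0" | "mi_order nu = k0" "k = k0" by blast
 then show "isCont (D f nu) x"
 proof cases
 case 1
 then show ?thesis using has_derivative_continuous[OF der[OF fm(1) 1]] by simp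
 next
 case 2
 obtain r B where r: "r > 0" "B-lipschitz_on (ball x r) (D f nu)" using lip[OF fm(1) 2] by blast
 show ?thesis using lipschitz_on_continuous_on[OF r(2)] r(1) by (simp add: continuous_on_eq_continuous_at)
 next
 case 3
 then have "s = et - of_int \<lfloor>et\<rfloor>" using hh(6) by simp
 then have "continuous_on UNIV (D f nu)"
 using continuous_of_holder[of "D f nu" "\<bar>K\<bar>" s] D(3)[OF fm(1) 3(1)] hh(1) by simp
 then show ?thesis by (simp add: continuous_on_eq_continuous_at)
 qed
 qed
 have bd: "\<bar>D f nu x\<bar> \<le> \<bar>K\<bar>" if "f \<in> ?H" "mi_order nu \<le> k" for f nu x
 by (rule continuous_AE_bound[OF cont[OF that] D(2)[OF that(1)]]) (use that hh(4) in linarith)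
 have "holder_bdd m s ?H (%f. D f nu)" if "mi_order nu + m = k" for m nu
 using that
 proof (induction m arbitrary: nu)
 case 0
 have "\<exists>B. \<forall>f\<in>?H. \<forall>x y. \<bar>D f nu x - D f nu y\<bar> \<le> B * norm (x - y) powr s"
 proof (cases "k = k0")
 case True
 then have "s = et - of_int \<lfloor>et\<rfloor>" using hh(6) by simp
 then show ?thesis using D(3)[of _ nu] 0 True by (intro exI[of _ "\<bar>K\<bar>"]) auto
 next
 case False
 then have k: "k0 = k + 1" "s = 1" using hh(5) by auto
 have "\<bar>D f nu x - D f nu y\<bar> \<le> CARD('n) * \<bar>K\<bar> * norm (x - y)" if f: "f \<in> ?H" for f x y
 proof (rule lipschitz_of_ae_gradient[OF lip[OF f] aed[OF f]])
 have "AE y in lborel. \<bar>D f (nu(i := nu i + 1)) y\<bar> \<le> \<bar>K\<bar>" for i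
 proof (rule D(2)[OF f])
 show "mi_order (nu(i := nu i + 1)) \<le> k0" unfolding mi_order_upd using 0 k by simp
 qed
 then show "AE y in lborel. \<forall>i. \<bar>D f (nu(i := nu i + 1)) y\<bar> \<le> \<bar>K\<bar>"
 by (simp add: AE_all_countable)
 qed (use 0 k in auto)
 then show ?thesis using k by (intro exI[of _ "CARD('n) * \<bar>K\<bar>"]) simp
 qed
 then show ?case unfolding holder_bdd.simps using bd[of _ nu] 0 by auto
 next
 case (Suc m)
 have upd: "mi_order (nu(i := nu i + 1)) + m = k" for i
 unfolding mi_order_upd using Suc.prems by simp
 have upd': "mi_order (nu(i := nu i + 1)) \<le> k" for i using upd[of i] by linarith
 have sub: "holder_bdd m s ?H (%f. D f (nu(i := nu i + 1)))" for i
 by (rule Suc.IH[OF upd])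
 have "(D f nu has_derivative (%h. \<Sum>i\<in>UNIV. D f (nu(i := nu i + 1)) x * h $ i)) (at x)" if f: "f \<in> ?H" for f x
 proof (cases "mi_order nu + 1 < k0")
 case True
 then show ?thesis by (rule der[OF f])
 next
 case False
 then have e: "mi_order nu + 1 = k0" using Suc.prems hh(4) by linarith
 show ?thesis
 proof (rule derivative_of_ae_gradient[OF lip[OF f e] aed[OF f e]])
 have "continuous_on UNIV (D f (nu(i := nu i + 1)))" for i
 by (rule cont[OF f upd'])
 then show "isCont (D f (nu(i := nu i + 1))) x" for i by (simp add: continuous_on_eq_continuous_at)
 qed
 qed
 then show ?case unfolding holder_bdd.simps using bd[of _ nu] Suc.prems sub
 by (intro conjI exI[of _ "\<bar>K\<bar>"] exI[of _ "%i f. D f (nu(i := nu i + 1))"]) auto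
 qed
 from this[of "%_. 0" k] have "holder_bdd k s ?H (%f. D f (%_. 0))" by simp
 moreover have "D f (%_. 0) = f" if "f \<in> ?H" for f using D(1)[OF that] by (simp add: is_jet_def)
 ultimately show ?thesis unfolding k_def[symmetric] s_def[symmetric] by (subst (asm) holder_bdd_cong) auto
qed

section \<open>Product bumps and mollification\<close>

text \<open>The polynomial left over when the power \<open>R - r\<close> of \<open>1 - t^2\<close>
  is split off the \<open>r\<close>-th derivative of its power \<open>R\<close>; the recursion is
  the product rule. A truncated polynomial has as many derivatives as a given proof needs and keeps
  them explicit.\<close>

primrec bump_poly :: "nat => nat => real poly" where
 "bump_poly R 0 = 1"
| "bump_poly R (Suc r) = smult (- 2 * real (R - r)) ([:0, 1:] * bump_poly R r) + [:1, 0, -1:] * pderiv (bump_poly R r)"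

text \<open>\<open>bump1 N r\<close> is the \<open>r\<close>-th derivative of \<open>(1 - t\<^sup>2)\<^sub>+\<close> to the power \<open>N + 2\<close>.\<close>

definition bump1 :: "nat => nat => real => real" where
 "bump1 N r t = max 0 (1 - t\<^sup>2) ^ (N + 2 - r) * poly (bump_poly (N + 2) r) t"

lemma max0_power_deriv:
 assumes "m \<ge> 2"
 shows "((%u::real. max 0 u ^ m) has_real_derivative real m * max 0 u ^ (m - 1)) (at u)"
proof -
 consider "u < 0" | "u > 0" | "u = 0" by linarith
 then show ?thesis
 proof cases
 case 1
 have "((%u::real. 0) has_real_derivative 0) (at u)" by simp
 then have "((%u::real. max 0 u ^ m) has_real_derivative 0) (at u)"
 by (rule DERIV_cong_ev[THEN iffD1, rotated 3])
 (use 1 assms eventually_nhds_in_open[of "{..<0}" u] in \<open>auto elim!: eventually_mono simp: max_def\<close>)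
 then show ?thesis using 1 assms by (simp add: max_def power_0_left)
 next
 case 2
 have "((%u::real. u ^ m) has_real_derivative real m * u ^ (m - 1)) (at u)"
 using DERIV_pow[of m u UNIV] by simp
 then have "((%u::real. max 0 u ^ m) has_real_derivative real m * u ^ (m - 1)) (at u)"
 by (rule DERIV_cong_ev[THEN iffD1, rotated 3])
 (use 2 eventually_nhds_in_open[of "{0<..}" u] in \<open>auto elim!: eventually_mono simp: max_def\<close>)
 then show ?thesis using 2 by (simp add: max_def)
 next
 case 3
 have "((%h::real. (max 0 (0 + h) ^ m - max 0 0 ^ m) / h) \<longlongrightarrow> 0) (at 0)"
 proof (rule Lim_null_comparison)
 show "eventually (%h::real. norm ((max 0 (0 + h) ^ m - max 0 0 ^ m) / h) \<le> \<bar>h\<bar>) (at 0)"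
 proof -
 have "eventually (%h::real. h \<in> {-1<..<1}) (at 0)" by (rule eventually_at_in_open') auto
 then show ?thesis
 proof eventually_elim
 case (elim h)
 have "max 0 h ^ m \<le> \<bar>h\<bar> ^ m" by (intro power_mono) auto
 also have "... \<le> \<bar>h\<bar> ^ 2" using elim assms by (intro power_decreasing) auto
 finally have "max 0 h ^ m \<le> \<bar>h\<bar> * \<bar>h\<bar>" by (simp add: power2_eq_square)
 then show ?case using assms by (cases "h = 0") (auto simp: abs_divide divide_le_eq power_0_left)
 qed
 qed
 show "((%h::real. \<bar>h\<bar>) \<longlongrightarrow> 0) (at 0)" by (rule tendsto_eq_intros refl | simp)+
 qed
 then show ?thesis using 3 assms by (simp add: DERIV_def power_0_left)
 qed
qed

lemma bump1_deriv:
 assumes "r \<le> N"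
 shows "(bump1 N r has_real_derivative bump1 N (Suc r) t) (at t)"
proof -
 define m where "m = N + 2 - r"
 have m: "m \<ge> 2" "N + 2 - Suc r = m - 1" using assms by (auto simp: m_def)
 let ?w = "max 0 (1 - t\<^sup>2)" and ?P = "bump_poly (N + 2) r"
 have 1: "((%t. max 0 (1 - t\<^sup>2) ^ m) has_real_derivative (real m * ?w ^ (m - 1)) * (- 2 * t)) (at t)"
 by (rule DERIV_chain'[OF _ max0_power_deriv[OF m(1)]]) (auto intro!: derivative_eq_intros)
 have 2: "(bump1 N r has_real_derivative (real m * ?w ^ (m - 1)) * (- 2 * t) * poly ?P t + poly (pderiv ?P) t * ?w ^ m) (at t)"
 unfolding bump1_def m_def[symmetric] by (rule DERIV_mult[OF 1 poly_DERIV])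
 \<comment> \<open>The positive part may be dropped in one factor because, by
   \<open>m \<ge> 2\<close>, another factor remains that vanishes wherever \<open>1 - t^2\<close> is
   negative.\<close>
 have w: "?w ^ m = ?w ^ (m - 1) * (1 - t\<^sup>2)"
 proof -
 have "?w ^ m = ?w ^ (m - 1) * ?w" using m(1) by (metis Suc_1 Suc_le_D diff_Suc_1 mult.commute power_Suc)
 also have "... = ?w ^ (m - 1) * (1 - t\<^sup>2)" using m(1) by (simp add: max_def power_0_left)
 finally show ?thesis .
 qed
 have "poly (bump_poly (N + 2) (Suc r)) t = - 2 * real m * (t * poly ?P t) + (1 - t\<^sup>2) * poly (pderiv ?P) t"
 by (simp add: m_def power2_eq_square algebra_simps)
 then have "bump1 N (Suc r) t = ?w ^ (m - 1) * (- 2 * real m * (t * poly ?P t) + (1 - t\<^sup>2) * poly (pderiv ?P) t)"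
 unfolding bump1_def m(2) by simp
 also have "... = (real m * ?w ^ (m - 1)) * (- 2 * t) * poly ?P t + poly (pderiv ?P) t * ?w ^ m"
 unfolding w by (simp add: algebra_simps)
 finally show ?thesis using 2 by simp
qed

lemma bump1_cont: "continuous_on A (bump1 N r)"
 unfolding bump1_def by (intro continuous_intros)

lemma bump1_supp: "r \<le> N + 1 ==> \<bar>t\<bar> \<ge> 1 ==> bump1 N r t = 0"
proof -
 assume "r \<le> N + 1" "\<bar>t\<bar> \<ge> 1"
 then have "1 - t\<^sup>2 \<le> 0" using power_mono[of 1 "\<bar>t\<bar>" 2] by simp
 then show ?thesis using \<open>r \<le> N + 1\<close> by (simp add: bump1_def max_def)
qed

lemma bump1_0: "bump1 N 0 t = max 0 (1 - t\<^sup>2) ^ (N + 2)" by (simp add: bump1_def)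

text \<open>For \<open>nu\<close> of order at most \<open>N + 1\<close> this is the partial
  derivative of that order of the bump with index 0, by \<open>pbump_deriv\<close>. The support is
  the cube of half-width 1, so every point of it has norm at most \<open>CARD('n)\<close>.\<close>

definition pbump :: "nat => ('n::finite => nat) => real^'n => real" where
 "pbump N nu x = (\<Prod>i\<in>UNIV. bump1 N (nu i) (x $ i))"

lemma le_mi_order: "nu i \<le> mi_order nu" for nu :: "'n::finite => nat"
 unfolding mi_order_def by (rule member_le_sum) auto

lemma pbump_cont: "continuous_on A (pbump N nu)"
 unfolding pbump_def
 by (intro continuous_on_prod continuous_on_compose2[OF bump1_cont[of UNIV]] continuous_intros) auto

lemma pbump_meas [measurable]: "pbump N nu \<in> bmeas"
 by (rule borel_measurable_continuous_onI[OF pbump_cont])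

lemma pbump_supp:
 assumes "mi_order nu \<le> N + 1" "\<bar>x $ i\<bar> \<ge> 1"
 shows "pbump N nu x = 0"
proof -
 have "bump1 N (nu i) (x $ i) = 0" by (rule bump1_supp) (use assms le_mi_order[of nu i] in auto)
 then show ?thesis unfolding pbump_def by (intro prod_zero) auto
qed

lemma norm_le_card_inf: "(!!i. \<bar>x $ i\<bar> \<le> 1) ==> norm (x :: real^'n::finite) \<le> CARD('n)"
 using sum_nth_bound[of x 1] by simp

lemma pbump_supp_norm:
 fixes x :: "real^'n::finite"
 assumes "mi_order nu \<le> N + 1" "norm x > CARD('n)"
 shows "pbump N nu x = 0"
proof -
 obtain i where "\<bar>x $ i\<bar> > 1" using norm_le_card_inf[of x] assms(2) by (meson linorder_not_less)
 then show ?thesis by (intro pbump_supp[OF assms(1), of x i]) auto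
qed

lemma pbump_deriv:
 fixes x :: "real^'n::finite"
 assumes "mi_order nu \<le> N"
 shows "(pbump N nu has_derivative (%h. \<Sum>i\<in>UNIV. pbump N (nu(i := nu i + 1)) x * h $ i)) (at x)"
proof -
 have d: "((%x. bump1 N (nu i) (x $ i)) has_derivative (%h. bump1 N (Suc (nu i)) (x $ i) * h $ i)) (at x)" for i
 proof -
 have "nu i \<le> N" using le_mi_order[of nu i] assms by linarith
 from bump1_deriv[OF this, of "x $ i"]
 have "(bump1 N (nu i) has_derivative (%t. bump1 N (Suc (nu i)) (x $ i) * t)) (at (x $ i))"
 by (simp add: has_field_derivative_def)
 from has_derivative_compose[OF bounded_linear_imp_has_derivative[OF bounded_linear_vec_nth] this]
 show ?thesis .
 qed
 have "(pbump N nu has_derivative (%h. \<Sum>i\<in>UNIV. (bump1 N (Suc (nu i)) (x $ i) * h $ i) * (\<Prod>j\<in>UNIV - {i}. bump1 N (nu j) (x $ j)))) (at x)"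
 unfolding pbump_def[abs_def] by (rule has_derivative_prod) (rule d)
 moreover have "pbump N (nu(i := nu i + 1)) x = bump1 N (Suc (nu i)) (x $ i) * (\<Prod>j\<in>UNIV - {i}. bump1 N (nu j) (x $ j))" for i
 unfolding pbump_def by (subst prod.remove[of _ i]) (auto intro!: prod.cong)
 ultimately show ?thesis by (simp add: mult_ac)
qed

lemma pbump_bound:
 obtains B where "B > 0" "!!nu (x :: real^'n::finite). mi_order nu \<le> N + 1 ==> \<bar>pbump N nu x\<bar> \<le> B"
proof -
 have ex: "\<exists>B. \<forall>x :: real^'n. \<bar>pbump N nu x\<bar> \<le> B" if "mi_order nu \<le> N + 1" for nu
 proof -
 have "compact (pbump N nu ` cball (0 :: real^'n) CARD('n))"
 by (intro compact_continuous_image pbump_cont compact_cball)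
 then have "bounded (pbump N nu ` cball (0 :: real^'n) CARD('n))" by (rule compact_imp_bounded)
 then obtain B where B: "!!x :: real^'n. norm x \<le> CARD('n) ==> \<bar>pbump N nu x\<bar> \<le> B"
 unfolding bounded_iff by (metis image_eqI mem_cball_0 real_norm_def)
 have "\<bar>pbump N nu x\<bar> \<le> \<bar>B\<bar>" for x :: "real^'n"
 using B[of x] pbump_supp_norm[OF that, of x] by (cases "norm x \<le> CARD('n)") auto
 then show ?thesis by blast
 qed
 then obtain b where b: "!!nu (x :: real^'n). mi_order nu \<le> N + 1 ==> \<bar>pbump N nu x\<bar> \<le> b nu" by metis
 let ?S = "{nu :: 'n => nat. mi_order nu \<le> N + 1}"
 have "\<bar>pbump N nu x\<bar> \<le> (\<Sum>nu\<in>?S. \<bar>b nu\<bar>) + 1" if "mi_order nu \<le> N + 1" for nu and x :: "real^'n"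
 proof -
 have "\<bar>b nu\<bar> \<le> (\<Sum>nu\<in>?S. \<bar>b nu\<bar>)" using that by (intro member_le_sum finite_mi_order_le) auto
 then show ?thesis using b[OF that, of x] by linarith
 qed
 moreover have "(\<Sum>nu\<in>?S. \<bar>b nu\<bar>) + 1 > 0" by (intro add_nonneg_pos sum_nonneg) auto
 ultimately show ?thesis using that by blast
qed

lemma pbump_0_nonneg: "pbump N (%_. 0) x \<ge> 0"
 by (auto simp: pbump_def bump1_0 intro!: prod_nonneg)

lemma pbump_0_even: "pbump N (%_. 0) (- x) = pbump N (%_. 0) x"
 by (simp add: pbump_def bump1_0)

lemma pbump_0_0: "pbump N (%_. 0) 0 = 1"
 by (simp add: pbump_def bump1_0)

lemma pbump_0_le_1: "pbump N (%_. 0) x \<le> 1"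
 unfolding pbump_def bump1_0 by (intro prod_le_1 conjI zero_le_power power_le_one) auto

lemma pbump_integrable:
 fixes nu :: "'n::finite => nat"
 assumes "mi_order nu \<le> N + 1"
 shows "integrable lborel (pbump N nu)"
proof -
 have "integrable lborel (%x. indicator (cball (0 :: real^'n) CARD('n)) x *\<^sub>R pbump N nu x)"
 by (intro borel_integrable_compact compact_cball pbump_cont)
 moreover have "indicator (cball (0 :: real^'n) CARD('n)) x *\<^sub>R pbump N nu x = pbump N nu x" for x
 using pbump_supp_norm[OF assms, of x] by (auto simp: indicator_def)
 then have "(%x. indicator (cball (0 :: real^'n) CARD('n)) x *\<^sub>R pbump N nu x) = pbump N nu" by blast
 ultimately show ?thesis by simp
qed

lemma integrable_bounded_mult:
 fixes f p :: "'a => real"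
 assumes "integrable M p" "f \<in> borel_measurable M" "!!x. \<bar>f x\<bar> \<le> B"
 shows "integrable M (%x. f x * p x)"
proof (rule Bochner_Integration.integrable_bound[of M "%x. B * p x"])
 show "AE x in M. norm (f x * p x) \<le> norm (B * p x)"
 proof (rule AE_I2)
 fix x
 have "\<bar>f x\<bar> \<le> \<bar>B\<bar>" using assms(3)[of x] by linarith
 then show "norm (f x * p x) \<le> norm (B * p x)" by (simp add: abs_mult mult_right_mono)
 qed
qed (use assms in auto)

lemma abs_integral_mult_le:
 fixes f p :: "'a => real"
 assumes "integrable M p" "f \<in> borel_measurable M" "!!x. p x \<noteq> 0 ==> \<bar>f x\<bar> \<le> B"
 shows "\<bar>\<integral>x. f x * p x \<partial>M\<bar> \<le> B * (\<integral>x. \<bar>p x\<bar> \<partial>M)"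
proof -
 have le: "\<bar>f x * p x\<bar> \<le> B * \<bar>p x\<bar>" for x
 using assms(3)[of x] by (cases "p x = 0") (auto simp: abs_mult mult_right_mono)
 have int: "integrable M (%x. B * \<bar>p x\<bar>)" using assms(1) by auto
 have int2: "integrable M (%x. f x * p x)"
 by (rule Bochner_Integration.integrable_bound[OF int]) (use le assms order_trans[OF le abs_ge_self] in auto)
 have "\<bar>\<integral>x. f x * p x \<partial>M\<bar> \<le> (\<integral>x. \<bar>f x * p x\<bar> \<partial>M)" by (rule integral_abs_bound)
 also have "... \<le> (\<integral>x. B * \<bar>p x\<bar> \<partial>M)" by (intro integral_mono le int integrable_abs int2)
 finally show ?thesis by simp
qed

definition bump_mass :: "nat => 'n::finite itself => real" where
 "bump_mass N _ = (LBINT x. pbump N (%_::'n. 0) x)"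

lemma bump_mass_pos: "bump_mass N TYPE('n::finite) > 0"
proof -
 let ?p = "pbump N (%_::'n. 0)"
 have int: "integrable lborel ?p" by (rule pbump_integrable) simp
 have "bump_mass N TYPE('n) \<noteq> 0"
 proof
 assume "bump_mass N TYPE('n) = 0"
 then have "AE x in lborel. ?p x = 0"
 using integral_nonneg_eq_0_iff_AE[OF int AE_I2[OF pbump_0_nonneg]] by (simp add: bump_mass_def)
 then have "AE x in lborel. \<bar>?p x\<bar> \<le> 0" by eventually_elim simp
 from continuous_AE_bound[OF pbump_cont this, of 0] show False by (simp add: pbump_0_0)
 qed
 moreover have "bump_mass N TYPE('n) \<ge> 0" unfolding bump_mass_def by (intro Bochner_Integration.integral_nonneg pbump_0_nonneg)
 ultimately show ?thesis by simp
qed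

text \<open>The partial derivative of order \<open>nu\<close> of the mollification at scale
  \<open>bw\<close>, written with all derivatives on the kernel: each of them contributes a factor
  \<open>- 1 / bw\<close>.\<close>

definition moll :: "nat => ('n::finite => nat) => real => (real^'n => real) => real^'n => real" where
 "moll N nu bw f x = (- 1) ^ mi_order nu / (bw ^ mi_order nu * bump_mass N TYPE('n)) *
 (LBINT z. f (x + bw *\<^sub>R z) * pbump N nu z)"

lemma taylor_first_order:
 fixes f :: "real^'n::finite => real" and B :: real
 assumes d: "!!x. (f has_derivative (%h. \<Sum>j\<in>UNIV. f' j x * h $ j)) (at x)"
 and hol: "!!j x y. \<bar>f' j x - f' j y\<bar> \<le> B * norm (x - y) powr s" and s: "s > 0" and B: "B \<ge> 0"
 shows "\<bar>f (x + h) - f x - (\<Sum>j\<in>UNIV. f' j x * h $ j)\<bar> \<le> CARD('n) * B * norm h powr (1 + s)"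
proof -
 define g where "g y = f y - (\<Sum>j\<in>UNIV. f' j x * y $ j)" for y
 have lin: "bounded_linear (%y. \<Sum>j\<in>UNIV. f' j x * y $ j)"
 by (intro bounded_linear_sum bounded_linear_const_mult bounded_linear_vec_nth)
 have "norm (g (x + h) - g x) \<le> (CARD('n) * (B * norm h powr s)) * norm (x + h - x)"
 proof (rule differentiable_bound[of "cball x (norm h)"])
 fix y assume y: "y \<in> cball x (norm h)"
 have "(g has_derivative (%k. (\<Sum>j\<in>UNIV. f' j y * k $ j) - (\<Sum>j\<in>UNIV. f' j x * k $ j))) (at y)"
 unfolding g_def by (rule has_derivative_diff[OF d bounded_linear_imp_has_derivative[OF lin]])
 then show "(g has_derivative (%k. \<Sum>j\<in>UNIV. (f' j y - f' j x) * k $ j)) (at y within cball x (norm h))"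
 by - (rule has_derivative_at_withinI, simp only: left_diff_distrib sum_subtractf)
 show "onorm (%k. \<Sum>j\<in>UNIV. (f' j y - f' j x) * k $ j) \<le> CARD('n) * (B * norm h powr s)"
 proof (rule onorm_le)
 fix k :: "real^'n"
 have "\<bar>f' j y - f' j x\<bar> \<le> B * norm h powr s" for j
 proof (rule order_trans[OF hol])
 show "B * norm (y - x) powr s \<le> B * norm h powr s"
 using y s B by (intro mult_left_mono powr_mono2) (auto simp: dist_norm norm_minus_commute)
 qed
 from abs_sum_comp_le[OF this, where h = k]
 show "norm (\<Sum>j\<in>UNIV. (f' j y - f' j x) * k $ j) \<le> CARD('n) * (B * norm h powr s) * norm k" by simp
 qed
 qed (auto simp: dist_norm)
 moreover have "g (x + h) - g x = f (x + h) - f x - (\<Sum>j\<in>UNIV. f' j x * h $ j)"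
 by (simp add: g_def algebra_simps sum.distrib)
 moreover have "norm h powr s * norm h = norm h powr (1 + s)" by (cases "h = 0") (simp_all add: powr_add)
 ultimately show ?thesis by (simp add: mult.assoc)
qed

text \<open>Derivatives of mollifications and of inverse matrices are obtained from explicit
  remainders of order \<open>1 + s\<close>. Such a bound survives integration against a kernel,
  which replaces differentiation under the integral sign.\<close>

lemma has_derivative_of_remainder:
 fixes g :: "real^'n::finite => real"
 assumes "!!h. norm h \<le> 1 ==> \<bar>g (x + h) - g x - (\<Sum>j\<in>UNIV. c j * h $ j)\<bar> \<le> C * norm h powr (1 + s)" "s > 0"
 shows "(g has_derivative (%h. \<Sum>j\<in>UNIV. c j * h $ j)) (at x)"
 unfolding has_derivative_at_alt
proof (intro conjI allI impI)
 show "bounded_linear (%h. \<Sum>j\<in>UNIV. c j * h $ j)"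
 by (intro bounded_linear_sum bounded_linear_const_mult bounded_linear_vec_nth)
 fix e :: real assume e: "e > 0"
 define d where "d = min 1 ((e / (\<bar>C\<bar> + 1)) powr (1 / s))"
 have d: "d > 0" "d \<le> 1" "d powr s \<le> e / (\<bar>C\<bar> + 1)"
 proof -
 show "d > 0" "d \<le> 1" using e by (auto simp: d_def)
 have "d powr s \<le> ((e / (\<bar>C\<bar> + 1)) powr (1 / s)) powr s"
 using \<open>d > 0\<close> assms(2) by (intro powr_mono2) (auto simp: d_def)
 also have "... = e / (\<bar>C\<bar> + 1)" using e assms(2) by (simp add: powr_powr)
 finally show "d powr s \<le> e / (\<bar>C\<bar> + 1)" .
 qed
 show "\<exists>d>0. \<forall>y. norm (y - x) < d --> norm (g y - g x - (\<Sum>j\<in>UNIV. c j * (y - x) $ j)) \<le> e * norm (y - x)"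
 proof (intro exI[of _ d] conjI d(1) allI impI)
 fix y assume y: "norm (y - x) < d"
 have "norm (g y - g x - (\<Sum>j\<in>UNIV. c j * (y - x) $ j)) \<le> C * norm (y - x) powr (1 + s)"
 using assms(1)[of "y - x"] y d by simp
 also have "... \<le> (\<bar>C\<bar> + 1) * norm (y - x) powr (1 + s)" by (intro mult_right_mono) auto
 also have "norm (y - x) powr (1 + s) = norm (y - x) powr s * norm (y - x)"
 by (cases "y = x") (simp_all add: powr_add)
 also have "(\<bar>C\<bar> + 1) * (norm (y - x) powr s * norm (y - x)) \<le> (\<bar>C\<bar> + 1) * ((e / (\<bar>C\<bar> + 1)) * norm (y - x))"
 proof (intro mult_left_mono mult_right_mono)
 have "norm (y - x) powr s \<le> d powr s" using y assms(2) by (intro powr_mono2) auto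
 then show "norm (y - x) powr s \<le> e / (\<bar>C\<bar> + 1)" using d(3) by linarith
 qed auto
 also have "... = e * norm (y - x)" using add_nonneg_pos[OF abs_ge_zero[of C] zero_less_one] by simp
 finally show "norm (g y - g x - (\<Sum>j\<in>UNIV. c j * (y - x) $ j)) \<le> e * norm (y - x)" .
 qed
qed

context
 fixes N :: nat and nu :: "'n::finite => nat" and bw :: real and f :: "real^'n => real" and B0 :: real
 assumes bw: "bw > 0" and f: "continuous_on UNIV f" "!!x. \<bar>f x\<bar> \<le> B0"
begin

lemma moll_integrand_meas: "(%z. f (x + bw *\<^sub>R z)) \<in> borel_measurable lborel"
 using borel_measurable_continuous_onI[OF continuous_on_compose2[OF f(1), of UNIV "%z. x + bw *\<^sub>R z"]]
 by (simp add: continuous_intros)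

lemma moll_integrable: "mi_order nu \<le> N + 1 ==> integrable lborel (%z. f (x + bw *\<^sub>R z) * pbump N nu z)"
 by (rule integrable_bounded_mult[OF pbump_integrable moll_integrand_meas f(2)])

lemma moll_translate:
 "(LBINT z. f (x + h + bw *\<^sub>R z) * pbump N nu z) = (LBINT w. f (x + bw *\<^sub>R w) * pbump N nu (w - h /\<^sub>R bw))"
proof -
 define v where "v = h /\<^sub>R bw"
 have "(LBINT w. f (x + bw *\<^sub>R w) * pbump N nu (w - v)) = (\<integral>w. f (x + bw *\<^sub>R w) * pbump N nu (w - v) \<partial>distr lborel borel ((+) v))"
 by (simp add: lborel_distr_plus)
 also have "... = (LBINT z. f (x + bw *\<^sub>R (v + z)) * pbump N nu (v + z - v))"
 proof (rule integral_distr)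
 show "(%w. f (x + bw *\<^sub>R w) * pbump N nu (w - v)) \<in> bmeas"
 using moll_integrand_meas[of x] by auto
 qed auto
 also have "... = (LBINT z. f (x + h + bw *\<^sub>R z) * pbump N nu z)"
 using bw by (simp add: v_def scaleR_add_right add.assoc)
 finally show ?thesis by (simp add: v_def)
qed

text \<open>A translation of the integration variable moves the increment from \<open>f\<close> into
  the kernel, whose Taylor remainder is quadratic. Hence boundedness and continuity of
  \<open>f\<close> suffice.\<close>

lemma moll_has_derivative_kernel:
 assumes nu: "mi_order nu + 1 \<le> N"
 shows "(moll N nu bw f has_derivative (%h. \<Sum>i\<in>UNIV. moll N (nu(i := nu i + 1)) bw f x * h $ i)) (at x)"
proof -
 obtain B where B: "B > 0" "!!nu (x :: real^'n). mi_order nu \<le> N + 1 ==> \<bar>pbump N nu x\<bar> \<le> B"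
 using pbump_bound by blast
 let ?n = "real CARD('n)"
 have Lip: "\<bar>pbump N (nu(j := nu j + 1)) y - pbump N (nu(j := nu j + 1)) z\<bar> \<le> (?n * B) * norm (y - z) powr 1" for j y z
 proof -
 have o: "mi_order (nu(j := nu j + 1)) \<le> N" unfolding mi_order_upd using nu by simp
 have "\<bar>pbump N (nu(j := nu j + 1)) y - pbump N (nu(j := nu j + 1)) z\<bar> \<le> ?n * B * norm (y - z)"
 proof (rule grad_bound_imp_lipschitz[OF pbump_deriv[OF o] B(2)])
 fix i show "mi_order ((nu(j := nu j + 1))(i := (nu(j := nu j + 1)) i + 1)) \<le> N + 1"
 unfolding mi_order_upd using nu by simp
 qed
 then show ?thesis by simp
 qed
 have rem: "\<bar>pbump N nu (w - v) - pbump N nu w + (\<Sum>i\<in>UNIV. pbump N (nu(i := nu i + 1)) w * v $ i)\<bar> \<le> ?n * (?n * B) * norm v ^ 2" for w v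
 proof -
 have "mi_order nu \<le> N" using nu by simp
 from taylor_first_order[OF pbump_deriv[OF this] Lip, of w "- v"] B(1)
 show ?thesis by (simp add: sum_negf powr_numeral)
 qed
 define c where "c = (- 1) ^ mi_order nu / (bw ^ mi_order nu * bump_mass N TYPE('n))"
 define I where "I nu = (LBINT z. f (x + bw *\<^sub>R z) * pbump N nu z)" for nu
 have T: "moll N nu bw f x = c * I nu" by (simp add: moll_def c_def I_def)
 have Tu: "moll N (nu(i := nu i + 1)) bw f x = - (c / bw) * I (nu(i := nu i + 1))" for i
 unfolding moll_def mi_order_upd by (simp add: c_def I_def)
 \<comment> \<open>Outside this ball the kernel and its translate both vanish: the support reaches
   no further than \<open>?n\<close>, and the shift \<open>v\<close> has norm at most
   \<open>1 / bw\<close> because \<open>norm h \<le> 1\<close>.\<close>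
 let ?R = "?n + 1 / bw"
 have vol: "integrable lborel (%w. indicator (cball (0 :: real^'n) ?R) w :: real)"
 using emeasure_lborel_cball_finite[of "0 :: real^'n" ?R] by (intro integrable_real_indicator) auto
 define V where "V = (\<integral>w. indicator (cball (0 :: real^'n) ?R) w \<partial>lborel :: real)"
 have V0: "V \<ge> 0" unfolding V_def by (intro Bochner_Integration.integral_nonneg) auto
 show ?thesis
 proof (rule has_derivative_of_remainder[where s = 1 and C = "\<bar>c\<bar> * (\<bar>B0\<bar> * (?n * (?n * B) / bw\<^sup>2) * V)"])
 fix h :: "real^'n" assume h: "norm h \<le> 1"
 define v where "v = h /\<^sub>R bw"
 have v: "norm v \<le> 1 / bw" "norm v ^ 2 = norm h ^ 2 / bw\<^sup>2" using h bw by (simp_all add: v_def divide_simps power_divide)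
 have ints: "integrable lborel (%w. f (x + bw *\<^sub>R w) * pbump N nu (w - v))"
 proof (rule integrable_bounded_mult[OF _ moll_integrand_meas f(2)])
 have "integrable (distr lborel borel ((+) (- v))) (pbump N nu)"
 unfolding lborel_distr_plus using nu by (intro pbump_integrable) simp
 then show "integrable lborel (%w. pbump N nu (w - v))" by (subst (asm) integrable_distr_eq) auto
 qed
 have ord: "mi_order (nu(i := nu i + 1)) \<le> N + 1" for i unfolding mi_order_upd using nu by simp
 have inti: "integrable lborel (%w. f (x + bw *\<^sub>R w) * pbump N (nu(i := nu i + 1)) w)" for i
 by (rule integrable_bounded_mult[OF pbump_integrable[OF ord] moll_integrand_meas f(2)])
 have int0: "integrable lborel (%w. f (x + bw *\<^sub>R w) * pbump N nu w)" using nu by (intro moll_integrable) simp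
 define P where "P i = pbump N (nu(i := nu i + 1))" for i
 have intP: "integrable lborel (%w. f (x + bw *\<^sub>R w) * P i w)" for i unfolding P_def by (rule inti)
 have IP: "I (nu(i := nu i + 1)) = (LBINT w. f (x + bw *\<^sub>R w) * P i w)" for i
 unfolding I_def P_def ..
 have "(\<Sum>i\<in>UNIV. I (nu(i := nu i + 1)) * v $ i) = (LBINT w. (\<Sum>i\<in>UNIV. f (x + bw *\<^sub>R w) * P i w * v $ i))"
 unfolding IP by (subst Bochner_Integration.integral_sum) (simp_all add: intP)
 moreover have "(LBINT w. f (x + bw *\<^sub>R w) * pbump N nu (w - v)) - I nu
 = (LBINT w. f (x + bw *\<^sub>R w) * pbump N nu (w - v) - f (x + bw *\<^sub>R w) * pbump N nu w)"
 unfolding I_def by (rule Bochner_Integration.integral_diff[OF ints int0, symmetric])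
 ultimately have "(LBINT w. f (x + bw *\<^sub>R w) * pbump N nu (w - v)) - I nu + (\<Sum>i\<in>UNIV. I (nu(i := nu i + 1)) * v $ i)
 = (LBINT w. (f (x + bw *\<^sub>R w) * pbump N nu (w - v) - f (x + bw *\<^sub>R w) * pbump N nu w)
 + (\<Sum>i\<in>UNIV. f (x + bw *\<^sub>R w) * P i w * v $ i))"
 by (simp only:) (rule Bochner_Integration.integral_add[symmetric],
 auto intro!: ints int0 Bochner_Integration.integrable_sum integrable_mult_left intP)
 also have "... = (LBINT w. f (x + bw *\<^sub>R w) * (pbump N nu (w - v) - pbump N nu w
 + (\<Sum>i\<in>UNIV. P i w * v $ i)))"
 by (intro Bochner_Integration.integral_cong) (simp_all add: algebra_simps sum_distrib_left)
 finally have eq: "(LBINT w. f (x + bw *\<^sub>R w) * pbump N nu (w - v)) - I nu + (\<Sum>i\<in>UNIV. I (nu(i := nu i + 1)) * v $ i) =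
 (\<integral>w. f (x + bw *\<^sub>R w) * (pbump N nu (w - v) - pbump N nu w
 + (\<Sum>i\<in>UNIV. pbump N (nu(i := nu i + 1)) w * v $ i)) \<partial>lborel)" unfolding P_def .
 let ?Q = "\<bar>B0\<bar> * (?n * (?n * B) * norm v ^ 2)"
 have "\<bar>(\<integral>w. f (x + bw *\<^sub>R w) * (pbump N nu (w - v) - pbump N nu w
 + (\<Sum>i\<in>UNIV. pbump N (nu(i := nu i + 1)) w * v $ i)) \<partial>lborel)\<bar> \<le> (LBINT w. ?Q * indicator (cball (0 :: real^'n) ?R) w)"
 proof (rule integral_abs_bound[THEN order_trans], rule integral_mono')
 show "integrable lborel (%w. ?Q * indicator (cball (0 :: real^'n) ?R) w)" using vol by simp
 fix w
 show "\<bar>f (x + bw *\<^sub>R w) * (pbump N nu (w - v) - pbump N nu w + (\<Sum>i\<in>UNIV. pbump N (nu(i := nu i + 1)) w * v $ i))\<bar>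
 \<le> ?Q * indicator (cball (0 :: real^'n) ?R) w"
 proof (cases "norm w \<le> ?R")
 case True
 have "\<bar>f (x + bw *\<^sub>R w)\<bar> \<le> \<bar>B0\<bar>" using f(2)[of "x + bw *\<^sub>R w"] by linarith
 then have "\<bar>f (x + bw *\<^sub>R w) * (pbump N nu (w - v) - pbump N nu w + (\<Sum>i\<in>UNIV. pbump N (nu(i := nu i + 1)) w * v $ i))\<bar> \<le> ?Q"
 unfolding abs_mult by (intro mult_mono rem) auto
 then show ?thesis using True by simp
 next
 case False
 have "norm w \<le> norm (w - v) + norm v" using norm_triangle_ineq[of "w - v" v] by simp
 then have 1: "norm (w - v) > ?n" using False v by linarith
 have 2: "norm w > ?n" using False bw by (smt (verit) divide_pos_pos)
 have "pbump N nu (w - v) = 0" "pbump N nu w = 0" "!!i. pbump N (nu(i := nu i + 1)) w = 0"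
 using pbump_supp_norm[OF _ 1, of nu N] pbump_supp_norm[OF _ 2, of nu N] pbump_supp_norm[OF ord 2] nu by auto
 then show ?thesis using B(1) by (simp add: indicator_def)
 qed
 qed (use B(1) in simp)
 also have "... = ?Q * V" by (simp add: V_def)
 finally have bd: "\<bar>(LBINT w. f (x + bw *\<^sub>R w) * pbump N nu (w - v)) - I nu + (\<Sum>i\<in>UNIV. I (nu(i := nu i + 1)) * v $ i)\<bar> \<le> ?Q * V"
 unfolding eq .
 have "moll N nu bw f (x + h) = c * (LBINT w. f (x + bw *\<^sub>R w) * pbump N nu (w - v))"
 unfolding moll_def moll_translate c_def v_def ..
 then have "moll N nu bw f (x + h) - moll N nu bw f x - (\<Sum>i\<in>UNIV. moll N (nu(i := nu i + 1)) bw f x * h $ i)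
 = c * ((LBINT w. f (x + bw *\<^sub>R w) * pbump N nu (w - v)) - I nu + (\<Sum>i\<in>UNIV. I (nu(i := nu i + 1)) * v $ i))"
 unfolding T Tu by (simp add: v_def algebra_simps sum_distrib_left sum_negf divide_inverse)
 also have "\<bar>...\<bar> \<le> \<bar>c\<bar> * (?Q * V)" unfolding abs_mult by (intro mult_left_mono bd) auto
 also have "... = \<bar>c\<bar> * (\<bar>B0\<bar> * (?n * (?n * B) / bw\<^sup>2) * V) * norm h powr (1 + 1)"
 by (simp add: v(2) powr_numeral)
 finally show "\<bar>moll N nu bw f (x + h) - moll N nu bw f x - (\<Sum>i\<in>UNIV. moll N (nu(i := nu i + 1)) bw f x * h $ i)\<bar>
 \<le> \<bar>c\<bar> * (\<bar>B0\<bar> * (?n * (?n * B) / bw\<^sup>2) * V) * norm h powr (1 + 1)" .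
 qed simp
qed

end

section \<open>Bounds for mollified families\<close>

lemma moll_0_bounded:
 fixes f :: "real^'n::finite => real"
 assumes "f \<in> bmeas" "!!x. \<bar>f x\<bar> \<le> B"
 shows "\<bar>moll N (%_. 0) bw f x\<bar> \<le> B"
proof -
 have m: "(%z. f (x + bw *\<^sub>R z)) \<in> borel_measurable lborel" using assms(1) by measurable
 have "\<bar>\<integral>z. f (x + bw *\<^sub>R z) * pbump N (%_. 0) z \<partial>lborel\<bar> \<le> B * (LBINT z. \<bar>pbump N (%_::'n. 0) z\<bar>)"
 by (rule abs_integral_mult_le[OF pbump_integrable m]) (use assms in auto)
 also have "(LBINT z. \<bar>pbump N (%_::'n. 0) z\<bar>) = bump_mass N TYPE('n)"
 by (simp add: bump_mass_def pbump_0_nonneg)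
 finally show ?thesis using bump_mass_pos[of N, where 'n = 'n]
 by (simp add: moll_def abs_mult divide_le_eq)
qed

lemma partials_unique:
 fixes g :: "real^'n::finite => real"
 assumes "(g has_derivative (%h. \<Sum>j\<in>UNIV. c j * h $ j)) (at x)" "(g has_derivative (%h. \<Sum>j\<in>UNIV. d j * h $ j)) (at x)"
 shows "c i = d i"
proof -
 have "(%h. \<Sum>j\<in>UNIV. c j * h $ j) = (%h. \<Sum>j\<in>UNIV. d j * h $ j)" by (rule has_derivative_unique[OF assms])
 then have "(\<Sum>j\<in>UNIV. c j * axis i 1 $ j) = (\<Sum>j\<in>UNIV. d j * axis i 1 $ j)" by metis
 then show ?thesis by (simp add: axis_def if_distrib[of "%x. _ * x"] cong: if_cong)
qed

lemma moll_has_derivative_fun: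
 fixes f :: "real^'n::finite => real" and B B0 :: real
 assumes bw: "bw > 0" and nu: "mi_order nu \<le> N + 1"
 and d: "!!x. (f has_derivative (%h. \<Sum>j\<in>UNIV. f' j x * h $ j)) (at x)"
 and hol: "!!j x y. \<bar>f' j x - f' j y\<bar> \<le> B * norm (x - y) powr s" and s: "s > 0" "B \<ge> 0"
 and bd: "!!x. \<bar>f x\<bar> \<le> B0" "!!j x. \<bar>f' j x\<bar> \<le> B0"
 shows "(moll N nu bw f has_derivative (%h. \<Sum>i\<in>UNIV. moll N nu bw (f' i) x * h $ i)) (at x)"
proof -
 have cf: "continuous_on UNIV f" by (rule differentiable_imp_continuous_on) (use d in \<open>auto simp: differentiable_on_def differentiable_def intro: has_derivative_at_withinI\<close>)
 have cf': "continuous_on UNIV (f' j)" for j by (rule continuous_of_holder[OF hol s(1)])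
 define c where "c = (- 1) ^ mi_order nu / (bw ^ mi_order nu * bump_mass N TYPE('n))"
 define p where "p = pbump N nu"
 have M: "moll N nu bw g y = c * (LBINT z. g (y + bw *\<^sub>R z) * p z)" for g y by (simp add: moll_def c_def p_def)
 have if0: "integrable lborel (%z. f (y + bw *\<^sub>R z) * p z)" for y
 unfolding p_def by (rule moll_integrable[OF bw cf bd(1) nu])
 have if': "integrable lborel (%z. f' j (x + bw *\<^sub>R z) * p z)" for j
 unfolding p_def by (rule moll_integrable[OF bw cf' bd(2) nu])
 show ?thesis
 proof (rule has_derivative_of_remainder[OF _ s(1)])
 fix h :: "real^'n"
 have "(\<Sum>j\<in>UNIV. (LBINT z. f' j (x + bw *\<^sub>R z) * p z) * h $ j) = (LBINT z. (\<Sum>j\<in>UNIV. f' j (x + bw *\<^sub>R z) * p z * h $ j))"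
 by (subst Bochner_Integration.integral_sum) (simp_all add: if')
 moreover have "(LBINT z. f (x + h + bw *\<^sub>R z) * p z) - (LBINT z. f (x + bw *\<^sub>R z) * p z)
 = (LBINT z. f (x + h + bw *\<^sub>R z) * p z - f (x + bw *\<^sub>R z) * p z)"
 by (rule Bochner_Integration.integral_diff[OF if0 if0, symmetric])
 ultimately have "(LBINT z. f (x + h + bw *\<^sub>R z) * p z) - (LBINT z. f (x + bw *\<^sub>R z) * p z)
 - (\<Sum>j\<in>UNIV. (LBINT z. f' j (x + bw *\<^sub>R z) * p z) * h $ j)
 = (LBINT z. (f (x + h + bw *\<^sub>R z) * p z - f (x + bw *\<^sub>R z) * p z) - (\<Sum>j\<in>UNIV. f' j (x + bw *\<^sub>R z) * p z * h $ j))"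
 by (simp only:) (rule Bochner_Integration.integral_diff[symmetric],
 auto intro!: if0 if' Bochner_Integration.integrable_sum integrable_mult_left Bochner_Integration.integrable_diff)
 also have "... = (\<integral>z. (f (x + bw *\<^sub>R z + h) - f (x + bw *\<^sub>R z) - (\<Sum>j\<in>UNIV. f' j (x + bw *\<^sub>R z) * h $ j)) * p z \<partial>lborel)"
 by (intro Bochner_Integration.integral_cong) (simp_all add: left_diff_distrib right_diff_distrib sum_distrib_left sum_distrib_right mult_ac add_ac)
 also have "\<bar>...\<bar> \<le> (CARD('n) * B * norm h powr (1 + s)) * (LBINT z. \<bar>p z\<bar>)"
 proof (rule abs_integral_mult_le)
 show "integrable lborel p" unfolding p_def by (rule pbump_integrable[OF nu])
 have [measurable]: "f \<in> bmeas" "!!j. f' j \<in> bmeas"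
 using cf cf' by (auto intro: borel_measurable_continuous_onI)
 show "(%z. f (x + bw *\<^sub>R z + h) - f (x + bw *\<^sub>R z) - (\<Sum>j\<in>UNIV. f' j (x + bw *\<^sub>R z) * h $ j)) \<in> borel_measurable lborel"
 by measurable
 qed (rule taylor_first_order[OF d hol s])
 finally have bd': "\<bar>(LBINT z. f (x + h + bw *\<^sub>R z) * p z) - (LBINT z. f (x + bw *\<^sub>R z) * p z)
 - (\<Sum>j\<in>UNIV. (LBINT z. f' j (x + bw *\<^sub>R z) * p z) * h $ j)\<bar> \<le> (CARD('n) * B * norm h powr (1 + s)) * (LBINT z. \<bar>p z\<bar>)" .
 have "moll N nu bw f (x + h) - moll N nu bw f x - (\<Sum>j\<in>UNIV. moll N nu bw (f' j) x * h $ j)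
 = c * ((LBINT z. f (x + h + bw *\<^sub>R z) * p z) - (LBINT z. f (x + bw *\<^sub>R z) * p z)
 - (\<Sum>j\<in>UNIV. (LBINT z. f' j (x + bw *\<^sub>R z) * p z) * h $ j))"
 unfolding M by (simp add: right_diff_distrib sum_distrib_left mult_ac)
 then have "\<bar>moll N nu bw f (x + h) - moll N nu bw f x - (\<Sum>j\<in>UNIV. moll N nu bw (f' j) x * h $ j)\<bar>
 \<le> \<bar>c\<bar> * ((CARD('n) * B * norm h powr (1 + s)) * (LBINT z. \<bar>p z\<bar>))"
 using mult_left_mono[OF bd', of "\<bar>c\<bar>"] by (simp add: abs_mult)
 then show "\<bar>moll N nu bw f (x + h) - moll N nu bw f x - (\<Sum>j\<in>UNIV. moll N nu bw (f' j) x * h $ j)\<bar>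
 \<le> (\<bar>c\<bar> * (CARD('n) * B * (LBINT z. \<bar>p z\<bar>))) * norm h powr (1 + s)"
 by (simp add: mult_ac)
 qed
qed

lemma multi_index_pred:
 fixes nu :: "'n::finite => nat"
 assumes "mi_order nu \<noteq> 0"
 obtains i mu where "nu = mu(i := mu i + 1)" "mi_order nu = mi_order mu + 1"
proof -
 obtain i where i: "nu i \<noteq> 0" using assms by (auto simp: mi_order_def)
 define mu where "mu = nu(i := nu i - 1)"
 have "nu = mu(i := mu i + 1)" using i by (auto simp: mu_def)
 then show ?thesis using that mi_order_upd[of mu i] by metis
qed

text \<open>The mollification of the constant 1 does not depend on the point. Its derivative is 0 on
  the one hand and, by the kernel formula, a multiple of the integral in question on the
  other.\<close>

lemma pbump_integral_0:
 fixes nu :: "'n::finite => nat"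
 assumes "mi_order nu \<noteq> 0" "mi_order nu \<le> N"
 shows "(LBINT z. pbump N nu z) = 0"
proof -
 obtain i mu where mu: "nu = mu(i := mu i + 1)" "mi_order nu = mi_order mu + 1" by (rule multi_index_pred[OF assms(1)])
 have o: "mi_order mu + 1 \<le> N" using assms mu by simp
 have "(moll N mu 1 (%_. 1) has_derivative (%h. \<Sum>i\<in>UNIV. moll N (mu(i := mu i + 1)) 1 (%_. 1) (0::real^'n) * h $ i)) (at 0)"
 by (rule moll_has_derivative_kernel[OF _ _ _ o, of _ _ 1]) auto
 moreover have "(moll N mu 1 (%_. 1) has_derivative (%h. \<Sum>i\<in>UNIV. 0 * h $ i)) (at (0::real^'n))"
 unfolding moll_def[abs_def] by simp
 ultimately have "moll N (mu(i := mu i + 1)) 1 (%_. 1) (0::real^'n) = 0" by (rule partials_unique[of _ "%i. moll N (mu(i := mu i + 1)) 1 (%_. 1) 0"])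
 then show ?thesis using bump_mass_pos[of N, where 'n = 'n] unfolding mu(1)[symmetric] moll_def by simp
qed

lemma mi_order_eq_0: "mi_order nu = 0 \<longleftrightarrow> nu = (%_. 0)"
 by (auto simp: mi_order_def)

text \<open>Integration by parts: both sides are partial derivatives of
  \<open>moll N mu bw (F i)\<close>, once with the derivative on the kernel and once on the
  function.\<close>

lemma moll_partial:
 fixes F :: "'i => real^'n::finite => real"
 assumes s: "0 < s" "s \<le> 1"
 and F': "!!i x. i \<in> I ==> (F i has_derivative (%h. \<Sum>j\<in>UNIV. F' j i x * h $ j)) (at x)"
 "!!j. holder_bdd k s I (F' j)"
 and F: "holder_bdd (Suc k) s I F" and i: "i \<in> I" and bw: "bw > 0" and mu: "mi_order mu + 1 \<le> N"
 shows "moll N (mu(l := mu l + 1)) bw (F i) x = moll N mu bw (F' l i) x"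
proof -
 obtain B where B: "B > 0" "!!i x. i \<in> I ==> \<bar>F i x\<bar> \<le> B" by (rule holder_bdd_bounded[OF F], rule that)
 obtain B' where B': "B' > 0" "!!j i x. i \<in> I ==> \<bar>F' j i x\<bar> \<le> B'" by (rule holder_bdd_components_bounded[OF F'(2)], rule that)
 obtain C where C: "C > 0" "!!j i x y. i \<in> I ==> \<bar>F' j i x - F' j i y\<bar> \<le> C * norm (x - y) powr s"
 by (rule holder_bdd_components_holder0[OF F'(2) s], rule that)
 have "(moll N mu bw (F i) has_derivative (%h. \<Sum>l\<in>UNIV. moll N (mu(l := mu l + 1)) bw (F i) x * h $ l)) (at x)"
 by (rule moll_has_derivative_kernel[OF bw holder_bdd_continuous[OF F s i] B(2)[OF i] mu])
 moreover have "(moll N mu bw (F i) has_derivative (%h. \<Sum>l\<in>UNIV. moll N mu bw (F' l i) x * h $ l)) (at x)"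
 proof (rule moll_has_derivative_fun[OF bw _ F'(1)[OF i] C(2)[OF i] s(1), where ?B0.0 = "max B B'"])
 show "\<bar>F i x\<bar> \<le> max B B'" for x using B(2)[OF i, of x] by simp
 show "\<bar>F' j i x\<bar> \<le> max B B'" for j x using B'(2)[OF i, of j x] by simp
 qed (use mu C in auto)
 ultimately show ?thesis by (rule partials_unique[of _ "%l. moll N (mu(l := mu l + 1)) bw (F i) x"])
qed

text \<open>Up to \<open>k\<close> derivatives are moved onto \<open>F\<close>; each remaining one
  costs \<open>1 / bw\<close>. If any remain, the kernel has integral 0, so the value of
  \<open>F\<close> at the centre can be subtracted and the Hoelder condition gives back
  \<open>bw powr s\<close>.\<close>

lemma moll_family_bound:
 fixes F :: "'i => real^'n::finite => real" and s :: real
 assumes s: "0 < s" "s \<le> 1" and "holder_bdd k s I F" "mi_order nu \<le> N"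
 shows "\<exists>C>0. \<forall>i\<in>I. \<forall>bw>0. \<forall>x. \<bar>moll N nu bw (F i) x\<bar> \<le> C * (if mi_order nu \<le> k then 1 else bw powr (k + s - mi_order nu))"
 using assms(3,4)
proof (induction k arbitrary: F nu)
 case 0
 obtain B where B: "B > 0" "!!i x. i \<in> I ==> \<bar>F i x\<bar> \<le> B" by (rule holder_bdd_bounded[OF 0(1)], rule that)
 have cont: "i \<in> I ==> continuous_on UNIV (F i)" for i by (rule holder_bdd_continuous[OF 0(1) s])
 show ?case
 proof (cases "mi_order nu = 0")
 case True
 then have "\<bar>moll N nu bw (F i) x\<bar> \<le> B" if "i \<in> I" for i bw x
 using moll_0_bounded[OF borel_measurable_continuous_onI[OF cont[OF that]] B(2)[OF that]] by (simp add: mi_order_eq_0)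
 then show ?thesis using B(1) True by (intro exI[of _ B]) auto
 next
 case False
 define m where "m = mi_order nu"
 define J where "J = (LBINT z. \<bar>pbump N nu z\<bar>)"
 have J: "J \<ge> 0" unfolding J_def by (intro Bochner_Integration.integral_nonneg) auto
 have bm: "bump_mass N TYPE('n) > 0" by (rule bump_mass_pos)
 have ip: "integrable lborel (pbump N nu)" using 0(2) by (intro pbump_integrable) simp
 obtain C where C: "C > 0" "!!i x y. i \<in> I ==> \<bar>F i x - F i y\<bar> \<le> C * norm (x - y) powr s"
 by (rule holder_bdd_holder0[OF 0(1) s], rule that)
 let ?n = "real CARD('n)"
 have "\<bar>moll N nu bw (F i) x\<bar> \<le> (C * ?n powr s * J / bump_mass N TYPE('n) + 1) * bw powr (s - m)" if i: "i \<in> I" and bw: "bw > 0" for i bw x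
 proof -
 have [measurable]: "F i \<in> bmeas" using cont[OF i] by (rule borel_measurable_continuous_onI)
 have "(LBINT z. F i (x + bw *\<^sub>R z) * pbump N nu z) = (LBINT z. F i (x + bw *\<^sub>R z) * pbump N nu z) - (LBINT z. F i x * pbump N nu z)"
 using pbump_integral_0[OF False 0(2)] by simp
 also have "... = (LBINT z. F i (x + bw *\<^sub>R z) * pbump N nu z - F i x * pbump N nu z)"
 using 0(2) by (intro Bochner_Integration.integral_diff[symmetric] integrable_mult_right ip
 moll_integrable[OF bw cont[OF i] B(2)[OF i]]) auto
 also have "... = (LBINT z. (F i (x + bw *\<^sub>R z) - F i x) * pbump N nu z)"
 by (simp add: left_diff_distrib)
 also have "\<bar>...\<bar> \<le> (C * (bw * ?n) powr s) * J" unfolding J_def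
 proof (rule abs_integral_mult_le[OF ip])
 fix z assume "pbump N nu z \<noteq> 0"
 then have "norm z \<le> ?n" using pbump_supp_norm[of nu N z] 0(2) by fastforce
 then have "norm (bw *\<^sub>R z) powr s \<le> (bw * ?n) powr s" using bw s by (intro powr_mono2) auto
 then have "C * norm (x + bw *\<^sub>R z - x) powr s \<le> C * (bw * ?n) powr s" using C(1) by simp
 with C(2)[OF i, of "x + bw *\<^sub>R z" x] show "\<bar>F i (x + bw *\<^sub>R z) - F i x\<bar> \<le> C * (bw * ?n) powr s" by linarith
 qed measurable
 finally have "\<bar>moll N nu bw (F i) x\<bar> \<le> (C * (bw * ?n) powr s) * J / (bw ^ m * bump_mass N TYPE('n))"
 using bw bm by (simp add: moll_def abs_mult m_def divide_right_mono)
 also have "... = (C * ?n powr s * J / bump_mass N TYPE('n)) * bw powr (s - m)"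
 using bw bm by (simp add: powr_mult powr_diff powr_realpow mult_ac)
 also have "... \<le> (C * ?n powr s * J / bump_mass N TYPE('n) + 1) * bw powr (s - m)"
 by (intro mult_right_mono) auto
 finally show ?thesis .
 qed
 moreover have "C * ?n powr s * J / bump_mass N TYPE('n) + 1 > 0" using C(1) J bm by (intro add_nonneg_pos divide_nonneg_pos mult_nonneg_nonneg) auto
 ultimately show ?thesis using False by (intro exI[of _ "C * ?n powr s * J / bump_mass N TYPE('n) + 1"]) (simp add: m_def)
 qed
next
 case (Suc k)
 obtain B where B: "B > 0" "!!i x. i \<in> I ==> \<bar>F i x\<bar> \<le> B" by (rule holder_bdd_bounded[OF Suc.prems(1)], rule that)
 have cont: "i \<in> I ==> continuous_on UNIV (F i)" for i by (rule holder_bdd_continuous[OF Suc.prems(1) s])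
 show ?case
 proof (cases "mi_order nu = 0")
 case True
 then have "\<bar>moll N nu bw (F i) x\<bar> \<le> B" if "i \<in> I" for i bw x
 using moll_0_bounded[OF borel_measurable_continuous_onI[OF cont[OF that]] B(2)[OF that]] by (simp add: mi_order_eq_0)
 then show ?thesis using B(1) True by (intro exI[of _ B]) auto
 next
 case False
 obtain l mu where mu: "nu = mu(l := mu l + 1)" "mi_order nu = mi_order mu + 1" by (rule multi_index_pred[OF False])
 have o: "mi_order mu + 1 \<le> N" using mu(2) Suc.prems(2) by linarith
 obtain F' where F': "!!i x. i \<in> I ==> (F i has_derivative (%h. \<Sum>j\<in>UNIV. F' j i x * h $ j)) (at x)"
 "!!j. holder_bdd k s I (F' j)" by (rule holder_bdd_SucE[OF Suc.prems(1)], rule that)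
 have "moll N nu bw (F i) x = moll N mu bw (F' l i) x" if "i \<in> I" "bw > 0" for i bw x
 unfolding mu(1) by (rule moll_partial[OF s F' Suc.prems(1) that o])
 moreover obtain C where "C > 0" "\<forall>i\<in>I. \<forall>bw>0. \<forall>x. \<bar>moll N mu bw (F' l i) x\<bar> \<le> C * (if mi_order mu \<le> k then 1 else bw powr (k + s - mi_order mu))"
 using Suc.IH[OF F'(2), of mu l] Suc.prems(2) mu(2) by auto
 ultimately show ?thesis by (intro exI[of _ C]) (auto simp: mu(2) algebra_simps)
 qed
qed

text \<open>Here all derivatives are moved onto \<open>F\<close>, leaving an average of functions
  with a common Hoelder bound. Only order exactly \<open>k\<close> is needed: elsewhere the bounds
  of \<open>moll_family_bound\<close> on two consecutive orders can be interpolated.\<close>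

lemma moll_family_holder:
 fixes F :: "'i => real^'n::finite => real" and s :: real
 assumes s: "0 < s" "s \<le> 1" and "holder_bdd k s I F" "mi_order nu = k" "k \<le> N"
 shows "\<exists>C>0. \<forall>i\<in>I. \<forall>bw>0. \<forall>x y. \<bar>moll N nu bw (F i) x - moll N nu bw (F i) y\<bar> \<le> C * norm (x - y) powr s"
 using assms(3-)
proof (induction k arbitrary: F nu)
 case 0
 obtain B where B: "B > 0" "!!i x. i \<in> I ==> \<bar>F i x\<bar> \<le> B" by (rule holder_bdd_bounded[OF 0(1)], rule that)
 have cont: "i \<in> I ==> continuous_on UNIV (F i)" for i by (rule holder_bdd_continuous[OF 0(1) s])
 obtain C where C: "C > 0" "!!i x y. i \<in> I ==> \<bar>F i x - F i y\<bar> \<le> C * norm (x - y) powr s"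
 by (rule holder_bdd_holder0[OF 0(1) s], rule that)
 have bm: "bump_mass N TYPE('n) > 0" by (rule bump_mass_pos)
 have "\<bar>moll N nu bw (F i) x - moll N nu bw (F i) y\<bar> \<le> C * norm (x - y) powr s" if i: "i \<in> I" and bw: "bw > 0" for i bw x y
 proof -
 have nu: "nu = (%_. 0)" using 0 by (simp add: mi_order_eq_0)
 have [measurable]: "F i \<in> bmeas" using cont[OF i] by (rule borel_measurable_continuous_onI)
 have ip: "integrable lborel (pbump N nu)" using 0 by (intro pbump_integrable) simp
 have "(LBINT z. F i (x + bw *\<^sub>R z) * pbump N nu z) - (LBINT z. F i (y + bw *\<^sub>R z) * pbump N nu z)
 = (LBINT z. F i (x + bw *\<^sub>R z) * pbump N nu z - F i (y + bw *\<^sub>R z) * pbump N nu z)"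
 using 0(2) by (intro Bochner_Integration.integral_diff[symmetric] moll_integrable[OF bw cont[OF i] B(2)[OF i]]) auto
 also have "... = (LBINT z. (F i (x + bw *\<^sub>R z) - F i (y + bw *\<^sub>R z)) * pbump N nu z)"
 by (simp add: left_diff_distrib)
 also have "\<bar>...\<bar> \<le> (C * norm (x - y) powr s) * (LBINT z. \<bar>pbump N nu z\<bar>)"
 proof (rule abs_integral_mult_le[OF ip])
 show "\<bar>F i (x + bw *\<^sub>R z) - F i (y + bw *\<^sub>R z)\<bar> \<le> C * norm (x - y) powr s" for z
 using C(2)[OF i, of "x + bw *\<^sub>R z" "y + bw *\<^sub>R z"] by simp
 qed measurable
 also have "(LBINT z. \<bar>pbump N nu z\<bar>) = bump_mass N TYPE('n)"
 unfolding nu by (simp add: bump_mass_def pbump_0_nonneg)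
 finally show ?thesis unfolding moll_def nu using bm
 by (simp add: abs_divide divide_le_eq flip: diff_divide_distrib)
 qed
 then show ?case using C(1) by blast
next
 case (Suc k)
 have "mi_order nu \<noteq> 0" using Suc.prems by simp
 then obtain l mu where mu: "nu = mu(l := mu l + 1)" "mi_order nu = mi_order mu + 1" by (rule multi_index_pred)
 have o: "mi_order mu + 1 \<le> N" using mu(2) Suc.prems(2,3) by linarith
 obtain F' where F': "!!i x. i \<in> I ==> (F i has_derivative (%h. \<Sum>j\<in>UNIV. F' j i x * h $ j)) (at x)"
 "!!j. holder_bdd k s I (F' j)" by (rule holder_bdd_SucE[OF Suc.prems(1)], rule that)
 have "moll N nu bw (F i) x = moll N mu bw (F' l i) x" if "i \<in> I" "bw > 0" for i bw x
 unfolding mu(1) by (rule moll_partial[OF s F' Suc.prems(1) that o])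
 then show ?case using Suc.IH[OF F'(2), of mu l] Suc.prems mu(2) by auto
qed

section \<open>Membership in Hoelder classes\<close>

lemma Linf_norm_le:
 fixes f :: "real^'n::finite => real"
 assumes "continuous_on UNIV f" "!!x. \<bar>f x\<bar> \<le> M"
 shows "Linf_norm f \<le> ennreal M"
 unfolding Linf_norm_def
proof (rule esssup_I)
 have "f \<in> bmeas" using assms(1) by (rule borel_measurable_continuous_onI)
 then have "f \<in> borel_measurable lebesgue" by (simp add: measurable_completion)
 then show "(%x. ennreal \<bar>f x\<bar>) \<in> borel_measurable lebesgue" by measurable
qed (use assms(2) in \<open>auto intro!: AE_I2 ennreal_leI\<close>)

text \<open>The number of summands in the Hoelder norm: a common bound \<open>M\<close> for the
  summands bounds the norm by this multiple of \<open>M\<close>.\<close>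

definition mi_count :: "'n::finite itself => nat => nat" where
 "mi_count _ k = card {nu :: 'n => nat. mi_order nu \<le> k} + card {nu :: 'n => nat. mi_order nu = k}"

lemma mi_count_pos: "mi_count TYPE('n::finite) k > 0"
proof -
 have "card {nu :: 'n => nat. mi_order nu \<le> k} > 0"
 by (subst card_gt_0_iff) (auto simp: finite_mi_order_le intro: exI[of _ "%_. 0"])
 then show ?thesis by (simp add: mi_count_def)
qed

lemma holder_class_of_smooth:
 fixes f :: "real^'n::finite => real"
 assumes D0: "D (%_. 0) = f"
 and der: "!!nu x. mi_order nu < nat \<lfloor>et\<rfloor> ==> (D nu has_derivative (%h. \<Sum>i\<in>UNIV. D (nu(i := nu i + 1)) x * h $ i)) (at x)"
 and cont: "!!nu. mi_order nu \<le> nat \<lfloor>et\<rfloor> ==> continuous_on UNIV (D nu)"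
 and bd: "!!nu x. mi_order nu \<le> nat \<lfloor>et\<rfloor> ==> \<bar>D nu x\<bar> \<le> M"
 and hol: "!!nu x y. mi_order nu = nat \<lfloor>et\<rfloor> ==> x \<noteq> y ==>
 \<bar>D nu x - D nu y\<bar> * ln (inverse (min (norm (x - y)) (1/2))) powr al \<le> M * norm (x - y) powr (et - of_int \<lfloor>et\<rfloor>)"
 and M: "real (mi_count TYPE('n) (nat \<lfloor>et\<rfloor>)) * M \<le> K"
 shows "f \<in> holder_class et al K"
proof -
 have M0: "M \<ge> 0" using bd[of "%_. 0" 0] by (simp; linarith)
 have "is_jet (nat \<lfloor>et\<rfloor>) f D"
 unfolding is_jet_def
 proof (intro conjI allI impI D0)
 fix nu :: "'n => nat" and x :: "real^'n" assume nu: "mi_order nu + 1 = nat \<lfloor>et\<rfloor>"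
 have "\<bar>D (nu(i := nu i + 1)) x\<bar> \<le> M" for i x by (rule bd) (unfold mi_order_upd, use nu in simp)
 then have "\<bar>D nu x - D nu y\<bar> \<le> CARD('n) * M * norm (x - y)" for x y
 using nu by (intro grad_bound_imp_lipschitz[OF der]) auto
 then have "(CARD('n) * M)-lipschitz_on (ball x 1) (D nu)"
 using M0 by (intro lipschitz_onI) (auto simp: dist_norm)
 then show "\<exists>r>0. \<exists>B. B-lipschitz_on (ball x r) (D nu)" by (intro exI[of _ 1]) auto
 next
 fix nu :: "'n => nat" assume nu: "mi_order nu + 1 = nat \<lfloor>et\<rfloor>"
 show "AE x in lebesgue. (D nu has_derivative (%h. \<Sum>i\<in>UNIV. D (nu(i := nu i + 1)) x * h $ i)) (at x)"
 using der[of nu] nu by (intro AE_I2) auto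
 qed (rule der, simp)
 moreover have "(\<Sum>nu | mi_order nu \<le> nat \<lfloor>et\<rfloor>. Linf_norm (D nu))
 + (\<Sum>nu | mi_order nu = nat \<lfloor>et\<rfloor>. holder_seminorm (et - of_int \<lfloor>et\<rfloor>) al (D nu)) \<le> ennreal K"
 proof -
 have "(\<Sum>nu | mi_order nu \<le> nat \<lfloor>et\<rfloor>. Linf_norm (D nu)) \<le> (\<Sum>nu | mi_order (nu :: 'n => nat) \<le> nat \<lfloor>et\<rfloor>. ennreal M)"
 by (intro sum_mono Linf_norm_le cont bd) auto
 moreover have "holder_seminorm (et - of_int \<lfloor>et\<rfloor>) al (D nu) \<le> ennreal M" if nu: "mi_order nu = nat \<lfloor>et\<rfloor>" for nu
 unfolding holder_seminorm_def
 proof (intro SUP_least, clarsimp intro!: ennreal_leI)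
 fix x y :: "real^'n" assume xy: "x \<noteq> y"
 show "\<bar>D nu x - D nu y\<bar> * ln (inverse (min (norm (x - y)) (1/2))) powr al / norm (x - y) powr (et - of_int \<lfloor>et\<rfloor>) \<le> M"
 using hol[OF nu xy] xy by (simp add: pos_divide_le_eq)
 qed
 then have "(\<Sum>nu | mi_order nu = nat \<lfloor>et\<rfloor>. holder_seminorm (et - of_int \<lfloor>et\<rfloor>) al (D nu)) \<le> (\<Sum>nu | mi_order (nu :: 'n => nat) = nat \<lfloor>et\<rfloor>. ennreal M)"
 by (intro sum_mono) auto
 ultimately have "(\<Sum>nu | mi_order nu \<le> nat \<lfloor>et\<rfloor>. Linf_norm (D nu))
 + (\<Sum>nu | mi_order nu = nat \<lfloor>et\<rfloor>. holder_seminorm (et - of_int \<lfloor>et\<rfloor>) al (D nu))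
 \<le> (\<Sum>nu | mi_order (nu :: 'n => nat) \<le> nat \<lfloor>et\<rfloor>. ennreal M) + (\<Sum>nu | mi_order (nu :: 'n => nat) = nat \<lfloor>et\<rfloor>. ennreal M)"
 by (rule add_mono)
 also have "... = ennreal (real (mi_count TYPE('n) (nat \<lfloor>et\<rfloor>)) * M)"
 using M0 by (simp add: mi_count_def ennreal_mult ennreal_of_nat_eq_real_of_nat distrib_right)
 also have "... \<le> ennreal K" using M by (rule ennreal_leI)
 finally show ?thesis .
 qed
 ultimately show ?thesis unfolding holder_class_def by blast
qed

lemma holder_class_nonempty:
 assumes "K \<ge> 0" shows "(%_. 0) \<in> (holder_class et al K :: (real^'n::finite => real) set)"
 by (rule holder_class_of_smooth[where D = "%_ _. 0" and M = 0]) (use assms in auto)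

text \<open>A mollified function of smoothness \<open>k + s\<close> is a multiple of an element of
  the unit ball of smoothness \<open>et\<close>; the price is \<open>bw powr (k + s - et)\<close>
  when this exceeds 1. With \<open>et = d / 2\<close> this makes test functions comparable to
  discriminators. Scales up to \<open>Dl\<close> are allowed because \<open>lowpass\<close> uses
  multiples of \<open>bw\<close>, and \<open>a\<close> is free in order to have both signs
  available.\<close>

lemma moll_holder_class:
 fixes F :: "'i => real^'n::finite => real" and s et Dl :: real
 assumes s: "0 < s" "s \<le> 1" and F: "holder_bdd k s I F" and et: "et \<ge> 0"
 and N: "N \<ge> nat \<lfloor>et\<rfloor> + 1" and Dl: "Dl > 0"
 shows "\<exists>C>0. \<forall>i\<in>I. \<forall>bw a. 0 < bw --> bw \<le> Dl --> \<bar>a\<bar> \<le> 1 -->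
 (%x. a / (C * max 1 (bw powr (k + s - et))) * moll N (%_. 0) bw (F i) x) \<in> holder_class et 0 1"
proof -
 define m where "m = nat \<lfloor>et\<rfloor>"
 define sg where "sg = et - of_int \<lfloor>et\<rfloor>"
 have sg: "0 \<le> sg" "sg < 1" "et = m + sg" using et floor_correct[of et] by (simp_all add: sg_def m_def; linarith)+
 define w where "w j bw = (if j \<le> k then 1 else bw powr (k + s - real j))" for j bw
 define W where "W bw = max 1 (bw powr (k + s - et))" for bw
 have W1: "W bw \<ge> 1" for bw by (simp add: W_def)
 let ?S = "{nu :: 'n => nat. mi_order nu \<le> m + 1}"
 obtain C0 where C0: "C0 > 0" "!!nu i bw x. mi_order nu \<le> m + 1 ==> i \<in> I ==> bw > 0 ==> \<bar>moll N nu bw (F i) x\<bar> \<le> C0 * w (mi_order nu) bw"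
 proof -
 have "\<forall>nu\<in>?S. \<exists>C>0. \<forall>i\<in>I. \<forall>bw>0. \<forall>x. \<bar>moll N nu bw (F i) x\<bar> \<le> C * w (mi_order nu) bw"
 using moll_family_bound[OF s F, of _ N] N unfolding w_def m_def by auto
 then obtain c where c: "!!nu. nu \<in> ?S ==> c nu > 0" "!!nu i bw x. nu \<in> ?S ==> i \<in> I ==> bw > 0 ==> \<bar>moll N nu bw (F i) x\<bar> \<le> c nu * w (mi_order nu) bw"
 by metis
 show ?thesis
 proof (rule that[of "(\<Sum>nu\<in>?S. c nu) + 1"])
 show "(\<Sum>nu\<in>?S. c nu) + 1 > 0" by (intro add_nonneg_pos sum_nonneg less_imp_le[OF c(1)]) auto
 fix nu :: "'n => nat" and i bw and x :: "real^'n" assume a: "mi_order nu \<le> m + 1" "i \<in> I" "bw > (0::real)"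
 have "c nu \<le> (\<Sum>nu\<in>?S. c nu)" by (rule member_le_sum) (use a less_imp_le[OF c(1)] finite_mi_order_le in auto)
 then have "c nu * w (mi_order nu) bw \<le> ((\<Sum>nu\<in>?S. c nu) + 1) * w (mi_order nu) bw"
 by (intro mult_right_mono) (auto simp: w_def)
 with c(2)[of nu i bw x] a show "\<bar>moll N nu bw (F i) x\<bar> \<le> ((\<Sum>nu\<in>?S. c nu) + 1) * w (mi_order nu) bw" by simp
 qed
 qed
 obtain C2 where C2: "C2 > 0" "!!nu i bw x y. mi_order nu = m ==> m = k ==> i \<in> I ==> bw > 0 ==>
 \<bar>moll N nu bw (F i) x - moll N nu bw (F i) y\<bar> \<le> C2 * norm (x - y) powr s"
 proof (cases "m = k")
 case True
 let ?T = "{nu :: 'n => nat. mi_order nu = m}"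
 have kN: "k \<le> N" using True N by (simp add: m_def)
 have "\<forall>nu\<in>?T. \<exists>C>0. \<forall>i\<in>I. \<forall>bw>0. \<forall>x y. \<bar>moll N nu bw (F i) x - moll N nu bw (F i) y\<bar> \<le> C * norm (x - y) powr s"
 using moll_family_holder[OF s F _ kN] True by simp
 then obtain c where c: "!!nu. nu \<in> ?T ==> c nu > 0" "!!nu i bw x y. nu \<in> ?T ==> i \<in> I ==> bw > 0 ==> \<bar>moll N nu bw (F i) x - moll N nu bw (F i) y\<bar> \<le> c nu * norm (x - y) powr s"
 by metis
 show ?thesis
 proof (rule that[of "(\<Sum>nu\<in>?T. c nu) + 1"])
 show "(\<Sum>nu\<in>?T. c nu) + 1 > 0" by (intro add_nonneg_pos sum_nonneg less_imp_le[OF c(1)]) auto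
 fix nu :: "'n => nat" and i bw and x y :: "real^'n" assume a: "mi_order nu = m" "i \<in> I" "bw > (0::real)"
 have "c nu \<le> (\<Sum>nu\<in>?T. c nu)" by (rule member_le_sum) (use a less_imp_le[OF c(1)] finite_mi_order_eq in auto)
 then have "c nu * norm (x - y) powr s \<le> ((\<Sum>nu\<in>?T. c nu) + 1) * norm (x - y) powr s"
 by (intro mult_right_mono) auto
 with c(2)[of nu i bw x y] a show "\<bar>moll N nu bw (F i) x - moll N nu bw (F i) y\<bar> \<le> ((\<Sum>nu\<in>?T. c nu) + 1) * norm (x - y) powr s" by simp
 qed
 qed (use that[of 1] in auto)
 obtain B where B: "B > 0" "!!i x. i \<in> I ==> \<bar>F i x\<bar> \<le> B" by (rule holder_bdd_bounded[OF F], rule that)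
 have cont: "i \<in> I ==> continuous_on UNIV (F i)" for i by (rule holder_bdd_continuous[OF F s])
 have der: "(moll N nu bw (F i) has_derivative (%h. \<Sum>j\<in>UNIV. moll N (nu(j := nu j + 1)) bw (F i) x * h $ j)) (at x)"
 if "mi_order nu \<le> m" "i \<in> I" "bw > 0" for nu i bw x
 by (rule moll_has_derivative_kernel[OF that(3) cont[OF that(2)] B(2)[OF that(2)]]) (use that(1) N in \<open>simp add: m_def\<close>)
 define n where "n = real CARD('n)"
 have n: "n \<ge> 1" by (simp add: n_def Suc_leI)
 define D' where "D' = max 1 Dl"
 define E where "E = 2 * C0 + n * C0 * D' + C2"
 have E: "E > 0" "2 * C0 \<le> E" "n * C0 * D' \<le> E" "C2 \<le> E" "C0 \<le> E"
 using C0(1) C2(1) n by (auto simp: E_def D'_def intro!: add_pos_pos add_nonneg_nonneg mult_nonneg_nonneg)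
 have wW: "w j bw \<le> W bw" if "j \<le> m" "bw > 0" for j bw
 proof (cases "j \<le> k")
 case True then show ?thesis by (simp add: w_def W_def)
 next
 case False
 show ?thesis
 proof (cases "bw \<le> 1")
 case True
 have "bw powr (k + s - real j) \<le> bw powr (k + s - et)" using that True sg by (intro powr_mono') auto
 then show ?thesis using False by (simp add: w_def W_def)
 next
 case d: False
 have "real j \<ge> real k + 1" using False by linarith
 then have "bw powr (k + s - real j) \<le> bw powr 0" using d s by (intro powr_mono) auto
 then show ?thesis using False d by (simp add: w_def W_def)
 qed
 qed
 have hol: "\<bar>moll N nu bw (F i) x - moll N nu bw (F i) y\<bar> \<le> E * W bw * norm (x - y) powr sg"
 if nu: "mi_order nu = m" and i: "i \<in> I" and bw: "bw > 0" "bw \<le> Dl" and xy: "x \<noteq> y" for nu i bw x y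
 proof -
 define r where "r = norm (x - y)"
 define g where "g = \<bar>moll N nu bw (F i) x - moll N nu bw (F i) y\<bar>"
 have r: "r > 0" using xy by (simp add: r_def)
 have a: "g \<le> 2 * C0 * w m bw"
 using C0(2)[of nu i bw x] C0(2)[of nu i bw y] nu i bw by (simp add: g_def; linarith)
 have b: "g \<le> n * C0 * w (m + 1) bw * r"
 proof -
 have "g \<le> n * (C0 * w (m + 1) bw) * r" unfolding g_def r_def n_def
 proof (rule grad_bound_imp_lipschitz[OF der])
 show "\<bar>moll N (nu(j := nu j + 1)) bw (F i) x\<bar> \<le> C0 * w (m + 1) bw" for j x
 using C0(2)[of "nu(j := nu j + 1)" i bw x] i bw unfolding mi_order_upd nu by simp
 qed (use nu i bw in auto)
 then show ?thesis by (simp add: mult_ac)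
 qed
 have nC: "n * C0 \<le> E" "0 \<le> n * C0"
 proof -
 have "n * C0 * 1 \<le> n * C0 * D'" using n C0(1) by (intro mult_left_mono) (auto simp: D'_def)
 then show "n * C0 \<le> E" using E(3) by simp
 show "0 \<le> n * C0" using n C0(1) by simp
 qed
 have pr: "r = r powr (1 - sg) * r powr sg" using r by (simp flip: powr_add)
 have fin: "g \<le> E * W bw * r powr sg" if "g \<le> c * v * r powr sg" "c \<le> E" "v \<le> W bw" "0 \<le> v" for c v
 proof -
 have "c * v \<le> E * W bw" by (rule mult_mono) (use that E in auto)
 then show ?thesis using that(1) mult_right_mono[of "c * v" "E * W bw" "r powr sg"] by (simp; linarith)
 qed
 have "g \<le> E * W bw * r powr sg"
 \<comment> \<open>Below the scale \<open>bw\<close> the Lipschitz bound is used, with the surplus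
   power of \<open>r\<close> estimated by the same power of \<open>bw\<close>. Above it the choice
   depends on how the order \<open>m\<close> compares with \<open>k\<close>.\<close>
 proof (cases "r \<le> bw")
 case True
 have rd: "r powr (1 - sg) \<le> bw powr (1 - sg)" using True r sg by (intro powr_mono2) auto
 have "g \<le> n * C0 * w (m + 1) bw * (bw powr (1 - sg) * r powr sg)"
 using b nC(2) rd by (subst (asm) pr) (rule order_trans, assumption, intro mult_left_mono mult_right_mono, auto simp: w_def)
 then have g1: "g \<le> n * C0 * (w (m + 1) bw * bw powr (1 - sg)) * r powr sg" by (simp add: mult_ac)
 show ?thesis
 proof (cases "m + 1 \<le> k")
 case k: True
 have "bw powr (1 - sg) \<le> D'"
 proof (cases "bw \<le> 1")
 case True then show ?thesis using bw sg powr_mono'[of 0 "1 - sg" bw] by (simp add: D'_def)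
 next
 case False then show ?thesis using bw sg powr_mono[of "1 - sg" 1 bw] by (simp add: D'_def)
 qed
 then have "n * C0 * bw powr (1 - sg) \<le> n * C0 * D'" using nC(2) by (rule mult_left_mono)
 then have "n * C0 * bw powr (1 - sg) \<le> E" using E(3) by linarith
 moreover have "g \<le> (n * C0 * bw powr (1 - sg)) * 1 * r powr sg" using g1 k by (simp add: w_def)
 ultimately show ?thesis using W1 by (intro fin[of "n * C0 * bw powr (1 - sg)" 1]) auto
 next
 case k: False
 have "w (m + 1) bw * bw powr (1 - sg) = bw powr (k + s - et)"
 using k by (simp add: w_def sg(3) algebra_simps flip: powr_add)
 then show ?thesis using g1 nC(1) by (intro fin[of "n * C0" "bw powr (k + s - et)"]) (auto simp: W_def)
 qed
 next
 case False
 show ?thesis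
 proof (cases "m \<le> k \<and> r \<ge> 1")
 case True
 then have "1 \<le> r powr sg" using sg by (simp add: ge_one_powr_ge_zero)
 then have "2 * C0 \<le> 2 * C0 * 1 * r powr sg" using C0(1) by simp
 then have "g \<le> 2 * C0 * 1 * r powr sg" using a True by (simp add: w_def)
 then show ?thesis using E(2) W1 by (intro fin[of "2 * C0" 1]) auto
 next
 case F1: False
 consider "m < k" "r < 1" | "m = k" "r < 1" | "m > k" using F1 by linarith
 then show ?thesis
 proof cases
 case 1
 have "r \<le> r powr sg" using 1 r sg powr_mono'[of sg 1 r] by simp
 then have "n * C0 * r \<le> n * C0 * r powr sg" using nC by (intro mult_left_mono) auto
 then have "g \<le> n * C0 * 1 * r powr sg" using b 1 by (simp add: w_def)
 then show ?thesis using nC W1 by (intro fin[of "n * C0" 1]) auto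
 next
 \<comment> \<open>The one case in which neither the sup bound nor the Lipschitz bound is sharp
   enough for \<open>s < sg\<close>, since \<open>r\<close> lies between \<open>bw\<close> and 1;
   the Hoelder bound of order \<open>k\<close> is needed.\<close>
 case 2
 have g2: "g \<le> C2 * r powr s" unfolding g_def r_def by (rule C2(2)) (use nu 2 i bw in auto)
 show ?thesis
 proof (cases "s \<ge> sg")
 case True
 have "r powr s \<le> r powr sg" using 2 r True by (intro powr_mono') auto
 then have "C2 * r powr s \<le> C2 * r powr sg" using C2(1) by simp
 then have "g \<le> C2 * 1 * r powr sg" using g2 by simp
 then show ?thesis using E(4) W1 by (intro fin[of C2 1]) auto
 next
 case sl: False
 have "r powr s = r powr (s - sg) * r powr sg" using r by (simp flip: powr_add)
 also have "... \<le> bw powr (s - sg) * r powr sg"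
 using sl False bw r by (intro mult_right_mono powr_mono2') auto
 finally have "C2 * r powr s \<le> C2 * (bw powr (s - sg) * r powr sg)" using C2(1) by simp
 then have "g \<le> C2 * bw powr (k + s - et) * r powr sg" using g2 2 sg(3) by (simp add: mult_ac)
 then show ?thesis using E(4) by (intro fin[of C2 "bw powr (k + s - et)"]) (auto simp: W_def)
 qed
 next
 case 3
 have "w m bw = bw powr (k + s - et) * bw powr sg" using 3 by (simp add: w_def sg(3) algebra_simps flip: powr_add)
 also have "... \<le> bw powr (k + s - et) * r powr sg" using False bw sg by (intro mult_left_mono powr_mono2) auto
 finally have "2 * C0 * w m bw \<le> 2 * C0 * (bw powr (k + s - et) * r powr sg)" using C0(1) by simp
 then have "g \<le> 2 * C0 * bw powr (k + s - et) * r powr sg" using a by (simp add: mult_ac)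
 then show ?thesis using E(2) by (intro fin[of "2 * C0" "bw powr (k + s - et)"]) (auto simp: W_def)
 qed
 qed
 qed
 then show ?thesis by (simp add: g_def r_def)
 qed
 define c where "c = real (mi_count TYPE('n) m)"
 have c: "c > 0" using mi_count_pos[of m, where 'n = 'n] by (simp add: c_def)
 show ?thesis
 proof (intro exI[of _ "c * E"] conjI ballI allI impI)
 fix i bw a assume i: "i \<in> I" and bw: "0 < bw" "bw \<le> Dl" and a: "\<bar>a\<bar> \<le> (1::real)"
 define b where "b = a / (c * E * W bw)"
 have p: "c * E * W bw > 0" using c E(1) W1[of bw] by (auto intro!: mult_pos_pos)
 have b: "\<bar>b\<bar> * (E * W bw) \<le> 1 / c"
 proof -
 have "\<bar>b\<bar> * (E * W bw) = \<bar>a\<bar> / c" using p c E(1) W1[of bw] by (simp add: b_def abs_mult)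
 then show ?thesis using a c by (simp add: divide_right_mono)
 qed
 have "(%x. b * moll N (%_. 0) bw (F i) x) \<in> holder_class et 0 1"
 proof (rule holder_class_of_smooth[where D = "%nu x. b * moll N nu bw (F i) x" and M = "1 / c" and et = et, folded m_def sg_def])
 show "((%x. b * moll N nu bw (F i) x) has_derivative (%h. \<Sum>j\<in>UNIV. b * moll N (nu(j := nu j + 1)) bw (F i) x * h $ j)) (at x)"
 if "mi_order nu < m" for nu x
 using has_derivative_mult_right[OF der[OF less_imp_le[OF that] i bw(1)], of b] by (simp add: sum_distrib_left mult.assoc)
 show "continuous_on UNIV (%x. b * moll N nu bw (F i) x)" if "mi_order nu \<le> m" for nu
 proof -
 have "continuous_on UNIV (moll N nu bw (F i))"
 by (rule continuous_at_imp_continuous_on) (use has_derivative_continuous[OF der[OF that i bw(1)]] in auto)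
 then show ?thesis by (intro continuous_intros)
 qed
 show "\<bar>b * moll N nu bw (F i) x\<bar> \<le> 1 / c" if "mi_order nu \<le> m" for nu x
 proof -
 have "\<bar>moll N nu bw (F i) x\<bar> \<le> C0 * w (mi_order nu) bw" using that i bw by (intro C0(2)) auto
 also have "... \<le> E * W bw" using wW[OF that bw(1)] E C0(1) by (intro mult_mono) (auto simp: w_def)
 finally have "\<bar>b\<bar> * \<bar>moll N nu bw (F i) x\<bar> \<le> \<bar>b\<bar> * (E * W bw)" by (rule mult_left_mono) simp
 then show ?thesis using b by (simp add: abs_mult)
 qed
 show "\<bar>b * moll N nu bw (F i) x - b * moll N nu bw (F i) y\<bar> * ln (inverse (min (norm (x - y)) (1/2))) powr 0
 \<le> 1 / c * norm (x - y) powr sg" if "mi_order nu = m" "x \<noteq> y" for nu x y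
 proof -
 have "\<bar>b * moll N nu bw (F i) x - b * moll N nu bw (F i) y\<bar> = \<bar>b\<bar> * \<bar>moll N nu bw (F i) x - moll N nu bw (F i) y\<bar>"
 by (simp add: abs_mult flip: right_diff_distrib)
 also have "... \<le> \<bar>b\<bar> * (E * W bw * norm (x - y) powr sg)" using hol[OF that(1) i bw that(2)] by (rule mult_left_mono) simp
 also have "... = (\<bar>b\<bar> * (E * W bw)) * norm (x - y) powr sg" by simp
 also have "... \<le> 1 / c * norm (x - y) powr sg" using b by (rule mult_right_mono) simp
 finally have le: "\<bar>b * moll N nu bw (F i) x - b * moll N nu bw (F i) y\<bar> \<le> 1 / c * norm (x - y) powr sg" .
 have "\<bar>b * moll N nu bw (F i) x - b * moll N nu bw (F i) y\<bar> * ln (inverse (min (norm (x - y)) (1/2))) powr 0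
 \<le> \<bar>b * moll N nu bw (F i) x - b * moll N nu bw (F i) y\<bar> * 1" by (intro mult_left_mono) auto
 from order_trans[OF this[unfolded mult_1_right] le] show ?thesis .
 qed
 show "real (mi_count TYPE('n) m) * (1 / c) \<le> 1" using c by (simp add: c_def)
 qed simp
 then show "(%x. a / (c * E * max 1 (bw powr (k + s - et))) * moll N (%_. 0) bw (F i) x) \<in> holder_class et 0 1"
 by (simp add: b_def W_def)
 qed (use c E(1) in auto)
qed

section \<open>Reproduction of a function by several scales\<close>

primrec fdiff_coeff :: "nat => nat => real" where
 "fdiff_coeff 0 j = (if j = 0 then 1 else 0)"
| "fdiff_coeff (Suc m) j = (if j = 0 then 0 else fdiff_coeff m (j - 1)) - fdiff_coeff m j"

lemma fdiff_coeff_0: "fdiff_coeff m 0 = (- 1) ^ m" by (induction m) auto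

lemma fdiff_coeff_gt: "j > m ==> fdiff_coeff m j = 0" by (induction m arbitrary: j) auto

text \<open>The recursion of \<open>fdiff_coeff\<close> is Pascal's rule; its values are the signed
  binomial coefficients \<open>(- 1) ^ (m - j) * (m choose j)\<close>, with 0 beyond
  \<open>m\<close>.\<close>

lemma fdiff_expand: "(fdiff u ^^ m) f x = (\<Sum>j\<le>m. fdiff_coeff m j * f (x + real j *\<^sub>R u))"
proof (induction m arbitrary: x)
 case (Suc m)
 have "(fdiff u ^^ Suc m) f x = (\<Sum>j\<le>m. fdiff_coeff m j * f (x + u + real j *\<^sub>R u)) - (\<Sum>j\<le>m. fdiff_coeff m j * f (x + real j *\<^sub>R u))"
 by (simp add: fdiff_def Suc)
 also have "(\<Sum>j\<le>m. fdiff_coeff m j * f (x + u + real j *\<^sub>R u)) = (\<Sum>j\<le>m. fdiff_coeff m j * f (x + real (Suc j) *\<^sub>R u))"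
 by (simp add: algebra_simps)
 also have "... = (\<Sum>j\<le>Suc m. (if j = 0 then 0 else fdiff_coeff m (j - 1)) * f (x + real j *\<^sub>R u))"
 by (subst sum.atMost_Suc_shift) simp
 also have "(\<Sum>j\<le>m. fdiff_coeff m j * f (x + real j *\<^sub>R u)) = (\<Sum>j\<le>Suc m. fdiff_coeff m j * f (x + real j *\<^sub>R u))"
 by (simp add: fdiff_coeff_gt)
 finally show ?case by (simp add: left_diff_distrib flip: sum_subtractf)
qed simp

text \<open>The combination of mollifications that reproduces polynomials of degree below \<open>m\<close>:
 the error at \<open>x\<close> is an average of \<open>m\<close>-th finite differences.\<close>

definition lowpass :: "nat => nat => real => (real^'n::finite => real) => real^'n => real" where
 "lowpass N m bw f x = (\<Sum>j\<in>{1..m}. - ((- 1) ^ m * fdiff_coeff m j) * moll N (%_. 0) (real j * bw) f x)"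

text \<open>The term \<open>j = 0\<close> of the \<open>m\<close>-th difference is
  \<open>(- 1) ^ m * f x\<close>. Averaging the difference over the kernel and solving for this term
  leaves mollifications at the scales \<open>j * bw\<close>; that is the origin of the coefficients
  of \<open>lowpass\<close>.\<close>

lemma lowpass_error:
 fixes f :: "real^'n::finite => real"
 assumes f: "continuous_on UNIV f" "!!x. \<bar>f x\<bar> \<le> B" and bw: "bw > 0"
 shows "f x - lowpass N m bw f x = (- 1) ^ m / bump_mass N TYPE('n) *
 (LBINT z. (fdiff (bw *\<^sub>R z) ^^ m) f x * pbump N (%_. 0) z)"
proof -
 define p where "p = pbump N (%_::'n. 0)"
 define b where "b = bump_mass N TYPE('n)"
 have b: "b > 0" unfolding b_def by (rule bump_mass_pos)
 have ip: "integrable lborel p" unfolding p_def by (rule pbump_integrable) simp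
 have int: "integrable lborel (%z. f (x + real j *\<^sub>R bw *\<^sub>R z) * p z)" for j :: nat
 proof (cases "j = 0")
 case False
 then show ?thesis using moll_integrable[of "real j * bw" f B "%_. 0" N x] f bw by (simp add: p_def)
 qed (simp add: ip)
 have "(LBINT z. (fdiff (bw *\<^sub>R z) ^^ m) f x * p z) = (\<integral>z. (\<Sum>j\<le>m. fdiff_coeff m j * (f (x + real j *\<^sub>R bw *\<^sub>R z) * p z)) \<partial>lborel)"
 unfolding fdiff_expand sum_distrib_right by (simp add: mult.assoc)
 also have "... = (\<Sum>j\<le>m. fdiff_coeff m j * (LBINT z. f (x + real j *\<^sub>R bw *\<^sub>R z) * p z))"
 by (subst Bochner_Integration.integral_sum) (use int in auto)
 also have "{..m} = insert 0 {1..m}" by auto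
 finally have "(LBINT z. (fdiff (bw *\<^sub>R z) ^^ m) f x * p z) = (- 1) ^ m * f x * b
 + (\<Sum>j\<in>{1..m}. fdiff_coeff m j * (LBINT z. f (x + real j *\<^sub>R bw *\<^sub>R z) * p z))"
 by (simp add: fdiff_coeff_0 b_def bump_mass_def p_def)
 moreover have "moll N (%_. 0) (real j * bw) f x = (LBINT z. f (x + real j *\<^sub>R bw *\<^sub>R z) * p z) / b" for j
 by (simp add: moll_def b_def p_def)
 ultimately show ?thesis
 unfolding lowpass_def p_def[symmetric] b_def[symmetric] using b
 by (simp add: algebra_simps sum_distrib_left sum_divide_distrib sum_negf add_divide_distrib flip: power_mult_distrib)
qed

lemma lowpass_family_error:
 fixes F :: "'i => real^'n::finite => real" and s :: real
 assumes s: "0 < s" "s \<le> 1" and F: "holder_bdd k s I F" and m: "m \<ge> k + 1"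
 shows "\<exists>C>0. \<forall>i\<in>I. \<forall>bw>0. \<forall>x. \<bar>F i x - lowpass N m bw (F i) x\<bar> \<le> C * bw powr (k + s)"
proof -
 obtain C where C: "C > 0" "!!i u x. i \<in> I ==> \<bar>(fdiff u ^^ m) (F i) x\<bar> \<le> C * norm u powr (k + s)"
 using holder_bdd_fdiff[OF s F m] by blast
 obtain B where B: "B > 0" "!!i x. i \<in> I ==> \<bar>F i x\<bar> \<le> B" by (rule holder_bdd_bounded[OF F], rule that)
 have cont: "i \<in> I ==> continuous_on UNIV (F i)" for i by (rule holder_bdd_continuous[OF F s])
 let ?n = "real CARD('n)"
 define p where "p = pbump N (%_::'n. 0)"
 have "\<bar>F i x - lowpass N m bw (F i) x\<bar> \<le> C * ?n powr (k + s) * bw powr (k + s)" if i: "i \<in> I" and bw: "bw > 0" for i bw x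
 proof -
 have [measurable]: "F i \<in> bmeas" using cont[OF i] by (rule borel_measurable_continuous_onI)
 have bm: "bump_mass N TYPE('n) > 0" by (rule bump_mass_pos)
 have "\<bar>\<integral>z. (fdiff (bw *\<^sub>R z) ^^ m) (F i) x * p z \<partial>lborel\<bar> \<le> (C * (bw * ?n) powr (k + s)) * (LBINT z. \<bar>p z\<bar>)"
 proof (rule abs_integral_mult_le)
 show "integrable lborel p" unfolding p_def by (rule pbump_integrable) simp
 show "(%z. (fdiff (bw *\<^sub>R z) ^^ m) (F i) x) \<in> borel_measurable lborel" unfolding fdiff_expand by measurable
 fix z assume "p z \<noteq> 0"
 then have "norm z \<le> ?n" using pbump_supp_norm[of "%_::'n. 0" N z] unfolding p_def by fastforce
 then have "norm (bw *\<^sub>R z) powr (k + s) \<le> (bw * ?n) powr (k + s)" using bw s by (intro powr_mono2) auto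
 then have "C * norm (bw *\<^sub>R z) powr (k + s) \<le> C * (bw * ?n) powr (k + s)" using C(1) by simp
 with C(2)[OF i, of "bw *\<^sub>R z" x] show "\<bar>(fdiff (bw *\<^sub>R z) ^^ m) (F i) x\<bar> \<le> C * (bw * ?n) powr (k + s)" by linarith
 qed
 also have "(LBINT z. \<bar>p z\<bar>) = bump_mass N TYPE('n)" by (simp add: p_def bump_mass_def pbump_0_nonneg)
 finally show ?thesis
 unfolding lowpass_error[OF cont[OF i] B(2)[OF i] bw] p_def[symmetric] using bm bw
 by (simp add: abs_mult divide_le_eq powr_mult mult_ac power_abs)
 qed
 then show ?thesis using C(1) by (intro exI[of _ "C * ?n powr (k + s)"]) auto
qed

section \<open>Expanding maps are diffeomorphisms\<close>

text \<open>A global inverse theorem of Hadamard type. Uniform Hoelder continuity of the Jacobian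
  gives one radius on which \<open>g\<close> expands distances everywhere; so every image ball of a
  fixed radius is reached, \<open>g\<close> is onto, and preimages of small balls split into
  disjoint sheets. A covering of Euclidean space by itself is invertible because the base is simply
  connected.\<close>

lemma expanding_map_global_inverse:
 fixes g :: "real^'n::finite => real^'n" and A :: "real^'n => real^'n^'n" and C s L :: real
 assumes d: "!!x. (g has_derivative (%h. A x *v h)) (at x)"
 and hol: "!!i j x y. \<bar>A x $ i $ j - A y $ i $ j\<bar> \<le> C * norm (x - y) powr s" and s: "s > 0" and C: "C \<ge> 0"
 and low: "!!x v. norm v / L \<le> norm (A x *v v)" and L: "L > 0"
 obtains G where "!!x. G (g x) = x" "!!y. g (G y) = y" "continuous_on UNIV G"
proof -
 define n where "n = real CARD('n)"
 \<comment> \<open>Half of the expansion \<open>1 / L\<close> of the Jacobian; the other half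
   absorbs the Taylor remainder.\<close>
 define c where "c = 1 / (2 * L)"
 have c: "c > 0" using L by (simp add: c_def)
 have cont: "continuous_on UNIV g"
 by (rule continuous_at_imp_continuous_on) (use has_derivative_continuous[OF d] in auto)
 have rem: "norm (g (x + h) - g x - A x *v h) \<le> n * (n * C * norm h powr (1 + s))" for x h
 unfolding n_def
 proof (rule sum_nth_bound)
 fix l
 have dl: "((%x. g x $ l) has_derivative (%h. \<Sum>j\<in>UNIV. A x $ l $ j * h $ j)) (at x)" for x
 using bounded_linear.has_derivative[OF bounded_linear_vec_nth d[of x], of l] by (simp add: matrix_vector_mult_def)
 from taylor_first_order[where f = "%x. g x $ l" and f' = "%j x. A x $ l $ j", OF dl hol s C, of x h]
 show "\<bar>(g (x + h) - g x - A x *v h) $ l\<bar> \<le> real CARD('n) * C * norm h powr (1 + s)"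
 by (simp add: matrix_vector_mult_def)
 qed
 \<comment> \<open>Chosen so that the remainder of order \<open>1 + s\<close> is at most
   \<open>c * norm h\<close> for \<open>norm h \<le> rh\<close>; the added 1 avoids division by
   0.\<close>
 define rh where "rh = (c / (n * (n * C) + 1)) powr (1 / s)"
 have q0: "n * (n * C) + 1 > 0" using C by (simp add: n_def add_nonneg_pos)
 have rh: "rh > 0" "rh powr s = c / (n * (n * C) + 1)"
 using c q0 s by (simp_all add: rh_def powr_powr)
 have exp: "c * norm h \<le> norm (g (x + h) - g x)" if "norm h \<le> rh" for x h
 proof -
 have "n * (n * C * norm h powr (1 + s)) = (n * (n * C)) * norm h powr s * norm h"
 by (cases "h = 0") (simp_all add: powr_add)
 also have "... \<le> c * norm h"
 proof (rule mult_right_mono)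
 have "norm h powr s \<le> rh powr s" using that s by (intro powr_mono2) auto
 then have "(n * (n * C)) * norm h powr s \<le> (n * (n * C)) * (c / (n * (n * C) + 1))"
 unfolding rh(2) using C by (intro mult_left_mono) (auto simp: n_def)
 also have "... \<le> c" using c q0 by (simp add: divide_le_eq algebra_simps)
 finally show "(n * (n * C)) * norm h powr s \<le> c" .
 qed simp
 finally have 1: "norm (g (x + h) - g x - A x *v h) \<le> c * norm h" using rem[of x h] by linarith
 have "norm h / L = 2 * c * norm h" by (simp add: c_def)
 then have "2 * c * norm h \<le> norm (A x *v h)" using low[of h x] by simp
 moreover have "norm (A x *v h) \<le> norm (g (x + h) - g x) + norm (g (x + h) - g x - A x *v h)"
 using norm_triangle_ineq4[of "g (x + h) - g x" "g (x + h) - g x - A x *v h"] by simp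
 ultimately show ?thesis using 1 by linarith
 qed
 have exp2: "c * norm (x - y) \<le> norm (g x - g y)" if "norm (x - y) \<le> rh" for x y
 using exp[of "x - y" y] that by simp
 \<comment> \<open>Two points of one ball of this radius, or the centres of two overlapping ones,
   are then closer than \<open>rh\<close>, so that the expansion estimate applies to them.\<close>
 define rh' where "rh' = rh / 3"
 define r where "r = c * rh'"
 have r: "rh' > 0" "r > 0" using rh c by (simp_all add: rh'_def r_def)
 have inj: "inj_on g (cball x rh')" for x
 proof (rule inj_onI)
 fix y z assume yz: "y \<in> cball x rh'" "z \<in> cball x rh'" "g y = g z"
 have "norm (y - z) \<le> rh' + rh'" using yz dist_triangle2[of y z x] by (simp add: dist_norm norm_minus_commute)
 then have "c * norm (y - z) \<le> 0" using exp2[of y z] yz rh by (simp add: rh'_def)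
 then show "y = z" using c by (simp add: mult_le_0_iff)
 qed
 \<comment> \<open>By expansion, points on the boundary of \<open>cball x rh'\<close> are sent to
   distance at least \<open>r\<close> from \<open>g x\<close>. Hence the connected ball around
   \<open>g x\<close> is covered by two open sets that are disjoint on it, the image of the open
   ball and the complement of the image of the closed one, and it meets the first.\<close>
 have onto: "ball (g x) r \<subseteq> g ` ball x rh'" for x
 proof -
 have op: "open (g ` ball x rh')"
 by (rule invariance_of_domain[OF continuous_on_subset[OF cont subset_UNIV] open_ball inj_on_subset[OF inj[of x] ball_subset_cball]])
 have cl: "closed (g ` cball x rh')"
 by (intro compact_imp_closed compact_continuous_image continuous_on_subset[OF cont]) auto
 have cover: "ball (g x) r \<subseteq> g ` ball x rh' \<union> - g ` cball x rh'"
 proof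
 fix w assume w: "w \<in> ball (g x) r"
 show "w \<in> g ` ball x rh' \<union> - g ` cball x rh'"
 proof (cases "w \<in> g ` cball x rh'")
 case True
 then obtain y where y: "w = g y" "y \<in> cball x rh'" by auto
 have "norm (y - x) \<le> rh" using y rh by (simp add: dist_norm norm_minus_commute rh'_def)
 then have "c * norm (y - x) < c * rh'"
 using exp2[of y x] w y by (simp add: dist_norm norm_minus_commute r_def)
 then have "norm (y - x) < rh'" using c by simp
 then show ?thesis using y by (auto simp: dist_norm norm_minus_commute)
 qed auto
 qed
 have "g ` ball x rh' \<inter> ball (g x) r = {} \<or> - g ` cball x rh' \<inter> ball (g x) r = {}"
 by (rule connectedD[OF connected_ball op _ _ cover]) (use cl in auto)
 moreover have "g x \<in> g ` ball x rh' \<inter> ball (g x) r" using r by auto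
 ultimately show ?thesis using cover by blast
 qed
 have surj: "range g = UNIV"
 proof -
 have "open (range g)"
 unfolding open_contains_ball using onto r by blast
 moreover have "closure (range g) \<subseteq> range g"
 proof
 fix y assume "y \<in> closure (range g)"
 then obtain z where "z \<in> range g" "dist z y < r" using r(2) unfolding closure_approachable by blast
 then obtain x where "dist (g x) y < r" by blast
 then have "y \<in> ball (g x) r" by simp
 then show "y \<in> range g" using onto[of x] by blast
 qed
 then have "closed (range g)" by (simp add: closure_subset_eq)
 ultimately show ?thesis using clopen[of "range g"] by auto
 qed
 have cov: "covering_space UNIV g UNIV"
 proof (rule covering_spaceI[OF cont surj])
 fix y :: "real^'n"
 define V where "V x = ball x rh' \<inter> g -` ball y r" for x
 have opV: "open (V x)" for x
 unfolding V_def by (intro open_Int open_ball open_vimage cont)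
 show "\<exists>T. y \<in> T \<and> openin (top_of_set UNIV) T \<and> (\<exists>v. \<Union> v = UNIV \<inter> g -` T \<and> (\<forall>u\<in>v. openin (top_of_set UNIV) u) \<and>
 pairwise disjnt v \<and> (\<forall>u\<in>v. \<exists>q. homeomorphism u T g q))"
 proof (intro exI[of _ "ball y r"] conjI exI[of _ "V ` {x. g x = y}"] ballI)
 show "\<Union> (V ` {x. g x = y}) = UNIV \<inter> g -` ball y r"
 proof
 show "UNIV \<inter> g -` ball y r \<subseteq> \<Union> (V ` {x. g x = y})"
 proof
 fix z assume z: "z \<in> UNIV \<inter> g -` ball y r"
 then have "y \<in> ball (g z) r" by (simp add: dist_commute)
 then obtain x where "g x = y" "x \<in> ball z rh'" using onto[of z] by blast
 then show "z \<in> \<Union> (V ` {x. g x = y})" using z by (auto simp: V_def dist_commute)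
 qed
 qed (auto simp: V_def)
 show "pairwise disjnt (V ` {x. g x = y})"
 unfolding pairwise_def
 proof (intro ballI impI)
 fix U U' assume "U \<in> V ` {x. g x = y}" "U' \<in> V ` {x. g x = y}" "U \<noteq> U'"
 then obtain x x' where U: "U = V x" "U' = V x'" and "g x = y" "g x' = y" by blast
 then have x: "g x = g x'" "V x \<noteq> V x'" using \<open>U \<noteq> U'\<close> by simp_all
 show "disjnt U U'" unfolding U
 proof (rule ccontr)
 assume "\<not> disjnt (V x) (V x')"
 then obtain z where "z \<in> ball x rh'" "z \<in> ball x' rh'" by (auto simp: disjnt_def V_def)
 then have "dist x x' < rh' + rh'" using dist_triangle[of x x' z] by (simp add: dist_commute)
 then have "c * norm (x - x') \<le> 0" using exp2[of x x'] x rh by (simp add: rh'_def dist_norm)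
 then have "x = x'" using c by (simp add: mult_le_0_iff)
 then show False using x by simp
 qed
 qed
 fix u assume "u \<in> V ` {x. g x = y}"
 then obtain x where x: "u = V x" "g x = y" by auto
 have iV: "inj_on g (V x)" by (rule inj_on_subset[OF inj[of x]]) (auto simp: V_def)
 obtain q where q: "homeomorphism (V x) (g ` V x) g q"
 using invariance_of_domain_homeomorphism[OF opV continuous_on_subset[OF cont subset_UNIV] order_refl iV] by metis
 have "g ` V x = ball y r" using onto[of x] x by (auto simp: V_def)
 then show "\<exists>q. homeomorphism u (ball y r) g q" using q x by auto
 qed (use r opV in auto)
 qed
 have sc: "simply_connected (UNIV :: (real^'n) set)" by (simp add: convex_imp_simply_connected)
 have lpc: "locally path_connected (UNIV :: (real^'n) set)" by (simp add: convex_imp_locally_path_connected)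
 \<comment> \<open>The inverse is a lift of the identity through the covering \<open>g\<close>,
   normalised at one point. It is also a left inverse because \<open>G \<circ> g\<close> and the
   identity are two lifts of \<open>g\<close> that agree at 0.\<close>
 obtain G where G: "continuous_on UNIV G" "G (g 0) = 0" "!!y. g (G y) = y"
 by (rule covering_space_lift_strong[OF cov, of 0 "g 0" UNIV id]) (use sc lpc in \<open>auto intro: continuous_on_id'\<close>)
 have "G (g x) = x" for x
 proof -
 have "(G \<circ> g) x = id x"
 proof (rule covering_space_lift_unique[OF cov, of "G \<circ> g" 0 id UNIV g])
 show "continuous_on UNIV (G \<circ> g)" by (rule continuous_on_compose[OF cont continuous_on_subset[OF G(1)]]) auto
 qed (use G cont in \<open>auto intro: continuous_on_id'\<close>)
 then show ?thesis by simp
 qed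
 then show ?thesis using that G by blast
qed

section \<open>Inverses of Jacobian matrices\<close>

lemma matrix_inv_of_expanding:
 fixes A :: "real^'n::finite^'n"
 assumes low: "!!v. norm v / L \<le> norm (A *v v)" and L: "L > 0"
 shows "A ** matrix_inv A = mat 1" "matrix_inv A ** A = mat 1" "\<bar>matrix_inv A $ i $ j\<bar> \<le> L"
proof -
 have "inj ((*v) A)"
 proof (rule injI)
 fix x y assume "A *v x = A *v y"
 then have "norm (A *v (x - y)) = 0" by (simp add: matrix_vector_mult_diff_distrib)
 with low[of "x - y"] L have "norm (x - y) \<le> 0" by (simp add: divide_le_0_iff)
 then show "x = y" by simp
 qed
 then obtain B where "B ** A = mat 1" using matrix_left_invertible_injective[of A] by blast
 then have "\<exists>B. A ** B = mat 1 \<and> B ** A = mat 1" using matrix_left_right_inverse by blast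
 then have inv: "A ** matrix_inv A = mat 1 \<and> matrix_inv A ** A = mat 1"
 unfolding matrix_inv_def by (rule someI_ex)
 then show "A ** matrix_inv A = mat 1" "matrix_inv A ** A = mat 1" by auto
 have "norm (matrix_inv A *v axis j 1) / L \<le> norm (A *v (matrix_inv A *v axis j 1))" by (rule low)
 also have "... = 1" by (simp add: matrix_vector_mul_assoc inv)
 finally have "norm (matrix_inv A *v axis j 1) \<le> L" using L by simp
 moreover have "(matrix_inv A *v axis j 1) $ i = matrix_inv A $ i $ j"
 by (simp add: matrix_vector_mult_def axis_def if_distrib[of "%x. _ * x"] cong: if_cong)
 ultimately show "\<bar>matrix_inv A $ i $ j\<bar> \<le> L" using abs_comp_le_norm[of "matrix_inv A *v axis j 1" i] by simp
qed

lemma mat_mult_entry: "(A ** B) $ i $ j = (\<Sum>k\<in>UNIV. A $ i $ k * B $ k $ j)"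
 by (simp add: matrix_matrix_mult_def)

text \<open>The resolvent identity \<open>N - M = M ** (A - B) ** N\<close>, read entrywise. It
  passes increments of a matrix function on to its inverse.\<close>

lemma inverse_difference:
 fixes A B M N :: "real^'n::finite^'n"
 assumes "M ** A = mat 1" "B ** N = mat 1"
 shows "N $ i $ j - M $ i $ j = (\<Sum>p\<in>UNIV. \<Sum>q\<in>UNIV. M $ i $ p * (A $ p $ q - B $ p $ q) * N $ q $ j)"
proof -
 have "M ** (A - B) ** N = N - M"
 proof -
 have "M ** (A - B) ** N = M ** A ** N - M ** (B ** N)"
 unfolding matrix_mul_assoc
 by (simp add: vec_eq_iff mat_mult_entry sum_subtractf left_diff_distrib right_diff_distrib)
 then show ?thesis using assms by simp
 qed
 then have "N $ i $ j - M $ i $ j = (M ** (A - B) ** N) $ i $ j" by simp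
 also have "... = (\<Sum>q\<in>UNIV. \<Sum>p\<in>UNIV. M $ i $ p * (A $ p $ q - B $ p $ q) * N $ q $ j)"
 by (simp add: mat_mult_entry sum_distrib_right)
 also have "... = (\<Sum>p\<in>UNIV. \<Sum>q\<in>UNIV. M $ i $ p * (A $ p $ q - B $ p $ q) * N $ q $ j)"
 by (rule sum.swap)
 finally show ?thesis .
qed

lemma double_sum_bound:
 fixes a :: "'a::finite => 'b::finite => real" and B :: real
 assumes "!!p q. \<bar>a p q\<bar> \<le> B"
 shows "\<bar>\<Sum>p\<in>UNIV. \<Sum>q\<in>UNIV. a p q\<bar> \<le> CARD('a) * (CARD('b) * B)"
proof -
 have "\<bar>\<Sum>p\<in>UNIV. \<Sum>q\<in>UNIV. a p q\<bar> \<le> (\<Sum>p\<in>UNIV. \<Sum>q\<in>UNIV. \<bar>a p q\<bar>)"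
 by (rule order_trans[OF sum_abs]) (intro sum_mono sum_abs)
 also have "... \<le> (\<Sum>p\<in>(UNIV::'a set). \<Sum>q\<in>(UNIV::'b set). B)" by (intro sum_mono assms)
 finally show ?thesis by simp
qed

text \<open>The derivative of an inverse is minus the product of the inverse, the derivative and the
  inverse, so regularity is inherited order by order from a uniform bound on the inverse. No lower
  bound on a determinant enters.\<close>

lemma holder_bdd_matrix_inverse:
 fixes A N :: "'i => real^'n::finite => real^'m::finite^'m" and s :: real
 assumes s: "0 < s" "s \<le> 1"
 and inv: "!!i x. i \<in> I ==> A i x ** N i x = mat 1" "!!i x. i \<in> I ==> N i x ** A i x = mat 1"
 and bd: "!!i x a b. i \<in> I ==> \<bar>N i x $ a $ b\<bar> \<le> L"
 and A: "!!a b. holder_bdd k s I (%i x. A i x $ a $ b)"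
 shows "holder_bdd k s I (%i x. N i x $ a $ b)"
 using A
proof (induction k arbitrary: a b)
 case 0
 obtain C where C: "C > 0" "!!p i x y. i \<in> I ==> \<bar>A i x $ fst p $ snd p - A i y $ fst p $ snd p\<bar> \<le> C * norm (x - y) powr s"
 by (rule holder_bdd_components_holder0[where F = "%p i x. A i x $ fst p $ snd p", OF 0 s], rule that)
 have "\<bar>N i x $ a $ b - N i y $ a $ b\<bar> \<le> (CARD('m) * (CARD('m) * (L * C * L))) * norm (x - y) powr s" if i: "i \<in> I" for i x y
 proof -
 have L: "L \<ge> 0" using bd[OF i, of x a b] by linarith
 have "\<bar>N i x $ a $ b - N i y $ a $ b\<bar> = \<bar>\<Sum>p\<in>UNIV. \<Sum>q\<in>UNIV. N i y $ a $ p * (A i y $ p $ q - A i x $ p $ q) * N i x $ q $ b\<bar>"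
 by (subst inverse_difference[OF inv(2)[OF i, of y] inv(1)[OF i, of x]]) simp
 also have "... \<le> CARD('m) * (CARD('m) * (L * (C * norm (x - y) powr s) * L))"
 by (rule double_sum_bound, unfold abs_mult, intro mult_mono)
 (use bd[OF i] C(2)[where p = "(_, _)" and x = y and y = x, OF i] L C(1) in \<open>auto simp: norm_minus_commute\<close>)
 finally show ?thesis by (simp add: mult_ac)
 qed
 then show ?case using bd unfolding holder_bdd.simps by blast
next
 case (Suc k)
 have A0: "holder_bdd k s I (%i x. A i x $ a $ b)" for a b by (rule holder_bdd_pred[OF s Suc.prems])
 note N = Suc.IH[OF A0]
 define P where "P p A' \<longleftrightarrow> (\<forall>i\<in>I. \<forall>x. ((%x. A i x $ fst p $ snd p) has_derivative (%h. \<Sum>j\<in>UNIV. A' j i x * h $ j)) (at x)) \<and> (\<forall>j. holder_bdd k s I (A' j))"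
 for p :: "'m \<times> 'm" and A' :: "'n => 'i => real^'n => real"
 have "\<forall>p. \<exists>A'. P p A'"
 using Suc.prems unfolding holder_bdd.simps P_def by simp
 from choice[OF this] obtain A' where "\<forall>p. P p (A' p)" ..
 then have A': "!!p i x. i \<in> I ==> ((%x. A i x $ fst p $ snd p) has_derivative (%h. \<Sum>j\<in>UNIV. A' p j i x * h $ j)) (at x)"
 "!!p j. holder_bdd k s I (A' p j)" unfolding P_def by blast+
 obtain Ba where Ba: "Ba > 0" "!!q i x. i \<in> I ==> \<bar>A' (fst q) (snd q) i x\<bar> \<le> Ba"
 by (rule holder_bdd_components_bounded[where F = "%q. A' (fst q) (snd q)", OF A'(2)], rule that)
 obtain Ca where Ca: "Ca > 0" "!!q i x y. i \<in> I ==> \<bar>A' (fst q) (snd q) i x - A' (fst q) (snd q) i y\<bar> \<le> Ca * norm (x - y) powr s"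
 by (rule holder_bdd_components_holder0[where F = "%q. A' (fst q) (snd q)", OF A'(2) s], rule that)
 obtain Cn where Cn: "Cn > 0" "!!p i x y. i \<in> I ==> \<bar>N i x $ fst p $ snd p - N i y $ fst p $ snd p\<bar> \<le> Cn * norm (x - y) powr s"
 by (rule holder_bdd_components_holder0[where F = "%p i x. N i x $ fst p $ snd p", OF N s], rule that)
 define N' where "N' j i x = - (\<Sum>p\<in>UNIV. \<Sum>q\<in>UNIV. N i x $ a $ p * A' (p, q) j i x * N i x $ q $ b)" for j i x
 have hN': "holder_bdd k s I (N' j)" for j
 proof -
 have "holder_bdd k s I (%i x. (-1) * (\<Sum>p\<in>UNIV. \<Sum>q\<in>UNIV. N i x $ a $ p * A' (p, q) j i x * N i x $ q $ b))"
 by (intro holder_bdd_cmult[OF _ s] holder_bdd_sum holder_bdd_mult[OF s] N A'(2))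
 then show ?thesis by (subst holder_bdd_cong[where G = "%i x. (-1) * (\<Sum>p\<in>UNIV. \<Sum>q\<in>UNIV. N i x $ a $ p * A' (p, q) j i x * N i x $ q $ b)"]) (auto simp: N'_def)
 qed
 have "((%x. N i x $ a $ b) has_derivative (%h. \<Sum>j\<in>UNIV. N' j i x * h $ j)) (at x)" if i: "i \<in> I" for i x
 proof (rule has_derivative_of_remainder[OF _ s(1)])
 fix h :: "real^'n"
 let ?n = "real CARD('n)"
 define dA where "dA p q = A i (x + h) $ p $ q - A i x $ p $ q" for p q
 define LA where "LA p q = (\<Sum>j\<in>UNIV. A' (p, q) j i x * h $ j)" for p q
 have L: "L \<ge> 0" using bd[OF i, of x a b] by linarith
 have t1: "\<bar>dA p q - LA p q\<bar> \<le> ?n * Ca * norm h powr (1 + s)" for p q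
 unfolding dA_def LA_def
 using taylor_first_order[where f = "%x. A i x $ p $ q" and f' = "%j x. A' (p, q) j i x", OF A'(1)[OF i, of "(p, q)", simplified] Ca(2)[OF i, of "((p, q), _)", simplified] s(1)] Ca(1) by simp
 have t2: "\<bar>dA p q\<bar> \<le> ?n * Ba * norm h" for p q
 unfolding dA_def
 using grad_bound_imp_lipschitz[where f = "%x. A i x $ p $ q" and f' = "%j x. A' (p, q) j i x", OF A'(1)[OF i, of "(p, q)", simplified] Ba(2)[OF i, of "((p, q), _)", simplified], of "x + h" x] by simp
 have t3: "\<bar>N i (x + h) $ p $ q - N i x $ p $ q\<bar> \<le> Cn * norm h powr s" for p q
 using Cn(2)[where p = "(p, q)" and x = "x + h" and y = x, OF i] by simp
 have "(\<Sum>j\<in>UNIV. N' j i x * h $ j) = - (\<Sum>p\<in>UNIV. \<Sum>q\<in>UNIV. N i x $ a $ p * LA p q * N i x $ q $ b)"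
 proof -
 have "(\<Sum>j\<in>UNIV. N' j i x * h $ j) = - (\<Sum>j\<in>UNIV. \<Sum>p\<in>UNIV. \<Sum>q\<in>UNIV. N i x $ a $ p * (A' (p, q) j i x * h $ j) * N i x $ q $ b)"
 by (simp add: N'_def sum_distrib_left sum_negf mult_ac)
 also have "(\<Sum>j\<in>UNIV. \<Sum>p\<in>UNIV. \<Sum>q\<in>UNIV. N i x $ a $ p * (A' (p, q) j i x * h $ j) * N i x $ q $ b)
 = (\<Sum>p\<in>UNIV. \<Sum>j\<in>UNIV. \<Sum>q\<in>UNIV. N i x $ a $ p * (A' (p, q) j i x * h $ j) * N i x $ q $ b)"
 by (rule sum.swap)
 also have "... = (\<Sum>p\<in>UNIV. \<Sum>q\<in>UNIV. \<Sum>j\<in>UNIV. N i x $ a $ p * (A' (p, q) j i x * h $ j) * N i x $ q $ b)"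
 by (intro sum.cong refl sum.swap)
 finally show ?thesis by (simp add: LA_def sum_distrib_left sum_distrib_right)
 qed
 moreover have "N i (x + h) $ a $ b - N i x $ a $ b = - (\<Sum>p\<in>UNIV. \<Sum>q\<in>UNIV. N i (x + h) $ a $ p * dA p q * N i x $ q $ b)"
 using inverse_difference[OF inv(2)[OF i, of "x + h"] inv(1)[OF i, of x], of a b] by (simp add: dA_def)
 ultimately have "N i (x + h) $ a $ b - N i x $ a $ b - (\<Sum>j\<in>UNIV. N' j i x * h $ j)
 = (\<Sum>p\<in>UNIV. \<Sum>q\<in>UNIV. N i x $ a $ p * LA p q * N i x $ q $ b - N i (x + h) $ a $ p * dA p q * N i x $ q $ b)"
 by (simp add: sum_subtractf)
 also have "\<bar>...\<bar> \<le> CARD('m) * (CARD('m) * ((L * (?n * Ca) * L + Cn * (?n * Ba) * L) * norm h powr (1 + s)))"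
 proof (rule double_sum_bound)
 fix p q
 \<comment> \<open>After the Taylor remainder of \<open>A\<close> is split off, a product of two
   increments remains: one of \<open>N\<close>, of order \<open>s\<close>, and one of
   \<open>A\<close>, of order 1.\<close>
 have "N i x $ a $ p * LA p q * N i x $ q $ b - N i (x + h) $ a $ p * dA p q * N i x $ q $ b
 = N i x $ a $ p * (LA p q - dA p q) * N i x $ q $ b + (N i x $ a $ p - N i (x + h) $ a $ p) * dA p q * N i x $ q $ b"
 by (simp add: algebra_simps)
 also have "\<bar>...\<bar> \<le> L * (?n * Ca * norm h powr (1 + s)) * L + (Cn * norm h powr s) * (?n * Ba * norm h) * L"
 by (rule order_trans[OF abs_triangle_ineq], unfold abs_mult, intro add_mono mult_mono)
 (use t1[of p q] t2[of p q] t3[of a p] bd[OF i] L Ca(1) Cn(1) Ba(1) in \<open>auto simp: abs_minus_commute\<close>)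
 also have "... = (L * (?n * Ca) * L + Cn * (?n * Ba) * L) * norm h powr (1 + s)"
 by (cases "h = 0") (simp_all add: powr_add algebra_simps)
 finally show "\<bar>N i x $ a $ p * LA p q * N i x $ q $ b - N i (x + h) $ a $ p * dA p q * N i x $ q $ b\<bar> \<le> ..." .
 qed
 finally show "\<bar>N i (x + h) $ a $ b - N i x $ a $ b - (\<Sum>j\<in>UNIV. N' j i x * h $ j)\<bar>
 \<le> (CARD('m) * (CARD('m) * (L * (?n * Ca) * L + Cn * (?n * Ba) * L))) * norm h powr (1 + s)"
 by (simp add: mult_ac)
 qed
 then show ?case using bd hN' unfolding holder_bdd.simps by (intro conjI exI[of _ L] exI[of _ N']) auto
qed

section \<open>Change of variables\<close>

text \<open>The library states the change of variables formula only for index types with a well-order;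
 a copy of the index type by an initial segment of the naturals provides one.\<close>

typedef ('a::finite) ordered_index = "{..<CARD('a)} :: nat set"
 by (rule exI[of _ 0]) simp

instantiation ordered_index :: (finite) wellorder
begin

definition "x \<le> y \<longleftrightarrow> Rep_ordered_index x \<le> Rep_ordered_index y"
definition "x < y \<longleftrightarrow> Rep_ordered_index x < Rep_ordered_index y"

instance
proof
 fix P :: "'a ordered_index => bool" and a
 assume *: "!!x. (!!y. y < x ==> P y) ==> P x"
 show "P a"
 by (induction "Rep_ordered_index a" arbitrary: a rule: less_induct)
 (auto intro: * simp: less_ordered_index_def)
qed (auto simp: less_eq_ordered_index_def less_ordered_index_def Rep_ordered_index_inject)

end

lemma UNIV_ordered_index: "(UNIV :: 'a::finite ordered_index set) = Abs_ordered_index ` {..<CARD('a)}"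
 by (metis Abs_ordered_index_inverse Rep_ordered_index Rep_ordered_index_inverse UNIV_eq_I image_eqI)

instance ordered_index :: (finite) finite
 by standard (simp add: UNIV_ordered_index)

lemma card_ordered_index: "CARD('a::finite ordered_index) = CARD('a)"
 using type_definition.card[OF type_definition_ordered_index] by simp

definition oidx :: "'a::finite ordered_index => 'a" where
 "oidx = (SOME f. bij f)"

lemma bij_oidx: "bij (oidx :: 'a::finite ordered_index => 'a)"
proof -
 have "\<exists>f :: 'a ordered_index => 'a. bij_betw f UNIV UNIV"
 by (intro finite_same_card_bij) (auto simp: card_ordered_index)
 then show ?thesis unfolding oidx_def by (rule someI_ex)
qed

lemma oidx_simps [simp]: "oidx (inv oidx i) = i" "inv oidx (oidx j) = j" "oidx j = oidx j' \<longleftrightarrow> j = j'"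
 using surj_f_inv_f[OF bij_is_surj[OF bij_oidx]] inv_f_f[OF bij_is_inj[OF bij_oidx]] inj_eq[OF bij_is_inj[OF bij_oidx]] by auto

definition to_oidx :: "real^'n::finite => real^'n ordered_index" where
 "to_oidx x = (\<chi> i. x $ oidx i)"
definition of_oidx :: "real^'n::finite ordered_index => real^'n" where
 "of_oidx x = (\<chi> i. x $ inv oidx i)"

lemma of_to_oidx [simp]: "of_oidx (to_oidx x) = x" "to_oidx (of_oidx y) = y"
 by (auto simp: of_oidx_def to_oidx_def vec_eq_iff)

lemma linear_oidx: "linear to_oidx" "linear of_oidx"
 by (auto intro!: linearI simp: to_oidx_def of_oidx_def vec_eq_iff)

lemma measurable_oidx [measurable]: "to_oidx \<in> bmeas" "of_oidx \<in> bmeas"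
 using linear_oidx by (auto intro!: borel_measurable_continuous_onI linear_continuous_on simp: linear_conv_bounded_linear)

lemma content_prod_cart:
 fixes l u :: "real^'n::finite"
 assumes "!!i. l $ i \<le> u $ i"
 shows "(\<Prod>b\<in>Basis. (u - l) \<bullet> b) = (\<Prod>i\<in>UNIV. u $ i - l $ i)"
proof -
 have B: "(Basis :: (real^'n) set) = (%i::'n. axis i (1::real)) ` UNIV" by (auto simp: Basis_vec_def)
 have inj: "inj (%i::'n. axis i (1::real))" by (auto simp: inj_on_def axis_eq_axis)
 show ?thesis unfolding B prod.reindex[OF inj] by (simp add: inner_axis)
qed

lemma lborel_to_oidx: "distr lborel borel (to_oidx :: real^'n::finite => _) = lborel"
proof (rule lborel_eqI[symmetric])
 fix l u :: "real^'n ordered_index"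
 assume le: "!!b. b \<in> Basis ==> l \<bullet> b \<le> u \<bullet> b"
 have le': "l $ i \<le> u $ i" for i using le[of "axis i 1"] by (simp add: inner_axis)
 have le2: "of_oidx l $ i \<le> of_oidx u $ i" for i by (simp add: of_oidx_def le')
 have box: "to_oidx -` box l u = box (of_oidx l) (of_oidx u)"
 proof -
 have "(\<forall>i. l $ i < x $ oidx i \<and> x $ oidx i < u $ i) \<longleftrightarrow> (\<forall>i. of_oidx l $ i < x $ i \<and> x $ i < of_oidx u $ i)" for x :: "real^'n"
 proof
 assume a: "\<forall>i. l $ i < x $ oidx i \<and> x $ oidx i < u $ i"
 then show "\<forall>i. of_oidx l $ i < x $ i \<and> x $ i < of_oidx u $ i"
 by (metis oidx_simps(1) of_oidx_def vec_lambda_beta)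
 next
 assume a: "\<forall>i. of_oidx l $ i < x $ i \<and> x $ i < of_oidx u $ i"
 then show "\<forall>i. l $ i < x $ oidx i \<and> x $ oidx i < u $ i"
 by (metis oidx_simps(2) of_oidx_def vec_lambda_beta)
 qed
 then show ?thesis by (auto simp: mem_box_cart to_oidx_def)
 qed
 have "emeasure (distr lborel borel to_oidx) (box l u) = emeasure lborel (box (of_oidx l) (of_oidx u))"
 by (subst emeasure_distr) (auto simp: box)
 also have "... = ennreal (\<Prod>b\<in>Basis. (of_oidx u - of_oidx l) \<bullet> b)"
 using le2 by (subst emeasure_lborel_box) (auto simp: Basis_vec_def inner_axis)
 also have "(\<Prod>b\<in>Basis. (of_oidx u - of_oidx l) \<bullet> b) = (\<Prod>i\<in>UNIV. of_oidx u $ i - of_oidx l $ i)"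
 by (rule content_prod_cart) (rule le2)
 also have "... = (\<Prod>i\<in>UNIV. u $ i - l $ i)"
 by (rule prod.reindex_bij_witness[of _ oidx "inv oidx"])
 (auto simp: of_oidx_def)
 also have "... = (\<Prod>b\<in>Basis. (u - l) \<bullet> b)" by (rule content_prod_cart[symmetric]) (rule le')
 finally show "emeasure (distr lborel borel to_oidx) (box l u) = ennreal (\<Prod>b\<in>Basis. (u - l) \<bullet> b)" .
qed simp

lemma has_derivative_continuous_on_UNIV:
 "(!!x. (f has_derivative f' x) (at x)) ==> continuous_on UNIV f"
 using has_derivative_continuous by (blast intro: continuous_at_imp_continuous_on)

text \<open>The Jacobian determinant is taken after renaming the indices, which spares relating the
 two determinants.\<close>

definition odet :: "real^'n::finite^'n => real" where
 "odet M = det (\<chi> i j. M $ oidx i $ oidx j)"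

lemma odet_nonzero:
 fixes A M :: "real^'n::finite^'n"
 assumes "A ** M = mat 1"
 shows "odet M \<noteq> 0"
proof -
 have "(\<chi> i j. A $ oidx i $ oidx j) ** (\<chi> i j. M $ oidx i $ oidx j) = (mat 1 :: real^'n ordered_index^'n ordered_index)"
 proof -
 have "(\<Sum>k\<in>UNIV. A $ oidx i $ oidx k * M $ oidx k $ oidx j) = (\<Sum>k\<in>UNIV. A $ oidx i $ k * M $ k $ oidx j)" for i j :: "'n ordered_index"
 by (rule sum.reindex_bij_betw[OF bij_oidx])
 moreover have "(\<Sum>k\<in>UNIV. A $ oidx i $ k * M $ k $ oidx j) = mat 1 $ oidx i $ oidx j" for i j :: "'n ordered_index"
 using assms by (metis mat_mult_entry)
 ultimately show ?thesis
 by (auto simp: vec_eq_iff mat_mult_entry mat_def)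
 qed
 then have "det (\<chi> i j. A $ oidx i $ oidx j) * odet M = 1"
 unfolding odet_def by (metis det_I det_mul)
 then show ?thesis by auto
qed

text \<open>The formula is applied to the conjugate \<open>H\<close> of \<open>G\<close> under the
  renaming of coordinates, and the result is pulled back along \<open>to_oidx\<close>, which
  preserves Lebesgue measure.\<close>

lemma change_of_variables_lborel:
 fixes G :: "real^'n::finite => real^'n" and N :: "real^'n => real^'n^'n" and f :: "real^'n => real"
 assumes G: "bij G" and d: "!!y. (G has_derivative (%h. N y *v h)) (at y)"
 and N: "!!i j. continuous_on UNIV (%y. N y $ i $ j)"
 and f: "integrable lborel f"
 shows "integrable lborel (%y. f (G y) * \<bar>odet (N y)\<bar>)" "(LBINT y. f (G y) * \<bar>odet (N y)\<bar>) = (LBINT z. f z)"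
proof -
 define H where "H = to_oidx \<circ> G \<circ> of_oidx"
 define M where "M w = (\<chi> i j. N (of_oidx w) $ oidx i $ oidx j)" for w :: "real^'n ordered_index"
 have [measurable]: "f \<in> bmeas" using f by auto
 have contG: "continuous_on UNIV G" by (rule has_derivative_continuous_on_UNIV[OF d])
 then have [measurable]: "G \<in> bmeas" by (rule borel_measurable_continuous_onI)
 have contO: "continuous_on UNIV (%y. odet (N y))"
 unfolding odet_def det_def by (auto intro!: continuous_intros N)
 then have [measurable]: "(%y. odet (N y)) \<in> bmeas" by (rule borel_measurable_continuous_onI)
 have dH: "(H has_derivative (%h. M w *v h)) (at w)" for w
 proof -
 have 1: "(of_oidx has_derivative of_oidx) (at w)"
 using linear_oidx by (intro bounded_linear_imp_has_derivative) (auto simp: linear_conv_bounded_linear)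
 have 2: "(to_oidx has_derivative to_oidx) (at (G (of_oidx w)))"
 using linear_oidx by (intro bounded_linear_imp_has_derivative) (auto simp: linear_conv_bounded_linear)
 have "(H has_derivative (%h. to_oidx (N (of_oidx w) *v of_oidx h))) (at w)"
 unfolding H_def comp_def by (rule has_derivative_compose[OF has_derivative_compose[OF 1 d] 2])
 moreover have "to_oidx (N (of_oidx w) *v of_oidx h) = M w *v h" for h
 proof -
 have "(\<Sum>j\<in>UNIV. N (of_oidx w) $ a $ j * h $ inv oidx j) = (\<Sum>j\<in>UNIV. N (of_oidx w) $ a $ oidx j * h $ j)" for a
 by (rule sum.reindex_bij_witness[of _ oidx "inv oidx"])
 auto
 then show ?thesis by (simp add: vec_eq_iff to_oidx_def of_oidx_def M_def matrix_vector_mult_def)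
 qed
 ultimately show ?thesis by simp
 qed
 have bijH: "bij H" unfolding H_def
 by (intro bij_comp G o_bij[of of_oidx to_oidx] o_bij[of to_oidx of_oidx]) (auto simp: fun_eq_iff)
 define F where "F w = f (of_oidx w)" for w
 have intF: "integrable lborel F" "(LBINT w. F w) = (LBINT z. f z)"
 proof -
 have "integrable (distr lborel borel to_oidx) F" unfolding F_def by (subst integrable_distr_eq) (auto simp: f)
 then show "integrable lborel F" by (simp add: lborel_to_oidx)
 have "(LBINT w. F w) = (\<integral>w. F w \<partial>distr lborel borel to_oidx)" by (simp add: lborel_to_oidx)
 also have "... = (LBINT z. f z)" unfolding F_def by (subst integral_distr) auto
 finally show "(LBINT w. F w) = (LBINT z. f z)" .
 qed
 have [measurable]: "F \<in> bmeas" using intF by auto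
 have absF: "F absolutely_integrable_on UNIV"
 unfolding set_integrable_def using intF(1) by (simp add: integrable_completion)
 have valF: "integral UNIV F = (LBINT z. f z)"
 using set_lebesgue_integral_eq_integral(2)[OF absF] intF by (simp add: set_lebesgue_integral_def integral_completion)
 let ?K = "%w. \<bar>det (matrix ((*v) (M w)))\<bar> * F (H w)"
 have K: "?K = (%w. f (G (of_oidx w)) * \<bar>odet (N (of_oidx w))\<bar>)"
 by (simp add: F_def H_def M_def odet_def fun_eq_iff)
 \<comment> \<open>Values are passed to \<open>real^1\<close> to match a formula for vector-valued
   integrands.\<close>
 have vF: "(%w. vec (F w) :: real^1) absolutely_integrable_on UNIV" "integral UNIV (%w. vec (F w) :: real^1) = vec (LBINT z. f z)"
 using absF valF by (auto simp: absolutely_integrable_on_1_iff integral_on_1_eq)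
 have "(%w. \<bar>det (matrix ((*v) (M w)))\<bar> *\<^sub>R (vec (F (H w)) :: real^1)) absolutely_integrable_on UNIV \<and>
 integral UNIV (%w. \<bar>det (matrix ((*v) (M w)))\<bar> *\<^sub>R (vec (F (H w)) :: real^1)) = vec (LBINT z. f z)"
 by (subst has_absolute_integral_change_of_variables[of UNIV H "%w. (*v) (M w)" "%w. vec (F w)"])
 (use dH bijH vF in \<open>auto simp: bij_is_inj bij_is_surj\<close>)
 then have absK: "?K absolutely_integrable_on UNIV" and valK: "integral UNIV ?K = (LBINT z. f z)"
 by (auto simp: absolutely_integrable_on_1_iff integral_on_1_eq vec_eq_iff)
 have mK: "?K \<in> borel_measurable lborel" unfolding K by measurable
 have intK: "integrable lborel ?K"
 using absK mK unfolding set_integrable_def by (simp add: integrable_completion)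
 have valK': "(LBINT w. ?K w) = (LBINT z. f z)"
 using set_lebesgue_integral_eq_integral(2)[OF absK] valK mK by (simp add: set_lebesgue_integral_def integral_completion)
 have "integrable (distr lborel borel to_oidx) ?K" using intK by (simp add: lborel_to_oidx)
 then show "integrable lborel (%y. f (G y) * \<bar>odet (N y)\<bar>)"
 unfolding K by (subst (asm) integrable_distr_eq) auto
 have "(\<integral>w. ?K w \<partial>distr lborel borel to_oidx) = (LBINT y. f (G y) * \<bar>odet (N y)\<bar>)"
 unfolding K by (subst integral_distr) auto
 then show "(LBINT y. f (G y) * \<bar>odet (N y)\<bar>) = (LBINT z. f z)"
 using valK' by (simp add: lborel_to_oidx)
qed

section \<open>The Gaussian measure\<close>

text \<open>Exponentials of this norm factorise over the coordinates, so tail integrals reduce to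
  one-dimensional ones; the Euclidean norm has no such property.\<close>

definition l1norm :: "real^'n::finite => real" where "l1norm x = (\<Sum>i\<in>UNIV. \<bar>x $ i\<bar>)"

lemma l1norm_bounds: "norm x \<le> l1norm x" "0 \<le> l1norm x" "l1norm (x :: real^'n::finite) \<le> CARD('n) * norm x"
proof -
 show "norm x \<le> l1norm x" "0 \<le> l1norm x" unfolding l1norm_def by (auto intro: norm_le_l1_cart sum_nonneg)
 have "l1norm x \<le> (\<Sum>i\<in>(UNIV::'n set). norm x)" unfolding l1norm_def by (intro sum_mono abs_comp_le_norm)
 then show "l1norm x \<le> CARD('n) * norm x" by simp
qed

lemma l1norm_triangle: "l1norm (x + y) \<le> l1norm x + l1norm y"
 unfolding l1norm_def by (simp flip: sum.distrib) (intro sum_mono abs_triangle_ineq)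

lemma l1norm_scale: "l1norm (c *\<^sub>R x) = \<bar>c\<bar> * l1norm x"
 unfolding l1norm_def by (simp add: abs_mult sum_distrib_left)

lemma l1norm_measurable [measurable]: "l1norm \<in> bmeas"
 unfolding l1norm_def[abs_def] by measurable

lemma nn_integral_lborel_cart:
 fixes f :: "'n::finite => real => ennreal"
 assumes [measurable]: "!!i. f i \<in> bmeas"
 shows "(\<integral>\<^sup>+x. (\<Prod>i\<in>UNIV. f i (x $ i)) \<partial>lborel) = (\<Prod>i\<in>UNIV. \<integral>\<^sup>+t. f i t \<partial>lborel)"
proof -
 define idx where "idx b = (SOME i::'n. b = axis i (1::real))" for b
 have idx: "idx (axis i 1) = i" for i unfolding idx_def by (auto simp: axis_eq_axis)
 have B: "(Basis :: (real^'n) set) = (%i::'n. axis i (1::real)) ` UNIV" by (auto simp: Basis_vec_def)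
 have inj: "inj (%i::'n. axis i (1::real))" by (auto simp: inj_on_def axis_eq_axis)
 have "(\<integral>\<^sup>+x. (\<Prod>b\<in>(Basis :: (real^'n) set). f (idx b) (x \<bullet> b)) \<partial>lborel) = (\<Prod>b\<in>(Basis :: (real^'n) set). \<integral>\<^sup>+t. f (idx b) t \<partial>lborel)"
 by (rule nn_integral_lborel_prod) auto
 then show ?thesis unfolding B prod.reindex[OF inj] by (simp add: idx inner_axis)
qed

lemma gauss_density_measurable [measurable]: "gauss_density \<in> bmeas"
 unfolding gauss_density_def[abs_def] by measurable

lemma gauss_density_pos: "gauss_density x > 0"
 unfolding gauss_density_def by (intro prod_pos ballI normal_density_pos) auto

lemma gauss_density_nonneg: "gauss_density x \<ge> 0"
 using gauss_density_pos less_imp_le by blast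

lemma gauss_density_nn_integral: "(\<integral>\<^sup>+x. ennreal (gauss_density (x :: real^'n::finite)) \<partial>lborel) = 1"
proof -
 have "(\<integral>\<^sup>+x. ennreal (gauss_density (x :: real^'n)) \<partial>lborel) = (\<integral>\<^sup>+x. (\<Prod>i\<in>UNIV. ennreal (std_normal_density ((x :: real^'n) $ i))) \<partial>lborel)"
 unfolding gauss_density_def by (simp add: prod_ennreal)
 also have "... = (\<Prod>i\<in>(UNIV :: 'n set). \<integral>\<^sup>+t. ennreal (std_normal_density t) \<partial>lborel)"
 by (rule nn_integral_lborel_cart) auto
 also have "(\<integral>\<^sup>+t. ennreal (std_normal_density t) \<partial>lborel) = 1"
 by (subst nn_integral_eq_integral) auto
 finally show ?thesis by simp
qed

lemma sets_gauss_measure [simp, measurable_cong]: "sets gauss_measure = sets borel"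
 by (simp add: gauss_measure_def)

lemma space_gauss_measure [simp]: "space gauss_measure = UNIV"
 by (simp add: gauss_measure_def)

lemma prob_space_gauss: "prob_space (gauss_measure :: (real^'n::finite) measure)"
 by (rule prob_spaceI) (simp add: gauss_measure_def emeasure_density gauss_density_nn_integral)

text \<open>In one coordinate the exponential of \<open>b\<close> times the absolute value is
  dominated by two plain exponentials, and by completing the square each of these merely shifts the
  mean of the Gaussian.\<close>

lemma gauss_l1_moment: "integrable (gauss_measure :: (real^'n::finite) measure) (%z. exp (b * l1norm z))"
proof -
 have 1: "(\<integral>\<^sup>+t. ennreal (exp (b * \<bar>t\<bar>) * std_normal_density t) \<partial>lborel) < \<infinity>"
 proof -
 have le: "exp (b * \<bar>t\<bar>) * std_normal_density t \<le> exp (b\<^sup>2 / 2) * (normal_density b 1 t + normal_density (- b) 1 t)" for t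
 proof -
 have e: "exp (c * t) * std_normal_density t = exp (c\<^sup>2 / 2) * normal_density c 1 t" for c
 by (simp add: normal_density_def field_simps power2_eq_square flip: exp_add)
 have "exp (b * \<bar>t\<bar>) \<le> exp (b * t) + exp ((- b) * t)" by (cases "t \<ge> 0") auto
 then have "exp (b * \<bar>t\<bar>) * std_normal_density t \<le> (exp (b * t) + exp ((- b) * t)) * std_normal_density t"
 by (rule mult_right_mono) simp
 also have "... = exp (b\<^sup>2 / 2) * normal_density b 1 t + exp ((- b)\<^sup>2 / 2) * normal_density (- b) 1 t"
 unfolding distrib_right e ..
 finally show ?thesis by (simp add: distrib_left)
 qed
 have "(\<integral>\<^sup>+t. ennreal (exp (b * \<bar>t\<bar>) * std_normal_density t) \<partial>lborel) \<le> (\<integral>\<^sup>+t. ennreal (exp (b\<^sup>2 / 2) * (normal_density b 1 t + normal_density (- b) 1 t)) \<partial>lborel)"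
 by (intro nn_integral_mono ennreal_leI le)
 also have "... < \<infinity>"
 by (subst nn_integral_eq_integral) (auto intro!: integrable_mult_right Bochner_Integration.integrable_add)
 finally show ?thesis .
 qed
 have eq: "ennreal (gauss_density z) * ennreal (exp (b * l1norm z)) = (\<Prod>i\<in>UNIV. ennreal (exp (b * \<bar>z $ i\<bar>) * std_normal_density (z $ i)))" for z :: "real^'n"
 proof -
 have "gauss_density z * exp (b * l1norm z) = (\<Prod>i\<in>UNIV. exp (b * \<bar>z $ i\<bar>) * std_normal_density (z $ i))"
 by (simp add: gauss_density_def l1norm_def sum_distrib_left exp_sum prod.distrib mult.commute)
 then show ?thesis by (simp add: prod_ennreal gauss_density_nonneg flip: ennreal_mult)
 qed
 have "(\<integral>\<^sup>+z. ennreal (exp (b * l1norm z)) \<partial>(gauss_measure :: (real^'n) measure)) = (\<integral>\<^sup>+z. (\<Prod>i\<in>UNIV. ennreal (exp (b * \<bar>(z::real^'n) $ i\<bar>) * std_normal_density (z $ i))) \<partial>lborel)"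
 unfolding gauss_measure_def by (subst nn_integral_density) (auto simp: eq)
 also have "... = (\<Prod>i\<in>(UNIV :: 'n set). \<integral>\<^sup>+t. ennreal (exp (b * \<bar>t\<bar>) * std_normal_density t) \<partial>lborel)"
 by (rule nn_integral_lborel_cart) auto
 also have "... < \<infinity>"
 proof -
 obtain c where "(\<integral>\<^sup>+t. ennreal (exp (b * \<bar>t\<bar>) * std_normal_density t) \<partial>lborel) = ennreal c" "c \<ge> 0"
 using 1 by (cases "\<integral>\<^sup>+t. ennreal (exp (b * \<bar>t\<bar>) * std_normal_density t) \<partial>lborel" rule: ennreal_cases) auto
 then show ?thesis by (simp add: ennreal_power)
 qed
 finally show ?thesis by (intro integrableI_nonneg) auto
qed

lemma holder_bdd_0_of_gradient:
 fixes F :: "'i => real^'n::finite => real" and s B B' :: real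
 assumes s: "0 < s" "s \<le> 1" and B: "!!i x. i \<in> I ==> \<bar>F i x\<bar> \<le> B"
 and d: "!!i x. i \<in> I ==> (F i has_derivative (%h. \<Sum>j\<in>UNIV. F' j i x * h $ j)) (at x)"
 and B': "!!i j x. i \<in> I ==> \<bar>F' j i x\<bar> \<le> B'"
 shows "holder_bdd 0 s I F"
proof -
 have "\<bar>F i x - F i y\<bar> \<le> (2 * \<bar>B\<bar> + CARD('n) * \<bar>B'\<bar>) * norm (x - y) powr s" if i: "i \<in> I" for i x y
 proof (rule le_min_powr)
 show "\<bar>F i x - F i y\<bar> \<le> 2 * \<bar>B\<bar>" using B[OF i, of x] B[OF i, of y] by linarith
 show "\<bar>F i x - F i y\<bar> \<le> real CARD('n) * \<bar>B'\<bar> * norm (x - y)"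
 by (rule grad_bound_imp_lipschitz[OF d[OF i]]) (rule order_trans[OF B'[OF i] abs_ge_self])
 qed (use s in auto)
 then show ?thesis using B unfolding holder_bdd.simps by blast
qed

text \<open>A single term of the exponential series bounds the power by \<open>fact m\<close> times
  an exponential, and \<open>t - t^2 / 2 \<le> 1 / 2\<close> for all \<open>t\<close>.\<close>

lemma power_gauss_bounded: "\<exists>B. \<forall>t. \<bar>t ^ m * std_normal_density t\<bar> \<le> B"
proof -
 have "\<bar>t ^ m * std_normal_density t\<bar> \<le> fact m * exp (1 / 2)" for t :: real
 proof -
 have "(\<Sum>k\<in>{m}. \<bar>t\<bar> ^ k /\<^sub>R fact k) \<le> (\<Sum>k. \<bar>t\<bar> ^ k /\<^sub>R fact k)"
 by (rule sum_le_suminf[OF summable_exp_generic]) auto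
 then have "\<bar>t\<bar> ^ m /\<^sub>R fact m \<le> exp \<bar>t\<bar>" by (simp add: exp_def)
 then have 1: "\<bar>t\<bar> ^ m \<le> fact m * exp \<bar>t\<bar>" by (simp add: divide_simps mult.commute)
 have "std_normal_density t \<le> exp (- t\<^sup>2 / 2)"
 proof -
 have "1 \<le> sqrt (2 * pi)" using pi_gt3 by (simp add: real_le_rsqrt)
 then have "1 / sqrt (2 * pi) * exp (- t\<^sup>2 / 2) \<le> 1 * exp (- t\<^sup>2 / 2)" by (intro mult_right_mono) (auto simp: divide_le_eq)
 then show ?thesis by (simp add: std_normal_density_def)
 qed
 then have "\<bar>t ^ m * std_normal_density t\<bar> \<le> (fact m * exp \<bar>t\<bar>) * exp (- t\<^sup>2 / 2)"
 unfolding abs_mult power_abs using 1 by (intro mult_mono) auto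
 also have "... = fact m * exp (\<bar>t\<bar> - t\<^sup>2 / 2)" by (simp flip: exp_add)
 also have "... \<le> fact m * exp (1 / 2)"
 proof -
 have "0 \<le> (\<bar>t\<bar> - 1)\<^sup>2" by simp
 then have "\<bar>t\<bar> - t\<^sup>2 / 2 \<le> 1 / 2" by (simp add: power2_diff)
 then show ?thesis by simp
 qed
 finally show ?thesis .
 qed
 then show ?thesis by blast
qed

text \<open>Monomials times the Gaussian are closed under differentiation up to linear combinations,
  so allowing all powers \<open>m\<close> makes the induction on \<open>k\<close> possible. For
  \<open>m = 0\<close> the truncated power \<open>m - 1\<close> is harmless because its coefficient
  is 0.\<close>

lemma power_gauss_holder_bdd:
 fixes i :: "'n::finite" and s :: real
 assumes s: "0 < s" "s \<le> 1"
 shows "holder_bdd k s (UNIV :: unit set) (%_ (x :: real^'n). (x $ i) ^ m * std_normal_density (x $ i))"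
proof -
 let ?u = "%m t. t ^ m * std_normal_density t :: real"
 define v where "v m t = real m * ?u (m - 1) t - ?u (m + 1) t" for m t
 have d1: "(?u m has_real_derivative v m t) (at t)" for m t
 proof -
 have "(std_normal_density has_real_derivative - t * std_normal_density t) (at t)"
 proof -
 define c where "c = 1 / sqrt (2 * pi)"
 have "((%t. c * exp (- t\<^sup>2 / 2)) has_real_derivative - t * (c * exp (- t\<^sup>2 / 2))) (at t)"
 by (auto intro!: derivative_eq_intros)
 then show ?thesis by (simp add: std_normal_density_def[abs_def] c_def)
 qed
 from DERIV_mult[OF DERIV_pow[of m t UNIV] this] show ?thesis
 by (simp add: v_def algebra_simps)
 qed
 define F' where "F' m j x = (if j = i then v m (x $ i) else 0)" for m j and x :: "real^'n"
 have d: "((%x. ?u m (x $ i)) has_derivative (%h. \<Sum>j\<in>UNIV. F' m j x * h $ j)) (at x)" for m and x :: "real^'n"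
 proof -
 have "((%x. ?u m (x $ i)) has_derivative (%h. v m (x $ i) * h $ i)) (at x)"
 using has_derivative_compose[OF bounded_linear_imp_has_derivative[OF bounded_linear_vec_nth] d1[of m "x $ i", unfolded has_field_derivative_def]] .
 moreover have "(\<Sum>j\<in>UNIV. F' m j x * h $ j) = v m (x $ i) * h $ i" for h
 by (simp add: F'_def if_distrib[of "%a. a * _"] cong: if_cong)
 ultimately show ?thesis by simp
 qed
 show ?thesis
 proof (induction k arbitrary: m)
 case 0
 obtain B0 B1 B2 where B: "!!t. \<bar>?u m t\<bar> \<le> B0" "!!t. \<bar>?u (m - 1) t\<bar> \<le> B1" "!!t. \<bar>?u (m + 1) t\<bar> \<le> B2"
 using power_gauss_bounded by metis
 have "\<bar>v m t\<bar> \<le> real m * B1 + B2" for t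
 unfolding v_def using B(3)[of t] mult_left_mono[OF B(2)[of t], of "real m"]
 by (intro order_trans[OF abs_triangle_ineq4]) (simp add: abs_mult)
 moreover from this[of 0] have "0 \<le> real m * B1 + B2" by linarith
 ultimately show ?case
 by (intro holder_bdd_0_of_gradient[OF s, where F' = "%j _. F' m j" and B = B0 and B' = "real m * B1 + B2"] d B(1))
 (auto simp: F'_def)
 next
 case (Suc k)
 obtain B0 where B: "!!t. \<bar>?u m t\<bar> \<le> B0" using power_gauss_bounded by metis
 have hv: "holder_bdd k s (UNIV :: unit set) (%_ x. v m ((x :: real^'n) $ i))"
 proof -
 have "holder_bdd k s (UNIV :: unit set) (%_ (x :: real^'n). real m * ?u (m - 1) (x $ i) + (- 1) * ?u (m + 1) (x $ i))"
 by (intro holder_bdd_add holder_bdd_cmult[OF _ s] Suc.IH)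
 then show ?thesis by (simp add: v_def)
 qed
 have "holder_bdd k s (UNIV :: unit set) (%_. F' m j)" for j
 using hv holder_bdd_const[of UNIV "%_ :: unit. 0" 0 k s, where 'n = 'n] by (cases "j = i") (simp_all add: F'_def[abs_def])
 then show ?case unfolding holder_bdd.simps using d B
 by (intro conjI exI[of _ B0] exI[of _ "%j _. F' m j"]) auto
 qed
qed

lemma gauss_density_holder_bdd:
 assumes s: "0 < s" "s \<le> (1::real)"
 shows "holder_bdd k s I (%_. gauss_density :: real^'n::finite => real)"
proof -
 have "holder_bdd k s (UNIV :: unit set) (%_ (x :: real^'n). \<Prod>i\<in>UNIV. (x $ i) ^ 0 * std_normal_density (x $ i))"
 by (intro holder_bdd_prod[OF s] power_gauss_holder_bdd[OF s])
 then have "holder_bdd k s (UNIV :: unit set) (%_. gauss_density :: real^'n => real)"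
 by (simp add: gauss_density_def[abs_def])
 from holder_bdd_reindex[OF this, of I "%_. ()"] show ?thesis by auto
qed

section \<open>Densities of generated distributions\<close>

lemma integral_gauss:
 fixes f :: "real^'n::finite => real"
 assumes [measurable]: "f \<in> bmeas"
 shows "integrable gauss_measure f \<longleftrightarrow> integrable lborel (%z. f z * gauss_density z)"
 "(\<integral>z. f z \<partial>gauss_measure) = (LBINT z. f z * gauss_density z)"
 unfolding gauss_measure_def
 by (subst integrable_density integral_density; auto simp: gauss_density_nonneg mult.commute)+

lemma lborel_shift:
 fixes f :: "real^'n::finite => real"
 assumes [measurable]: "f \<in> bmeas"
 shows "integrable lborel (%y. f (y + v)) \<longleftrightarrow> integrable lborel f" "(LBINT y. f (y + v)) = (LBINT y. f y)"
proof -
 have "integrable lborel f \<longleftrightarrow> integrable (distr lborel borel ((+) v)) f" by (simp add: lborel_distr_plus)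
 then show "integrable lborel (%y. f (y + v)) \<longleftrightarrow> integrable lborel f"
 by (subst (asm) integrable_distr_eq) (auto simp: add.commute)
 have "(LBINT y. f y) = (\<integral>y. f y \<partial>distr lborel borel ((+) v))" by (simp add: lborel_distr_plus)
 also have "... = (LBINT y. f (y + v))" by (subst integral_distr) (auto simp: add.commute)
 finally show "(LBINT y. f (y + v)) = (LBINT y. f y)" ..
qed

context
 fixes \<beta> L C0 :: real and GC :: "(real^'n::finite => real^'n) set" and k :: nat and s :: real
 assumes \<beta>: "\<beta> > 0" and L: "L > 0"
 defines "GC \<equiv> generator_class \<beta> L C0" and "k \<equiv> hidx \<beta>" and "s \<equiv> hexp \<beta>"
begin

lemma gen_s: "0 < s" "s \<le> 1" "real k + s = \<beta>"
 using hidx_hexp[OF \<beta>] by (auto simp: k_def s_def)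

lemma gen_deriv: "g \<in> GC ==> (g has_derivative (%h. jacobian g (at x) *v h)) (at x)"
 unfolding GC_def generator_class_def jacobian_holder_def using jacobian_works by blast

lemma gen_cont: "g \<in> GC ==> continuous_on UNIV g"
 by (rule has_derivative_continuous_on_UNIV[OF gen_deriv])

lemma gen_meas: "g \<in> GC ==> g \<in> bmeas"
 by (rule borel_measurable_continuous_onI[OF gen_cont])

lemma gen_holder: "holder_bdd k s GC (%g x. jacobian g (at x) $ i $ j)"
 unfolding k_def s_def
 by (rule holder_bdd_reindex[OF holder_class_imp_holder_bdd[OF \<beta>, of C0], where h = "%g x. jacobian g (at x) $ i $ j"])
 (auto simp: GC_def generator_class_def jacobian_holder_def)

text \<open>By homogeneity unit vectors suffice. The infima are real ones, so each step down to a
  member has to supply boundedness below, and the outer one also nonemptiness of the sphere, which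
  comes from \<open>v \<noteq> 0\<close>.\<close>

lemma gen_low:
 assumes g: "g \<in> GC"
 shows "norm v / L \<le> norm (jacobian g (at x) *v v)"
proof (cases "v = 0")
 case False
 let ?f = "%x. INF v\<in>sphere 0 1. norm (jacobian g (at x) *v v)"
 have ne: "sphere (0 :: real^'n) 1 \<noteq> {}" using False by (intro ex_in_conv[THEN iffD1] exI[of _ "v /\<^sub>R norm v"]) simp
 have "inverse L \<le> (INF x. ?f x)" using g by (simp add: GC_def generator_class_def)
 also have "... \<le> ?f x"
 by (rule cINF_lower) (auto intro!: bdd_belowI2[of _ 0] cINF_greatest ne)
 also have "... \<le> norm (jacobian g (at x) *v (v /\<^sub>R norm v))"
 by (rule cINF_lower) (use False in \<open>auto intro!: bdd_belowI2[of _ 0]\<close>)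
 also have "... = norm (jacobian g (at x) *v v) / norm v"
 by (simp add: matrix_vector_mult_scaleR divide_inverse mult.commute)
 finally show ?thesis using False L by (simp add: field_simps)
qed simp

definition gen_N :: "(real^'n => real^'n) => real^'n => real^'n^'n" where
 "gen_N g x = matrix_inv (jacobian g (at x))"

lemma gen_N:
 assumes "g \<in> GC"
 shows "jacobian g (at x) ** gen_N g x = mat 1" "gen_N g x ** jacobian g (at x) = mat 1" "\<bar>gen_N g x $ i $ j\<bar> \<le> L"
 unfolding gen_N_def using matrix_inv_of_expanding[OF gen_low[OF assms] L] by auto

lemma gen_N_holder: "holder_bdd k s GC (%g x. gen_N g x $ i $ j)"
 by (rule holder_bdd_matrix_inverse[OF gen_s(1,2) gen_N gen_holder])

lemma gen_bij:
 assumes g: "g \<in> GC"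
 shows "inv g (g x) = x" "g (inv g y) = y" "continuous_on UNIV (inv g)" "bij (inv g)"
proof -
 obtain C where C: "C > 0" "!!p g x y. g \<in> GC ==> \<bar>jacobian g (at x) $ fst p $ snd p - jacobian g (at y) $ fst p $ snd p\<bar> \<le> C * norm (x - y) powr s"
 by (rule holder_bdd_components_holder0[where F = "%p g x. jacobian g (at x) $ fst p $ snd p", OF gen_holder gen_s(1,2)], rule that)
 have hol: "\<bar>jacobian g (at x) $ i $ j - jacobian g (at y) $ i $ j\<bar> \<le> C * norm (x - y) powr s" for i j x y
 using C(2)[where p = "(i, j)", OF g] by simp
 obtain G where G: "!!x. G (g x) = x" "!!y. g (G y) = y" "continuous_on UNIV G"
 by (rule expanding_map_global_inverse[OF gen_deriv[OF g] hol gen_s(1) less_imp_le[OF C(1)] gen_low[OF g] L]) (rule that)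
 have "inj g" using G(1) by (metis injI)
 have iG: "inv g = G" using G \<open>inj g\<close> by (metis ext inv_f_f)
 show "inv g (g x) = x" "g (inv g y) = y" "continuous_on UNIV (inv g)" unfolding iG by (rule G)+
 show "bij (inv g)" unfolding iG by (rule o_bij[of g]) (auto simp: fun_eq_iff G)
qed

lemma gen_inv_deriv:
 assumes g: "g \<in> GC"
 shows "(inv g has_derivative (%h. gen_N g (inv g y) *v h)) (at y)"
proof (rule has_derivative_inverse_basic[OF gen_deriv[OF g], where T = UNIV])
 show "(*v) (gen_N g (inv g y)) \<circ> (*v) (jacobian g (at (inv g y))) = id"
 by (simp add: fun_eq_iff matrix_vector_mul_assoc gen_N[OF g])
 show "isCont (inv g) y" using gen_bij(3)[OF g] by (simp add: continuous_on_eq_continuous_at)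
qed (auto simp: gen_bij[OF g] matrix_vector_mul_bounded_linear)

lemma gen_inv_comp_deriv:
 assumes g: "g \<in> GC"
 shows "((%y. inv g y $ l) has_derivative (%h. \<Sum>j\<in>UNIV. gen_N g (inv g y) $ l $ j * h $ j)) (at y)"
 using bounded_linear.has_derivative[OF bounded_linear_vec_nth gen_inv_deriv[OF g, of y], of l] by (simp add: matrix_vector_mult_def)

lemma gen_inv_lipschitz:
 assumes g: "g \<in> GC"
 shows "norm (inv g x - inv g y) \<le> CARD('n) * (CARD('n) * L * norm (x - y))"
 by (rule sum_nth_bound) (use grad_bound_imp_lipschitz[OF gen_inv_comp_deriv[OF g] gen_N(3)[OF g]] in auto)

text \<open>Bootstrapping: these functions are the first derivatives of \<open>inv g\<close>. Once
  they have order \<open>l\<close>, the map \<open>inv g\<close> is regular enough for its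
  composition with \<open>gen_N\<close> to have order \<open>l + 1\<close>, up to the order
  \<open>k\<close> of \<open>gen_N\<close> itself.\<close>

lemma gen_N_inv_holder: "holder_bdd k s GC (%g y. gen_N g (inv g y) $ i $ j)"
proof -
 have "holder_bdd l s GC (%g y. gen_N g (inv g y) $ i $ j)" if "l \<le> k" for l i j
 using that
 proof (induction l arbitrary: i j)
 case 0
 obtain C where C: "C > 0" "!!g x y. g \<in> GC ==> \<bar>gen_N g x $ i $ j - gen_N g y $ i $ j\<bar> \<le> C * norm (x - y) powr s"
 by (rule holder_bdd_holder0[OF gen_N_holder gen_s(1,2)], rule that)
 have "\<bar>gen_N g (inv g x) $ i $ j - gen_N g (inv g y) $ i $ j\<bar> \<le> (C * (CARD('n) * (CARD('n) * L)) powr s) * norm (x - y) powr s" if g: "g \<in> GC" for g x y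
 proof -
 have "\<bar>gen_N g (inv g x) $ i $ j - gen_N g (inv g y) $ i $ j\<bar> \<le> C * norm (inv g x - inv g y) powr s" by (rule C(2)[OF g])
 also have "... \<le> C * (CARD('n) * (CARD('n) * L) * norm (x - y)) powr s"
 using gen_inv_lipschitz[OF g, of x y] C(1) gen_s by (intro mult_left_mono powr_mono2) (auto simp: mult.assoc)
 finally show ?thesis using L by (simp add: powr_mult)
 qed
 then show ?case unfolding holder_bdd.simps using gen_N(3) by blast
 next
 case (Suc l)
 show ?case
 proof (rule holder_bdd_compose[OF gen_s(1,2), where J = "%j l g y. gen_N g (inv g y) $ l $ j" and F = "%g x. gen_N g x $ i $ j"])
 show "holder_bdd (Suc l) s GC (%g x. gen_N g x $ i $ j)"
 by (rule holder_bdd_mono[OF gen_s(1,2) gen_N_holder Suc.prems])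
 qed (use Suc gen_inv_comp_deriv in auto)
 qed
 then show ?thesis by simp
qed

definition gen_density :: "(real^'n => real^'n) => real^'n => real" where
 "gen_density g y = gauss_density (inv g y) * \<bar>odet (gen_N g (inv g y))\<bar>"

lemma odet_holder: "holder_bdd k s GC (%g y. odet (gen_N g (inv g y)))"
 unfolding odet_def det_def
 by (intro holder_bdd_sum holder_bdd_mult[OF gen_s(1,2)] holder_bdd_prod[OF gen_s(1,2)] holder_bdd_const)
 (auto intro: gen_N_inv_holder simp: sign_def)

text \<open>The absolute value would destroy differentiability, but the determinant is continuous
  and never 0. By connectedness its sign is constant, so the absolute value is multiplication by a
  constant \<open>e g\<close> of modulus 1.\<close>

lemma gen_density_holder: "holder_bdd k s GC gen_density"
proof -
 define e where "e g = sgn (odet (gen_N g (inv g 0)))" for g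
 have abs: "\<bar>odet (gen_N g (inv g y))\<bar> = e g * odet (gen_N g (inv g y))" if g: "g \<in> GC" for g y
 proof -
 let ?f = "%y. odet (gen_N g (inv g y))"
 have cont: "continuous_on UNIV ?f" by (rule holder_bdd_continuous[OF odet_holder gen_s(1,2) g])
 have nz: "?f z \<noteq> 0" for z by (rule odet_nonzero[OF gen_N(1)[OF g]])
 have con: "connected (range ?f)" by (rule connected_continuous_image[OF cont connected_UNIV])
 have "sgn (?f y) = sgn (?f 0)"
 proof (rule ccontr)
 assume "sgn (?f y) \<noteq> sgn (?f 0)"
 then have "min (?f y) (?f 0) \<le> 0" "0 \<le> max (?f y) (?f 0)" using nz[of y] nz[of 0] by (auto simp: sgn_real_def split: if_splits)
 moreover have "min (?f y) (?f 0) \<in> range ?f" "max (?f y) (?f 0) \<in> range ?f" by (auto simp: min_def max_def)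
 ultimately have "0 \<in> range ?f" using connectedD_interval[OF con] by blast
 then show False using nz by auto
 qed
 then show ?thesis unfolding e_def by (metis abs_sgn mult.commute)
 qed
 have "holder_bdd k s GC (%g y. gauss_density (inv g y) * (e g * odet (gen_N g (inv g y))))"
 proof (intro holder_bdd_mult[OF gen_s(1,2)] odet_holder holder_bdd_const)
 show "\<bar>e g\<bar> \<le> 1" for g by (simp add: e_def abs_sgn_eq)
 show "holder_bdd k s GC (%g y. gauss_density (inv g y))"
 proof (rule holder_bdd_compose[OF gen_s(1,2), where J = "%j l g y. gen_N g (inv g y) $ l $ j" and F = "%_. gauss_density"])
 show "holder_bdd (k - 1) s GC (%g y. gen_N g (inv g y) $ l $ j)" for j l
 by (rule holder_bdd_mono[OF gen_s(1,2) gen_N_inv_holder]) simp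
 qed (use gen_inv_comp_deriv gauss_density_holder_bdd[OF gen_s(1,2)] in auto)
 qed
 then show ?thesis
 by (subst holder_bdd_cong[where G = "%g y. gauss_density (inv g y) * (e g * odet (gen_N g (inv g y)))"]) (auto simp: gen_density_def abs)
qed

lemma gen_density_nonneg: "gen_density g y \<ge> 0"
 by (simp add: gen_density_def gauss_density_nonneg)

lemma gen_density_integral:
 fixes f :: "real^'n => real"
 assumes g: "g \<in> GC" and [measurable]: "f \<in> bmeas" and int: "integrable gauss_measure (%z. f (g z))"
 shows "integrable lborel (%y. f y * gen_density g y)" "(\<integral>y. f y \<partial>distr gauss_measure borel g) = (LBINT y. f y * gen_density g y)"
proof -
 have [measurable]: "g \<in> bmeas" by (rule gen_meas[OF g])
 have int': "integrable lborel (%z. f (g z) * gauss_density z)" using int by (subst (asm) integral_gauss) auto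
 have N: "continuous_on UNIV (%y. gen_N g (inv g y) $ i $ j)" for i j
 by (rule holder_bdd_continuous[OF gen_N_inv_holder gen_s(1,2) g])
 note cv = change_of_variables_lborel[OF gen_bij(4)[OF g] gen_inv_deriv[OF g] N int']
 show "integrable lborel (%y. f y * gen_density g y)"
 using cv(1) by (simp add: gen_bij[OF g] gen_density_def mult.assoc)
 have "(\<integral>y. f y \<partial>distr gauss_measure borel g) = (\<integral>z. f (g z) \<partial>gauss_measure)"
 by (rule integral_distr) measurable
 also have "... = (LBINT z. f (g z) * gauss_density z)" by (rule integral_gauss) measurable
 also have "... = (LBINT y. f y * gen_density g y)"
 using cv(2) by (simp add: gen_bij[OF g] gen_density_def mult.assoc)
 finally show "(\<integral>y. f y \<partial>distr gauss_measure borel g) = (LBINT y. f y * gen_density g y)" .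
qed

text \<open>A generator is bounded at 0 and has a bounded Jacobian, hence grows at most linearly,
  with constants common to the class. Its exponential moment is then dominated by one of the
  Gaussian.\<close>

lemma pushforward_tail:
 obtains M where "M > 0" "!!g. g \<in> GC ==> integrable gauss_measure (%z. exp (l1norm (g z)))"
 "!!g. g \<in> GC ==> (\<integral>z. exp (l1norm (g z)) \<partial>gauss_measure) \<le> M"
proof -
 let ?n = "real CARD('n)"
 obtain B where B: "B > 0" "!!p g x. g \<in> GC ==> \<bar>jacobian g (at x) $ fst p $ snd p\<bar> \<le> B"
 by (rule holder_bdd_components_bounded[where F = "%p g x. jacobian g (at x) $ fst p $ snd p", OF gen_holder], rule that)
 define a where "a = ?n * C0"
 define b where "b = ?n * (?n * (?n * B))"
 have le: "l1norm (g z) \<le> a + b * l1norm z" if g: "g \<in> GC" for g z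
 proof -
 have "norm (g z - g 0) \<le> ?n * (?n * B * norm (z - 0))"
 proof (rule sum_nth_bound)
 fix l
 have "((%y. g y $ l) has_derivative (%h. \<Sum>j\<in>UNIV. jacobian g (at y) $ l $ j * h $ j)) (at y)" for y
 using bounded_linear.has_derivative[OF bounded_linear_vec_nth gen_deriv[OF g, of y], of l] by (simp add: matrix_vector_mult_def)
 from grad_bound_imp_lipschitz[where f' = "%j y. jacobian g (at y) $ l $ j", OF this, of B z 0] B(2)[where p = "(l, _)", OF g]
 show "\<bar>(g z - g 0) $ l\<bar> \<le> ?n * B * norm (z - 0)" by simp
 qed
 also have "... \<le> ?n * (?n * B * l1norm z)" using l1norm_bounds(1)[of z] B(1) by (intro mult_left_mono) auto
 finally have "norm (g z) \<le> C0 + ?n * (?n * B * l1norm z)"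
 using g norm_triangle_ineq2[of "g z" "g 0"] by (simp add: GC_def generator_class_def)
 then have "?n * norm (g z) \<le> ?n * (C0 + ?n * (?n * B * l1norm z))" by (rule mult_left_mono) simp
 then show ?thesis using l1norm_bounds(3)[of "g z"] by (simp add: a_def b_def algebra_simps)
 qed
 have int: "integrable gauss_measure (%z :: real^'n. exp a * exp (b * l1norm z))"
 by (intro integrable_mult_right gauss_l1_moment)
 have le': "exp (l1norm (g z)) \<le> exp a * exp (b * l1norm z)" if "g \<in> GC" for g z
 using le[OF that, of z] by (simp flip: exp_add)
 have int2: "integrable gauss_measure (%z. exp (l1norm (g z)))" if g: "g \<in> GC" for g
 proof (rule Bochner_Integration.integrable_bound[OF int])
 have [measurable]: "g \<in> bmeas" by (rule gen_meas[OF g])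
 show "(%z. exp (l1norm (g z))) \<in> borel_measurable gauss_measure" by measurable
 qed (use le'[OF g] in auto)
 define M where "M = (\<integral>z. exp a * exp (b * l1norm z) \<partial>(gauss_measure :: (real^'n) measure))"
 have "(\<integral>z. exp (l1norm (g z)) \<partial>gauss_measure) \<le> \<bar>M\<bar> + 1" if g: "g \<in> GC" for g
 proof -
 have "(\<integral>z. exp (l1norm (g z)) \<partial>gauss_measure) \<le> M"
 unfolding M_def by (rule integral_mono[OF int2[OF g] int le'[OF g]])
 then show ?thesis by linarith
 qed
 then show ?thesis using that[of "\<bar>M\<bar> + 1"] int2 by auto
qed

text \<open>Summation by parts moves all differences from the merely bounded \<open>F\<close> onto
  the density, where they gain \<open>norm u powr \<beta>\<close> pointwise. This is integrated over
  a ball of radius \<open>R\<close>; outside it the exponential moment contributes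
  \<open>exp (- R)\<close>. The volume of the ball is the source of the logarithmic factor.\<close>

lemma pushforward_smooth:
 assumes m: "m \<ge> k + 1"
 obtains C where "C > 0" "!!g (bw :: real) (u :: real^'n) (b :: real) F. g \<in> GC ==> 0 < bw ==> bw \<le> 1 ==> norm u \<le> CARD('n) * bw ==>
 continuous_on UNIV F ==> (!!y. \<bar>F y\<bar> \<le> b) ==>
 \<bar>\<integral>y. (fdiff u ^^ m) F y \<partial>distr gauss_measure borel g\<bar> \<le> C * b * bw powr \<beta> * (1 + ln (1 / bw)) ^ CARD('n)"
proof -
 let ?n = "CARD('n)" let ?r = "real CARD('n)"
 obtain M where M: "M > 0" "!!g. g \<in> GC ==> integrable gauss_measure (%z. exp (l1norm (g z)))"
 "!!g. g \<in> GC ==> (\<integral>z. exp (l1norm (g z)) \<partial>gauss_measure) \<le> M" by (rule pushforward_tail, rule that)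
 obtain C1 where C1: "C1 > 0" "!!g u x. g \<in> GC ==> \<bar>(fdiff u ^^ m) (gen_density g) x\<bar> \<le> C1 * norm u powr \<beta>"
 using holder_bdd_fdiff[OF gen_s(1,2) gen_density_holder m] unfolding gen_s(3) by blast
 define V where "V = unit_ball_vol ?r"
 have V: "V \<ge> 0" by (simp add: V_def)
 define Sc where "Sc = (\<Sum>j\<le>m. \<bar>fdiff_coeff m j\<bar>)"
 have Sc: "Sc \<ge> 0" by (auto simp: Sc_def intro: sum_nonneg)
 define D where "D = C1 * ?r powr \<beta> * (V * (1 + \<beta>) ^ ?n) + Sc * (exp (m * (?r * ?r)) * M) + 1"
 show ?thesis
 proof (rule that[of D])
 show "D > 0" unfolding D_def using C1 V Sc M \<beta> by (intro add_nonneg_pos add_nonneg_nonneg mult_nonneg_nonneg) auto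
 fix g and bw b :: real and u :: "real^'n" and F :: "real^'n => real"
 assume g: "g \<in> GC" and bw: "0 < bw" "bw \<le> (1::real)" and u: "norm u \<le> CARD('n) * bw"
 and F: "continuous_on UNIV F" "!!y. \<bar>F y\<bar> \<le> b"
 define q where "q = gen_density g"
 have b: "b \<ge> 0" using F(2)[of 0] by linarith
 have [measurable]: "g \<in> bmeas" by (rule gen_meas[OF g])
 have [measurable]: "F \<in> bmeas" by (rule borel_measurable_continuous_onI[OF F(1)])
 have [measurable]: "q \<in> bmeas" unfolding q_def
 by (rule borel_measurable_continuous_onI[OF holder_bdd_continuous[OF gen_density_holder gen_s(1,2) g]])
 have q0: "q y \<ge> 0" for y unfolding q_def by (rule gen_density_nonneg)
 interpret P: prob_space "gauss_measure :: (real^'n) measure" by (rule prob_space_gauss)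
 have intq: "integrable lborel q"
 using gen_density_integral(1)[OF g, of "%_. 1"] by (simp add: q_def)
 have shiftq: "integrable lborel (%y. q (y + v))" for v using intq by (subst lborel_shift) auto
 have intFq: "integrable lborel (%y. F (y + v) * q y)" for v
 by (rule integrable_bounded_mult[OF intq, of _ b]) (use F(2) in auto)
 have intFq': "integrable lborel (%y. F y * q (y + v))" for v
 by (rule integrable_bounded_mult[OF shiftq, of _ b]) (use F(2) in auto)
 have mF: "(%y. (fdiff u ^^ m) F y) \<in> bmeas" unfolding fdiff_expand by measurable
 have Fb: "\<bar>(fdiff u ^^ m) F y\<bar> \<le> 2 ^ m * b" for y by (rule fdiff_bounded[OF F(2)])
 have "(\<integral>y. (fdiff u ^^ m) F y \<partial>distr gauss_measure borel g) = (LBINT y. (fdiff u ^^ m) F y * q y)"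
 unfolding q_def
 by (rule gen_density_integral(2)[OF g mF], rule P.integrable_const_bound[of _ "2 ^ m * b"])
 (use Fb mF in \<open>auto intro!: measurable_compose[OF _ mF]\<close>)
 also have "... = (\<integral>y. (\<Sum>j\<le>m. fdiff_coeff m j * (F (y + real j *\<^sub>R u) * q y)) \<partial>lborel)"
 unfolding fdiff_expand by (simp add: sum_distrib_right mult.assoc)
 also have "... = (\<Sum>j\<le>m. fdiff_coeff m j * (LBINT y. F (y + real j *\<^sub>R u) * q y))"
 by (subst Bochner_Integration.integral_sum) (auto intro!: integrable_mult_right intFq)
 \<comment> \<open>Translating each term of the expansion by \<open>- j * u\<close> turns forward
   differences of \<open>F\<close> into backward differences of the density.\<close>
 also have "... = (\<Sum>j\<le>m. fdiff_coeff m j * (LBINT y. F y * q (y + real j *\<^sub>R (- u))))"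
 proof (intro sum.cong refl arg_cong[where f = "(*) _"])
 fix j
 have "(LBINT y. F (y + real j *\<^sub>R u) * q y) = (\<integral>y. F ((y + real j *\<^sub>R (- u)) + real j *\<^sub>R u) * q (y + real j *\<^sub>R (- u)) \<partial>lborel)"
 by (rule lborel_shift(2)[symmetric, of "%y. F (y + real j *\<^sub>R u) * q y"]) measurable
 then show "(LBINT y. F (y + real j *\<^sub>R u) * q y) = (LBINT y. F y * q (y + real j *\<^sub>R (- u)))" by simp
 qed
 also have "... = (\<integral>y. (\<Sum>j\<le>m. fdiff_coeff m j * (F y * q (y + real j *\<^sub>R (- u)))) \<partial>lborel)"
 by (subst Bochner_Integration.integral_sum[OF integrable_mult_right[OF intFq']]) simp
 also have "... = (LBINT y. F y * (fdiff (- u) ^^ m) q y)"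
 unfolding fdiff_expand by (simp add: sum_distrib_left mult_ac)
 finally have eq: "(\<integral>y. (fdiff u ^^ m) F y \<partial>distr gauss_measure borel g) = (LBINT y. F y * (fdiff (- u) ^^ m) q y)" .
 have intw: "integrable lborel ((fdiff (- u) ^^ m) q)"
 proof -
 have "integrable lborel (%y. \<Sum>j\<le>m. fdiff_coeff m j * q (y + real j *\<^sub>R (- u)))"
 by (intro Bochner_Integration.integrable_sum integrable_mult_right shiftq)
 then show ?thesis by (simp add: fdiff_expand[abs_def])
 qed
 \<comment> \<open>With this radius \<open>exp (- R) \<le> bw powr \<beta>\<close>, so the tail does
   not exceed the rate of the main part, while \<open>R\<close> grows only logarithmically.\<close>
 define R where "R = 1 + \<beta> * ln (1 / bw)"
 have ln0: "ln (1 / bw) \<ge> 0" using bw by simp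
 have R: "R > 0" "exp (- R) \<le> bw powr \<beta>" "R \<le> (1 + \<beta>) * (1 + ln (1 / bw))"
 proof -
 have "\<beta> * ln (1 / bw) \<ge> 0" using \<beta> ln0 by simp
 then show "R > 0" by (simp add: R_def)
 show "exp (- R) \<le> bw powr \<beta>" using bw by (simp add: R_def powr_def ln_div)
 show "R \<le> (1 + \<beta>) * (1 + ln (1 / bw))" unfolding R_def distrib_left distrib_right using \<beta> ln0 by simp
 qed
 let ?e = "%j y. exp (l1norm y) * q (y + real j *\<^sub>R (- u))"
 have e: "integrable lborel (?e j)" "(LBINT y. ?e j y) \<le> exp (m * (?r * ?r)) * M" if j: "j \<le> m" for j
 proof -
 define v where "v = real j *\<^sub>R u"
 have v: "l1norm v \<le> m * (?r * ?r)"
 proof -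
 have "l1norm u \<le> ?r * norm u" by (rule l1norm_bounds)
 also have "... \<le> ?r * (?r * 1)"
 proof (rule mult_left_mono)
 have "?r * bw \<le> ?r * 1" using bw by (intro mult_left_mono) auto
 then show "norm u \<le> ?r * 1" using u by linarith
 qed simp
 finally have "real j * l1norm u \<le> real m * (?r * ?r)" using j l1norm_bounds(2)[of u] by (intro mult_mono) auto
 then show ?thesis by (simp add: v_def l1norm_scale)
 qed
 have i1: "integrable lborel (%y. exp (l1norm y) * q y)"
 unfolding q_def by (rule gen_density_integral(1)[OF g _ M(2)[OF g]]) measurable
 have i1': "(LBINT y. exp (l1norm y) * q y) \<le> M"
 proof -
 have "(LBINT y. exp (l1norm y) * q y) = (\<integral>y. exp (l1norm y) \<partial>distr gauss_measure borel g)"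
 unfolding q_def by (rule gen_density_integral(2)[OF g _ M(2)[OF g], symmetric]) measurable
 also have "... = (\<integral>z. exp (l1norm (g z)) \<partial>gauss_measure)" by (rule integral_distr) measurable
 finally show ?thesis using M(3)[OF g] by simp
 qed
 have le: "exp (l1norm (y + v)) * q y \<le> exp (m * (?r * ?r)) * (exp (l1norm y) * q y)" for y
 proof -
 have "l1norm (y + v) \<le> m * (?r * ?r) + l1norm y" using l1norm_triangle[of y v] v by linarith
 then have "exp (l1norm (y + v)) \<le> exp (m * (?r * ?r)) * exp (l1norm y)" by (simp flip: exp_add)
 from mult_right_mono[OF this q0[of y]] show ?thesis by (simp only: mult.assoc)
 qed
 have i2: "integrable lborel (%y. exp (l1norm (y + v)) * q y)"
 proof (rule Bochner_Integration.integrable_bound[OF integrable_mult_right[OF i1, of "exp (m * (?r * ?r))"]])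
 show "AE y in lborel. norm (exp (l1norm (y + v)) * q y) \<le> norm (exp (m * (?r * ?r)) * (exp (l1norm y) * q y))"
 by (rule AE_I2) (use le q0 in \<open>simp add: abs_mult\<close>)
 qed measurable
 have sh: "?e j y = (%y. exp (l1norm (y + v)) * q y) (y + - v)" for y by (simp add: v_def)
 show "integrable lborel (?e j)" unfolding sh using i2 by (subst lborel_shift) auto
 have "(LBINT y. ?e j y) = (LBINT y. exp (l1norm (y + v)) * q y)"
 unfolding sh by (rule lborel_shift) measurable
 also have "... \<le> (LBINT y. exp (m * (?r * ?r)) * (exp (l1norm y) * q y))"
 by (intro integral_mono i2 integrable_mult_right i1 le)
 also have "... \<le> exp (m * (?r * ?r)) * M" using i1' by simp
 finally show "(LBINT y. ?e j y) \<le> exp (m * (?r * ?r)) * M" .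
 qed
 let ?I = "indicator (cball (0 :: real^'n) R) :: real^'n => real"
 have cb: "integrable lborel ?I" using emeasure_lborel_cball_finite[of "0 :: real^'n" R] by (intro integrable_real_indicator) auto
 have cbv: "(LBINT y. ?I y) = V * R ^ ?n"
 using R(1) by (simp add: V_def measure_def emeasure_cball)
 \<comment> \<open>Beyond radius \<open>R\<close> cancellation is given up: all terms of the
   difference are added, and \<open>1 \<le> exp (- R) * exp (l1norm y)\<close> brings in the moment.
   The shifts by multiples of \<open>u\<close> are bounded, so they change the moment by a constant
   factor only.\<close>
 have pw: "\<bar>(fdiff (- u) ^^ m) q y\<bar> \<le> C1 * norm u powr \<beta> * ?I y + exp (- R) * (\<Sum>j\<le>m. \<bar>fdiff_coeff m j\<bar> * ?e j y)" for y
 proof (cases "l1norm y \<le> R")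
 case True
 then have "norm y \<le> R" using l1norm_bounds(1)[of y] by linarith
 moreover have "0 \<le> exp (- R) * (\<Sum>j\<le>m. \<bar>fdiff_coeff m j\<bar> * ?e j y)"
 by (intro mult_nonneg_nonneg sum_nonneg) (auto simp: q0)
 ultimately show ?thesis using C1(2)[OF g, of "- u" y] by (simp add: q_def)
 next
 case False
 have "\<bar>(fdiff (- u) ^^ m) q y\<bar> \<le> (\<Sum>j\<le>m. \<bar>fdiff_coeff m j\<bar> * q (y + real j *\<^sub>R (- u)))"
 unfolding fdiff_expand by (rule order_trans[OF sum_abs]) (auto simp: abs_mult q0)
 also have "... \<le> (\<Sum>j\<le>m. \<bar>fdiff_coeff m j\<bar> * (exp (- R) * ?e j y))"
 proof (intro sum_mono mult_left_mono)
 fix j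
 have "1 \<le> exp (- R) * exp (l1norm y)" using False by (simp flip: exp_add)
 then show "q (y + real j *\<^sub>R (- u)) \<le> exp (- R) * ?e j y"
 using mult_right_mono[of 1 "exp (- R) * exp (l1norm y)" "q (y + real j *\<^sub>R (- u))"] q0[of "y + real j *\<^sub>R (- u)"] by (simp only: mult.assoc mult_1)
 qed simp
 also have "... = exp (- R) * (\<Sum>j\<le>m. \<bar>fdiff_coeff m j\<bar> * ?e j y)" by (simp add: sum_distrib_left mult_ac)
 finally have "\<bar>(fdiff (- u) ^^ m) q y\<bar> \<le> exp (- R) * (\<Sum>j\<le>m. \<bar>fdiff_coeff m j\<bar> * ?e j y)" .
 moreover have "0 \<le> C1 * norm u powr \<beta> * ?I y" using C1(1) by (simp add: indicator_def)
 ultimately show ?thesis by linarith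
 qed
 have ie: "integrable lborel (%y. \<Sum>j\<le>m. \<bar>fdiff_coeff m j\<bar> * ?e j y)"
 by (intro Bochner_Integration.integrable_sum integrable_mult_right e) auto
 have "\<bar>\<integral>y. F y * (fdiff (- u) ^^ m) q y \<partial>lborel\<bar> \<le> b * (LBINT y. \<bar>(fdiff (- u) ^^ m) q y\<bar>)"
 by (rule abs_integral_mult_le[OF intw]) (use F(2) in auto)
 also have "(LBINT y. \<bar>(fdiff (- u) ^^ m) q y\<bar>) \<le> (LBINT y. C1 * norm u powr \<beta> * ?I y + exp (- R) * (\<Sum>j\<le>m. \<bar>fdiff_coeff m j\<bar> * ?e j y))"
 by (intro integral_mono pw integrable_abs intw Bochner_Integration.integrable_add integrable_mult_right cb ie)
 also have "... = C1 * norm u powr \<beta> * (V * R ^ ?n) + exp (- R) * (\<Sum>j\<le>m. \<bar>fdiff_coeff m j\<bar> * (LBINT y. ?e j y))"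
 proof -
 have "(LBINT y. (\<Sum>j\<le>m. \<bar>fdiff_coeff m j\<bar> * ?e j y)) = (\<Sum>j\<le>m. \<bar>fdiff_coeff m j\<bar> * (LBINT y. ?e j y))"
 proof -
 have "(LBINT y. (\<Sum>j\<le>m. \<bar>fdiff_coeff m j\<bar> * ?e j y)) = (\<Sum>j\<le>m. \<integral>y. \<bar>fdiff_coeff m j\<bar> * ?e j y \<partial>lborel)"
 by (rule Bochner_Integration.integral_sum) (rule integrable_mult_right, rule e(1), simp)
 also have "... = (\<Sum>j\<le>m. \<bar>fdiff_coeff m j\<bar> * (LBINT y. ?e j y))"
 by (intro sum.cong refl integral_mult_right_zero)
 finally show ?thesis .
 qed
 moreover have "(LBINT y. C1 * norm u powr \<beta> * ?I y + exp (- R) * (\<Sum>j\<le>m. \<bar>fdiff_coeff m j\<bar> * ?e j y))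
 = (LBINT y. C1 * norm u powr \<beta> * ?I y) + (LBINT y. exp (- R) * (\<Sum>j\<le>m. \<bar>fdiff_coeff m j\<bar> * ?e j y))"
 by (intro Bochner_Integration.integral_add integrable_mult_right cb ie)
 moreover have "(LBINT y. C1 * norm u powr \<beta> * ?I y) = C1 * norm u powr \<beta> * (LBINT y. ?I y)"
 by (rule integral_mult_right_zero)
 moreover have "(LBINT y. exp (- R) * (\<Sum>j\<le>m. \<bar>fdiff_coeff m j\<bar> * ?e j y)) = exp (- R) * (LBINT y. (\<Sum>j\<le>m. \<bar>fdiff_coeff m j\<bar> * ?e j y))"
 by (rule integral_mult_right_zero)
 ultimately show ?thesis by (simp only: cbv)
 qed
 also have "... \<le> D * bw powr \<beta> * (1 + ln (1 / bw)) ^ ?n"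
 proof -
 let ?l = "(1 + ln (1 / bw)) ^ ?n"
 have l: "?l \<ge> 1" using ln0 by (simp add: one_le_power)
 have "norm u powr \<beta> \<le> (?r * bw) powr \<beta>" using u \<beta> by (intro powr_mono2) auto
 then have u': "norm u powr \<beta> \<le> ?r powr \<beta> * bw powr \<beta>" using bw by (simp add: powr_mult)
 have "R ^ ?n \<le> ((1 + \<beta>) * (1 + ln (1 / bw))) ^ ?n" using R by (intro power_mono) auto
 then have R': "V * R ^ ?n \<le> V * ((1 + \<beta>) ^ ?n * ?l)" using V by (intro mult_left_mono) (auto simp: power_mult_distrib)
 have "C1 * norm u powr \<beta> * (V * R ^ ?n) \<le> C1 * (?r powr \<beta> * bw powr \<beta>) * (V * ((1 + \<beta>) ^ ?n * ?l))"
 by (rule mult_mono[OF mult_left_mono[OF u'] R']) (use C1(1) V R in auto)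
 also have "... = (C1 * ?r powr \<beta> * (V * (1 + \<beta>) ^ ?n)) * bw powr \<beta> * ?l" by (simp add: mult_ac)
 finally have 1: "C1 * norm u powr \<beta> * (V * R ^ ?n) \<le> (C1 * ?r powr \<beta> * (V * (1 + \<beta>) ^ ?n)) * bw powr \<beta> * ?l" .
 have "(\<Sum>j\<le>m. \<bar>fdiff_coeff m j\<bar> * (LBINT y. ?e j y)) \<le> (\<Sum>j\<le>m. \<bar>fdiff_coeff m j\<bar> * (exp (m * (?r * ?r)) * M))"
 by (intro sum_mono mult_left_mono e) auto
 then have "(\<Sum>j\<le>m. \<bar>fdiff_coeff m j\<bar> * (LBINT y. ?e j y)) \<le> Sc * (exp (m * (?r * ?r)) * M)"
 by (simp add: Sc_def sum_distrib_right)
 then have "exp (- R) * (\<Sum>j\<le>m. \<bar>fdiff_coeff m j\<bar> * (LBINT y. ?e j y)) \<le> bw powr \<beta> * (Sc * (exp (m * (?r * ?r)) * M))"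
 by (rule mult_mono[OF R(2)]) (auto intro!: sum_nonneg mult_nonneg_nonneg simp: q0)
 also have "... \<le> bw powr \<beta> * (Sc * (exp (m * (?r * ?r)) * M)) * ?l"
 using l Sc M(1) mult_left_mono[OF l, of "bw powr \<beta> * (Sc * (exp (m * (?r * ?r)) * M))"] by simp
 finally have 2: "exp (- R) * (\<Sum>j\<le>m. \<bar>fdiff_coeff m j\<bar> * (LBINT y. ?e j y)) \<le> (Sc * (exp (m * (?r * ?r)) * M)) * bw powr \<beta> * ?l"
 by (simp add: mult_ac)
 have "0 \<le> 1 * bw powr \<beta> * ?l" using l by simp
 then show ?thesis using 1 2 unfolding D_def by (simp add: distrib_right)
 qed
 finally have "\<bar>\<integral>y. F y * (fdiff (- u) ^^ m) q y \<partial>lborel\<bar> \<le> b * (D * bw powr \<beta> * (1 + ln (1 / bw)) ^ ?n)"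
 using b by (simp add: mult_left_mono)
 then show "\<bar>\<integral>y. (fdiff u ^^ m) F y \<partial>distr gauss_measure borel g\<bar> \<le> D * b * bw powr \<beta> * (1 + ln (1 / bw)) ^ CARD('n)"
 unfolding eq by (simp add: mult_ac)
 qed
qed

end

section \<open>Uniform deviation of the empirical measure\<close>

text \<open>After centring, products of different coordinates have mean 0 by independence, so only
  the \<open>n\<close> diagonal terms survive; the variance is then at most the second
  moment.\<close>

lemma sum_iid_variance:
 fixes \<phi> :: "'a => real" and B :: real and n :: nat
 assumes mu: "prob_space mu" and \<phi>[measurable]: "\<phi> \<in> borel_measurable mu" and B: "!!x. \<bar>\<phi> x\<bar> \<le> B" and n: "n > 0"
 shows "(\<integral>X. ((\<Sum>i<n. \<phi> (X i)) / n - (\<integral>x. \<phi> x \<partial>mu))\<^sup>2 \<partial>PiM {..<n} (%_. mu)) \<le> (\<integral>x. (\<phi> x)\<^sup>2 \<partial>mu) / n"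
proof -
 interpret mu: prob_space mu by (rule mu)
 interpret P: product_prob_space "%_ :: nat. mu" "{..<n}" by unfold_locales
 interpret PP: prob_space "PiM {..<n} (%_. mu)" by (rule prob_space_PiM) (rule mu)
 define e where "e = (\<integral>x. \<phi> x \<partial>mu)"
 define ps where "ps x = \<phi> x - e" for x
 have [measurable]: "ps \<in> borel_measurable mu" unfolding ps_def[abs_def] by measurable
 have i\<phi>: "integrable mu \<phi>" by (rule mu.integrable_const_bound[of _ B]) (use B in auto)
 have i\<phi>2: "integrable mu (%x. (\<phi> x)\<^sup>2)"
 proof (rule mu.integrable_const_bound[of _ "B\<^sup>2"])
 show "AE x in mu. norm ((\<phi> x)\<^sup>2) \<le> B\<^sup>2"
 proof (rule AE_I2)
 fix x
 have "\<bar>\<phi> x\<bar>\<^sup>2 \<le> B\<^sup>2" by (rule power_mono[OF B]) simp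
 then show "norm ((\<phi> x)\<^sup>2) \<le> B\<^sup>2" by simp
 qed
 qed measurable
 have ips: "integrable mu ps" unfolding ps_def[abs_def] by (intro Bochner_Integration.integrable_diff i\<phi>) simp
 have ps0: "(\<integral>x. ps x \<partial>mu) = 0" by (simp add: ps_def i\<phi> e_def mu.prob_space)
 have sq: "(ps x)\<^sup>2 = (\<phi> x)\<^sup>2 - 2 * e * \<phi> x + e\<^sup>2" for x by (simp add: ps_def power2_diff)
 have ips2: "integrable mu (%x. (ps x)\<^sup>2)" unfolding sq
 by (intro Bochner_Integration.integrable_add Bochner_Integration.integrable_diff i\<phi>2 integrable_mult_right i\<phi>) simp
 have ps2: "(\<integral>x. (ps x)\<^sup>2 \<partial>mu) \<le> (\<integral>x. (\<phi> x)\<^sup>2 \<partial>mu)"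
 proof -
 have "(\<integral>x. (ps x)\<^sup>2 \<partial>mu) = (\<integral>x. (\<phi> x)\<^sup>2 \<partial>mu) - 2 * e * e + e\<^sup>2"
 unfolding sq by (simp add: i\<phi>2 i\<phi> mu.prob_space e_def[symmetric])
 then show ?thesis by (simp add: power2_eq_square)
 qed
 have prod: "integrable (PiM {..<n} (%_. mu)) (%X. ps (X i) * ps (X j)) \<and>
 (\<integral>X. ps (X i) * ps (X j) \<partial>PiM {..<n} (%_. mu)) = (if i = j then \<integral>x. (ps x)\<^sup>2 \<partial>mu else 0)"
 if ij: "i < n" "j < n" for i j
 proof -
 \<comment> \<open>Writes the product of two coordinates as a product over all coordinates, to which
   Fubini for product measures applies for \<open>i = j\<close> and \<open>i \<noteq> j\<close>
   alike.\<close>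
 define f where "f l x = (if l = i then ps x else 1) * (if l = j then ps x else 1)" for l :: nat and x
 have fi: "integrable mu (f l)" for l
 unfolding f_def[abs_def] using ips ips2 by (cases "l = i"; cases "l = j") (simp_all add: power2_eq_square)
 have eq: "(\<Prod>l\<in>{..<n}. f l (X l)) = ps (X i) * ps (X j)" for X
 unfolding f_def prod.distrib using ij by (simp add: prod.delta)
 have "(\<Prod>l\<in>{..<n}. \<integral>x. f l x \<partial>mu) = (if i = j then \<integral>x. (ps x)\<^sup>2 \<partial>mu else 0)"
 proof (cases "i = j")
 case True
 have "(\<integral>x. f l x \<partial>mu) = (if l = i then \<integral>x. (ps x)\<^sup>2 \<partial>mu else 1)" for l
 using True by (simp add: f_def power2_eq_square mu.prob_space)
 then show ?thesis using True ij by simp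
 next
 case False
 have "(\<integral>x. f i x \<partial>mu) = 0" using False ps0 by (simp add: f_def)
 then show ?thesis using False ij by (auto intro!: prod_zero)
 qed
 moreover have "integrable (PiM {..<n} (%_. mu)) (%X. \<Prod>l\<in>{..<n}. f l (X l))"
 by (rule P.product_integrable_prod) (auto intro: fi)
 moreover have "(\<integral>X. (\<Prod>l\<in>{..<n}. f l (X l)) \<partial>PiM {..<n} (%_. mu)) = (\<Prod>l\<in>{..<n}. \<integral>x. f l x \<partial>mu)"
 by (rule P.product_integral_prod) (auto intro: fi)
 ultimately show ?thesis by (simp add: eq)
 qed
 have "((\<Sum>i<n. \<phi> (X i)) / n - e)\<^sup>2 = (\<Sum>i<n. \<Sum>j<n. ps (X i) * ps (X j)) / n\<^sup>2" for X
 proof -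
 have "(\<Sum>i<n. \<phi> (X i)) / n - e = (\<Sum>i<n. ps (X i)) / n" using n by (simp add: ps_def sum_subtractf field_simps)
 then show ?thesis by (simp add: power_divide power2_eq_square sum_product)
 qed
 then have "(\<integral>X. ((\<Sum>i<n. \<phi> (X i)) / n - e)\<^sup>2 \<partial>PiM {..<n} (%_. mu)) = (\<integral>X. (\<Sum>i<n. \<Sum>j<n. ps (X i) * ps (X j)) / n\<^sup>2 \<partial>PiM {..<n} (%_. mu))"
 by simp
 also have "... = (\<Sum>i<n. \<Sum>j<n. if i = j then \<integral>x. (ps x)\<^sup>2 \<partial>mu else 0) / n\<^sup>2"
 proof -
 have "(\<integral>X. (\<Sum>i<n. \<Sum>j<n. ps (X i) * ps (X j)) \<partial>PiM {..<n} (%_. mu)) = (\<Sum>i<n. \<integral>X. (\<Sum>j<n. ps (X i) * ps (X j)) \<partial>PiM {..<n} (%_. mu))"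
 by (rule Bochner_Integration.integral_sum) (intro Bochner_Integration.integrable_sum, use prod in auto)
 also have "... = (\<Sum>i<n. \<Sum>j<n. \<integral>X. ps (X i) * ps (X j) \<partial>PiM {..<n} (%_. mu))"
 by (intro sum.cong refl Bochner_Integration.integral_sum) (use prod in auto)
 also have "... = (\<Sum>i<n. \<Sum>j<n. if i = j then \<integral>x. (ps x)\<^sup>2 \<partial>mu else 0)"
 by (intro sum.cong refl) (use prod in auto)
 finally show ?thesis by simp
 qed
 also have "... = (\<integral>x. (ps x)\<^sup>2 \<partial>mu) / n" using n by (simp add: power2_eq_square)
 also have "... \<le> (\<integral>x. (\<phi> x)\<^sup>2 \<partial>mu) / n" using ps2 by (intro divide_right_mono) auto
 finally show ?thesis by (simp add: e_def)
qed

text \<open>The deviation of an unnormalised kernel density estimate at the point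
  \<open>bw *\<^sub>R w\<close>. In the variable \<open>w\<close> the kernel has unit scale.\<close>

definition ekern :: "nat => nat => (real^'n::finite) measure => real => (nat => real^'n) => real^'n => real" where
 "ekern N n mu bw X w = (\<Sum>i<n. pbump N (%_. 0) (w - X i /\<^sub>R bw)) / n - (\<integral>x. pbump N (%_. 0) (w - x /\<^sub>R bw) \<partial>mu)"

lemma nn_integral_exp_l1:
 assumes "bw > 0"
 shows "(\<integral>\<^sup>+w. ennreal (exp (- (bw * l1norm (w :: real^'n::finite)))) \<partial>lborel) = ennreal ((2 / bw) ^ CARD('n))"
proof -
 have half: "(\<integral>\<^sup>+t. ennreal (exp (- (bw * t)) * indicator {0..} t) \<partial>lborel) = ennreal (1 / bw)"
 proof -
 have "(\<integral>\<^sup>+t. ennreal (exp (- (bw * t)) * indicator {0..} t) \<partial>lborel) = (\<integral>\<^sup>+t. ennreal (exp (- (bw * t))) * indicator {0..} t \<partial>lborel)"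
 by (intro nn_integral_cong) (auto simp: indicator_def)
 also have "... = ennreal (0 - (- exp (- (bw * 0)) / bw))"
 proof (rule nn_integral_FTC_atLeast)
 show "DERIV (%t. - exp (- (bw * t)) / bw) x :> exp (- (bw * x))" if "0 \<le> x" for x
 using assms by (auto intro!: derivative_eq_intros)
 show "((%t. - exp (- (bw * t)) / bw) \<longlongrightarrow> 0) at_top" using assms by real_asymp
 qed auto
 finally show ?thesis by simp
 qed
 have half': "(\<integral>\<^sup>+t. ennreal (exp (bw * t) * indicator {..0} t) \<partial>lborel) = ennreal (1 / bw)"
 proof -
 have "(\<integral>\<^sup>+t. ennreal (exp (bw * t) * indicator {..0} t) \<partial>lborel) = (\<integral>\<^sup>+t. ennreal (exp (bw * t) * indicator {..0} t) \<partial>distr lborel borel uminus)"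
 by (simp add: lborel_distr_uminus)
 also have "... = (\<integral>\<^sup>+t. ennreal (exp (- (bw * t)) * indicator {0..} t) \<partial>lborel)"
 by (subst nn_integral_distr) (auto intro!: nn_integral_cong simp: indicator_def)
 finally show ?thesis using half by simp
 qed
 have one: "(\<integral>\<^sup>+t. ennreal (exp (- (bw * \<bar>t\<bar>))) \<partial>lborel) = ennreal (2 / bw)"
 proof -
 have "(\<integral>\<^sup>+t. ennreal (exp (- (bw * \<bar>t\<bar>))) \<partial>lborel) = (\<integral>\<^sup>+t. ennreal (exp (- (bw * t)) * indicator {0..} t) + ennreal (exp (bw * t) * indicator {..0} t) \<partial>lborel)"
 proof (rule nn_integral_cong_AE)
 have "AE t in lborel. t \<noteq> (0::real)" by (rule AE_lborel_singleton)
 then show "AE t in lborel. ennreal (exp (- (bw * \<bar>t\<bar>))) = ennreal (exp (- (bw * t)) * indicator {0..} t) + ennreal (exp (bw * t) * indicator {..0} t)"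
 by eventually_elim (auto simp: indicator_def)
 qed
 also have "... = ennreal (1 / bw) + ennreal (1 / bw)" by (subst nn_integral_add) (auto simp: half half')
 also have "... = ennreal (2 / bw)" using assms by (simp flip: ennreal_plus)
 finally show ?thesis .
 qed
 have "(\<integral>\<^sup>+w. ennreal (exp (- (bw * l1norm (w :: real^'n)))) \<partial>lborel) = (\<integral>\<^sup>+w. (\<Prod>i\<in>UNIV. ennreal (exp (- (bw * \<bar>(w :: real^'n) $ i\<bar>)))) \<partial>lborel)"
 by (intro nn_integral_cong) (simp add: prod_ennreal l1norm_def sum_distrib_left exp_sum flip: sum_negf)
 also have "... = (\<Prod>i\<in>(UNIV :: 'n set). \<integral>\<^sup>+t. ennreal (exp (- (bw * \<bar>t\<bar>))) \<partial>lborel)" by (rule nn_integral_lborel_cart) measurable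
 also have "... = ennreal ((2 / bw) ^ CARD('n))" using assms by (simp add: one ennreal_power)
 finally show ?thesis .
qed

lemma amgm_weight:
 fixes t a :: real
 assumes "a > 0" shows "\<bar>t\<bar> \<le> (a + t\<^sup>2 / a) / 2"
proof -
 have "(\<bar>t\<bar> - a)\<^sup>2 = t\<^sup>2 - 2 * \<bar>t\<bar> * a + a\<^sup>2" by (simp add: power2_diff)
 moreover have "0 \<le> (\<bar>t\<bar> - a)\<^sup>2" by simp
 ultimately have "2 * \<bar>t\<bar> * a \<le> a\<^sup>2 + t\<^sup>2" by linarith
 then have "2 * \<bar>t\<bar> * a / a \<le> (a\<^sup>2 + t\<^sup>2) / a" using assms by (intro divide_right_mono) auto
 then show ?thesis using assms by (simp add: add_divide_distrib power2_eq_square)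
qed

context
 fixes mu :: "(real^'n::finite) measure" and N n :: nat and M :: real
 assumes mu: "prob_space mu" and smu[measurable_cong, simp]: "sets mu = sets borel" and n: "n > 0"
 and M: "(\<integral>\<^sup>+x. ennreal (exp (l1norm x)) \<partial>mu) \<le> ennreal M" and M0: "M \<ge> 0"
begin

lemma ekern_measurable: "(%(X, w). ekern N n mu bw X w) \<in> borel_measurable (PiM {..<n} (%_. mu) \<Otimes>\<^sub>M lborel)"
proof -
 interpret prob_space mu by (rule mu)
 have 1: "(%p :: (nat => real^'n) \<times> (real^'n). \<Sum>i<n. pbump N (%_. 0) (snd p - fst p i /\<^sub>R bw)) \<in> borel_measurable (PiM {..<n} (%_. mu) \<Otimes>\<^sub>M lborel)"
 proof (rule borel_measurable_sum)
 fix i assume i: "i \<in> {..<n}"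
 have [measurable]: "(%X :: nat => real^'n. X i) \<in> borel_measurable (PiM {..<n} (%_. mu))"
 using measurable_component_singleton[OF i, of "%_. mu"] by (simp cong: measurable_cong_sets)
 show "(%p :: (nat => real^'n) \<times> (real^'n). pbump N (%_. 0) (snd p - fst p i /\<^sub>R bw)) \<in> borel_measurable (PiM {..<n} (%_. mu) \<Otimes>\<^sub>M lborel)"
 by measurable
 qed
 have 2: "(%w :: real^'n. \<integral>x. pbump N (%_. 0) (w - x /\<^sub>R bw) \<partial>mu) \<in> borel_measurable lborel"
 by measurable
 show ?thesis unfolding ekern_def split_beta
 by (intro borel_measurable_diff borel_measurable_divide 1 measurable_compose[OF measurable_snd 2]) auto
qed

lemma ekern_square:
 "(\<integral>\<^sup>+X. ennreal ((ekern N n mu bw X w)\<^sup>2) \<partial>PiM {..<n} (%_. mu)) \<le> ennreal (1 / n) * (\<integral>\<^sup>+x. ennreal ((pbump N (%_. 0) (w - x /\<^sub>R bw))\<^sup>2) \<partial>mu)"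
proof -
 interpret mu: prob_space mu by (rule mu)
 interpret PP: prob_space "PiM {..<n} (%_. mu)" by (rule prob_space_PiM) (rule mu)
 define \<phi> where "\<phi> x = pbump N (%_. 0) (w - x /\<^sub>R bw)" for x
 have [measurable]: "\<phi> \<in> bmeas" unfolding \<phi>_def[abs_def] by measurable
 have \<phi>m: "\<phi> \<in> borel_measurable mu" by measurable
 have \<phi>b: "0 \<le> \<phi> x" "\<phi> x \<le> 1" for x unfolding \<phi>_def by (rule pbump_0_nonneg pbump_0_le_1)+
 have \<phi>a: "\<bar>\<phi> x\<bar> \<le> 1" for x using \<phi>b[of x] by simp
 have ek: "ekern N n mu bw X w = (\<Sum>i<n. \<phi> (X i)) / n - (\<integral>x. \<phi> x \<partial>mu)" for X by (simp add: ekern_def \<phi>_def)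
 have em: "(%X. ekern N n mu bw X w) \<in> borel_measurable (PiM {..<n} (%_. mu))"
 using measurable_compose[OF measurable_Pair2'[of w lborel "PiM {..<n} (%_. mu)"] ekern_measurable] by simp
 have e0: "0 \<le> (\<integral>x. \<phi> x \<partial>mu)" "(\<integral>x. \<phi> x \<partial>mu) \<le> 1"
 proof -
 show "0 \<le> (\<integral>x. \<phi> x \<partial>mu)" by (rule Bochner_Integration.integral_nonneg) (rule \<phi>b)
 have "(\<integral>x. \<phi> x \<partial>mu) \<le> (\<integral>x. 1 \<partial>mu)" by (intro integral_mono mu.integrable_const_bound[of _ 1]) (use \<phi>a \<phi>b \<phi>m in auto)
 then show "(\<integral>x. \<phi> x \<partial>mu) \<le> 1" by (simp add: mu.prob_space)
 qed
 have eb: "(ekern N n mu bw X w)\<^sup>2 \<le> 1" for X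
 proof -
 have s: "0 \<le> (\<Sum>i<n. \<phi> (X i))" "(\<Sum>i<n. \<phi> (X i)) \<le> (\<Sum>i<n. 1)" by (intro sum_nonneg sum_mono \<phi>b)+
 then have "0 \<le> (\<Sum>i<n. \<phi> (X i)) / n" "(\<Sum>i<n. \<phi> (X i)) / n \<le> 1" using n by (auto simp: divide_le_eq)
 then have "\<bar>ekern N n mu bw X w\<bar> \<le> 1" unfolding ek using e0 by linarith
 then show ?thesis by (simp add: abs_square_le_1)
 qed
 have "integrable (PiM {..<n} (%_. mu)) (%X. (ekern N n mu bw X w)\<^sup>2)"
 by (rule PP.integrable_const_bound[of _ 1]) (use eb em in auto)
 then have "(\<integral>\<^sup>+X. ennreal ((ekern N n mu bw X w)\<^sup>2) \<partial>PiM {..<n} (%_. mu)) = ennreal (\<integral>X. (ekern N n mu bw X w)\<^sup>2 \<partial>PiM {..<n} (%_. mu))"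
 by (rule nn_integral_eq_integral) simp
 also have "... \<le> ennreal ((\<integral>x. (\<phi> x)\<^sup>2 \<partial>mu) / n)"
 unfolding ek by (rule ennreal_leI, rule sum_iid_variance[OF mu \<phi>m \<phi>a n])
 also have "... = ennreal (1 / n) * ennreal (\<integral>x. (\<phi> x)\<^sup>2 \<partial>mu)"
 by (simp add: ennreal_mult' flip: ennreal_mult'')
 also have "ennreal (\<integral>x. (\<phi> x)\<^sup>2 \<partial>mu) = (\<integral>\<^sup>+x. ennreal ((\<phi> x)\<^sup>2) \<partial>mu)"
 proof (rule nn_integral_eq_integral[symmetric])
 show "integrable mu (%x. (\<phi> x)\<^sup>2)"
 by (rule mu.integrable_const_bound[of _ 1]) (use \<phi>a in \<open>auto simp: abs_square_le_1\<close>)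
 qed simp
 finally show ?thesis by (simp add: \<phi>_def)
qed

text \<open>At each point the second moment is of order \<open>1 / n\<close>, but integrating a
  first moment over all of space needs decay. The weighted inequality \<open>amgm_weight\<close>
  with weight \<open>exp (- bw * l1norm w)\<close> provides it: the weight is integrable, and its
  inverse is absorbed by the exponential moment \<open>M\<close>.\<close>

lemma ekern_mass:
 fixes Dl :: real
 assumes bw: "bw > 0" "bw \<le> Dl"
 shows "(\<integral>\<^sup>+X. (\<integral>\<^sup>+w. ennreal \<bar>ekern N n mu bw X w\<bar> \<partial>lborel) \<partial>PiM {..<n} (%_. mu))
 \<le> ennreal ((2 ^ CARD('n) + exp (Dl * CARD('n)) * M * bump_mass N TYPE('n)) * (n powr (- 1/2) * bw powr (- real CARD('n) / 2)))"
proof -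
 interpret mu: prob_space mu by (rule mu)
 interpret PP: prob_space "PiM {..<n} (%_. mu)" by (rule prob_space_PiM) (rule mu)
 interpret pair_sigma_finite "PiM {..<n} (%_. mu)" "lborel :: (real^'n) measure" ..
 interpret ml: pair_sigma_finite "lborel :: (real^'n) measure" mu ..
 let ?P = "PiM {..<n} (%_. mu)" let ?d = "real CARD('n)"
 \<comment> \<open>Balances the two terms of the inequality, of sizes
   \<open>ep * bw powr (- d)\<close> and \<open>1 / (n * ep)\<close>.\<close>
 define ep where "ep = bw powr (?d / 2) * n powr (- 1/2)"
 have ep: "ep > 0" using bw n by (simp add: ep_def)
 define a where "a w = exp (- (bw * l1norm w))" for w :: "real^'n"
 have a: "a w > 0" for w by (simp add: a_def)
 have [measurable]: "a \<in> bmeas" unfolding a_def[abs_def] by measurable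
 note [measurable] = ekern_measurable[of bw]
 define p where "p = (pbump N (%_. 0) :: real^'n => real)"
 have [measurable]: "p \<in> bmeas" unfolding p_def by measurable
 have p: "0 \<le> p x" "p x \<le> 1" for x unfolding p_def by (rule pbump_0_nonneg pbump_0_le_1)+
 define K where "K = exp (Dl * ?d) * M * bump_mass N TYPE('n)"
 have K0: "K \<ge> 0" using M0 bump_mass_pos[of N, where 'n = 'n] by (simp add: K_def)
 have inner: "(\<integral>\<^sup>+w. ennreal ((p (w - x /\<^sub>R bw))\<^sup>2) * ennreal (exp (bw * l1norm w)) \<partial>lborel) \<le> ennreal (exp (Dl * ?d) * bump_mass N TYPE('n)) * ennreal (exp (l1norm x))" for x
 proof -
 \<comment> \<open>On the support of the kernel \<open>w\<close> is within 1 of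
   \<open>x / bw\<close> in each coordinate, so \<open>bw * l1norm w\<close> exceeds
   \<open>l1norm x\<close> by at most \<open>bw * d\<close>.\<close>
 have pt: "(p (w - x /\<^sub>R bw))\<^sup>2 * exp (bw * l1norm w) \<le> exp (Dl * ?d) * exp (l1norm x) * p (w - x /\<^sub>R bw)" for w
 proof (cases "p (w - x /\<^sub>R bw) = 0")
 case False
 have "\<bar>(w - x /\<^sub>R bw) $ i\<bar> \<le> 1" for i
 using pbump_supp[of "%_. 0" N "w - x /\<^sub>R bw" i] False unfolding p_def by fastforce
 then have l: "l1norm (w - x /\<^sub>R bw) \<le> ?d" unfolding l1norm_def using sum_mono[of UNIV "%i. \<bar>(w - x /\<^sub>R bw) $ i\<bar>" "%_. 1"] by simp
 have "l1norm w \<le> l1norm (w - x /\<^sub>R bw) + l1norm (x /\<^sub>R bw)" using l1norm_triangle[of "w - x /\<^sub>R bw" "x /\<^sub>R bw"] by simp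
 then have "l1norm w \<le> ?d + l1norm x / bw" using l bw by (simp add: l1norm_scale divide_inverse mult.commute)
 then have "bw * l1norm w \<le> bw * ?d + l1norm x" using bw by (simp add: field_simps)
 also have "... \<le> Dl * ?d + l1norm x" using bw by simp
 finally have "exp (bw * l1norm w) \<le> exp (Dl * ?d) * exp (l1norm x)" by (simp flip: exp_add)
 moreover have "(p (w - x /\<^sub>R bw))\<^sup>2 \<le> p (w - x /\<^sub>R bw)"
 using p[of "w - x /\<^sub>R bw"] mult_left_le[of "p (w - x /\<^sub>R bw)" "p (w - x /\<^sub>R bw)"] by (simp add: power2_eq_square)
 ultimately have "(p (w - x /\<^sub>R bw))\<^sup>2 * exp (bw * l1norm w) \<le> p (w - x /\<^sub>R bw) * (exp (Dl * ?d) * exp (l1norm x))"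
 using p by (intro mult_mono) auto
 then show ?thesis by (simp add: mult_ac)
 qed simp
 have "(\<integral>\<^sup>+w. ennreal ((p (w - x /\<^sub>R bw))\<^sup>2) * ennreal (exp (bw * l1norm w)) \<partial>lborel) \<le> (\<integral>\<^sup>+w. ennreal (exp (Dl * ?d) * exp (l1norm x)) * ennreal (p (w - x /\<^sub>R bw)) \<partial>lborel)"
 using pt p by (intro nn_integral_mono) (simp flip: ennreal_mult)
 also have "... = ennreal (exp (Dl * ?d) * exp (l1norm x)) * (\<integral>\<^sup>+w. ennreal (p (w - x /\<^sub>R bw)) \<partial>lborel)"
 by (rule nn_integral_cmult) measurable
 also have "(\<integral>\<^sup>+w. ennreal (p (w - x /\<^sub>R bw)) \<partial>lborel) = (\<integral>\<^sup>+w. ennreal (p w) \<partial>lborel)"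
 proof -
 have "(\<integral>\<^sup>+w. ennreal (p w) \<partial>lborel) = (\<integral>\<^sup>+w. ennreal (p w) \<partial>distr lborel borel ((+) (- (x /\<^sub>R bw))))" by (simp only: lborel_distr_plus)
 also have "... = (\<integral>\<^sup>+w. ennreal (p (w - x /\<^sub>R bw)) \<partial>lborel)" by (subst nn_integral_distr) auto
 finally show ?thesis ..
 qed
 also have "(\<integral>\<^sup>+w. ennreal (p w) \<partial>lborel) = ennreal (bump_mass N TYPE('n))"
 unfolding bump_mass_def p_def by (rule nn_integral_eq_integral[OF pbump_integrable]) (auto simp: pbump_0_nonneg)
 finally show ?thesis using bump_mass_pos[of N, where 'n = 'n] by (simp add: mult_ac flip: ennreal_mult)
 qed
 have sq: "(\<integral>\<^sup>+w. (\<integral>\<^sup>+X. ennreal ((ekern N n mu bw X w)\<^sup>2) \<partial>?P) * ennreal (exp (bw * l1norm w)) \<partial>lborel) \<le> ennreal (K / n)"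
 proof -
 have "(\<integral>\<^sup>+w. (\<integral>\<^sup>+X. ennreal ((ekern N n mu bw X w)\<^sup>2) \<partial>?P) * ennreal (exp (bw * l1norm w)) \<partial>lborel)
 \<le> (\<integral>\<^sup>+w. ennreal (1 / n) * (\<integral>\<^sup>+x. ennreal ((p (w - x /\<^sub>R bw))\<^sup>2) * ennreal (exp (bw * l1norm w)) \<partial>mu) \<partial>lborel)"
 proof (rule nn_integral_mono)
 fix w
 have "(\<integral>\<^sup>+x. ennreal ((p (w - x /\<^sub>R bw))\<^sup>2) * ennreal (exp (bw * l1norm w)) \<partial>mu) = (\<integral>\<^sup>+x. ennreal ((p (w - x /\<^sub>R bw))\<^sup>2) \<partial>mu) * ennreal (exp (bw * l1norm w))"
 by (rule nn_integral_multc) measurable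
 then show "(\<integral>\<^sup>+X. ennreal ((ekern N n mu bw X w)\<^sup>2) \<partial>?P) * ennreal (exp (bw * l1norm w))
 \<le> ennreal (1 / n) * (\<integral>\<^sup>+x. ennreal ((p (w - x /\<^sub>R bw))\<^sup>2) * ennreal (exp (bw * l1norm w)) \<partial>mu)"
 using mult_right_mono[OF ekern_square[of bw w], of "ennreal (exp (bw * l1norm w))"] by (simp add: p_def mult.assoc)
 qed
 also have "... = ennreal (1 / n) * (\<integral>\<^sup>+w. (\<integral>\<^sup>+x. ennreal ((p (w - x /\<^sub>R bw))\<^sup>2) * ennreal (exp (bw * l1norm w)) \<partial>mu) \<partial>lborel)"
 by (rule nn_integral_cmult) measurable
 also have "... \<le> ennreal (1 / n) * ennreal K"
 proof (rule mult_left_mono)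
 have "(\<integral>\<^sup>+w. (\<integral>\<^sup>+x. ennreal ((p (w - x /\<^sub>R bw))\<^sup>2) * ennreal (exp (bw * l1norm w)) \<partial>mu) \<partial>lborel)
 = (\<integral>\<^sup>+x. (\<integral>\<^sup>+w. ennreal ((p (w - x /\<^sub>R bw))\<^sup>2) * ennreal (exp (bw * l1norm w)) \<partial>lborel) \<partial>mu)"
 by (rule ml.Fubini'[symmetric]) measurable
 also have "... \<le> (\<integral>\<^sup>+x. ennreal (exp (Dl * ?d) * bump_mass N TYPE('n)) * ennreal (exp (l1norm x)) \<partial>mu)"
 by (intro nn_integral_mono inner)
 also have "... = ennreal (exp (Dl * ?d) * bump_mass N TYPE('n)) * (\<integral>\<^sup>+x. ennreal (exp (l1norm x)) \<partial>mu)"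
 by (rule nn_integral_cmult) measurable
 also have "... \<le> ennreal (exp (Dl * ?d) * bump_mass N TYPE('n)) * ennreal M" by (intro mult_left_mono M) auto
 also have "... = ennreal K" using M0 bump_mass_pos[of N, where 'n = 'n]
 by (simp add: K_def mult_ac flip: ennreal_mult)
 finally show "(\<integral>\<^sup>+w. (\<integral>\<^sup>+x. ennreal ((p (w - x /\<^sub>R bw))\<^sup>2) * ennreal (exp (bw * l1norm w)) \<partial>mu) \<partial>lborel) \<le> ennreal K" .
 qed simp
 also have "... = ennreal (K / n)" using K0 by (simp flip: ennreal_mult)
 finally show ?thesis .
 qed
 have pw: "ennreal \<bar>ekern N n mu bw X w\<bar> \<le> ennreal (ep / 2) * ennreal (a w) + ennreal (1 / (2 * ep)) * (ennreal ((ekern N n mu bw X w)\<^sup>2) * ennreal (exp (bw * l1norm w)))" for X w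
 proof -
 have "\<bar>ekern N n mu bw X w\<bar> \<le> (ep * a w + (ekern N n mu bw X w)\<^sup>2 / (ep * a w)) / 2" using ep a by (intro amgm_weight mult_pos_pos)
 also have "... = ep / 2 * a w + 1 / (2 * ep) * ((ekern N n mu bw X w)\<^sup>2 * exp (bw * l1norm w))"
 using ep by (simp add: a_def exp_minus field_simps)
 finally have "ennreal \<bar>ekern N n mu bw X w\<bar> \<le> ennreal (ep / 2 * a w + 1 / (2 * ep) * ((ekern N n mu bw X w)\<^sup>2 * exp (bw * l1norm w)))" by (rule ennreal_leI)
 then show ?thesis using ep a[of w] by (simp add: less_imp_le flip: ennreal_mult ennreal_plus)
 qed
 have "(\<integral>\<^sup>+X. (\<integral>\<^sup>+w. ennreal \<bar>ekern N n mu bw X w\<bar> \<partial>lborel) \<partial>?P) = (\<integral>\<^sup>+w. (\<integral>\<^sup>+X. ennreal \<bar>ekern N n mu bw X w\<bar> \<partial>?P) \<partial>lborel)"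
 by (rule Fubini'[symmetric]) measurable
 also have "... \<le> (\<integral>\<^sup>+w. ennreal (ep / 2) * ennreal (a w) + ennreal (1 / (2 * ep)) * ((\<integral>\<^sup>+X. ennreal ((ekern N n mu bw X w)\<^sup>2) \<partial>?P) * ennreal (exp (bw * l1norm w))) \<partial>lborel)"
 proof (rule nn_integral_mono)
 fix w :: "real^'n"
 have em[measurable]: "(%X. ekern N n mu bw X w) \<in> borel_measurable ?P"
 using measurable_compose[OF measurable_Pair2'[of w lborel ?P] ekern_measurable] by simp
 have "(\<integral>\<^sup>+X. ennreal \<bar>ekern N n mu bw X w\<bar> \<partial>?P) \<le> (\<integral>\<^sup>+X. ennreal (ep / 2) * ennreal (a w) + ennreal (1 / (2 * ep)) * (ennreal ((ekern N n mu bw X w)\<^sup>2) * ennreal (exp (bw * l1norm w))) \<partial>?P)"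
 by (intro nn_integral_mono pw)
 also have "... = ennreal (ep / 2) * ennreal (a w) + ennreal (1 / (2 * ep)) * ((\<integral>\<^sup>+X. ennreal ((ekern N n mu bw X w)\<^sup>2) \<partial>?P) * ennreal (exp (bw * l1norm w)))"
 by (subst nn_integral_add) (auto simp: nn_integral_cmult nn_integral_multc PP.emeasure_space_1)
 finally show "(\<integral>\<^sup>+X. ennreal \<bar>ekern N n mu bw X w\<bar> \<partial>?P) \<le> ..." .
 qed
 also have "... = ennreal (ep / 2) * (\<integral>\<^sup>+w. ennreal (a w) \<partial>lborel) + ennreal (1 / (2 * ep)) * (\<integral>\<^sup>+w. (\<integral>\<^sup>+X. ennreal ((ekern N n mu bw X w)\<^sup>2) \<partial>?P) * ennreal (exp (bw * l1norm w)) \<partial>lborel)"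
 by (subst nn_integral_add) (auto simp: nn_integral_cmult)
 also have "... \<le> ennreal (ep / 2) * ennreal ((2 / bw) ^ CARD('n)) + ennreal (1 / (2 * ep)) * ennreal (K / n)"
 unfolding a_def nn_integral_exp_l1[OF bw(1)] by (intro add_mono mult_left_mono sq) auto
 also have "... = ennreal (ep / 2 * (2 / bw) ^ CARD('n) + 1 / (2 * ep) * (K / n))"
 using ep bw K0 by (simp add: less_imp_le flip: ennreal_mult ennreal_plus)
 also have "... \<le> ennreal ((2 ^ CARD('n) + K) * (n powr (- 1/2) * bw powr (- ?d / 2)))"
 proof (rule ennreal_leI)
 have e1: "ep * (2 / bw) ^ CARD('n) = 2 ^ CARD('n) * (n powr (- 1/2) * bw powr (- ?d / 2))"
 proof -
 have "bw powr (?d / 2) / bw ^ CARD('n) = bw powr (- ?d / 2)"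
 using bw by (simp add: powr_realpow[symmetric] powr_diff[symmetric])
 moreover have "ep * (2 / bw) ^ CARD('n) = 2 ^ CARD('n) * (n powr (- 1/2) * (bw powr (?d / 2) / bw ^ CARD('n)))"
 by (simp add: ep_def power_divide)
 ultimately show ?thesis by simp
 qed
 have e2: "1 / ep * (K / n) = K * (n powr (- 1/2) * bw powr (- ?d / 2))"
 proof -
 have a: "n powr (- 1/2) * n powr (- 1/2) = 1 / n" using n by (simp add: powr_minus_divide flip: powr_add)
 have "n powr (- 1/2) > 0" using n by simp
 then have "1 / n powr (- 1/2) * (1 / n) = n powr (- 1/2)" unfolding a[symmetric] by simp
 moreover have "1 / bw powr (?d / 2) = bw powr (- ?d / 2)" using bw by (simp add: powr_minus_divide)
 moreover have "1 / ep * (K / n) = K * ((1 / n powr (- 1/2) * (1 / n)) * (1 / bw powr (?d / 2)))"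
 by (simp add: ep_def)
 ultimately show ?thesis by simp
 qed
 let ?R = "n powr (- 1/2) * bw powr (- ?d / 2)"
 have "ep / 2 * (2 / bw) ^ CARD('n) + 1 / (2 * ep) * (K / n) = (ep * (2 / bw) ^ CARD('n) + 1 / ep * (K / n)) / 2" using ep by (simp add: field_simps)
 also have "... = (2 ^ CARD('n) + K) * ?R / 2" unfolding e1 e2 by (simp add: distrib_right)
 also have "... \<le> (2 ^ CARD('n) + K) * ?R" using K0 by (simp add: mult_nonneg_nonneg)
 finally show "ep / 2 * (2 / bw) ^ CARD('n) + 1 / (2 * ep) * (K / n) \<le> (2 ^ CARD('n) + K) * ?R" .
 qed
 finally show ?thesis by (simp add: K_def)
qed

lemma moll_unscaled:
 fixes f :: "real^'n => real"
 assumes bw: "bw > 0" and [measurable]: "f \<in> bmeas"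
 shows "moll N (%_. 0) bw f x = (LBINT w. f (bw *\<^sub>R w) * pbump N (%_. 0) (w - x /\<^sub>R bw)) / bump_mass N TYPE('n)"
proof -
 have "(LBINT z. f (x + bw *\<^sub>R z) * pbump N (%_. 0) z)
 = (\<integral>w. f (x + bw *\<^sub>R (w + - (x /\<^sub>R bw))) * pbump N (%_. 0) (w + - (x /\<^sub>R bw)) \<partial>lborel)"
 by (rule lborel_shift(2)[symmetric, of "%z. f (x + bw *\<^sub>R z) * pbump N (%_. 0) z"]) measurable
 then show ?thesis using bw by (simp add: moll_def scaleR_add_right scaleR_diff_right)
qed

lemma shifted_bump:
 shows "integrable lborel (%w. pbump N (%_. 0) (w - v :: real^'n))" "(LBINT w. pbump N (%_. 0) (w - v :: real^'n)) = bump_mass N TYPE('n)"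
 using lborel_shift[of "pbump N (%_. 0) :: real^'n => real" "- v"] pbump_integrable[of "%_ :: 'n. 0" N] by (simp_all add: bump_mass_def)

lemma bump_pair_integrable:
 fixes h :: "real^'n => real"
 assumes [measurable]: "h \<in> bmeas" and h: "!!x. \<bar>h x\<bar> \<le> b"
 shows "integrable (lborel \<Otimes>\<^sub>M mu) (%(w, x). h (bw *\<^sub>R w) * pbump N (%_. 0) (w - x /\<^sub>R bw))"
proof -
 interpret mu: prob_space mu by (rule mu)
 interpret ml: pair_sigma_finite "lborel :: (real^'n) measure" mu ..
 let ?p = "pbump N (%_ :: 'n. 0)"
 have "(\<integral>\<^sup>+z. ennreal (norm ((%(w, x). ?p (w - x /\<^sub>R bw)) z)) \<partial>(lborel \<Otimes>\<^sub>M mu)) = (\<integral>\<^sup>+x. (\<integral>\<^sup>+w. ennreal (?p (w - x /\<^sub>R bw)) \<partial>lborel) \<partial>mu)"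
 by (subst ml.nn_integral_snd[symmetric]) (auto simp: pbump_0_nonneg)
 also have "... = (\<integral>\<^sup>+x. ennreal (bump_mass N TYPE('n)) \<partial>mu)"
 by (intro nn_integral_cong) (subst nn_integral_eq_integral, auto simp: shifted_bump pbump_0_nonneg)
 also have "... < \<infinity>" by (simp add: mu.emeasure_space_1)
 finally have int: "integrable (lborel \<Otimes>\<^sub>M mu) (%(w, x). ?p (w - x /\<^sub>R bw))"
 by (intro integrableI_bounded) auto
 have "integrable (lborel \<Otimes>\<^sub>M mu) (%z. h (bw *\<^sub>R fst z) * (%(w, x). ?p (w - x /\<^sub>R bw)) z)"
 by (rule integrable_bounded_mult[OF int, of _ b]) (use h in auto)
 then show ?thesis by (simp add: case_prod_beta')
qed

text \<open>By Fubini the deviation of a mollified \<open>h\<close> is the integral of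
  \<open>h\<close> against \<open>ekern\<close>. The random factor on the right does not depend on
  \<open>h\<close>, so the bound is uniform over all functions bounded by \<open>b\<close> before
  any expectation is taken.\<close>

lemma ekern_moll:
 fixes h :: "real^'n => real"
 assumes bw: "bw > 0" and hm[measurable]: "h \<in> bmeas" and h: "!!x. \<bar>h x\<bar> \<le> b"
 shows "ennreal \<bar>(\<Sum>i<n. moll N (%_. 0) bw h (X i)) / n - (\<integral>x. moll N (%_. 0) bw h x \<partial>mu)\<bar>
 \<le> ennreal (b / bump_mass N TYPE('n)) * (\<integral>\<^sup>+w. ennreal \<bar>ekern N n mu bw X w\<bar> \<partial>lborel)"
proof -
 interpret mu: prob_space mu by (rule mu)
 interpret ml: pair_sigma_finite "lborel :: (real^'n) measure" mu ..
 let ?c = "bump_mass N TYPE('n)" let ?p = "pbump N (%_ :: 'n. 0)"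
 have c: "?c > 0" by (rule bump_mass_pos)
 have b0: "b \<ge> 0" using h[of 0] by linarith
 define P where "P w = (\<integral>x. ?p (w - x /\<^sub>R bw) \<partial>mu)" for w
 have [measurable]: "P \<in> bmeas" unfolding P_def[abs_def] by measurable
 note pi = bump_pair_integrable[OF hm h, of bw]
 note pi1 = bump_pair_integrable[of "%_. 1" 1 bw]
 have Pint: "integrable lborel P"
 using ml.integrable_fst'[OF pi1] by (simp add: P_def[abs_def])
 have i1: "integrable lborel (%w. h (bw *\<^sub>R w) * ?p (w - v))" for v
 by (rule integrable_bounded_mult[OF shifted_bump(1), of _ b]) (use h in auto)
 have i2: "integrable lborel (%w. h (bw *\<^sub>R w) * P w)"
 by (rule integrable_bounded_mult[OF Pint, of _ b]) (use h in auto)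
 have "(\<integral>x. moll N (%_. 0) bw h x \<partial>mu) = (\<integral>x. (LBINT w. h (bw *\<^sub>R w) * ?p (w - x /\<^sub>R bw)) \<partial>mu) / ?c"
 unfolding moll_unscaled[OF bw hm] by simp
 also have "(\<integral>x. (LBINT w. h (bw *\<^sub>R w) * ?p (w - x /\<^sub>R bw)) \<partial>mu) = (\<integral>w. (\<integral>x. h (bw *\<^sub>R w) * ?p (w - x /\<^sub>R bw) \<partial>mu) \<partial>lborel)"
 by (rule ml.Fubini_integral[OF pi])
 also have "... = (LBINT w. h (bw *\<^sub>R w) * P w)" by (simp add: P_def)
 finally have 2: "(\<integral>x. moll N (%_. 0) bw h x \<partial>mu) = (LBINT w. h (bw *\<^sub>R w) * P w) / ?c" .
 have "(\<Sum>i<n. moll N (%_. 0) bw h (X i)) = (\<Sum>i<n. \<integral>w. h (bw *\<^sub>R w) * ?p (w - X i /\<^sub>R bw) \<partial>lborel) / ?c"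
 unfolding moll_unscaled[OF bw hm] by (simp add: sum_divide_distrib)
 also have "(\<Sum>i<n. \<integral>w. h (bw *\<^sub>R w) * ?p (w - X i /\<^sub>R bw) \<partial>lborel) = (LBINT w. (\<Sum>i<n. h (bw *\<^sub>R w) * ?p (w - X i /\<^sub>R bw)))"
 by (rule Bochner_Integration.integral_sum[symmetric]) (rule i1)
 finally have 1: "(\<Sum>i<n. moll N (%_. 0) bw h (X i)) / n = (LBINT w. (\<Sum>i<n. h (bw *\<^sub>R w) * ?p (w - X i /\<^sub>R bw)) / n) / ?c" by simp
 have i3: "integrable lborel (%w. (\<Sum>i<n. h (bw *\<^sub>R w) * ?p (w - X i /\<^sub>R bw)) / n)"
 by (intro integrable_divide Bochner_Integration.integrable_sum i1)
 have eq: "(\<Sum>i<n. h (bw *\<^sub>R w) * ?p (w - X i /\<^sub>R bw)) / n - h (bw *\<^sub>R w) * P w = h (bw *\<^sub>R w) * ekern N n mu bw X w" for w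
 by (simp add: ekern_def P_def right_diff_distrib sum_distrib_left)
 have "(LBINT w. (\<Sum>i<n. h (bw *\<^sub>R w) * ?p (w - X i /\<^sub>R bw)) / n) - (LBINT w. h (bw *\<^sub>R w) * P w)
 = (LBINT w. h (bw *\<^sub>R w) * ekern N n mu bw X w)"
 unfolding eq[symmetric] by (rule Bochner_Integration.integral_diff[OF i3 i2, symmetric])
 then have D: "(\<Sum>i<n. moll N (%_. 0) bw h (X i)) / n - (\<integral>x. moll N (%_. 0) bw h x \<partial>mu) = (LBINT w. h (bw *\<^sub>R w) * ekern N n mu bw X w) / ?c"
 unfolding 1 2 diff_divide_distrib[symmetric] by (simp only:)
 have i4: "integrable lborel (%w. h (bw *\<^sub>R w) * ekern N n mu bw X w)"
 unfolding eq[symmetric] by (intro Bochner_Integration.integrable_diff i3 i2)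
 have em: "(%w. ekern N n mu bw X w) \<in> borel_measurable lborel"
 unfolding ekern_def by measurable
 have "ennreal \<bar>\<integral>w. h (bw *\<^sub>R w) * ekern N n mu bw X w \<partial>lborel\<bar> \<le> (\<integral>\<^sup>+w. ennreal \<bar>h (bw *\<^sub>R w) * ekern N n mu bw X w\<bar> \<partial>lborel)"
 using integral_norm_bound_ennreal[OF i4] by simp
 also have "... \<le> (\<integral>\<^sup>+w. ennreal b * ennreal \<bar>ekern N n mu bw X w\<bar> \<partial>lborel)"
 using h b0 by (intro nn_integral_mono) (auto simp: abs_mult simp flip: ennreal_mult intro!: ennreal_leI mult_right_mono)
 also have "... = ennreal b * (\<integral>\<^sup>+w. ennreal \<bar>ekern N n mu bw X w\<bar> \<partial>lborel)"
 by (rule nn_integral_cmult) (use em in measurable)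
 finally have fin: "ennreal \<bar>\<integral>w. h (bw *\<^sub>R w) * ekern N n mu bw X w \<partial>lborel\<bar> \<le> ennreal b * (\<integral>\<^sup>+w. ennreal \<bar>ekern N n mu bw X w\<bar> \<partial>lborel)" .
 have "ennreal \<bar>(LBINT w. h (bw *\<^sub>R w) * ekern N n mu bw X w) / ?c\<bar> = ennreal (1 / ?c) * ennreal \<bar>\<integral>w. h (bw *\<^sub>R w) * ekern N n mu bw X w \<partial>lborel\<bar>"
 using c by (simp add: abs_divide flip: ennreal_mult)
 also have "... \<le> ennreal (1 / ?c) * (ennreal b * (\<integral>\<^sup>+w. ennreal \<bar>ekern N n mu bw X w\<bar> \<partial>lborel))" by (intro mult_left_mono fin) simp
 also have "... = ennreal (b / ?c) * (\<integral>\<^sup>+w. ennreal \<bar>ekern N n mu bw X w\<bar> \<partial>lborel)"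
 using c b0 by (simp add: mult.assoc[symmetric] flip: ennreal_mult)
 finally show ?thesis unfolding D .
qed

end

section \<open>Linearity and commutation of the smoothing operators\<close>

lemma moll_0_cont:
 fixes f :: "real^'n::finite => real"
 assumes "bw > 0" "continuous_on UNIV f" "!!x. \<bar>f x\<bar> \<le> B" "N \<ge> 1"
 shows "continuous_on UNIV (moll N (%_. 0) bw f)"
 by (rule has_derivative_continuous_on_UNIV[OF moll_has_derivative_kernel[OF assms(1-3)]]) (use assms in auto)

lemma moll_0_sum:
 fixes f :: "'a => real^'n::finite => real"
 assumes bw: "bw > 0" and f: "!!l. l \<in> A ==> continuous_on UNIV (f l)" "!!l x. l \<in> A ==> \<bar>f l x\<bar> \<le> B l"
 shows "moll N (%_. 0) bw (%x. \<Sum>l\<in>A. a l * f l x) x = (\<Sum>l\<in>A. a l * moll N (%_. 0) bw (f l) x)"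
proof -
 have int: "integrable lborel (%z. f l (x + bw *\<^sub>R z) * pbump N (%_. 0) z)" if "l \<in> A" for l
 by (rule moll_integrable[OF bw f[OF that]]) simp
 have "(LBINT z. (\<Sum>l\<in>A. a l * f l (x + bw *\<^sub>R z)) * pbump N (%_. 0) z) = (\<integral>z. (\<Sum>l\<in>A. a l * (f l (x + bw *\<^sub>R z) * pbump N (%_. 0) z)) \<partial>lborel)"
 by (simp add: sum_distrib_right mult.assoc)
 also have "... = (\<Sum>l\<in>A. \<integral>z. a l * (f l (x + bw *\<^sub>R z) * pbump N (%_. 0) z) \<partial>lborel)"
 by (rule Bochner_Integration.integral_sum) (rule integrable_mult_right[OF int])
 also have "... = (\<Sum>l\<in>A. a l * (LBINT z. f l (x + bw *\<^sub>R z) * pbump N (%_. 0) z))"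
 by simp
 finally show ?thesis by (simp add: moll_def sum_divide_distrib)
qed

lemma moll_0_commute:
 fixes f :: "real^'n::finite => real"
 assumes f: "continuous_on UNIV f" "!!x. \<bar>f x\<bar> \<le> B"
 shows "moll N (%_. 0) bw (moll N (%_. 0) bw' f) x = moll N (%_. 0) bw' (moll N (%_. 0) bw f) x"
proof -
 let ?p = "pbump N (%_ :: 'n. 0)"
 have [measurable]: "f \<in> bmeas" by (rule borel_measurable_continuous_onI[OF f(1)])
 have ip: "integrable lborel ?p" by (rule pbump_integrable) simp
 have "integrable (lborel \<Otimes>\<^sub>M lborel) (%(y, z). ?p y * ?p z)"
 proof (rule lborel_pair.Fubini_integrable)
 show "AE y in lborel. integrable lborel (%z. case (y, z) of (y, z) => ?p y * ?p z)" using ip by simp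
 show "integrable lborel (%y. \<integral>z. norm (case (y, z) of (y, z) => ?p y * ?p z) \<partial>lborel)" using ip by (simp add: abs_mult)
 qed measurable
 then have "integrable (lborel \<Otimes>\<^sub>M lborel) (%w. f (x + bw *\<^sub>R snd w + bw' *\<^sub>R fst w) * (%(y, z). ?p y * ?p z) w)"
 by (rule integrable_bounded_mult[of _ _ _ B]) (use f(2) in auto)
 then have int: "integrable (lborel \<Otimes>\<^sub>M lborel) (%(y, z). f (x + bw *\<^sub>R z + bw' *\<^sub>R y) * (?p y * ?p z))"
 by (simp add: case_prod_beta')
 have "(\<integral>z. (\<integral>y. f (x + bw *\<^sub>R z + bw' *\<^sub>R y) * ?p y \<partial>lborel) * ?p z \<partial>lborel) = (\<integral>z. (\<integral>y. f (x + bw *\<^sub>R z + bw' *\<^sub>R y) * (?p y * ?p z) \<partial>lborel) \<partial>lborel)"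
 by (simp add: mult.assoc[symmetric])
 also have "... = (\<integral>y. (\<integral>z. f (x + bw *\<^sub>R z + bw' *\<^sub>R y) * (?p y * ?p z) \<partial>lborel) \<partial>lborel)"
 by (rule lborel_pair.Fubini_integral[OF int])
 also have "... = (\<integral>y. (\<integral>z. f (x + bw' *\<^sub>R y + bw *\<^sub>R z) * ?p z * ?p y \<partial>lborel) \<partial>lborel)"
 by (simp add: mult_ac add_ac)
 also have "... = (\<integral>y. (\<integral>z. f (x + bw' *\<^sub>R y + bw *\<^sub>R z) * ?p z \<partial>lborel) * ?p y \<partial>lborel)"
 by simp
 finally show ?thesis by (simp add: moll_def)
qed

lemma lowpass_cont_bounded:
 fixes f :: "real^'n::finite => real"
 assumes bw: "bw > 0" and f: "continuous_on UNIV f" "!!x. \<bar>f x\<bar> \<le> B" and N: "N \<ge> 1"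
 shows "continuous_on UNIV (lowpass N m bw f)" "\<bar>lowpass N m bw f x\<bar> \<le> (\<Sum>j\<in>{1..m}. \<bar>fdiff_coeff m j\<bar>) * B"
proof -
 have "continuous_on UNIV (moll N (%_. 0) (real j * bw) f)" if "j \<in> {1..m}" for j
 by (rule moll_0_cont[OF _ f N]) (use that bw in auto)
 then show "continuous_on UNIV (lowpass N m bw f)" unfolding lowpass_def[abs_def]
 by (intro continuous_on_sum continuous_on_mult_left) auto
 have [measurable]: "f \<in> bmeas" by (rule borel_measurable_continuous_onI[OF f(1)])
 have "\<bar>lowpass N m bw f x\<bar> \<le> (\<Sum>j\<in>{1..m}. \<bar>fdiff_coeff m j\<bar> * B)"
 unfolding lowpass_def
 by (rule order_trans[OF sum_abs], rule sum_mono) (auto simp: abs_mult power_abs intro!: mult_left_mono moll_0_bounded f(2))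
 then show "\<bar>lowpass N m bw f x\<bar> \<le> (\<Sum>j\<in>{1..m}. \<bar>fdiff_coeff m j\<bar>) * B" by (simp add: sum_distrib_right)
qed

lemma lowpass_diff:
 fixes f g :: "real^'n::finite => real"
 assumes bw: "bw > 0" and f: "continuous_on UNIV f" "!!x. \<bar>f x\<bar> \<le> B" and g: "continuous_on UNIV g" "!!x. \<bar>g x\<bar> \<le> B'"
 shows "lowpass N m bw (%x. f x - g x) x = lowpass N m bw f x - lowpass N m bw g x"
proof -
 have "moll N (%_. 0) (real j * bw) (%x. f x - g x) x = moll N (%_. 0) (real j * bw) f x - moll N (%_. 0) (real j * bw) g x"
 if "j \<in> {1..m}" for j
 using moll_0_sum[of "real j * bw" "{True, False}" "%c. if c then f else g" "%c. if c then B else B'" N "%c. if c then 1 else -1" x] that bw f g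
 by simp
 then show ?thesis unfolding lowpass_def by (simp add: right_diff_distrib flip: sum_subtractf)
qed

lemma lowpass_commute:
 fixes f :: "real^'n::finite => real"
 assumes bw: "bw > 0" "bw' > 0" and f: "continuous_on UNIV f" "!!x. \<bar>f x\<bar> \<le> B" and N: "N \<ge> 1"
 shows "lowpass N m bw (lowpass N m bw' f) x = lowpass N m bw' (lowpass N m bw f) x"
proof -
 define c where "c j = - ((- 1) ^ m * fdiff_coeff m j)" for j
 have meas: "f \<in> bmeas" by (rule borel_measurable_continuous_onI[OF f(1)])
 have e: "lowpass N m a (lowpass N m b f) x = (\<Sum>j\<in>{1..m}. \<Sum>l\<in>{1..m}. c j * c l * moll N (%_. 0) (real j * a) (moll N (%_. 0) (real l * b) f) x)"
 if "a > 0" "b > 0" for a b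
 proof -
 have "moll N (%_. 0) (real j * a) (lowpass N m b f) x = (\<Sum>l\<in>{1..m}. c l * moll N (%_. 0) (real j * a) (moll N (%_. 0) (real l * b) f) x)" if j: "j \<in> {1..m}" for j
 unfolding lowpass_def[abs_def] c_def[symmetric]
 by (rule moll_0_sum[where B = "%_. B"]) (use j \<open>a > 0\<close> \<open>b > 0\<close> in \<open>auto intro!: moll_0_cont[OF _ f N] moll_0_bounded[OF meas f(2)]\<close>)
 then show ?thesis
 unfolding lowpass_def[of _ _ a] c_def[symmetric] by (simp add: sum_distrib_left mult.assoc)
 qed
 show ?thesis unfolding e[OF bw] e[OF bw(2,1)]
 by (subst sum.swap, intro sum.cong refl, subst moll_0_commute[OF f]) (simp add: mult_ac)
qed

lemma empirical_integral:
 fixes f :: "real^'n::finite => real"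
 assumes [measurable]: "f \<in> bmeas" and n: "n > 0"
 shows "integral\<^sup>L (empirical n X) f = (\<Sum>i<n. f (X i)) / n"
proof -
 have X: "X \<in> measurable (uniform_count_measure {..<n}) borel" by (auto simp: measurable_def space_uniform_count_measure sets_uniform_count_measure)
 have "integral\<^sup>L (empirical n X) f = (\<integral>i. f (X i) \<partial>uniform_count_measure {..<n})"
 unfolding empirical_def by (rule integral_distr[OF X]) measurable
 also have "... = (\<Sum>i<n. f (X i)) / n"
 by (simp add: uniform_count_measure_def lebesgue_integral_point_measure_finite sum_divide_distrib)
 finally show ?thesis .
qed

text \<open>A random bound for deviations at scale \<open>bw\<close>, free of the test function: it
  collects the scales \<open>j * bw\<close> that enter \<open>lowpass\<close>.\<close>

definition lowdev :: "nat => nat => nat => (real^'n::finite) measure => real => (nat => real^'n) => ennreal" where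
 "lowdev N m n mu bw X = (\<Sum>j\<in>{1..m}. ennreal (\<bar>fdiff_coeff m j\<bar> / bump_mass N TYPE('n)) *
 (\<integral>\<^sup>+w. ennreal \<bar>ekern N n mu (real j * bw) X w\<bar> \<partial>lborel))"

definition empdev :: "nat => (real^'n::finite) measure => (nat => real^'n) => (real^'n => real) => real" where
 "empdev n mu X f = (\<Sum>i<n. f (X i)) / n - (\<integral>x. f x \<partial>mu)"

definition lowdev_const :: "'n::finite itself => nat => nat => real => real" where
 "lowdev_const _ N m M = (\<Sum>j\<in>{1..m}. \<bar>fdiff_coeff m j\<bar> / bump_mass N TYPE('n) *
 (2 ^ CARD('n) + exp (real m * CARD('n)) * M * bump_mass N TYPE('n)))"

lemma lowdev_const_nonneg: "M \<ge> 0 ==> lowdev_const TYPE('n::finite) N m M \<ge> 0"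
 unfolding lowdev_const_def using bump_mass_pos[of N, where 'n = 'n] by (intro sum_nonneg mult_nonneg_nonneg add_nonneg_nonneg) auto

context
 fixes mu :: "(real^'n::finite) measure" and N m n :: nat and M :: real
 assumes mu: "prob_space mu" and smu[measurable_cong, simp]: "sets mu = sets borel" and n: "n > 0"
 and M: "(\<integral>\<^sup>+x. ennreal (exp (l1norm x)) \<partial>mu) \<le> ennreal M" and M0: "M \<ge> 0" and N: "N \<ge> 1"
begin

lemma cont_integrable:
 fixes f :: "real^'n => real"
 assumes "continuous_on UNIV f" "!!x. \<bar>f x\<bar> \<le> B"
 shows "integrable mu f"
proof -
 interpret mu: prob_space mu by (rule mu)
 have [measurable]: "f \<in> bmeas" by (rule borel_measurable_continuous_onI[OF assms(1)])
 show ?thesis by (rule mu.integrable_const_bound[of _ B]) (use assms(2) in auto)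
qed

lemma empdev_diff:
 fixes f g :: "real^'n => real"
 assumes "continuous_on UNIV f" "!!x. \<bar>f x\<bar> \<le> B" "continuous_on UNIV g" "!!x. \<bar>g x\<bar> \<le> B'"
 shows "empdev n mu X (%x. f x - g x) = empdev n mu X f - empdev n mu X g"
 using cont_integrable[OF assms(1,2)] cont_integrable[OF assms(3,4)]
 by (simp add: empdev_def sum_subtractf diff_divide_distrib)

lemma empdev_bound:
 fixes f :: "real^'n => real"
 assumes "continuous_on UNIV f" "!!x. \<bar>f x\<bar> \<le> B"
 shows "\<bar>empdev n mu X f\<bar> \<le> 2 * B"
proof -
 interpret mu: prob_space mu by (rule mu)
 have "\<bar>\<Sum>i<n. f (X i)\<bar> \<le> (\<Sum>i<n. B)" by (rule order_trans[OF sum_abs sum_mono]) (rule assms)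
 then have "\<bar>\<Sum>i<n. f (X i)\<bar> / n \<le> B" using n by (simp add: divide_le_eq mult.commute)
 moreover have "\<bar>\<integral>x. f x \<partial>mu\<bar> \<le> (\<integral>x. B \<partial>mu)"
 by (rule integral_abs_bound[THEN order_trans], rule integral_mono) (use assms cont_integrable[OF assms] in auto)
 then have "\<bar>\<integral>x. f x \<partial>mu\<bar> \<le> B" by (simp add: mu.prob_space)
 moreover have "\<bar>(\<Sum>i<n. f (X i)) / n\<bar> = \<bar>\<Sum>i<n. f (X i)\<bar> / n" by (simp add: abs_divide)
 ultimately show ?thesis unfolding empdev_def by linarith
qed

lemma empdev_lowpass:
 fixes h :: "real^'n => real"
 assumes bw: "bw > 0" and h: "continuous_on UNIV h" "!!x. \<bar>h x\<bar> \<le> b"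
 shows "ennreal \<bar>empdev n mu X (lowpass N m bw h)\<bar> \<le> ennreal b * lowdev N m n mu bw X"
proof -
 interpret mu: prob_space mu by (rule mu)
 have hm: "h \<in> bmeas" by (rule borel_measurable_continuous_onI[OF h(1)])
 have b0: "b \<ge> 0" using h(2)[of 0] by linarith
 define A where "A j = moll N (%_ :: 'n. 0) (real j * bw) h" for j
 have A: "integrable mu (A j)" if "j \<in> {1..m}" for j
 unfolding A_def using that bw by (intro cont_integrable[of _ b] moll_0_cont[OF _ h N] moll_0_bounded hm h(2)) auto
 have "empdev n mu X (lowpass N m bw h) = (\<Sum>j\<in>{1..m}. - ((- 1) ^ m * fdiff_coeff m j) * empdev n mu X (A j))"
 proof -
 have "(\<integral>x. lowpass N m bw h x \<partial>mu) = (\<Sum>j\<in>{1..m}. - ((- 1) ^ m * fdiff_coeff m j) * (\<integral>x. A j x \<partial>mu))"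
 unfolding lowpass_def A_def[symmetric]
 by (subst Bochner_Integration.integral_sum) (rule integrable_mult_right, rule A, simp_all)
 moreover have "(\<Sum>i<n. lowpass N m bw h (X i)) / n = (\<Sum>j\<in>{1..m}. - ((- 1) ^ m * fdiff_coeff m j) * ((\<Sum>i<n. A j (X i)) / n))"
 unfolding lowpass_def A_def[symmetric] by (subst sum.swap) (simp add: sum_distrib_left sum_divide_distrib)
 ultimately show ?thesis unfolding empdev_def by (simp only: right_diff_distrib sum_subtractf)
 qed
 then have "ennreal \<bar>empdev n mu X (lowpass N m bw h)\<bar> \<le> ennreal (\<Sum>j\<in>{1..m}. \<bar>fdiff_coeff m j\<bar> * \<bar>empdev n mu X (A j)\<bar>)"
 by (intro ennreal_leI) (simp only:, rule order_trans[OF sum_abs], simp add: abs_mult power_abs)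
 also have "... = (\<Sum>j\<in>{1..m}. ennreal \<bar>fdiff_coeff m j\<bar> * ennreal \<bar>empdev n mu X (A j)\<bar>)"
 by (simp add: ennreal_mult flip: sum_ennreal)
 also have "... \<le> (\<Sum>j\<in>{1..m}. ennreal \<bar>fdiff_coeff m j\<bar> * (ennreal (b / bump_mass N TYPE('n)) * (\<integral>\<^sup>+w. ennreal \<bar>ekern N n mu (real j * bw) X w\<bar> \<partial>lborel)))"
 unfolding empdev_def A_def
 by (intro sum_mono mult_left_mono ekern_moll[OF mu smu n M M0 _ hm h(2)]) (use bw in auto)
 also have "... = ennreal b * lowdev N m n mu bw X"
 proof -
 have "ennreal \<bar>fdiff_coeff m j\<bar> * (ennreal (b / bump_mass N TYPE('n)) * w) = ennreal b * (ennreal (\<bar>fdiff_coeff m j\<bar> / bump_mass N TYPE('n)) * w)" for j w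
 proof -
 have "ennreal \<bar>fdiff_coeff m j\<bar> * ennreal (b / bump_mass N TYPE('n)) = ennreal b * ennreal (\<bar>fdiff_coeff m j\<bar> / bump_mass N TYPE('n))"
 using b0 bump_mass_pos[of N, where 'n = 'n] by (simp flip: ennreal_mult)
 then show ?thesis by (simp only: mult.assoc[symmetric])
 qed
 then show ?thesis unfolding lowdev_def sum_distrib_left by (intro sum.cong refl)
 qed
 finally show ?thesis .
qed

lemma lowdev_measurable: "lowdev N m n mu bw \<in> borel_measurable (PiM {..<n} (%_. mu))"
proof -
 note [measurable] = ekern_measurable[OF mu smu n M M0, of N]
 have "(%X. \<integral>\<^sup>+w. ennreal \<bar>ekern N n mu d X w\<bar> \<partial>lborel) \<in> borel_measurable (PiM {..<n} (%_. mu))" for d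
 by (rule sigma_finite_measure.borel_measurable_nn_integral[OF sigma_finite_lborel]) measurable
 then show ?thesis unfolding lowdev_def[abs_def] by measurable
qed

lemma lowdev_mean:
 assumes bw: "bw > 0" "bw \<le> 1"
 shows "(\<integral>\<^sup>+X. lowdev N m n mu bw X \<partial>PiM {..<n} (%_. mu)) \<le> ennreal (lowdev_const TYPE('n) N m M * (n powr (- 1/2) * bw powr (- real CARD('n) / 2)))"
proof -
 note [measurable] = ekern_measurable[OF mu smu n M M0, of N]
 let ?c = "bump_mass N TYPE('n)" let ?Q = "2 ^ CARD('n) + exp (real m * CARD('n)) * M * ?c"
 have c: "?c > 0" by (rule bump_mass_pos)
 have Q: "?Q \<ge> 0" using M0 c by (intro add_nonneg_nonneg mult_nonneg_nonneg) auto
 have [measurable]: "(%X. \<integral>\<^sup>+w. ennreal \<bar>ekern N n mu d X w\<bar> \<partial>lborel) \<in> borel_measurable (PiM {..<n} (%_. mu))" for d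
 by (rule sigma_finite_measure.borel_measurable_nn_integral[OF sigma_finite_lborel]) measurable
 have "(\<integral>\<^sup>+X. lowdev N m n mu bw X \<partial>PiM {..<n} (%_. mu)) = (\<Sum>j\<in>{1..m}. ennreal (\<bar>fdiff_coeff m j\<bar> / ?c) *
 (\<integral>\<^sup>+X. \<integral>\<^sup>+w. ennreal \<bar>ekern N n mu (real j * bw) X w\<bar> \<partial>lborel \<partial>PiM {..<n} (%_. mu)))"
 unfolding lowdev_def by (subst nn_integral_sum) (auto simp: nn_integral_cmult)
 also have "... \<le> (\<Sum>j\<in>{1..m}. ennreal (\<bar>fdiff_coeff m j\<bar> / ?c) * ennreal (?Q * (n powr (- 1/2) * bw powr (- real CARD('n) / 2))))"
 proof (intro sum_mono mult_left_mono)
 fix j assume j: "j \<in> {1..m}"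
 have "real j * bw \<le> real m * 1" using j bw by (intro mult_mono) auto
 then have "(\<integral>\<^sup>+X. \<integral>\<^sup>+w. ennreal \<bar>ekern N n mu (real j * bw) X w\<bar> \<partial>lborel \<partial>PiM {..<n} (%_. mu))
 \<le> ennreal (?Q * (n powr (- 1/2) * (real j * bw) powr (- real CARD('n) / 2)))"
 using j bw by (intro ekern_mass[OF mu smu n M M0]) auto
 also have "... \<le> ennreal (?Q * (n powr (- 1/2) * bw powr (- real CARD('n) / 2)))"
 proof (intro ennreal_leI mult_left_mono Q)
 have "1 * bw \<le> real j * bw" using j bw by (intro mult_right_mono) auto
 then show "(real j * bw) powr (- real CARD('n) / 2) \<le> bw powr (- real CARD('n) / 2)" using bw by (intro powr_mono2') auto
 qed auto
 finally show "(\<integral>\<^sup>+X. \<integral>\<^sup>+w. ennreal \<bar>ekern N n mu (real j * bw) X w\<bar> \<partial>lborel \<partial>PiM {..<n} (%_. mu)) \<le> ..." .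
 qed simp
 also have "... = ennreal (lowdev_const TYPE('n) N m M * (n powr (- 1/2) * bw powr (- real CARD('n) / 2)))"
 proof -
 have "(\<Sum>j\<in>{1..m}. ennreal (\<bar>fdiff_coeff m j\<bar> / ?c) * ennreal (?Q * (n powr (- 1/2) * bw powr (- real CARD('n) / 2))))
 = (\<Sum>j\<in>{1..m}. ennreal (\<bar>fdiff_coeff m j\<bar> / ?c * (?Q * (n powr (- 1/2) * bw powr (- real CARD('n) / 2)))))"
 by (intro sum.cong refl ennreal_mult[symmetric]) (use c Q in auto)
 also have "... = ennreal (\<Sum>j\<in>{1..m}. \<bar>fdiff_coeff m j\<bar> / ?c * (?Q * (n powr (- 1/2) * bw powr (- real CARD('n) / 2))))"
 by (rule sum_ennreal) (use c Q in auto)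
 finally show ?thesis by (simp add: lowdev_const_def sum_distrib_right mult.assoc)
 qed
 finally show ?thesis .
qed

text \<open>The telescoping step rewrites the difference of two smoothings as smoothings of small
 functions, which is what makes the deviation at each scale small.\<close>

lemma empdev_multiscale:
 fixes f :: "real^'n => real" and B E et :: real
 assumes f: "continuous_on UNIV f" "!!x. \<bar>f x\<bar> \<le> B"
 and E: "!!bw x. bw > 0 ==> \<bar>f x - lowpass N m bw f x\<bar> \<le> E * bw powr et"
 shows "ennreal \<bar>empdev n mu X f\<bar> \<le> ennreal B * lowdev N m n mu 1 X
 + (\<Sum>j<J. ennreal (E * ((1/2) ^ j) powr et) * lowdev N m n mu ((1/2) ^ Suc j) X
 + ennreal (E * ((1/2) ^ Suc j) powr et) * lowdev N m n mu ((1/2) ^ j) X)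
 + ennreal (2 * E * ((1/2) ^ J) powr et)"
proof -
 define d where "d j = (1/2 :: real) ^ j" for j
 have d: "d j > 0" for j by (simp add: d_def)
 define L where "L j = lowpass N m (d j) f" for j
 define r where "r j x = f x - L j x" for j x
 obtain B' where L: "continuous_on UNIV (L j)" "\<bar>L j x\<bar> \<le> B'" for j x
 unfolding L_def using lowpass_cont_bounded[OF d f N] by blast
 have r: "continuous_on UNIV (r j)" "\<bar>r j x\<bar> \<le> E * d j powr et" for j x
 unfolding r_def using E[OF d] by (auto simp: L_def intro!: continuous_intros f L[unfolded L_def])
 have lr: "continuous_on UNIV (lowpass N m (d i) (r j))" "\<bar>lowpass N m (d i) (r j) x\<bar> \<le> (\<Sum>j\<in>{1..m}. \<bar>fdiff_coeff m j\<bar>) * (E * d j powr et)" for i j x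
 by (rule lowpass_cont_bounded[OF d r N])+
 \<comment> \<open>With \<open>A\<close> and \<open>A'\<close> the smoothings at two consecutive
   scales, \<open>A' f - A f = A' (f - A f) - A (f - A' f)\<close>, because they commute. Each
   smoothing now acts on an error of size \<open>d j powr et\<close> or
   \<open>d (Suc j) powr et\<close>.\<close>
 have tel: "L (Suc j) x - L j x = lowpass N m (d (Suc j)) (r j) x - lowpass N m (d j) (r (Suc j)) x" for j x
 proof -
 have "lowpass N m (d (Suc j)) (r j) x = L (Suc j) x - lowpass N m (d (Suc j)) (L j) x"
 unfolding r_def by (subst lowpass_diff[OF d f L]) (simp add: L_def)
 moreover have "lowpass N m (d j) (r (Suc j)) x = L j x - lowpass N m (d j) (L (Suc j)) x"
 unfolding r_def by (subst lowpass_diff[OF d f L]) (simp add: L_def)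
 moreover have "lowpass N m (d (Suc j)) (L j) x = lowpass N m (d j) (L (Suc j)) x"
 unfolding L_def by (rule lowpass_commute[OF d d f N])
 ultimately show ?thesis by simp
 qed
 have step: "empdev n mu X (L (Suc j)) - empdev n mu X (L j) = empdev n mu X (lowpass N m (d (Suc j)) (r j)) - empdev n mu X (lowpass N m (d j) (r (Suc j)))" for j
 unfolding empdev_diff[OF L L, symmetric] empdev_diff[OF lr lr, symmetric] tel ..
 have "empdev n mu X f = empdev n mu X (L 0) + (\<Sum>j<J. empdev n mu X (L (Suc j)) - empdev n mu X (L j)) + empdev n mu X (r J)"
 proof -
 have "empdev n mu X (r J) = empdev n mu X f - empdev n mu X (L J)"
 unfolding r_def by (rule empdev_diff[OF f L])
 then show ?thesis using sum_lessThan_telescope[of "%j. empdev n mu X (L j)" J] by simp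
 qed
 then have "\<bar>empdev n mu X f\<bar> \<le> \<bar>empdev n mu X (L 0)\<bar> + (\<Sum>j<J. \<bar>empdev n mu X (lowpass N m (d (Suc j)) (r j))\<bar> + \<bar>empdev n mu X (lowpass N m (d j) (r (Suc j)))\<bar>) + 2 * E * d J powr et"
 proof -
 have "\<bar>\<Sum>j<J. empdev n mu X (L (Suc j)) - empdev n mu X (L j)\<bar> \<le> (\<Sum>j<J. \<bar>empdev n mu X (lowpass N m (d (Suc j)) (r j))\<bar> + \<bar>empdev n mu X (lowpass N m (d j) (r (Suc j)))\<bar>)"
 unfolding step by (rule order_trans[OF sum_abs sum_mono]) (rule abs_triangle_ineq4)
 moreover have "\<bar>empdev n mu X (r J)\<bar> \<le> 2 * E * d J powr et" using empdev_bound[OF r, of X J] by simp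
 ultimately show ?thesis using \<open>empdev n mu X f = _\<close> by linarith
 qed
 then have "ennreal \<bar>empdev n mu X f\<bar> \<le> ennreal (\<bar>empdev n mu X (L 0)\<bar> + (\<Sum>j<J. \<bar>empdev n mu X (lowpass N m (d (Suc j)) (r j))\<bar> + \<bar>empdev n mu X (lowpass N m (d j) (r (Suc j)))\<bar>) + 2 * E * d J powr et)"
 by (rule ennreal_leI)
 also have "... \<le> ennreal \<bar>empdev n mu X (L 0)\<bar> + (\<Sum>j<J. ennreal \<bar>empdev n mu X (lowpass N m (d (Suc j)) (r j))\<bar> + ennreal \<bar>empdev n mu X (lowpass N m (d j) (r (Suc j)))\<bar>) + ennreal (2 * E * d J powr et)"
 proof -
 have E0: "0 \<le> 2 * E * d J powr et" using order_trans[OF abs_ge_zero r(2)[of J 0]] by simp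
 then show ?thesis by (simp add: sum_nonneg sum_ennreal flip: ennreal_plus)
 qed
 also have "... \<le> ennreal B * lowdev N m n mu (d 0) X
 + (\<Sum>j<J. ennreal (E * d j powr et) * lowdev N m n mu (d (Suc j)) X + ennreal (E * d (Suc j) powr et) * lowdev N m n mu (d j) X)
 + ennreal (2 * E * d J powr et)"
 unfolding L_def by (intro add_mono sum_mono empdev_lowpass[OF d r] empdev_lowpass[OF d f]) simp
 finally show ?thesis by (simp add: d_def)
qed

end

text \<open>At scale \<open>d\<close> the smoothed functions have size
  \<open>d powr (D / 2)\<close>, where \<open>D\<close> is the dimension, and the deviation costs
  \<open>d powr (- D / 2)\<close>: every scale contributes the same \<open>n powr (- 1/2)\<close>,
  and the logarithm counts scales. The supremum over the class is replaced by a majorant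
  \<open>S\<close> because the latter is visibly measurable.\<close>

lemma empirical_process:
 fixes M :: real
 assumes M0: "M \<ge> 0"
 obtains C where "C > 0" "!!(mu :: (real^'n::finite) measure) n. prob_space mu ==> sets mu = sets borel ==>
 (\<integral>\<^sup>+x. ennreal (exp (l1norm x)) \<partial>mu) \<le> ennreal M ==> n \<ge> 2 ==>
 \<exists>S. S \<in> borel_measurable (PiM {..<n} (%_. mu)) \<and>
 (\<forall>X. \<forall>f\<in>holder_class (real CARD('n) / 2) 0 1. ennreal \<bar>empdev n mu X f\<bar> \<le> S X) \<and>
 (\<integral>\<^sup>+X. S X \<partial>PiM {..<n} (%_. mu)) \<le> ennreal (C * n powr (- 1/2) * ln n)"
proof -
 define et where "et = real CARD('n) / 2"
 have et: "et > 0" "et \<ge> 1/2" by (auto simp: et_def Suc_leI)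
 let ?H = "holder_class et 0 1 :: (real^'n => real) set"
 define k where "k = hidx et" define s where "s = hexp et" define m where "m = k + 1"
 have s: "0 < s" "s \<le> 1" "real k + s = et" using hidx_hexp[OF et(1)] by (auto simp: k_def s_def)
 have hb: "holder_bdd k s ?H (%f. f)" unfolding k_def s_def by (rule holder_class_imp_holder_bdd[OF et(1)])
 obtain B where B: "B > 0" "!!f x. f \<in> ?H ==> \<bar>f x\<bar> \<le> B" by (rule holder_bdd_bounded[OF hb], rule that)
 have cont: "f \<in> ?H ==> continuous_on UNIV f" for f by (rule holder_bdd_continuous[OF hb s(1,2)])
 obtain E where E: "E > 0" "!!f bw x. f \<in> ?H ==> bw > 0 ==> \<bar>f x - lowpass 1 m bw f x\<bar> \<le> E * bw powr et"
 using lowpass_family_error[OF s(1,2) hb, of m 1] unfolding s(3) m_def by auto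
 define K where "K = lowdev_const TYPE('n) 1 m M"
 have K: "K \<ge> 0" unfolding K_def by (rule lowdev_const_nonneg[OF M0])
 define C where "C = (B * K + 2 * E) / ln 2 + 2 * (E * K * (2 powr et + 1)) / ln 2"
 have C: "C > 0" unfolding C_def using B(1) E(1) K by (intro add_pos_nonneg divide_pos_pos divide_nonneg_pos add_nonneg_pos mult_nonneg_nonneg) auto
 show ?thesis
 proof (rule that[OF C])
 fix mu :: "(real^'n) measure" and n :: nat
 assume mu: "prob_space mu" and smu: "sets mu = sets borel" and M: "(\<integral>\<^sup>+x. ennreal (exp (l1norm x)) \<partial>mu) \<le> ennreal M" and n2: "n \<ge> 2"
 have n: "n > 0" using n2 by simp
 have ln2: "ln 2 > (0::real)" "ln 2 \<le> ln n" using n2 by auto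
 let ?P = "PiM {..<n} (%_. mu)" let ?r = "n powr (- 1/2)"
 note meas[measurable] = lowdev_measurable[OF mu smu n M M0 order_refl, of m]
 \<comment> \<open>Then \<open>2 ^ J \<ge> n\<close>, and since \<open>et \<ge> 1/2\<close> the
   error at the finest scale is at most \<open>n powr (- 1/2)\<close>.\<close>
 define J where "J = nat \<lceil>ln n / ln 2\<rceil>"
 have J: "ln n / ln 2 \<le> J" "real J \<le> 2 * ln n / ln 2"
 proof -
 have 1: "1 \<le> ln n / ln 2" using ln2 by simp
 then show "ln n / ln 2 \<le> J" unfolding J_def by linarith
 have "real J \<le> ln n / ln 2 + 1" unfolding J_def using 1 by linarith
 also have "... \<le> 2 * (ln n / ln 2)" using 1 by linarith
 finally show "real J \<le> 2 * ln n / ln 2" by simp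
 qed
 have dJ: "((1/2 :: real) ^ J) powr et \<le> ?r"
 proof -
 have "ln n \<le> J * ln 2" using J(1) ln2(1) by (simp add: pos_divide_le_eq)
 then have "n \<le> (2::real) ^ J" using n by (subst ln_le_cancel_iff[symmetric]) (auto simp: ln_realpow)
 then have "(1/2 :: real) ^ J \<le> 1 / n" using n by (simp add: power_divide frac_le)
 then have "((1/2 :: real) ^ J) powr et \<le> (1 / n) powr et" using et by (intro powr_mono2) auto
 also have "... \<le> (1 / n) powr (1/2)" using n et by (intro powr_mono') auto
 also have "... = ?r" using n by (simp add: powr_divide powr_minus_divide)
 finally show ?thesis .
 qed
 define S where "S X = ennreal B * lowdev 1 m n mu 1 X
 + (\<Sum>j<J. ennreal (E * ((1/2) ^ j) powr et) * lowdev 1 m n mu ((1/2) ^ Suc j) X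
 + ennreal (E * ((1/2) ^ Suc j) powr et) * lowdev 1 m n mu ((1/2) ^ j) X)
 + ennreal (2 * E * ((1/2) ^ J) powr et)" for X
 have LM: "(\<integral>\<^sup>+X. lowdev 1 m n mu ((1/2) ^ j) X \<partial>?P) \<le> ennreal (K * (?r * ((1/2) ^ j) powr (- et)))" for j :: nat
 using lowdev_mean[OF mu smu n M M0 order_refl, of "(1/2) ^ j" m] by (simp add: K_def et_def power_le_one)
 have pw: "(x * (1/2 :: real)) powr et = x powr et / 2 powr et" if "x > 0" for x
 using that by (simp add: powr_divide)
 \<comment> \<open>The critical balance: the powers of the scale cancel, up to the factor between
   neighbouring scales.\<close>
 have p1: "((1/2 :: real) ^ j) powr et * ((1/2) ^ Suc j) powr (- et) = 2 powr et" for j :: nat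
 proof -
 have "((1/2 :: real) ^ Suc j) powr (- et) = 2 powr et / ((1/2) ^ j) powr et"
 unfolding powr_minus_divide power_Suc2 by (subst pw) auto
 then show ?thesis by simp
 qed
 have p2: "((1/2 :: real) ^ Suc j) powr et * ((1/2) ^ j) powr (- et) \<le> 1" for j :: nat
 proof -
 have "((1/2 :: real) ^ Suc j) powr et \<le> ((1/2) ^ j) powr et"
 using et by (intro powr_mono2 power_decreasing) auto
 then have "((1/2 :: real) ^ Suc j) powr et * ((1/2) ^ j) powr (- et) \<le> ((1/2) ^ j) powr et * ((1/2) ^ j) powr (- et)"
 by (rule mult_right_mono) simp
 also have "... = 1" by (simp flip: powr_add)
 finally show ?thesis .
 qed
 have sumd: "(\<integral>\<^sup>+X. (\<Sum>j<J. ennreal (E * ((1/2) ^ j) powr et) * lowdev 1 m n mu ((1/2) ^ Suc j) X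
 + ennreal (E * ((1/2) ^ Suc j) powr et) * lowdev 1 m n mu ((1/2) ^ j) X) \<partial>?P) \<le> ennreal (real J * (E * K * (2 powr et + 1) * ?r))"
 proof -
 have "(\<integral>\<^sup>+X. (\<Sum>j<J. ennreal (E * ((1/2) ^ j) powr et) * lowdev 1 m n mu ((1/2) ^ Suc j) X
 + ennreal (E * ((1/2) ^ Suc j) powr et) * lowdev 1 m n mu ((1/2) ^ j) X) \<partial>?P)
 = (\<Sum>j<J. ennreal (E * ((1/2) ^ j) powr et) * (\<integral>\<^sup>+X. lowdev 1 m n mu ((1/2) ^ Suc j) X \<partial>?P)
 + ennreal (E * ((1/2) ^ Suc j) powr et) * (\<integral>\<^sup>+X. lowdev 1 m n mu ((1/2) ^ j) X \<partial>?P))"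
 proof (subst nn_integral_sum)
 show "(%X. ennreal (E * ((1/2) ^ j) powr et) * lowdev 1 m n mu ((1/2) ^ Suc j) X
 + ennreal (E * ((1/2) ^ Suc j) powr et) * lowdev 1 m n mu ((1/2) ^ j) X) \<in> borel_measurable ?P" for j by measurable
 have "(\<integral>\<^sup>+X. c * lowdev 1 m n mu a X + e * lowdev 1 m n mu b X \<partial>?P) = c * (\<integral>\<^sup>+X. lowdev 1 m n mu a X \<partial>?P) + e * (\<integral>\<^sup>+X. lowdev 1 m n mu b X \<partial>?P)" for a b c e
 by (subst nn_integral_add, measurable) (simp only: nn_integral_cmult[OF meas])
 then show "(\<Sum>j<J. \<integral>\<^sup>+X. ennreal (E * ((1/2) ^ j) powr et) * lowdev 1 m n mu ((1/2) ^ Suc j) X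
 + ennreal (E * ((1/2) ^ Suc j) powr et) * lowdev 1 m n mu ((1/2) ^ j) X \<partial>?P)
 = (\<Sum>j<J. ennreal (E * ((1/2) ^ j) powr et) * (\<integral>\<^sup>+X. lowdev 1 m n mu ((1/2) ^ Suc j) X \<partial>?P)
 + ennreal (E * ((1/2) ^ Suc j) powr et) * (\<integral>\<^sup>+X. lowdev 1 m n mu ((1/2) ^ j) X \<partial>?P))"
 by (simp only:)
 qed
 also have "... \<le> (\<Sum>j<J. ennreal (E * K * (2 powr et + 1) * ?r))"
 proof (rule sum_mono)
 fix j
 have "ennreal (E * ((1/2) ^ j) powr et) * (\<integral>\<^sup>+X. lowdev 1 m n mu ((1/2) ^ Suc j) X \<partial>?P)
 + ennreal (E * ((1/2) ^ Suc j) powr et) * (\<integral>\<^sup>+X. lowdev 1 m n mu ((1/2) ^ j) X \<partial>?P)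
 \<le> ennreal (E * ((1/2) ^ j) powr et) * ennreal (K * (?r * ((1/2) ^ Suc j) powr (- et)))
 + ennreal (E * ((1/2) ^ Suc j) powr et) * ennreal (K * (?r * ((1/2) ^ j) powr (- et)))"
 by (intro add_mono mult_left_mono LM) auto
 also have "... = ennreal (E * ((1/2) ^ j) powr et * (K * (?r * ((1/2) ^ Suc j) powr (- et)))
 + E * ((1/2) ^ Suc j) powr et * (K * (?r * ((1/2) ^ j) powr (- et))))"
 using E(1) K by (simp add: less_imp_le del: power_Suc flip: ennreal_mult ennreal_plus)
 also have "... \<le> ennreal (E * K * (2 powr et + 1) * ?r)"
 proof (rule ennreal_leI)
 have "E * ((1/2) ^ j) powr et * (K * (?r * ((1/2) ^ Suc j) powr (- et))) = E * K * ?r * (((1/2) ^ j) powr et * ((1/2) ^ Suc j) powr (- et))"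
 by (simp only: mult_ac)
 moreover have "E * ((1/2) ^ Suc j) powr et * (K * (?r * ((1/2) ^ j) powr (- et))) = E * K * ?r * (((1/2) ^ Suc j) powr et * ((1/2) ^ j) powr (- et))"
 by (simp only: mult_ac)
 moreover have "E * K * ?r * (((1/2) ^ Suc j) powr et * ((1/2) ^ j) powr (- et)) \<le> E * K * ?r * 1"
 using E(1) K by (intro mult_left_mono p2) auto
 moreover have "E * K * ?r * (((1/2) ^ j) powr et * ((1/2) ^ Suc j) powr (- et)) = E * K * ?r * 2 powr et"
 by (simp only: p1)
 moreover have "E * K * (2 powr et + 1) * ?r = E * K * ?r * 2 powr et + E * K * ?r * 1"
 by (simp only: distrib_left distrib_right mult_ac mult_1_right)
 ultimately show "E * ((1/2) ^ j) powr et * (K * (?r * ((1/2) ^ Suc j) powr (- et)))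
 + E * ((1/2) ^ Suc j) powr et * (K * (?r * ((1/2) ^ j) powr (- et))) \<le> E * K * (2 powr et + 1) * ?r"
 by linarith
 qed
 finally show "ennreal (E * ((1/2) ^ j) powr et) * (\<integral>\<^sup>+X. lowdev 1 m n mu ((1/2) ^ Suc j) X \<partial>?P)
 + ennreal (E * ((1/2) ^ Suc j) powr et) * (\<integral>\<^sup>+X. lowdev 1 m n mu ((1/2) ^ j) X \<partial>?P) \<le> ennreal (E * K * (2 powr et + 1) * ?r)" .
 qed
 also have "... = ennreal (real J * (E * K * (2 powr et + 1) * ?r))"
 using E(1) K by (simp add: ennreal_of_nat_eq_real_of_nat flip: ennreal_mult)
 finally show ?thesis .
 qed
 have Sm: "S \<in> borel_measurable ?P" unfolding S_def[abs_def] by measurable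
 have "(\<integral>\<^sup>+X. S X \<partial>?P) \<le> ennreal (C * ?r * ln n)"
 proof -
 interpret PP: prob_space ?P by (rule prob_space_PiM) (rule mu)
 have "(\<integral>\<^sup>+X. S X \<partial>?P) = ennreal B * (\<integral>\<^sup>+X. lowdev 1 m n mu ((1/2) ^ 0) X \<partial>?P)
 + (\<integral>\<^sup>+X. (\<Sum>j<J. ennreal (E * ((1/2) ^ j) powr et) * lowdev 1 m n mu ((1/2) ^ Suc j) X
 + ennreal (E * ((1/2) ^ Suc j) powr et) * lowdev 1 m n mu ((1/2) ^ j) X) \<partial>?P) + ennreal (2 * E * ((1/2) ^ J) powr et)"
 proof -
 have Tm: "(%X. \<Sum>j<J. ennreal (E * ((1/2) ^ j) powr et) * lowdev 1 m n mu ((1/2) ^ Suc j) X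
 + ennreal (E * ((1/2) ^ Suc j) powr et) * lowdev 1 m n mu ((1/2) ^ j) X) \<in> borel_measurable ?P" by measurable
 have gen: "(\<integral>\<^sup>+X. b * lowdev 1 m n mu a X + T X + c \<partial>?P) = b * (\<integral>\<^sup>+X. lowdev 1 m n mu a X \<partial>?P) + (\<integral>\<^sup>+X. T X \<partial>?P) + c"
 if "T \<in> borel_measurable ?P" for a b c T
 using that by (subst nn_integral_add, measurable, subst nn_integral_add, measurable) (simp only: nn_integral_cmult[OF meas] nn_integral_const PP.emeasure_space_1 mult_1_right)
 show ?thesis unfolding S_def power_0 by (rule gen[OF Tm])
 qed
 also have "... \<le> ennreal B * ennreal (K * (?r * ((1/2) ^ 0) powr (- et))) + ennreal (real J * (E * K * (2 powr et + 1) * ?r)) + ennreal (2 * E * ?r)"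
 using E(1) dJ by (intro add_mono mult_left_mono LM sumd ennreal_leI) auto
 also have "... = ennreal (B * (K * ?r) + real J * (E * K * (2 powr et + 1) * ?r) + 2 * E * ?r)"
 using B(1) E(1) K by (simp add: less_imp_le flip: ennreal_mult ennreal_plus)
 also have "... \<le> ennreal (C * ?r * ln n)"
 proof (rule ennreal_leI)
 have "real J * (E * K * (2 powr et + 1) * ?r) \<le> (2 * ln n / ln 2) * (E * K * (2 powr et + 1) * ?r)"
 using E(1) K by (intro mult_right_mono J(2)) auto
 moreover have "(B * K + 2 * E) * ?r * 1 \<le> (B * K + 2 * E) * ?r * (ln n / ln 2)"
 using B(1) E(1) K ln2 by (intro mult_left_mono) auto
 moreover have "C * ?r * ln n = (B * K + 2 * E) * ?r * (ln n / ln 2) + (2 * ln n / ln 2) * (E * K * (2 powr et + 1) * ?r)"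
 by (simp add: C_def add_divide_distrib algebra_simps)
 moreover have "B * (K * ?r) + 2 * E * ?r = (B * K + 2 * E) * ?r * 1" by (simp add: distrib_right)
 ultimately show "B * (K * ?r) + real J * (E * K * (2 powr et + 1) * ?r) + 2 * E * ?r \<le> C * ?r * ln n" by linarith
 qed
 finally show ?thesis .
 qed
 moreover have "ennreal \<bar>empdev n mu X f\<bar> \<le> S X" if f: "f \<in> ?H" for X f
 unfolding S_def by (rule empdev_multiscale[OF mu smu n M M0 order_refl cont[OF f] B(2)[OF f] E(2)[OF f]])
 ultimately show "\<exists>S. S \<in> borel_measurable ?P \<and> (\<forall>X. \<forall>f\<in>holder_class (real CARD('n) / 2) 0 1. ennreal \<bar>empdev n mu X f\<bar> \<le> S X) \<and>
 (\<integral>\<^sup>+X. S X \<partial>?P) \<le> ennreal (C * ?r * ln n)"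
 using Sm unfolding et_def by blast
 qed
qed

section \<open>Lower bound\<close>

lemma lborel_affine_integral:
 fixes f :: "real^'n::finite => real"
 assumes c: "c \<noteq> 0" and [measurable]: "f \<in> bmeas"
 shows "(LBINT x. f x) = \<bar>c\<bar> ^ CARD('n) * (LBINT x. f (t + c *\<^sub>R x))"
proof -
 have "(LBINT x. f x) = (\<integral>x. f x \<partial>density (distr lborel borel (%x. t + c *\<^sub>R x)) (%_. ennreal (\<bar>c\<bar> ^ CARD('n))))"
 using lborel_affine[OF c, of t] by (intro arg_cong[where f = "%M. integral\<^sup>L M f"]) simp
 also have "... = (\<integral>x. \<bar>c\<bar> ^ CARD('n) *\<^sub>R f x \<partial>distr lborel borel (%x. t + c *\<^sub>R x))"
 by (rule integral_density) auto
 also have "... = (LBINT x. \<bar>c\<bar> ^ CARD('n) *\<^sub>R f (t + c *\<^sub>R x))"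
 by (rule integral_distr) auto
 finally show ?thesis by simp
qed

lemma prob_integral_bound:
 fixes f :: "real^'n::finite => real"
 assumes "prob_space mu" "sets mu = sets borel" "continuous_on UNIV f" "!!x. \<bar>f x\<bar> \<le> B"
 shows "integrable mu f" "\<bar>\<integral>x. f x \<partial>mu\<bar> \<le> B"
proof -
 interpret mu: prob_space mu by (rule assms(1))
 have [measurable]: "f \<in> borel_measurable mu"
 using borel_measurable_continuous_onI[OF assms(3)] assms(2) measurable_cong_sets by blast
 show i: "integrable mu f" by (rule mu.integrable_const_bound[of _ B]) (use assms(4) in auto)
 have "\<bar>\<integral>x. f x \<partial>mu\<bar> \<le> (\<integral>x. B \<partial>mu)"
 by (rule integral_abs_bound[THEN order_trans], rule integral_mono) (use assms(4) i in auto)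
 then show "\<bar>\<integral>x. f x \<partial>mu\<bar> \<le> B" by (simp add: mu.prob_space)
qed

section \<open>Integral probability metrics and tilted Gaussian samples\<close>

lemma holder_class_cont_bounded:
 assumes "\<gamma> > 0"
 obtains B where "B > 0" "!!f. f \<in> (holder_class \<gamma> 0 K :: (real^'n::finite => real) set) ==> continuous_on UNIV f"
 "!!f x. f \<in> (holder_class \<gamma> 0 K :: (real^'n => real) set) ==> \<bar>f x\<bar> \<le> B"
proof -
 note h = holder_class_imp_holder_bdd[OF assms, of K, where 'n = 'n]
 obtain B where "B > 0" "!!f x. f \<in> (holder_class \<gamma> 0 K :: (real^'n => real) set) ==> \<bar>f x\<bar> \<le> B"
 by (rule holder_bdd_bounded[OF h], rule that)
 then show ?thesis
 by (intro that[of B]) (auto intro: holder_bdd_continuous[OF h hidx_hexp(1,2)[OF assms]])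
qed

text \<open>The supremum in \<open>ipm\<close> is one of real numbers and dominates its members only
  because the class is uniformly bounded.\<close>

lemma ipm_ge:
 fixes mu nu :: "(real^'n::finite) measure"
 assumes \<gamma>: "\<gamma> > 0" and "prob_space mu" "sets mu = sets borel" "prob_space nu" "sets nu = sets borel"
 and f: "f \<in> holder_class \<gamma> 0 1"
 shows "(\<integral>x. f x \<partial>mu) - (\<integral>x. f x \<partial>nu) \<le> ipm (holder_class \<gamma> 0 1) mu nu"
proof -
 obtain B where B: "!!f. f \<in> (holder_class \<gamma> 0 1 :: (real^'n => real) set) ==> continuous_on UNIV f"
 "!!f x. f \<in> (holder_class \<gamma> 0 1 :: (real^'n => real) set) ==> \<bar>f x\<bar> \<le> B"
 by (rule holder_class_cont_bounded[OF \<gamma>, of 1], rule that)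
 have "(\<integral>x. g x \<partial>mu) - (\<integral>x. g x \<partial>nu) \<le> 2 * B" if g: "g \<in> holder_class \<gamma> 0 1" for g
 using prob_integral_bound(2)[OF assms(2,3) B(1)[OF g] B(2)[OF g]] prob_integral_bound(2)[OF assms(4,5) B(1)[OF g] B(2)[OF g]] by linarith
 then show ?thesis unfolding ipm_def by (intro cSUP_upper[OF f]) (auto intro!: bdd_aboveI2[where M = "2 * B"])
qed

lemma gauss_tilt:
 fixes a :: "real^'n::finite => real"
 assumes [measurable]: "a \<in> bmeas"
 shows "prob_of_density (%x. gauss_density x * exp (a x)) = density gauss_measure (%x. ennreal (exp (a x)))"
 unfolding prob_of_density_def gauss_measure_def
 by (subst density_density_eq) (auto simp: ennreal_mult gauss_density_nonneg)

lemma prob_space_tilt: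
 fixes a :: "real^'n::finite => real"
 assumes [measurable]: "a \<in> bmeas" and I: "(\<integral>\<^sup>+x. ennreal (exp (a x)) \<partial>gauss_measure) = 1"
 shows "prob_space (prob_of_density (%x. gauss_density x * exp (a x)))"
proof -
 let ?G = "gauss_measure :: (real^'n) measure" let ?mu = "density ?G (%x. ennreal (exp (a x)))"
 have sG[measurable_cong]: "sets ?G = sets borel" by (rule sets_gauss_measure)
 have am: "(%x. ennreal (exp (a x))) \<in> borel_measurable ?G" by measurable
 have "emeasure ?mu (space ?mu) = (\<integral>\<^sup>+x. ennreal (exp (a x)) * indicator (space ?G) x \<partial>?G)"
 unfolding space_density by (rule emeasure_density[OF am sets.top])
 also have "... = (\<integral>\<^sup>+x. ennreal (exp (a x)) \<partial>?G)" by (rule nn_integral_cong) simp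
 finally show ?thesis using I unfolding gauss_tilt[OF assms(1)] by (intro prob_spaceI) simp
qed

lemma sample_law_tilt:
 fixes a :: "real^'n::finite => real"
 assumes am[measurable]: "a \<in> bmeas" and I: "(\<integral>\<^sup>+x. ennreal (exp (a x)) \<partial>gauss_measure) = 1"
 shows "sample_law N (%x. gauss_density x * exp (a x)) =
 density (PiM {..<N} (%_. gauss_measure)) (%X. ennreal (\<Prod>i<N. exp (a (X i))))"
proof -
 let ?G = "gauss_measure :: (real^'n) measure"
 define mu where "mu = density ?G (%x. ennreal (exp (a x)))"
 have smu: "sets mu = sets borel" by (simp add: mu_def sets_gauss_measure)
 have sG[measurable_cong]: "sets ?G = sets borel" by (rule sets_gauss_measure)
 have pm: "prob_space mu" using prob_space_tilt[OF am I] unfolding gauss_tilt[OF am] mu_def .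
 have M: "product_sigma_finite (%_ :: nat. mu)" by (rule product_sigma_finite.intro, rule prob_space_imp_sigma_finite, rule pm)
 have G: "product_sigma_finite (%_ :: nat. ?G)" by (rule product_sigma_finite.intro, rule prob_space_imp_sigma_finite, rule prob_space_gauss)
 have "density (PiM {..<N} (%_. ?G)) (%X. ennreal (\<Prod>i<N. exp (a (X i)))) = PiM {..<N} (%_. mu)"
 proof (rule product_sigma_finite.PiM_eqI[OF M])
 show "sets (density (PiM {..<N} (%_. ?G)) (%X. ennreal (\<Prod>i<N. exp (a (X i))))) = sets (PiM {..<N} (%_. mu))"
 unfolding sets_density by (rule sets_PiM_cong) (simp_all add: smu sG)
 fix A :: "nat => (real^'n) set" assume A: "!!i. i \<in> {..<N} ==> A i \<in> sets mu"
 have A': "A i \<in> sets ?G" if "i < N" for i using A[of i] that by (simp add: smu sG)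
 have m: "(%X. ennreal (\<Prod>i<N. exp (a (X i)))) \<in> borel_measurable (PiM {..<N} (%_. ?G))" by measurable
 have "emeasure (density (PiM {..<N} (%_. ?G)) (%X. ennreal (\<Prod>i<N. exp (a (X i))))) (PiE {..<N} A)
 = (\<integral>\<^sup>+X. ennreal (\<Prod>i<N. exp (a (X i))) * indicator (PiE {..<N} A) X \<partial>PiM {..<N} (%_. ?G))"
 using A' by (intro emeasure_density m sets_PiM_I_finite) auto
 also have "... = (\<integral>\<^sup>+X. (\<Prod>i<N. ennreal (exp (a (X i))) * indicator (A i) (X i)) \<partial>PiM {..<N} (%_. ?G))"
 proof (rule nn_integral_cong)
 fix X assume X: "X \<in> space (PiM {..<N} (%_. ?G))"
 have "(indicator (PiE {..<N} A) X :: ennreal) = (\<Prod>i<N. indicator (A i) (X i))"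
 proof (cases "X \<in> PiE {..<N} A")
 case False
 then obtain i where "i < N" "X i \<notin> A i" using X by (auto simp: space_PiM PiE_iff)
 then have "(\<Prod>i<N. indicator (A i) (X i)) = (0 :: ennreal)" by (intro prod_zero) (auto intro!: bexI[of _ i])
 then show ?thesis using False by simp
 next
 case True
 then have "(\<Prod>i<N. indicator (A i) (X i)) = (1 :: ennreal)" by (intro prod.neutral) (auto simp: PiE_iff)
 then show ?thesis using True by simp
 qed
 then show "ennreal (\<Prod>i<N. exp (a (X i))) * indicator (PiE {..<N} A) X = (\<Prod>i<N. ennreal (exp (a (X i))) * indicator (A i) (X i))"
 by (simp add: prod.distrib prod_ennreal)
 qed
 also have "... = (\<Prod>i<N. \<integral>\<^sup>+x. ennreal (exp (a x)) * indicator (A i) x \<partial>?G)"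
 using A' by (intro product_sigma_finite.product_nn_integral_prod[OF G]) auto
 also have "... = (\<Prod>i<N. emeasure mu (A i))"
 unfolding mu_def using A' by (intro prod.cong refl emeasure_density[symmetric]) auto
 finally show "emeasure (density (PiM {..<N} (%_. ?G)) (%X. ennreal (\<Prod>i<N. exp (a (X i))))) (PiE {..<N} A) = (\<Prod>i\<in>{..<N}. emeasure mu (A i))" .
 qed simp
 then show ?thesis unfolding sample_law_def gauss_tilt[OF am] mu_def by simp
qed

text \<open>Le Cam's two-point argument in chi-square form. With likelihoods \<open>p0\<close> and
  \<open>p1\<close>, their minimum is at least \<open>2 * p1 - p1^2 / p0 - p0 / 4\<close> pointwise.
  The assumption \<open>chi\<close> bounds the integral of \<open>p1^2 / p0\<close> over the sample
  space by \<open>exp (1/5) \<le> 5/4\<close>, so the minorant has integral at least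
  \<open>2 - 5/4 - 1/4 = 1/2\<close>.\<close>

lemma two_point_lower:
 fixes a0 a1 :: "real^'n::finite => real" and v0 v1 :: real
 assumes a0: "continuous_on UNIV a0" "!!x. \<bar>a0 x\<bar> \<le> B" and a1: "continuous_on UNIV a1" "!!x. \<bar>a1 x\<bar> \<le> B"
 and I0: "(\<integral>x. exp (a0 x) \<partial>gauss_measure) = 1" and I1: "(\<integral>x. exp (a1 x) \<partial>gauss_measure) = 1"
 and chi: "(\<integral>x. exp (2 * a1 x - a0 x) \<partial>gauss_measure) \<le> 1 + 1 / (5 * real N)" and N: "N > 0"
 and t[measurable]: "t \<in> borel_measurable (PiM {..<N} (%_. gauss_measure))"
 shows "ennreal (\<bar>v1 - v0\<bar> / 2) \<le> (\<integral>\<^sup>+X. ennreal \<bar>t X - v0\<bar> * ennreal (\<Prod>i<N. exp (a0 (X i))) \<partial>PiM {..<N} (%_. gauss_measure))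
 + (\<integral>\<^sup>+X. ennreal \<bar>t X - v1\<bar> * ennreal (\<Prod>i<N. exp (a1 (X i))) \<partial>PiM {..<N} (%_. gauss_measure))"
proof -
 let ?G = "gauss_measure :: (real^'n) measure" let ?P = "PiM {..<N} (%_. ?G)"
 have sG[measurable_cong]: "sets ?G = sets borel" by (rule sets_gauss_measure)
 have [measurable]: "a0 \<in> bmeas" "a1 \<in> bmeas"
 using borel_measurable_continuous_onI a0(1) a1(1) by blast+
 have G: "product_sigma_finite (%_ :: nat. ?G)" by (rule product_sigma_finite.intro, rule prob_space_imp_sigma_finite, rule prob_space_gauss)
 define D where "D b X = (\<Prod>i<N. exp (b (X i)))" for b :: "real^'n => real" and X :: "nat => real^'n"
 have D: "integrable ?P (D b)" "(\<integral>X. D b X \<partial>?P) = (\<integral>x. exp (b x) \<partial>?G) ^ N"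
 if b: "continuous_on UNIV b" "!!x. \<bar>b x\<bar> \<le> B'" for b B'
 proof -
 have "\<bar>exp (b x)\<bar> \<le> exp B'" for x using b(2)[of x] by (simp add: abs_le_iff)
 then have i: "integrable ?G (%x. exp (b x))"
 by (intro prob_integral_bound(1)[OF prob_space_gauss sG]) (auto intro!: continuous_intros b(1))
 show "integrable ?P (D b)" unfolding D_def[abs_def] by (rule product_sigma_finite.product_integrable_prod[OF G]) (auto intro: i)
 show "(\<integral>X. D b X \<partial>?P) = (\<integral>x. exp (b x) \<partial>?G) ^ N" unfolding D_def by (subst product_sigma_finite.product_integral_prod[OF G]) (auto intro: i)
 qed
 let ?a2 = "%x. 2 * a1 x - a0 x"
 have a2: "continuous_on UNIV ?a2" "\<bar>?a2 x\<bar> \<le> 3 * B" for x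
 using a0(2)[of x] a1(2)[of x] by (auto intro!: continuous_intros a0(1) a1(1))
 note D0 = D[OF a0, unfolded I0] and D1 = D[OF a1, unfolded I1] and D2 = D[OF a2]
 have pos: "D b X > 0" for b X unfolding D_def by (intro prod_pos) auto
 have rel: "D ?a2 X * D a0 X = D a1 X * D a1 X" for X
 unfolding D_def by (simp add: prod.distrib[symmetric] exp_add[symmetric])
 have "(\<integral>x. exp (?a2 x) \<partial>?G) ^ N \<le> exp (1 / (5 * real N)) ^ N"
 using chi exp_ge_add_one_self[of "1 / (5 * real N)"] by (intro power_mono) (auto intro: order_trans)
 also have "... = exp (1/5)" using N by (simp flip: exp_of_nat_mult)
 also have "... \<le> 5/4" using exp_bound[of "1/5 :: real"] by (simp add: power2_eq_square)
 finally have c2: "(\<integral>X. D ?a2 X \<partial>?P) \<le> 5/4" unfolding D2 .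
 \<comment> \<open>\<open>D ?a2\<close> is \<open>p1^2 / p0\<close>. The minorant follows from the
   nonnegative squares of \<open>p1 - p0 / 2\<close> and \<open>p1 - p0\<close>, each divided by
   \<open>p0\<close>.\<close>
 let ?g = "%X. \<bar>v1 - v0\<bar> * (2 * D a1 X - D ?a2 X - D a0 X / 4)"
 have gi: "integrable ?P ?g"
 by (intro integrable_mult_right Bochner_Integration.integrable_diff integrable_divide_zero) (simp_all add: D0 D1 D2)
 have ge: "\<bar>v1 - v0\<bar> * (2 - (\<integral>X. D ?a2 X \<partial>?P) - 1/4) = (\<integral>X. ?g X \<partial>?P)"
 using D0 D1 D2(1) by simp
 have "\<bar>v1 - v0\<bar> / 2 = \<bar>v1 - v0\<bar> * (1/2)" by simp
 also have "... \<le> \<bar>v1 - v0\<bar> * (2 - (\<integral>X. D ?a2 X \<partial>?P) - 1/4)"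
 using c2 by (intro mult_left_mono) auto
 also have "... = (\<integral>X. ?g X \<partial>?P)" by (rule ge)
 also have "... \<le> (\<integral>X. max 0 (?g X) \<partial>?P)" by (intro integral_mono gi integrable_max) auto
 finally have "ennreal (\<bar>v1 - v0\<bar> / 2) \<le> ennreal (\<integral>X. max 0 (?g X) \<partial>?P)" by (rule ennreal_leI)
 also have "... = (\<integral>\<^sup>+X. ennreal (max 0 (?g X)) \<partial>?P)"
 by (rule nn_integral_eq_integral[symmetric]) (auto intro!: integrable_max gi)
 also have "... \<le> (\<integral>\<^sup>+X. ennreal \<bar>t X - v0\<bar> * ennreal (D a0 X) + ennreal \<bar>t X - v1\<bar> * ennreal (D a1 X) \<partial>?P)"
 proof (rule nn_integral_mono)
 fix X
 let ?m = "min (D a0 X) (D a1 X)"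
 have "2 * D a1 X - D ?a2 X - D a0 X / 4 \<le> ?m"
 proof -
 have D2e: "D ?a2 X = D a1 X * D a1 X / D a0 X" using rel[of X] pos[of a0 X] by (simp add: field_simps)
 have p: "D a0 X > 0" "D a1 X > 0" by (rule pos)+
 have "0 \<le> (D a1 X - D a0 X / 2)\<^sup>2 / D a0 X" using p by simp
 also have "... = D ?a2 X - D a1 X + D a0 X / 4" unfolding D2e using p by (simp add: power2_eq_square field_simps)
 finally have "2 * D a1 X - D ?a2 X - D a0 X / 4 \<le> D a1 X" by linarith
 moreover have "0 \<le> (D a1 X - D a0 X)\<^sup>2 / D a0 X" using p by simp
 then have "0 \<le> D ?a2 X - 2 * D a1 X + D a0 X" unfolding D2e using p by (simp add: power2_eq_square field_simps)
 then have "2 * D a1 X - D ?a2 X - D a0 X / 4 \<le> D a0 X" using p by linarith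
 ultimately show ?thesis by simp
 qed
 then have "?g X \<le> \<bar>v1 - v0\<bar> * ?m" by (intro mult_left_mono) auto
 also have "... \<le> (\<bar>t X - v0\<bar> + \<bar>t X - v1\<bar>) * ?m" using pos[of a0 X] pos[of a1 X] by (intro mult_right_mono) auto
 also have "... \<le> \<bar>t X - v0\<bar> * D a0 X + \<bar>t X - v1\<bar> * D a1 X"
 unfolding distrib_right by (intro add_mono mult_left_mono) auto
 finally have "?g X \<le> \<bar>t X - v0\<bar> * D a0 X + \<bar>t X - v1\<bar> * D a1 X" .
 moreover have nn: "0 \<le> \<bar>t X - v0\<bar> * D a0 X" "0 \<le> \<bar>t X - v1\<bar> * D a1 X"
 using pos[of a0 X] pos[of a1 X] by simp_all
 ultimately have "ennreal (max 0 (?g X)) \<le> ennreal (\<bar>t X - v0\<bar> * D a0 X + \<bar>t X - v1\<bar> * D a1 X)"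
 by (intro ennreal_leI) auto
 also have "... = ennreal \<bar>t X - v0\<bar> * ennreal (D a0 X) + ennreal \<bar>t X - v1\<bar> * ennreal (D a1 X)"
 using nn pos[of a0 X] pos[of a1 X] by (simp add: ennreal_plus ennreal_mult less_imp_le)
 finally show "ennreal (max 0 (?g X)) \<le> ..." .
 qed
 also have "... = (\<integral>\<^sup>+X. ennreal \<bar>t X - v0\<bar> * ennreal (D a0 X) \<partial>?P) + (\<integral>\<^sup>+X. ennreal \<bar>t X - v1\<bar> * ennreal (D a1 X) \<partial>?P)"
 by (rule nn_integral_add; unfold D_def; measurable)
 finally show ?thesis unfolding D_def .
qed

text \<open>Identity covariance is admissible because \<open>K \<ge> 1\<close>; the same inequality
  enlarges the Hoelder ball of radius 1 to radius \<open>K\<close>.\<close>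

lemma gauss_tilt_density_class:
 fixes a :: "real^'n::finite => real"
 assumes K: "K \<ge> 1" and a: "a \<in> holder_class \<beta> 2 1" "a \<in> bmeas"
 and I: "(\<integral>x. exp (a x) \<partial>gauss_measure) = 1"
 shows "(%x. gauss_density x * exp (a x)) \<in> density_class \<beta> K"
proof -
 have le: "loewner_le (mat (inverse K)) (mat 1 :: real^'n^'n)" "loewner_le (mat 1 :: real^'n^'n) (mat K)" "loewner_le 0 (mat 1 :: real^'n^'n)"
 proof -
 have m: "mat c *v x = c *\<^sub>R x" for c and x :: "real^'n"
 by (simp add: vec_eq_iff matrix_vector_mult_def mat_def if_distrib if_distribR cong: if_cong)
 have "inverse K \<le> 1" using K by (simp add: inverse_eq_divide divide_le_eq)
 then have "inverse K * (x \<bullet> x) \<le> 1 * (x \<bullet> x)" "1 * (x \<bullet> x) \<le> K * (x \<bullet> x)" for x :: "real^'n"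
 using K by (intro mult_right_mono; simp)+
 then show "loewner_le (mat (inverse K)) (mat 1 :: real^'n^'n)" "loewner_le (mat 1 :: real^'n^'n) (mat K)" "loewner_le 0 (mat 1 :: real^'n^'n)"
 unfolding loewner_le_def m by simp_all
 qed
 have t: "transpose (mat 1 :: real^'n^'n) = mat 1" by (rule transpose_mat)
 have "matrix_inv (mat 1 :: real^'n^'n) = mat 1"
 by (simp add: matrix_inv_def matrix_mul_lid matrix_mul_rid)
 then have S: "is_inverse_sqrt (mat 1 :: real^'n^'n) (mat 1)" unfolding is_inverse_sqrt_def using t le(3) by (metis matrix_mul_lid)
 have M: "mat 1 \<in> (sym_between K :: (real^'n^'n) set)" unfolding sym_between_def using t le(1,2) by blast
 have "ennreal 1 \<le> ennreal K" using K by (rule ennreal_leI)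
 moreover obtain D where D: "is_jet (nat \<lfloor>\<beta>\<rfloor>) a D" "(\<Sum>nu | mi_order nu \<le> nat \<lfloor>\<beta>\<rfloor>. Linf_norm (D nu))
 + (\<Sum>nu | mi_order nu = nat \<lfloor>\<beta>\<rfloor>. holder_seminorm (\<beta> - of_int \<lfloor>\<beta>\<rfloor>) 2 (D nu)) \<le> ennreal 1"
 using a(1) unfolding holder_class_def mem_Collect_eq by (elim exE conjE)
 ultimately have aK: "a \<in> holder_class \<beta> 2 K"
 unfolding holder_class_def mem_Collect_eq by (intro exI[of _ D] conjI D(1)) (rule order_trans[OF D(2)])
 have "(LBINT x. gauss_density x * exp (a x)) = 1"
 using integral_gauss(2)[of "%x. exp (a x)"] I a(2) by (simp add: mult.commute)
 then show ?thesis unfolding density_class_def mem_Collect_eq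
 by (intro exI[of _ "mat 1"] exI[of _ a] conjI M S aK) (simp_all only: matrix_vector_mul_lid)
qed

lemma sum_Pow_split:
 fixes g :: "'a set => ennreal"
 assumes "finite A" "k \<in> A"
 shows "(\<Sum>sg\<in>Pow A. g sg) = (\<Sum>sg\<in>Pow (A - {k}). g sg + g (insert k sg))"
proof -
 have "Pow A = Pow (A - {k}) \<union> insert k ` Pow (A - {k})"
 using assms(2) by (metis Pow_insert insert_Diff)
 moreover have "Pow (A - {k}) \<inter> insert k ` Pow (A - {k}) = {}" by auto
 moreover have "inj_on (insert k) (Pow (A - {k}))" unfolding inj_on_def by (metis Diff_iff PowD insertI1 insert_ident subsetD)
 ultimately show ?thesis using assms(1) by (simp add: sum.union_disjoint sum.reindex sum.distrib)
qed

text \<open>The IPM at a sample dominates the sum of all coordinate errors, since one test function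
  may carry an arbitrary sign on each bump. The risk is then averaged over all subsets
  \<open>sg\<close>, and for each \<open>k\<close> the subsets are paired with and without
  \<open>k\<close>. That the mean of \<open>P k\<close> depends only on membership of
  \<open>k\<close> turns each pair into a two-point problem.\<close>

lemma assouad:
 fixes P :: "'k => real^'n::finite => real" and a :: "'k set => real^'n => real" and \<theta> :: "(nat => real^'n) => (real^'n) measure"
 and kp Dl \<gamma> \<beta> B :: real
 assumes fin: "finite Lm" and K: "K \<ge> 1" and N: "N > 0" and \<gamma>: "\<gamma> > 0" and \<theta>: "\<theta> \<in> estimators N"
 and a: "!!sg. sg \<subseteq> Lm ==> continuous_on UNIV (a sg)" "!!sg x. sg \<subseteq> Lm ==> \<bar>a sg x\<bar> \<le> B"
 "!!sg. sg \<subseteq> Lm ==> (\<integral>x. exp (a sg x) \<partial>gauss_measure) = 1" "!!sg. sg \<subseteq> Lm ==> a sg \<in> holder_class \<beta> 2 1"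
 and chi: "!!sg k. k \<in> Lm ==> sg \<subseteq> Lm - {k} ==> (\<integral>x. exp (2 * a (insert k sg) x - a sg x) \<partial>gauss_measure) \<le> 1 + 1 / (5 * real N)"
 and P: "!!k. k \<in> Lm ==> continuous_on UNIV (P k)" "!!k x. k \<in> Lm ==> \<bar>P k x\<bar> \<le> 1"
 and test: "!!s. (!!k. \<bar>s k\<bar> \<le> 1) ==> (%x. kp * (\<Sum>k\<in>Lm. s k * P k x)) \<in> holder_class \<gamma> 0 1" and kp: "kp \<ge> 0"
 and v: "!!sg k. k \<in> Lm ==> sg \<subseteq> Lm ==> (\<integral>x. P k x * exp (a sg x) \<partial>gauss_measure) = (if k \<in> sg then v1 k else v0 k)"
 and gap: "!!k. k \<in> Lm ==> Dl \<le> \<bar>v1 k - v0 k\<bar>" and Dl: "Dl \<ge> 0"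
 shows "ennreal (card Lm * (kp * Dl) / 4) \<le> max_risk \<beta> K \<gamma> N \<theta>"
proof (cases "Lm = {}")
 case False
 let ?G = "gauss_measure :: (real^'n) measure" let ?P = "PiM {..<N} (%_. ?G)"
 let ?R = "max_risk \<beta> K \<gamma> N \<theta>"
 have sG[measurable_cong]: "sets ?G = sets borel" by (rule sets_gauss_measure)
 have sP: "sets ?P = sets (PiM {..<N} (%_. borel :: (real^'n) measure))" by (rule sets_PiM_cong) (auto simp: sG)
 have Pm[measurable]: "P k \<in> bmeas" if "k \<in> Lm" for k by (rule borel_measurable_continuous_onI[OF P(1)[OF that]])
 have am: "a sg \<in> bmeas" if "sg \<subseteq> Lm" for sg by (rule borel_measurable_continuous_onI[OF a(1)[OF that]])
 define t where "t k X = (\<integral>x. P k x \<partial>\<theta> X)" for k X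
 have tm: "t k \<in> borel_measurable ?P" if "k \<in> Lm" for k
 proof -
 have "\<theta> \<in> PiM {..<N} (%_. borel) \<rightarrow>\<^sub>M subprob_algebra borel"
 using \<theta> by (auto simp: estimators_def intro: measurable_prob_algebraD)
 then have "t k \<in> borel_measurable (PiM {..<N} (%_. borel))"
 unfolding t_def[abs_def] using measurable_compose[OF _ integral_measurable_subprob_algebra[OF Pm[OF that]]] by blast
 then show ?thesis using measurable_cong_sets[OF sP refl] by blast
 qed
 define W where "W k c sg = (\<integral>\<^sup>+X. ennreal \<bar>t k X - c\<bar> * ennreal (\<Prod>i<N. exp (a sg (X i))) \<partial>?P)" for k c sg
 define V where "V sg k = (if k \<in> sg then v1 k else v0 k)" for sg k
 have one: "(\<Sum>k\<in>Lm. ennreal kp * W k (V sg k) sg) \<le> ?R" if sg: "sg \<subseteq> Lm" for sg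
 proof -
 note [measurable] = am[OF sg]
 let ?p = "%x. gauss_density x * exp (a sg x)"
 have "\<bar>exp (a sg x)\<bar> \<le> exp B" for x using a(2)[OF sg, of x] by (simp add: abs_le_iff)
 then have ei: "integrable ?G (%x. exp (a sg x))"
 by (intro prob_integral_bound(1)[OF prob_space_gauss sG]) (auto intro!: continuous_intros a(1)[OF sg])
 have I: "(\<integral>\<^sup>+x. ennreal (exp (a sg x)) \<partial>?G) = 1"
 by (subst nn_integral_eq_integral[OF ei]) (simp_all add: a(3)[OF sg])
 have pp: "prob_space (prob_of_density ?p)" by (rule prob_space_tilt[OF am[OF sg] I])
 have sp: "sets (prob_of_density ?p) = sets borel" by (simp add: prob_of_density_def)
 have vp: "(\<integral>x. P k x \<partial>prob_of_density ?p) = V sg k" if "k \<in> Lm" for k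
 proof -
 have "(\<integral>x. P k x \<partial>prob_of_density ?p) = (\<integral>x. exp (a sg x) *\<^sub>R P k x \<partial>?G)"
 unfolding gauss_tilt[OF am[OF sg]] using that by (intro integral_density) auto
 then show ?thesis using v[OF that sg] by (simp add: V_def mult.commute)
 qed
 have low: "(\<Sum>k\<in>Lm. ennreal kp * ennreal \<bar>t k X - V sg k\<bar>) \<le> ennreal (ipm (holder_class \<gamma> 0 1) (\<theta> X) (prob_of_density ?p))"
 if X: "X \<in> space ?P" for X
 proof -
 have "X \<in> space (PiM {..<N} (%_. borel))" using X sets_eq_imp_space_eq[OF sP] by simp
 then have "\<theta> X \<in> space (prob_algebra borel)" using \<theta> unfolding estimators_def by (auto dest: measurable_space)
 then have \<theta>p: "prob_space (\<theta> X)" "sets (\<theta> X) = sets borel" by (auto simp: space_prob_algebra)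
 \<comment> \<open>The signs depend on the sample; this is harmless because the test function is
   chosen after the sample, inside the supremum.\<close>
 define s where "s k = sgn (t k X - V sg k)" for k
 have e: "(\<integral>x. kp * (\<Sum>k\<in>Lm. s k * P k x) \<partial>nu) = kp * (\<Sum>k\<in>Lm. s k * (\<integral>x. P k x \<partial>nu))"
 if "prob_space nu" "sets nu = sets borel" for nu
 using prob_integral_bound(1)[OF that P(1) P(2)] by (subst integral_mult_right_zero, subst Bochner_Integration.integral_sum) auto
 have "(\<integral>x. kp * (\<Sum>k\<in>Lm. s k * P k x) \<partial>\<theta> X) - (\<integral>x. kp * (\<Sum>k\<in>Lm. s k * P k x) \<partial>prob_of_density ?p)
 \<le> ipm (holder_class \<gamma> 0 1) (\<theta> X) (prob_of_density ?p)"
 by (rule ipm_ge[OF \<gamma> \<theta>p pp sp test]) (simp add: s_def abs_sgn_eq)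
 moreover have "(\<integral>x. kp * (\<Sum>k\<in>Lm. s k * P k x) \<partial>\<theta> X) - (\<integral>x. kp * (\<Sum>k\<in>Lm. s k * P k x) \<partial>prob_of_density ?p)
 = (\<Sum>k\<in>Lm. kp * \<bar>t k X - V sg k\<bar>)"
 unfolding e[OF \<theta>p] e[OF pp sp] unfolding right_diff_distrib[symmetric] sum_subtractf[symmetric] sum_distrib_left
 by (intro sum.cong refl) (simp add: vp t_def[symmetric] s_def abs_sgn mult.commute)
 ultimately have "ennreal (\<Sum>k\<in>Lm. kp * \<bar>t k X - V sg k\<bar>) \<le> ennreal (ipm (holder_class \<gamma> 0 1) (\<theta> X) (prob_of_density ?p))"
 by (intro ennreal_leI) simp
 then show ?thesis using kp by (simp add: ennreal_mult sum_ennreal[symmetric] sum_nonneg flip: sum_ennreal)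
 qed
 have "(\<Sum>k\<in>Lm. ennreal kp * W k (V sg k) sg)
 = (\<integral>\<^sup>+X. ennreal (\<Prod>i<N. exp (a sg (X i))) * (\<Sum>k\<in>Lm. ennreal kp * ennreal \<bar>t k X - V sg k\<bar>) \<partial>?P)"
 proof -
 have m: "(%X. ennreal \<bar>t k X - V sg k\<bar> * ennreal (\<Prod>i<N. exp (a sg (X i)))) \<in> borel_measurable ?P" if "k \<in> Lm" for k
 using tm[OF that] by measurable
 have "(\<Sum>k\<in>Lm. ennreal kp * W k (V sg k) sg) = (\<Sum>k\<in>Lm. \<integral>\<^sup>+X. ennreal kp * (ennreal \<bar>t k X - V sg k\<bar> * ennreal (\<Prod>i<N. exp (a sg (X i)))) \<partial>?P)"
 unfolding W_def by (intro sum.cong refl nn_integral_cmult[symmetric] m)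
 also have "... = (\<integral>\<^sup>+X. (\<Sum>k\<in>Lm. ennreal kp * (ennreal \<bar>t k X - V sg k\<bar> * ennreal (\<Prod>i<N. exp (a sg (X i))))) \<partial>?P)"
 by (rule nn_integral_sum[symmetric]) (rule borel_measurable_times_ennreal, simp, rule m)
 also have "... = (\<integral>\<^sup>+X. ennreal (\<Prod>i<N. exp (a sg (X i))) * (\<Sum>k\<in>Lm. ennreal kp * ennreal \<bar>t k X - V sg k\<bar>) \<partial>?P)"
 unfolding sum_distrib_left by (intro nn_integral_cong sum.cong refl) (simp only: mult_ac)
 finally show ?thesis .
 qed
 also have "... = (\<integral>\<^sup>+X. (\<Sum>k\<in>Lm. ennreal kp * ennreal \<bar>t k X - V sg k\<bar>) \<partial>sample_law N ?p)"
 proof -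
 have mm: "(%X. ennreal kp * ennreal \<bar>t k X - V sg k\<bar>) \<in> borel_measurable ?P" if "k \<in> Lm" for k
 using tm[OF that] by measurable
 have md: "(%X. ennreal (\<Prod>i<N. exp (a sg (X i)))) \<in> borel_measurable ?P" by measurable
 show ?thesis unfolding sample_law_tilt[OF am[OF sg] I]
 by (rule nn_integral_density[OF md borel_measurable_sum[OF mm], symmetric])
 qed
 also have "... \<le> (\<integral>\<^sup>+X. ennreal (ipm (holder_class \<gamma> 0 1) (\<theta> X) (prob_of_density ?p)) \<partial>sample_law N ?p)"
 unfolding sample_law_tilt[OF am[OF sg] I] by (rule nn_integral_mono) (use low in simp)
 also have "... \<le> ?R" unfolding max_risk_def
 by (rule SUP_upper) (rule gauss_tilt_density_class[OF K a(4)[OF sg] am[OF sg] a(3)[OF sg]])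
 finally show ?thesis .
 qed
 have pair: "ennreal (Dl / 2) \<le> W k (V sg k) sg + W k (V (insert k sg) k) (insert k sg)" if k: "k \<in> Lm" and sg: "sg \<subseteq> Lm - {k}" for k sg
 proof -
 have s: "sg \<subseteq> Lm" "insert k sg \<subseteq> Lm" "k \<notin> sg" using k sg by auto
 have "ennreal (Dl / 2) \<le> ennreal (\<bar>v1 k - v0 k\<bar> / 2)" using gap[OF k] by (intro ennreal_leI) simp
 also have "... \<le> W k (v0 k) sg + W k (v1 k) (insert k sg)" unfolding W_def
 by (rule two_point_lower[OF a(1)[OF s(1)] a(2)[OF s(1)] a(1)[OF s(2)] a(2)[OF s(2)] a(3)[OF s(1)] a(3)[OF s(2)] chi[OF k sg] N tm[OF k]])
 finally show ?thesis using s by (simp add: V_def)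
 qed
 let ?c = "card Lm"
 have c: "?c > 0" using fin False by (simp add: card_gt_0_iff)
 \<comment> \<open>Each \<open>k\<close> has \<open>2 ^ (?c - 1)\<close> pairs and each pair
   contributes \<open>Dl / 2\<close>; relative to the \<open>2 ^ ?c\<close> hypotheses this is the
   factor 1/4.\<close>
 have "ennreal (2 ^ ?c) * ennreal (?c * (kp * Dl) / 4) = (\<Sum>k\<in>Lm. ennreal kp * (\<Sum>sg\<in>Pow (Lm - {k}). ennreal (Dl / 2)))"
 proof -
 have "ennreal kp * (\<Sum>sg\<in>Pow (Lm - {k}). ennreal (Dl / 2)) = ennreal (2 ^ ?c * (kp * Dl) / 4)" if "k \<in> Lm" for k
 proof -
 have "?c = Suc (card (Lm - {k}))" by (rule card.remove[OF fin that])
 then have "(2 :: real) ^ ?c = 2 * 2 ^ card (Lm - {k})" by simp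
 then have e: "2 ^ ?c * (kp * Dl) / 4 = kp * (2 ^ card (Lm - {k}) * (Dl / 2))" by simp
 have s: "(\<Sum>sg\<in>Pow (Lm - {k}). ennreal (Dl / 2)) = ennreal (2 ^ card (Lm - {k}) * (Dl / 2))"
 using Dl fin by (subst sum_ennreal) (auto simp: card_Pow)
 show ?thesis unfolding e s by (rule ennreal_mult[symmetric]) (use kp Dl in auto)
 qed
 then have "(\<Sum>k\<in>Lm. ennreal kp * (\<Sum>sg\<in>Pow (Lm - {k}). ennreal (Dl / 2))) = (\<Sum>k\<in>Lm. ennreal (2 ^ ?c * (kp * Dl) / 4))"
 by (rule sum.cong[OF refl])
 also have "... = ennreal (\<Sum>k\<in>Lm. 2 ^ ?c * (kp * Dl) / 4)" using kp Dl by (intro sum_ennreal) auto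
 also have "(\<Sum>k\<in>Lm. 2 ^ ?c * (kp * Dl) / 4) = 2 ^ ?c * (?c * (kp * Dl) / 4)" by simp
 also have "ennreal (2 ^ ?c * (?c * (kp * Dl) / 4)) = ennreal (2 ^ ?c) * ennreal (?c * (kp * Dl) / 4)"
 by (rule ennreal_mult) (use kp Dl in auto)
 finally show ?thesis by (rule sym)
 qed
 also have "... \<le> (\<Sum>k\<in>Lm. ennreal kp * (\<Sum>sg\<in>Pow Lm. W k (V sg k) sg))"
 proof (intro sum_mono mult_left_mono)
 fix k assume k: "k \<in> Lm"
 show "(\<Sum>sg\<in>Pow (Lm - {k}). ennreal (Dl / 2)) \<le> (\<Sum>sg\<in>Pow Lm. W k (V sg k) sg)"
 unfolding sum_Pow_split[OF fin k] by (intro sum_mono pair[OF k]) auto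
 qed simp
 also have "... = (\<Sum>sg\<in>Pow Lm. \<Sum>k\<in>Lm. ennreal kp * W k (V sg k) sg)"
 unfolding sum_distrib_left by (rule sum.swap)
 also have "... \<le> (\<Sum>sg\<in>Pow Lm. ?R)" by (intro sum_mono one) auto
 also have "... = ennreal (2 ^ ?c) * ?R" using fin by (simp add: card_Pow ennreal_of_nat_eq_real_of_nat)
 finally show ?thesis by (subst (asm) ennreal_mult_le_mult_iff) auto
qed simp

section \<open>Sums of bumps with disjoint supports\<close>

lemma abs_sum_disjoint:
 fixes f :: "'a => real"
 assumes "finite A" "!!a. a \<in> A ==> \<bar>f a\<bar> \<le> B" "B \<ge> 0" "!!a b. a \<in> A ==> b \<in> A ==> a \<noteq> b ==> f a = 0 \<or> f b = 0"
 shows "\<bar>\<Sum>a\<in>A. f a\<bar> \<le> B"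
proof (cases "\<exists>a\<in>A. f a \<noteq> 0")
 case True
 then obtain a where a: "a \<in> A" "f a \<noteq> 0" by blast
 have "sum f A = sum f {a}" by (rule sum.mono_neutral_right) (use assms(1,4) a in auto)
 then show ?thesis using assms(2)[OF a(1)] by simp
next
 case False
 then have "sum f A = 0" by (intro sum.neutral) auto
 then show ?thesis using assms(3) by simp
qed

text \<open>At most one summand is nonzero, so \<open>G\<close> acts on that one alone. With
  \<open>G\<close> an exponential, normalising constants become additive over the bumps.\<close>

lemma disjoint_sum_apply:
 fixes f :: "'a => real" and G :: "real => real"
 assumes "finite A" "!!a b. a \<in> A ==> b \<in> A ==> a \<noteq> b ==> f a = 0 \<or> f b = 0"
 shows "G (\<Sum>a\<in>A. f a) = G 0 + (\<Sum>a\<in>A. G (f a) - G 0)"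
proof (cases "\<exists>a\<in>A. f a \<noteq> 0")
 case True
 then obtain a where a: "a \<in> A" "f a \<noteq> 0" by blast
 have "sum f A = sum f {a}" by (rule sum.mono_neutral_right) (use assms a in auto)
 moreover have "(\<Sum>a\<in>A. G (f a) - G 0) = (\<Sum>a\<in>{a}. G (f a) - G 0)"
 proof (rule sum.mono_neutral_right[OF assms(1)])
 show "{a} \<subseteq> A" using a by simp
 show "\<forall>i\<in>A - {a}. G (f i) - G 0 = 0"
 proof
 fix i assume "i \<in> A - {a}"
 then have "f i = 0" using assms(2)[of i a] a by auto
 then show "G (f i) - G 0 = 0" by simp
 qed
 qed
 ultimately show ?thesis by simp
next
 case False
 then have "sum f A = 0" "(\<Sum>a\<in>A. G (f a) - G 0) = 0" by (intro sum.neutral; simp)+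
 then show ?thesis by simp
qed

text \<open>Above the scale \<open>bw\<close> the weight is at most a power of
  \<open>ln (1 / bw)\<close>. Below it the weight splits into that power and a logarithm of
  \<open>t = r / bw\<close>, which the surplus factor \<open>t powr (1 - sg)\<close> absorbs. So the
  weight costs no more than the logarithm at the bump scale.\<close>

lemma log_weight_scale:
 fixes r bw sg al :: real
 assumes bw: "0 < bw" "bw \<le> 1/2" and r: "r > 0" and sg: "0 \<le> sg" "sg < 1" and al: "al \<ge> 0"
 shows "min 1 (r / bw) * ln (inverse (min r (1/2))) powr al
 \<le> (1 + (al + 1) / (1 - sg)) powr al * (r / bw) powr sg * (1 + ln (1 / bw)) powr al"
proof -
 define l where "l = ln (1 / bw)"
 \<comment> \<open>A small exponent for bounding the logarithm by a power:
   \<open>ta * al \<le> 1 - sg\<close> is what can be afforded, and the added 1 keeps it defined for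
   \<open>al = 0\<close>.\<close>
 define ta where "ta = (1 - sg) / (al + 1)"
 have ta: "ta > 0" using sg al by (simp add: ta_def)
 define H where "H = (1 + 1 / ta) powr al"
 have He: "(1 + (al + 1) / (1 - sg)) powr al = H" by (simp add: H_def ta_def)
 have H1: "H \<ge> 1" unfolding H_def using ta al by (intro ge_one_powr_ge_zero) auto
 have l: "l \<ge> 0" unfolding l_def using bw by (intro ln_ge_zero) auto
 have goal: "min 1 (r / bw) * ln (inverse (min r (1/2))) powr al \<le> H * (r / bw) powr sg * (1 + l) powr al"
 proof (cases "r \<ge> bw")
 case True
 have "min r (1/2) \<ge> bw" using True bw by simp
 then have "inverse (min r (1/2)) \<le> 1 / bw" using bw by (simp add: inverse_eq_divide frac_le)
 moreover have p: "inverse (min r (1/2)) \<ge> 1" using r by (simp add: one_le_inverse_iff)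
 ultimately have "ln (inverse (min r (1/2))) \<le> l" unfolding l_def using r by (intro ln_mono) auto
 then have "ln (inverse (min r (1/2))) powr al \<le> (1 + l) powr al" using p al by (intro powr_mono2) auto
 moreover have "1 * 1 \<le> H * (r / bw) powr sg"
 using H1 True bw sg by (intro mult_mono ge_one_powr_ge_zero) auto
 ultimately have "1 * ln (inverse (min r (1/2))) powr al \<le> H * (r / bw) powr sg * (1 + l) powr al"
 by (intro mult_mono) auto
 then show ?thesis using True bw by simp
 next
 case False
 define t where "t = r / bw"
 have t: "0 < t" "t < 1" using False r bw by (auto simp: t_def)
 define u where "u = ln (1 / t)"
 have u: "u \<ge> 0" unfolding u_def using t by (intro ln_ge_zero) auto
 have "ln (inverse (min r (1/2))) = l + u"
 using False bw r by (simp add: l_def u_def t_def ln_div ln_inverse)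
 also have "... \<le> (1 + l) * (1 + u)" using l u by (simp add: distrib_left distrib_right)
 also have "... \<le> (1 + l) * ((1 + 1 / ta) * (1 / t) powr ta)"
 proof -
 have "u \<le> (1 / t) powr ta / ta" unfolding u_def using t ta by (intro ln_powr_bound) auto
 moreover have "1 \<le> (1 / t) powr ta" using t ta by (intro ge_one_powr_ge_zero) auto
 ultimately show ?thesis using l by (intro mult_left_mono) (auto simp: distrib_right)
 qed
 finally have "ln (inverse (min r (1/2))) powr al \<le> ((1 + l) * ((1 + 1 / ta) * (1 / t) powr ta)) powr al"
 using False bw r al by (intro powr_mono2) (auto intro!: ln_ge_zero simp: one_le_inverse_iff)
 also have "... = H * (1 / t) powr (ta * al) * (1 + l) powr al"
 using l ta t by (simp add: powr_mult powr_powr H_def)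
 finally have "t * ln (inverse (min r (1/2))) powr al \<le> t * (H * (1 / t) powr (ta * al) * (1 + l) powr al)"
 using t by (intro mult_left_mono) auto
 also have "... = H * (t powr 1 * t powr (- (ta * al))) * (1 + l) powr al"
 using t by (simp add: powr_minus powr_divide inverse_eq_divide)
 also have "t powr 1 * t powr (- (ta * al)) = t powr (1 - ta * al)" by (subst powr_add[symmetric]) simp
 also have "H * t powr (1 - ta * al) * (1 + l) powr al \<le> H * t powr sg * (1 + l) powr al"
 proof -
 have "ta * al \<le> ta * (al + 1)" using ta by simp
 also have "... = 1 - sg" using al by (simp add: ta_def)
 finally have "t powr (1 - ta * al) \<le> t powr sg" using t by (intro powr_mono') auto
 then show ?thesis using H1 by (intro mult_right_mono mult_left_mono) auto
 qed
 finally show ?thesis using t by (simp add: t_def)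
 qed
 then show ?thesis unfolding He l_def .
qed

lemma pbump_disjoint:
 fixes x :: "real^'n::finite"
 assumes "bw > 0" "\<bar>u $ i - v $ i\<bar> \<ge> 2 * bw" "mi_order nu \<le> N + 1"
 shows "pbump N nu (inverse bw *\<^sub>R (x - u)) = 0 \<or> pbump N nu (inverse bw *\<^sub>R (x - v)) = 0"
proof -
 have "\<bar>x $ i - u $ i\<bar> \<ge> bw \<or> \<bar>x $ i - v $ i\<bar> \<ge> bw" using assms(2) by linarith
 then have "\<bar>(inverse bw *\<^sub>R (x - u)) $ i\<bar> \<ge> 1 \<or> \<bar>(inverse bw *\<^sub>R (x - v)) $ i\<bar> \<ge> 1"
 using assms(1) by (simp add: abs_mult field_simps)
 then show ?thesis using pbump_supp[OF assms(3)] by blast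
qed

text \<open>With disjoint supports the derivatives are bounded as for a single bump, however many
  there are, and \<open>bw powr et\<close> pays for them. The remaining factor of the height pays
  for the weight. The constant \<open>q0\<close> makes room for a normalisation.\<close>

lemma bump_sum_holder:
 fixes et al :: real
 assumes et: "et > 0" and al: "al \<ge> 0" and N: "N \<ge> nat \<lfloor>et\<rfloor> + 1"
 obtains c0 where "c0 > 0" "!!bw e (A :: 'a set) xc c q0. 0 < bw ==> bw \<le> 1/2 ==> finite A ==>
 (\<forall>a\<in>A. \<forall>b\<in>A. a \<noteq> b --> (\<exists>i. \<bar>xc a $ i - xc b $ i\<bar> \<ge> 2 * bw)) ==> (\<forall>a\<in>A. \<bar>c a\<bar> \<le> 1) ==>
 0 \<le> e ==> e \<le> c0 * bw powr et * (1 + ln (1 / bw)) powr (- al) ==> \<bar>q0\<bar> \<le> c0 ==>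
 (%x :: real^'n::finite. e * (\<Sum>a\<in>A. c a * pbump N (%_. 0) (inverse bw *\<^sub>R (x - xc a))) + q0) \<in> holder_class et al 1"
proof -
 define m where "m = nat \<lfloor>et\<rfloor>"
 define sg where "sg = et - of_int \<lfloor>et\<rfloor>"
 have sg: "0 \<le> sg" "sg < 1" "real m + sg = et" using et by (auto simp: sg_def m_def) linarith
 let ?n = "real CARD('n)"
 obtain B where B: "B > 0" "!!nu (x :: real^'n). mi_order nu \<le> N + 1 ==> \<bar>pbump N nu x\<bar> \<le> B" by (rule pbump_bound, rule that)
 define H where "H = (1 + (al + 1) / (1 - sg)) powr al"
 have H: "H \<ge> 0" by (simp add: H_def)
 \<comment> \<open>Collects the sup bound, where \<open>q0\<close> accounts for the added 1, and the
   seminorm bound \<open>2 * ?n * B * H\<close>.\<close>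
 define G where "G = B + 1 + 2 * ?n * B * H"
 have G: "G > 0" "2 * ?n * B * H \<le> G" "B + 1 \<le> G" "B \<le> G" unfolding G_def using B(1) H by (auto intro!: add_pos_nonneg)
 define c0 where "c0 = 1 / (real (mi_count TYPE('n) m) * G)"
 have cnt: "real (mi_count TYPE('n) m) > 0" using mi_count_pos[where 'n = 'n] by simp
 have c0: "c0 > 0" unfolding c0_def using cnt G by simp
 show thesis
 proof (rule that[OF c0])
 fix bw e :: real and A :: "'a set" and xc :: "'a => real^'n" and c :: "'a => real" and q0 :: real
 assume bw: "0 < bw" "bw \<le> 1/2" and A: "finite A" and sep: "\<forall>a\<in>A. \<forall>b\<in>A. a \<noteq> b --> (\<exists>i. \<bar>xc a $ i - xc b $ i\<bar> \<ge> 2 * bw)"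
 and c: "\<forall>a\<in>A. \<bar>c a\<bar> \<le> 1" and e: "0 \<le> e" "e \<le> c0 * bw powr et * (1 + ln (1 / bw)) powr (- al)" and q0: "\<bar>q0\<bar> \<le> c0"
 define l where "l = 1 + ln (1 / bw)"
 have l: "l \<ge> 1" unfolding l_def using bw by (simp add: ln_ge_zero)
 define T where "T nu x = (\<Sum>a\<in>A. c a * pbump N nu (inverse bw *\<^sub>R (x - xc a)))" for nu and x :: "real^'n"
 have T: "\<bar>T nu x\<bar> \<le> B" if nu: "mi_order nu \<le> N + 1" for nu x
 unfolding T_def
 proof (rule abs_sum_disjoint[OF A])
 fix a assume "a \<in> A"
 then have "\<bar>c a\<bar> * \<bar>pbump N nu (inverse bw *\<^sub>R (x - xc a))\<bar> \<le> 1 * B" using c B(2)[OF nu] by (intro mult_mono) auto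
 then show "\<bar>c a * pbump N nu (inverse bw *\<^sub>R (x - xc a))\<bar> \<le> B" by (simp add: abs_mult)
 next
 fix a b assume "a \<in> A" "b \<in> A" "a \<noteq> b"
 with sep obtain i where "\<bar>xc a $ i - xc b $ i\<bar> \<ge> 2 * bw" by blast
 from pbump_disjoint[OF bw(1) this nu, of x]
 show "c a * pbump N nu (inverse bw *\<^sub>R (x - xc a)) = 0 \<or> c b * pbump N nu (inverse bw *\<^sub>R (x - xc b)) = 0" by auto
 qed (use B in simp)
 have Td: "(T nu has_derivative (%h. \<Sum>i\<in>UNIV. (inverse bw * T (nu(i := nu i + 1)) x) * h $ i)) (at x)"
 if nu: "mi_order nu \<le> N" for nu x
 proof -
 have "((%x. inverse bw *\<^sub>R (x - xc a)) has_derivative (%h. inverse bw *\<^sub>R h)) (at x)" for a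
 by (auto intro!: derivative_eq_intros)
 from has_derivative_compose[OF this pbump_deriv[OF nu]]
 have "((%x. \<Sum>a\<in>A. c a * pbump N nu (inverse bw *\<^sub>R (x - xc a))) has_derivative
 (%h. \<Sum>a\<in>A. c a * (\<Sum>i\<in>UNIV. pbump N (nu(i := nu i + 1)) (inverse bw *\<^sub>R (x - xc a)) * (inverse bw *\<^sub>R h) $ i))) (at x)"
 by (intro has_derivative_sum has_derivative_mult_right)
 moreover have "(%h. \<Sum>a\<in>A. c a * (\<Sum>i\<in>UNIV. pbump N (nu(i := nu i + 1)) (inverse bw *\<^sub>R (x - xc a)) * (inverse bw *\<^sub>R h) $ i))
 = (%h. \<Sum>i\<in>UNIV. (inverse bw * T (nu(i := nu i + 1)) x) * h $ i)"
 unfolding T_def sum_distrib_left sum_distrib_right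
 by (rule ext, subst sum.swap) (simp add: mult_ac)
 moreover have "T nu = (%x. \<Sum>a\<in>A. c a * pbump N nu (inverse bw *\<^sub>R (x - xc a)))" by (rule ext) (rule T_def)
 ultimately show ?thesis by (simp only:)
 qed
 have Tc: "continuous_on UNIV (T nu)" if "mi_order nu \<le> N" for nu
 by (rule has_derivative_continuous_on_UNIV[OF Td[OF that]])
 define D where "D nu x = e / bw ^ mi_order nu * T nu x + (if mi_order nu = 0 then q0 else 0)" for nu x
 have Dd: "(D nu has_derivative (%h. \<Sum>i\<in>UNIV. D (nu(i := nu i + 1)) x * h $ i)) (at x)" if nu: "mi_order nu \<le> N" for nu x
 proof -
 have "(D nu has_derivative (%h. e / bw ^ mi_order nu * (\<Sum>i\<in>UNIV. (inverse bw * T (nu(i := nu i + 1)) x) * h $ i) + 0)) (at x)"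
 unfolding D_def[abs_def] by (rule has_derivative_add[OF has_derivative_mult_right[OF Td[OF nu]] has_derivative_const])
 moreover have "(%h. e / bw ^ mi_order nu * (\<Sum>i\<in>UNIV. (inverse bw * T (nu(i := nu i + 1)) x) * h $ i) + 0)
 = (%h. \<Sum>i\<in>UNIV. D (nu(i := nu i + 1)) x * h $ i)"
 unfolding D_def mi_order_upd sum_distrib_left add_0_right using bw
 by (intro ext sum.cong refl) (simp add: field_simps)
 ultimately show ?thesis by (rule has_derivative_eq_rhs)
 qed
 have w: "e / bw ^ j \<le> c0" if "j \<le> m" for j
 proof -
 have "e \<le> c0 * bw powr et * 1"
 using l al c0 by (intro order_trans[OF e(2)] mult_left_mono) (auto simp: l_def powr_minus_divide ge_one_powr_ge_zero divide_le_eq_1)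
 also have "... \<le> c0 * bw powr j * 1"
 using c0 bw that sg by (intro mult_right_mono mult_left_mono powr_mono') auto
 finally show ?thesis using bw by (simp add: divide_le_eq powr_realpow)
 qed
 have "D (%_. 0) \<in> holder_class et al 1"
 proof (rule holder_class_of_smooth[where D = D and et = et and M = "c0 * G", folded m_def sg_def])
 fix nu :: "'n => nat" and x assume "mi_order nu < m"
 then show "(D nu has_derivative (%h. \<Sum>i\<in>UNIV. D (nu(i := nu i + 1)) x * h $ i)) (at x)"
 using N by (intro Dd) (simp add: m_def)
 next
 fix nu :: "'n => nat" assume "mi_order nu \<le> m"
 then show "continuous_on UNIV (D nu)"
 using N unfolding D_def[abs_def] by (intro continuous_intros Tc) (simp add: m_def)
 next
 fix nu :: "'n => nat" and x assume nu: "mi_order nu \<le> m"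
 have "\<bar>D nu x\<bar> \<le> e / bw ^ mi_order nu * \<bar>T nu x\<bar> + \<bar>q0\<bar>"
 unfolding D_def by (rule order_trans[OF abs_triangle_ineq]) (use e bw in \<open>auto simp: abs_mult\<close>)
 also have "... \<le> c0 * B + c0"
 using w[OF nu] T[of nu x] nu N q0 c0 by (intro add_mono mult_mono) (auto simp: m_def)
 also have "... = c0 * (B + 1)" by (simp add: distrib_left)
 also have "... \<le> c0 * G" using c0 G by (intro mult_left_mono) auto
 finally show "\<bar>D nu x\<bar> \<le> c0 * G" .
 next
 fix nu :: "'n => nat" and x y :: "real^'n" assume nu: "mi_order nu = m" and xy: "x \<noteq> y"
 define r where "r = norm (x - y)"
 have r: "r > 0" using xy by (simp add: r_def)
 have nuN: "mi_order nu \<le> N" using nu N by (simp add: m_def)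
 have n1: "1 \<le> ?n" by (simp add: Suc_leI)
 have "\<bar>T nu x - T nu y\<bar> \<le> 2 * B * 1" using T[of nu x] T[of nu y] nuN by (auto simp: abs_le_iff)
 also have "... \<le> 2 * B * ?n" using n1 B by (intro mult_left_mono) auto
 finally have t1: "\<bar>T nu x - T nu y\<bar> \<le> 2 * B * ?n" .
 have "\<bar>inverse bw * T (nu(i := nu i + 1)) z\<bar> \<le> B / bw" for i z
 proof -
 have "\<bar>T (nu(i := nu i + 1)) z\<bar> \<le> B" by (rule T) (unfold mi_order_upd, use nuN in simp)
 then have "\<bar>T (nu(i := nu i + 1)) z\<bar> / bw \<le> B / bw" using bw by (intro divide_right_mono) auto
 moreover have "\<bar>inverse bw * T (nu(i := nu i + 1)) z\<bar> = \<bar>T (nu(i := nu i + 1)) z\<bar> / bw"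
 using bw by (simp add: abs_mult field_simps)
 ultimately show ?thesis by simp
 qed
 then have t2: "\<bar>T nu x - T nu y\<bar> \<le> ?n * (B / bw) * r"
 unfolding r_def by (intro grad_bound_imp_lipschitz[OF Td[OF nuN]])
 \<comment> \<open>Combines the trivial and the Lipschitz bound in the form that
   \<open>log_weight_scale\<close> expects; points in different bumps need no separate
   treatment.\<close>
 have t3: "\<bar>T nu x - T nu y\<bar> \<le> 2 * ?n * B * min 1 (r / bw)"
 proof (cases "r / bw \<le> 1")
 case True
 have "?n * (B / bw) * r = 1 * (?n * B * (r / bw))" by simp
 also have "... \<le> 2 * (?n * B * (r / bw))" using B r bw by (intro mult_right_mono) auto
 finally show ?thesis using t2 True by simp
 qed (use t1 in \<open>simp add: mult_ac\<close>)
 let ?w = "ln (inverse (min (norm (x - y)) (1/2))) powr al"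
 have "\<bar>D nu x - D nu y\<bar> = e / bw ^ m * \<bar>T nu x - T nu y\<bar>"
 proof -
 have "D nu x - D nu y = e / bw ^ m * (T nu x - T nu y)" unfolding D_def nu by (simp add: right_diff_distrib)
 moreover have "\<bar>e / bw ^ m\<bar> = e / bw ^ m" using e bw by simp
 ultimately show ?thesis by (simp only: abs_mult)
 qed
 then have "\<bar>D nu x - D nu y\<bar> * ?w \<le> e / bw ^ m * (2 * ?n * B * min 1 (r / bw)) * ?w"
 using t3 e bw by (simp only:) (intro mult_right_mono mult_left_mono, auto)
 also have "... = e / bw ^ m * (2 * ?n * B) * (min 1 (r / bw) * ?w)" by (simp only: mult_ac)
 also have "... \<le> e / bw ^ m * (2 * ?n * B) * (H * (r / bw) powr sg * l powr al)"
 unfolding H_def l_def r_def[symmetric]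
 using e bw B by (intro mult_left_mono log_weight_scale[OF bw r sg(1,2) al]) auto
 also have "... = (e * l powr al / (bw powr m * bw powr sg)) * (2 * ?n * B * H) * r powr sg"
 using bw r by (simp add: powr_divide powr_realpow field_simps)
 also have "bw powr m * bw powr sg = bw powr et" using sg(3) by (simp flip: powr_add)
 also have "(e * l powr al / bw powr et) * (2 * ?n * B * H) * r powr sg \<le> c0 * G * r powr sg"
 proof (intro mult_right_mono mult_mono)
 have "e * l powr al \<le> c0 * bw powr et * l powr (- al) * l powr al"
 using e(2) by (intro mult_right_mono) (auto simp: l_def)
 also have "... = c0 * bw powr et" using l by (simp add: powr_minus)
 finally show "e * l powr al / bw powr et \<le> c0" using bw by (simp add: divide_le_eq)
 qed (use G B H c0 in auto)
 finally show "\<bar>D nu x - D nu y\<bar> * ?w \<le> c0 * G * norm (x - y) powr sg" unfolding r_def .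
 qed (use cnt G in \<open>simp_all add: c0_def\<close>)
 then show "(%x. e * (\<Sum>a\<in>A. c a * pbump N (%_. 0) (inverse bw *\<^sub>R (x - xc a))) + q0) \<in> holder_class et al 1"
 unfolding D_def[abs_def] T_def mi_order_0 by simp
 qed
qed

section \<open>The reflected bump hypotheses\<close>

lemma gauss_density_bounds:
 obtains g G where "g > 0" "G > 0" "!!x :: real^'n::finite. gauss_density x \<le> G" "!!x :: real^'n. \<forall>i. \<bar>x $ i\<bar> \<le> 1 ==> g \<le> gauss_density x"
proof -
 have h: "holder_bdd 0 1 (UNIV :: unit set) (%_. gauss_density :: real^'n => real)" by (rule gauss_density_holder_bdd) auto
 have c: "continuous_on A (gauss_density :: real^'n => real)" for A using holder_bdd_continuous[OF h, of "()"] by simp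
 obtain G where G: "G > 0" "!!u (x :: real^'n). u \<in> (UNIV :: unit set) ==> \<bar>gauss_density x\<bar> \<le> G" by (rule holder_bdd_bounded[OF h], rule that)
 have "\<exists>x\<in>cball (0 :: real^'n) CARD('n). \<forall>y\<in>cball (0 :: real^'n) CARD('n). gauss_density x \<le> gauss_density y"
 by (rule continuous_attains_inf[OF compact_cball _ c]) simp
 then obtain x0 :: "real^'n" where x0: "gauss_density x0 \<le> gauss_density y" if "y \<in> cball 0 CARD('n)" for y :: "real^'n" by blast
 show thesis
 proof (rule that[of "gauss_density x0" G])
 show "gauss_density x \<le> G" for x :: "real^'n" using G(2)[of "()" x] by auto
 show "gauss_density x0 \<le> gauss_density x" if "\<forall>i. \<bar>x $ i\<bar> \<le> 1" for x :: "real^'n"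
 using norm_le_card_inf[of x] that by (intro x0) simp
 qed (rule gauss_density_pos, rule G(1))
qed

lemma gauss_reflect:
 fixes f :: "real^'n::finite => real"
 assumes [measurable]: "f \<in> bmeas"
 shows "(\<integral>x. f (- x) \<partial>gauss_measure) = (\<integral>x. f x \<partial>gauss_measure)"
proof -
 have e: "gauss_density (- x) = gauss_density x" for x :: "real^'n"
 by (simp add: gauss_density_def normal_density_def)
 have "(LBINT x. f x * gauss_density x) = (LBINT x. f (- x) * gauss_density x)"
 by (subst lborel_affine_integral[of "-1" _ 0]) (simp_all add: e)
 then show ?thesis using integral_gauss(2)[of f] integral_gauss(2)[of "%x. f (- x)"] by simp
qed

lemma gauss_compare:
 fixes f :: "real^'n::finite => real"
 assumes g: "g > 0" "!!x :: real^'n. \<forall>i. \<bar>x $ i\<bar> \<le> 1 ==> g \<le> gauss_density x" and G: "!!x :: real^'n. gauss_density x \<le> G"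
 and f: "continuous_on UNIV f" "!!x. 0 \<le> f x" "!!x. f x \<le> 1" "!!x i. f x \<noteq> 0 ==> \<bar>x $ i\<bar> \<le> 1"
 shows "g * (LBINT x. f x) \<le> (\<integral>x. f x \<partial>gauss_measure)" "(\<integral>x. f x \<partial>gauss_measure) \<le> G * (LBINT x. f x)"
proof -
 have [measurable]: "f \<in> bmeas" by (rule borel_measurable_continuous_onI[OF f(1)])
 have f1: "\<bar>f x\<bar> \<le> 1" for x using f(2)[of x] f(3)[of x] by simp
 have "integrable gauss_measure f"
 by (rule prob_integral_bound(1)[OF prob_space_gauss sets_gauss_measure f(1) f1])
 then have i: "integrable lborel (%x. f x * gauss_density x)" by (simp add: integral_gauss)
 have le: "g * f x \<le> f x * gauss_density x" for x
 proof (cases "f x = 0")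
 case False
 then show ?thesis using g(2)[of x] f(4)[OF False] f(2)[of x] mult_right_mono[of g "gauss_density x" "f x"] by (simp add: mult.commute)
 qed simp
 have ig: "integrable lborel (%x. g * f x)"
 by (rule Bochner_Integration.integrable_bound[OF i]) (simp, intro AE_I2, simp add: abs_mult abs_of_nonneg[OF f(2)] abs_of_nonneg[OF gauss_density_nonneg] le g(1) less_imp_le)
 have if_: "integrable lborel f" using ig g(1) by simp
 have e: "(\<integral>x. f x \<partial>gauss_measure) = (LBINT x. f x * gauss_density x)" by (rule integral_gauss(2)) measurable
 have "(LBINT x. g * f x) \<le> (LBINT x. f x * gauss_density x)" by (rule integral_mono[OF ig i le])
 then show "g * (LBINT x. f x) \<le> (\<integral>x. f x \<partial>gauss_measure)" unfolding e by simp
 have "(LBINT x. f x * gauss_density x) \<le> (LBINT x. G * f x)"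
 by (rule integral_mono[OF i integrable_mult_right[OF if_]]) (simp add: mult.commute[of G] mult_left_mono G f(2))
 then show "(\<integral>x. f x \<partial>gauss_measure) \<le> G * (LBINT x. f x)" unfolding e by simp
qed

lemma pbump_sq_pos: "(LBINT x. (pbump N (%_ :: 'n::finite. 0) x)\<^sup>2) > 0"
proof -
 let ?p = "pbump N (%_::'n. 0)"
 have ip: "integrable lborel ?p" by (rule pbump_integrable) simp
 have le: "(?p x)\<^sup>2 \<le> ?p x" for x
 using pbump_0_nonneg[of N x] pbump_0_le_1[of N x] mult_left_le[of "?p x" "?p x"] by (simp add: power2_eq_square)
 have i: "integrable lborel (%x. (?p x)\<^sup>2)"
 by (rule Bochner_Integration.integrable_bound[OF ip]) (auto intro!: AE_I2 order_trans[OF le])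
 have "(LBINT x. (?p x)\<^sup>2) \<noteq> 0"
 proof
 assume "(LBINT x. (?p x)\<^sup>2) = 0"
 then have "AE x in lborel. (?p x)\<^sup>2 = 0" using integral_nonneg_eq_0_iff_AE[OF i] by simp
 then have "(LBINT x. ?p x) = 0" by (intro integral_eq_zero_AE) auto
 then show False using bump_mass_pos[of N, where 'n = 'n] by (simp add: bump_mass_def)
 qed
 moreover have "(LBINT x. (?p x)\<^sup>2) \<ge> 0" by (rule Bochner_Integration.integral_nonneg) simp
 ultimately show ?thesis by linarith
qed

lemma exp_minus_one_sq:
 fixes y :: real assumes "\<bar>y\<bar> \<le> 1" shows "(exp y - 1)\<^sup>2 \<le> 4 * y\<^sup>2"
proof -
 have "\<bar>exp y - 1\<bar> \<le> \<bar>2 * y\<bar>"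
 proof (cases "y \<ge> 0")
 case True
 have "exp y \<le> 1 + y + y\<^sup>2" using True assms by (intro exp_bound) auto
 moreover have "y\<^sup>2 \<le> y" using True assms mult_left_le[of y y] by (simp add: power2_eq_square)
 ultimately show ?thesis using True exp_ge_add_one_self[of y] by linarith
 next
 case False
 then show ?thesis using exp_ge_add_one_self[of y] exp_le_one_iff[of y] by linarith
 qed
 then have "(exp y - 1)\<^sup>2 \<le> (2 * y)\<^sup>2" unfolding abs_le_square_iff .
 then show ?thesis by (simp add: power_mult_distrib)
qed

text \<open>Height \<open>ep\<close> and width \<open>bw\<close> stay independent so that one
  construction can yield both rates. The two conditions are membership in the density class and
  indistinguishability of neighbouring hypotheses from \<open>N\<close> observations. Without the
  reflection, adding bump \<open>k\<close> would change the normaliser and thereby the mean of every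
  other \<open>P l\<close>.\<close>

lemma lower_core:
 fixes \<beta> \<gamma> K :: real
 assumes K: "K \<ge> 1" and \<beta>: "\<beta> > 0" and \<gamma>: "\<gamma> > 0"
 obtains c c1 c2 :: real where "c > 0" "c1 > 0" "c2 > 0"
 "!!N q (\<theta> :: (nat => real^'n::finite) => (real^'n) measure) ep bw. N > 0 ==> \<theta> \<in> estimators N ==> q > 0 ==> bw = 1 / (4 * real q) ==> 0 < ep ==>
 ep \<le> c1 * bw powr \<beta> * (1 + ln (1 / bw)) powr (- 2) ==> ep\<^sup>2 * bw ^ CARD('n) * real N \<le> c2 ==>
 ennreal (c * (bw powr \<gamma> * ep)) \<le> max_risk \<beta> K \<gamma> N \<theta>"
proof -
 let ?n = "CARD('n)"
 \<comment> \<open>Enough derivatives for the bumps to be both perturbations of smoothness \<beta>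
   and test functions of smoothness \<gamma>.\<close>
 define Nb where "Nb = nat \<lfloor>\<beta>\<rfloor> + nat \<lfloor>\<gamma>\<rfloor> + 1"
 define ps where "ps = pbump Nb (%_ :: 'n. 0)"
 obtain cb where cb: "cb > 0" "!!bw e (A :: ('n => nat) set) xc c q0. 0 < bw ==> bw \<le> 1/2 ==> finite A ==>
 (\<forall>a\<in>A. \<forall>b\<in>A. a \<noteq> b --> (\<exists>i. \<bar>xc a $ i - xc b $ i\<bar> \<ge> 2 * bw)) ==> (\<forall>a\<in>A. \<bar>c a\<bar> \<le> 1) ==>
 0 \<le> e ==> e \<le> cb * bw powr \<beta> * (1 + ln (1 / bw)) powr (- 2) ==> \<bar>q0\<bar> \<le> cb ==>
 (%x :: real^'n. e * (\<Sum>a\<in>A. c a * ps (inverse bw *\<^sub>R (x - xc a))) + q0) \<in> holder_class \<beta> 2 1"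
 by (rule bump_sum_holder[where 'n = 'n and 'a = "'n => nat" and N = Nb and al = 2, OF \<beta>, folded ps_def]) (simp, simp add: Nb_def, rule that)
 obtain cg where cg: "cg > 0" "!!bw e (A :: ('n => nat) set) xc c q0. 0 < bw ==> bw \<le> 1/2 ==> finite A ==>
 (\<forall>a\<in>A. \<forall>b\<in>A. a \<noteq> b --> (\<exists>i. \<bar>xc a $ i - xc b $ i\<bar> \<ge> 2 * bw)) ==> (\<forall>a\<in>A. \<bar>c a\<bar> \<le> 1) ==>
 0 \<le> e ==> e \<le> cg * bw powr \<gamma> * (1 + ln (1 / bw)) powr (- 0) ==> \<bar>q0\<bar> \<le> cg ==>
 (%x :: real^'n. e * (\<Sum>a\<in>A. c a * ps (inverse bw *\<^sub>R (x - xc a))) + q0) \<in> holder_class \<gamma> 0 1"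
 by (rule bump_sum_holder[where 'n = 'n and 'a = "'n => nat" and N = Nb and al = 0, OF \<gamma>, folded ps_def]) (simp, simp add: Nb_def, rule that)
 obtain g G where g: "g > 0" "!!x :: real^'n. \<forall>i. \<bar>x $ i\<bar> \<le> 1 ==> g \<le> gauss_density x"
 and G: "G > 0" "!!x :: real^'n. gauss_density x \<le> G"
 proof (rule gauss_density_bounds[where 'n = 'n])
 fix g G :: real
 assume "g > 0" "G > 0" "!!x :: real^'n. gauss_density x \<le> G" "!!x :: real^'n. \<forall>i. \<bar>x $ i\<bar> \<le> 1 ==> g \<le> gauss_density x"
 then show thesis by (intro that[of g G])
 qed
 define mass where "mass = bump_mass Nb TYPE('n)"
 have mass: "mass > 0" "mass = (LBINT x. ps x)" unfolding mass_def ps_def by (rule bump_mass_pos) (simp add: bump_mass_def)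
 define s2 where "s2 = (LBINT x. (ps x)\<^sup>2)"
 have s2: "s2 > 0" unfolding s2_def ps_def by (rule pbump_sq_pos)
 have ps: "0 \<le> ps x" "ps x \<le> 1" "ps (- x) = ps x" for x unfolding ps_def by (rule pbump_0_nonneg pbump_0_le_1 pbump_0_even)+
 have psc: "continuous_on UNIV (%x. ps (d *\<^sub>R (x - v)))" for d v
 unfolding ps_def by (rule continuous_on_compose2[OF pbump_cont[of UNIV]]) (auto intro!: continuous_intros)
 \<comment> \<open>Keeps \<open>ep\<close> below 1 for the exponential estimates and below
   \<open>cb\<close>, which \<open>ln Z\<close> must not exceed as additive constant.\<close>
 define c1 where "c1 = min cb 1"
 \<comment> \<open>In the chi-square estimate the factor is 24: 3 bounds the exponential, 4 comes
   from \<open>exp_minus_one_sq\<close>, and 2 counts the bump and its reflection. Then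
   \<open>24 * G * mass * c2 = 1/5\<close>.\<close>
 define c2 where "c2 = 1 / (120 * G * mass)"
 define c where "c = cg * g * s2 / (12 * 4 ^ ?n)"
 have c: "c > 0" "c1 > 0" "c2 > 0" unfolding c_def c1_def c2_def using cg(1) g(1) s2 cb(1) G(1) mass(1) by auto
 let ?G = "gauss_measure :: (real^'n) measure"
 note gi = prob_integral_bound(1)[OF prob_space_gauss sets_gauss_measure]
 show thesis
 proof (rule that[OF c])
 fix N q :: nat and \<theta> :: "(nat => real^'n) => (real^'n) measure" and ep bw :: real
 assume N: "N > 0" and \<theta>: "\<theta> \<in> estimators N" and q: "q > 0" and bwq: "bw = 1 / (4 * real q)" and ep: "0 < ep"
 and ep1: "ep \<le> c1 * bw powr \<beta> * (1 + ln (1 / bw)) powr (- 2)" and ep2: "ep\<^sup>2 * bw ^ ?n * real N \<le> c2"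
 have bw: "0 < bw" "bw \<le> 1/2" "4 * bw * real q = 1" using q unfolding bwq by (auto simp: field_simps)
 have "ln (1 / bw) \<ge> 0" using bw by (intro ln_ge_zero) auto
 then have w: "(1 + ln (1 / bw)) powr (- 2) \<le> 1" using powr_mono[of "-2" 0 "1 + ln (1 / bw)"] by simp
 have "bw powr \<beta> \<le> 1" using bw \<beta> by (intro powr_le1) auto
 then have "c1 * bw powr \<beta> * (1 + ln (1 / bw)) powr (- 2) \<le> c1 * 1 * 1" using w c by (intro mult_mono) auto
 then have ep3: "ep \<le> 1" "ep \<le> cb" using ep1 unfolding c1_def by auto
 have ep4: "ep \<le> cb * bw powr \<beta> * (1 + ln (1 / bw)) powr (- 2)"
 using ep1 by (rule order_trans) (intro mult_right_mono, auto simp: c1_def)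
 define Lm where "Lm = {k :: 'n => nat. \<forall>i. k i < q}"
 have Lm': "Lm = PiE UNIV (%_. {..<q})" unfolding Lm_def by (auto simp: PiE_iff)
 have Lm: "finite Lm" "card Lm = q ^ ?n" unfolding Lm' by (auto intro!: finite_PiE simp: card_PiE)
 \<comment> \<open>Centres in the unit cube with spacing \<open>4 * bw\<close>, kept at distance
   \<open>2 * bw\<close> from the coordinate hyperplanes; thus bumps and reflections of all indices
   are mutually disjoint.\<close>
 define u where "u k = (\<chi> i. 4 * bw * real (k i) + 2 * bw)" for k :: "'n => nat"
 define xc where "xc sg k = (if k \<in> sg then u k else - u k)" for sg k
 define R where "R sg k x = ps (inverse bw *\<^sub>R (x - xc sg k))" for sg k x
 define P where "P k x = ps (inverse bw *\<^sub>R (x - u k))" for k x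
 define Q where "Q k x = ps (inverse bw *\<^sub>R (x - (- u k)))" for k x
 have RP: "R sg k x = (if k \<in> sg then P k x else Q k x)" for sg k x by (simp add: R_def P_def Q_def xc_def)
 have up: "u k $ i \<ge> 2 * bw" for k i using bw by (simp add: u_def)
 have sep: "\<exists>i. \<bar>xc sg k $ i - xc ta l $ i\<bar> \<ge> 2 * bw" if "k \<noteq> l" for k l sg ta
 proof -
 from that obtain i where i: "k i \<noteq> l i" by (meson ext)
 then have "1 \<le> \<bar>real (k i) - real (l i)\<bar>" by linarith
 then have "4 * bw * 1 \<le> 4 * bw * \<bar>real (k i) - real (l i)\<bar>" using bw by (intro mult_left_mono) auto
 also have "... = \<bar>u k $ i - u l $ i\<bar>" using bw by (simp add: u_def abs_mult flip: right_diff_distrib)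
 finally have A: "4 * bw \<le> \<bar>u k $ i - u l $ i\<bar>" by simp
 have x: "xc sg k $ i = u k $ i \<or> xc sg k $ i = - (u k $ i)" for sg k by (simp add: xc_def)
 have "\<bar>xc sg k $ i - xc ta l $ i\<bar> \<ge> 2 * bw"
 using x[of sg k] x[of ta l] A up[of k i] up[of l i] bw by (elim disjE) linarith+
 then show ?thesis ..
 qed
 have dis: "R sg k x = 0 \<or> R ta l x = 0" if kl: "k \<noteq> l" for k l sg ta x
 proof -
 obtain i where "\<bar>xc sg k $ i - xc ta l $ i\<bar> \<ge> 2 * bw" using sep[OF kl] ..
 then show ?thesis unfolding R_def ps_def by (rule pbump_disjoint[OF bw(1)]) simp
 qed
 have PQ: "P k x = 0 \<or> Q k x = 0" for k x
 unfolding P_def Q_def ps_def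
 by (rule pbump_disjoint[OF bw(1), of _ undefined]) (use up[of k undefined] bw in auto)
 have P: "0 \<le> P k x" "P k x \<le> 1" and Q: "0 \<le> Q k x" "Q k x \<le> 1" and R: "0 \<le> R sg k x" "R sg k x \<le> 1" for sg k x
 unfolding P_def Q_def R_def by (rule ps)+
 have Pc[continuous_intros]: "continuous_on UNIV (P k)" and Qc[continuous_intros]: "continuous_on UNIV (Q k)" and Rc[continuous_intros]: "continuous_on UNIV (R sg k)" for sg k
 unfolding P_def[abs_def] Q_def[abs_def] R_def[abs_def] by (rule psc)+
 have QP: "Q k x = P k (- x)" for k x
 proof -
 have "inverse bw *\<^sub>R (x - (- u k)) = - (inverse bw *\<^sub>R (- x - u k))" by (simp add: scaleR_add_right scaleR_diff_right)
 then show ?thesis unfolding P_def Q_def using ps(3) by metis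
 qed
 have Psupp: "\<bar>x $ i\<bar> \<le> 1" if k: "k \<in> Lm" and "P k x \<noteq> 0" for k x i
 proof -
 have "\<not> \<bar>(inverse bw *\<^sub>R (x - u k)) $ i\<bar> \<ge> 1"
 using pbump_supp[of "%_. 0" Nb "inverse bw *\<^sub>R (x - u k)" i] that(2) unfolding P_def ps_def by auto
 then have "\<bar>x $ i - u k $ i\<bar> < bw" using bw by (simp add: abs_mult field_simps)
 moreover have "u k $ i \<le> 1 - 2 * bw"
 proof -
 have "k i + 1 \<le> q" using k by (simp add: Lm_def Suc_le_eq)
 then have "real (k i + 1) \<le> real q" by (rule of_nat_mono)
 then have "real (k i) + 1 \<le> real q" by simp
 then have "4 * bw * (real (k i) + 1) \<le> 4 * bw * real q" using bw by (intro mult_left_mono) auto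
 then show ?thesis using bw by (simp add: u_def distrib_left)
 qed
 ultimately show ?thesis using up[of k i] bw by linarith
 qed
 define b where "b sg x = ep * (\<Sum>k\<in>Lm. R sg k x)" for sg x
 have b: "0 \<le> b sg x" "b sg x \<le> ep" for sg x
 proof -
 have "\<bar>\<Sum>k\<in>Lm. R sg k x\<bar> \<le> 1" by (rule abs_sum_disjoint[OF Lm(1) _ _ dis]) (use R in auto)
 then have "ep * (\<Sum>k\<in>Lm. R sg k x) \<le> ep * 1" using ep by (intro mult_left_mono) auto
 then show "b sg x \<le> ep" by (simp add: b_def)
 show "0 \<le> b sg x" unfolding b_def using ep R by (intro mult_nonneg_nonneg sum_nonneg) auto
 qed
 have bc[continuous_intros]: "continuous_on UNIV (b sg)" for sg unfolding b_def[abs_def] by (intro continuous_intros)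
 define z where "z k = (\<integral>x. exp (ep * P k x) - 1 \<partial>?G)" for k
 have eR: "\<bar>exp (ep * y) - 1\<bar> \<le> exp ep" "0 \<le> exp (ep * y) - 1" if "0 \<le> y" "y \<le> 1" for y
 proof -
 have "exp (ep * y) \<le> exp ep" "1 \<le> exp (ep * y)" using that ep mult_left_le[of y ep] by auto
 then show "\<bar>exp (ep * y) - 1\<bar> \<le> exp ep" "0 \<le> exp (ep * y) - 1"
 using exp_gt_zero[of ep] by linarith+
 qed
 have zi: "integrable ?G (%x. exp (ep * R sg k x) - 1)" for sg k
 by (rule gi[of _ "exp ep"]) (intro continuous_intros, rule eR, rule R, rule R)
 \<comment> \<open>The Gaussian is symmetric, so a bump and its reflection have the same exponential
   mass. Hence \<open>Z\<close> is independent of \<open>sg\<close>.\<close>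
 have z: "(\<integral>x. exp (ep * R sg k x) - 1 \<partial>?G) = z k" for sg k
 proof (cases "k \<in> sg")
 case False
 have "(%x. exp (ep * P k x) - 1) \<in> bmeas"
 by (intro borel_measurable_continuous_onI continuous_intros)
 from gauss_reflect[OF this] show ?thesis using False by (simp add: RP QP z_def)
 qed (simp add: RP z_def)
 have z0: "z k \<ge> 0" for k unfolding z_def by (rule Bochner_Integration.integral_nonneg) (rule eR(2), rule P, rule P)
 define Z where "Z = 1 + (\<Sum>k\<in>Lm. z k)"
 have Z1: "Z \<ge> 1" unfolding Z_def using z0 by (simp add: sum_nonneg)
 interpret GP: prob_space ?G by (rule prob_space_gauss)
 have IZ: "(\<integral>x. exp (b sg x) \<partial>?G) = Z" for sg
 proof -
 have "exp (b sg x) = 1 + (\<Sum>k\<in>Lm. exp (ep * R sg k x) - 1)" for x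
 proof -
 have "exp (ep * (\<Sum>k\<in>Lm. R sg k x)) = exp (ep * 0) + (\<Sum>k\<in>Lm. exp (ep * R sg k x) - exp (ep * 0))"
 by (rule disjoint_sum_apply[where G = "%y. exp (ep * y)" and f = "%k. R sg k x", OF Lm(1) dis])
 then show ?thesis by (simp add: b_def)
 qed
 then have "(\<integral>x. exp (b sg x) \<partial>?G) = (\<integral>x. 1 + (\<Sum>k\<in>Lm. exp (ep * R sg k x) - 1) \<partial>?G)" by simp
 also have "... = (\<integral>x. 1 \<partial>?G) + (\<integral>x. (\<Sum>k\<in>Lm. exp (ep * R sg k x) - 1) \<partial>?G)"
 by (rule Bochner_Integration.integral_add) (rule GP.integrable_const, rule Bochner_Integration.integrable_sum, rule zi)
 also have "(\<integral>x. (\<Sum>k\<in>Lm. exp (ep * R sg k x) - 1) \<partial>?G) = (\<Sum>k\<in>Lm. z k)"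
 by (subst Bochner_Integration.integral_sum) (rule zi, simp only: z)
 finally show ?thesis using GP.prob_space by (simp add: Z_def space_gauss_measure)
 qed
 have eb: "\<bar>exp (b sg x)\<bar> \<le> exp ep" for sg x using b(2)[of sg x] by simp
 have Z2: "Z \<le> exp ep"
 proof -
 have "\<bar>\<integral>x. exp (b {} x) \<partial>?G\<bar> \<le> exp ep"
 by (rule prob_integral_bound(2)[OF prob_space_gauss sets_gauss_measure _ eb]) (intro continuous_intros)
 then show ?thesis unfolding IZ by linarith
 qed
 have Z3: "0 \<le> ln Z" "ln Z \<le> ep" "Z \<le> 3"
 proof -
 show "0 \<le> ln Z" using Z1 by (rule ln_ge_zero)
 show "ln Z \<le> ep" using Z1 Z2 by (metis exp_gt_zero ln_exp ln_le_cancel_iff order_less_le_trans zero_less_one)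
 have "exp ep \<le> exp 1" using ep3 by simp
 then show "Z \<le> 3" using Z2 exp_le by linarith
 qed
 define a where "a sg x = b sg x - ln Z" for sg x
 have ac[continuous_intros]: "continuous_on UNIV (a sg)" for sg unfolding a_def[abs_def] by (intro continuous_intros)
 have ab: "\<bar>a sg x\<bar> \<le> 1" for sg x using b[of sg x] Z3 ep3 unfolding a_def by linarith
 have ea: "exp (a sg x) = exp (b sg x) / Z" for sg x unfolding a_def using Z1 by (simp add: exp_diff)
 have Ia: "(\<integral>x. exp (a sg x) \<partial>?G) = 1" for sg unfolding ea using IZ[of sg] Z1 by simp
 have ah: "a sg \<in> holder_class \<beta> 2 1" for sg
 proof -
 have "(%x :: real^'n. ep * (\<Sum>k\<in>Lm. 1 * ps (inverse bw *\<^sub>R (x - xc sg k))) + (- ln Z)) \<in> holder_class \<beta> 2 1"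
 by (rule cb(2)[OF bw(1,2) Lm(1) _ _ _ ep4]) (use sep ep Z3 ep3 in auto)
 then show ?thesis unfolding a_def[abs_def] b_def R_def by simp
 qed
 have IP: "(\<integral>x. P k x \<partial>?G) \<le> G * (bw ^ ?n * mass)" "g * (bw ^ ?n * s2) \<le> (\<integral>x. (P k x)\<^sup>2 \<partial>?G)" if k: "k \<in> Lm" for k
 proof -
 have sc: "inverse bw *\<^sub>R (u k + bw *\<^sub>R x - u k) = x" for x :: "real^'n" using bw by simp
 have m: "P k \<in> bmeas" by (rule borel_measurable_continuous_onI[OF Pc])
 then have m2: "(%x. (P k x)\<^sup>2) \<in> bmeas" by measurable
 have 1: "(LBINT x. P k x) = bw ^ ?n * mass"
 using lborel_affine_integral[OF _ m, of bw "u k"] bw by (simp add: P_def sc mass(2))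
 have 2: "(LBINT x. (P k x)\<^sup>2) = bw ^ ?n * s2"
 using lborel_affine_integral[OF _ m2, of bw "u k"] bw by (simp add: P_def sc s2_def)
 show "(\<integral>x. P k x \<partial>?G) \<le> G * (bw ^ ?n * mass)"
 unfolding 1[symmetric] by (rule gauss_compare(2)[OF g G(2) Pc P Psupp[OF k]])
 show "g * (bw ^ ?n * s2) \<le> (\<integral>x. (P k x)\<^sup>2 \<partial>?G)"
 unfolding 2[symmetric]
 by (rule gauss_compare(1)[OF g G(2)]) (use P Psupp[OF k] in \<open>auto intro!: continuous_intros simp: power_le_one\<close>)
 qed
 have chi: "(\<integral>x. exp (2 * a (insert k sg) x - a sg x) \<partial>?G) \<le> 1 + 1 / (5 * real N)" if k: "k \<in> Lm" and sg: "sg \<subseteq> Lm - {k}" for k sg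
 proof -
 let ?sg = "insert k sg"
 define y where "y x = ep * (P k x - Q k x)" for x
 have diff: "a ?sg x = a sg x + y x" for x
 proof -
 have "(\<Sum>l\<in>Lm - {k}. R ?sg l x) = (\<Sum>l\<in>Lm - {k}. R sg l x)" by (rule sum.cong) (auto simp: RP)
 then have "(\<Sum>l\<in>Lm. R ?sg l x) = (\<Sum>l\<in>Lm. R sg l x) + (P k x - Q k x)"
 using sg by (simp add: sum.remove[OF Lm(1) k] RP subset_iff) blast
 then have "ep * (\<Sum>l\<in>Lm. R ?sg l x) = ep * (\<Sum>l\<in>Lm. R sg l x) + y x" by (simp only: y_def distrib_left)
 then show ?thesis unfolding a_def b_def by linarith
 qed
 have yc: "continuous_on UNIV y" unfolding y_def[abs_def] by (intro continuous_intros)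
 have y2: "\<bar>y x\<bar> \<le> 1" "(y x)\<^sup>2 \<le> ep\<^sup>2 * (P k x + Q k x)" for x
 proof -
 have d: "\<bar>P k x - Q k x\<bar> \<le> 1" using P[of k x] Q[of k x] by linarith
 then have "ep * \<bar>P k x - Q k x\<bar> \<le> 1 * 1" using ep ep3 by (intro mult_mono) auto
 then show "\<bar>y x\<bar> \<le> 1" using ep by (simp add: y_def abs_mult)
 have "(P k x - Q k x)\<^sup>2 \<le> P k x + Q k x"
 using PQ[of k x] P[of k x] Q[of k x] mult_left_le[of "P k x" "P k x"] mult_left_le[of "Q k x" "Q k x"]
 by (auto simp: power2_eq_square)
 then show "(y x)\<^sup>2 \<le> ep\<^sup>2 * (P k x + Q k x)" by (simp add: y_def power_mult_distrib mult_left_mono)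
 qed
 have e1: "\<bar>exp (a ta x)\<bar> \<le> exp 1" for ta x using abs_le_D1[OF ab[of ta x]] by simp
 have i1: "integrable ?G (%x. exp (a ta x))" for ta by (rule gi[OF _ e1]) (intro continuous_intros)
 \<comment> \<open>Isolates the quadratic part of the chi-square integrand; the other two terms are
   densities and integrate to \<open>2 - 1\<close>.\<close>
 have pt: "exp (2 * a ?sg x - a sg x) = exp (a sg x) * (exp (y x) - 1)\<^sup>2 + 2 * exp (a ?sg x) - exp (a sg x)" for x
 proof -
 have "2 * a ?sg x - a sg x = a sg x + (y x + y x)" by (simp add: diff)
 then show ?thesis by (simp only: exp_add diff) (simp add: power2_eq_square algebra_simps)
 qed
 have le: "exp (a sg x) * (exp (y x) - 1)\<^sup>2 \<le> 12 * ep\<^sup>2 * (P k x + Q k x)" for x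
 proof -
 have e3: "exp (a sg x) \<le> 3" using abs_le_D1[OF e1[of sg x]] exp_le by (rule order_trans)
 have s: "(exp (y x) - 1)\<^sup>2 \<le> 4 * (ep\<^sup>2 * (P k x + Q k x))"
 using exp_minus_one_sq[OF y2(1)[of x]] y2(2)[of x] by linarith
 have "exp (a sg x) * (exp (y x) - 1)\<^sup>2 \<le> 3 * (4 * (ep\<^sup>2 * (P k x + Q k x)))"
 by (rule mult_mono[OF e3 s]) auto
 then show ?thesis by simp
 qed
 have iP: "integrable ?G (P k)" "integrable ?G (Q k)"
 by (rule gi[of _ 1], rule Pc, use P in simp) (rule gi[of _ 1], rule Qc, use Q in simp)
 have iu: "integrable ?G (%x. 12 * ep\<^sup>2 * (P k x + Q k x))" using iP by simp
 have il: "integrable ?G (%x. exp (a sg x) * (exp (y x) - 1)\<^sup>2)"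
 by (rule Bochner_Integration.integrable_bound[OF iu])
 (auto intro!: borel_measurable_continuous_onI continuous_intros yc AE_I2 order_trans[OF le] simp: measurable_cong_sets[OF sets_gauss_measure refl])
 have IQ: "(\<integral>x. Q k x \<partial>?G) = (\<integral>x. P k x \<partial>?G)"
 unfolding QP by (rule gauss_reflect) (rule borel_measurable_continuous_onI[OF Pc])
 have "(\<integral>x. exp (2 * a ?sg x - a sg x) \<partial>?G) = (\<integral>x. exp (a sg x) * (exp (y x) - 1)\<^sup>2 \<partial>?G) + 2 * 1 - 1"
 unfolding pt using il i1 Ia by simp
 also have "... \<le> (\<integral>x. 12 * ep\<^sup>2 * (P k x + Q k x) \<partial>?G) + 1"
 using integral_mono[OF il iu le] by simp
 also have "(\<integral>x. 12 * ep\<^sup>2 * (P k x + Q k x) \<partial>?G) = 24 * ep\<^sup>2 * (\<integral>x. P k x \<partial>?G)"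
 using iP IQ by simp
 also have "... \<le> 24 * ep\<^sup>2 * (G * (bw ^ ?n * mass))" by (rule mult_left_mono[OF IP(1)[OF k]]) simp
 also have "... \<le> 1 / (5 * real N)"
 proof -
 have "24 * G * mass * (ep\<^sup>2 * bw ^ ?n * real N) \<le> 24 * G * mass * c2" using G(1) mass(1) by (intro mult_left_mono ep2) auto
 also have "... = 1/5" unfolding c2_def using G(1) mass(1) by simp
 finally show ?thesis using N by (simp add: field_simps)
 qed
 finally show ?thesis by simp
 qed
 \<comment> \<open>\<open>t = 1\<close> stands for a bump at \<open>u k\<close> and
   \<open>t = 0\<close> for one at the reflected centre, where \<open>P k\<close> does not see
   it.\<close>
 define v where "v t k = (\<integral>x. P k x * exp (ep * t * P k x) \<partial>?G) / Z" for t :: real and k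
 have iv: "integrable ?G (%x. P k x * exp (ep * t * P k x))" if "0 \<le> t" "t \<le> 1" for t k
 proof (rule gi[of _ "1 * exp 1"])
 show "continuous_on UNIV (%x. P k x * exp (ep * t * P k x))" by (intro continuous_intros)
 have "ep * t * P k x \<le> 1 * 1 * 1" for x using that ep ep3 P[of k x] by (intro mult_mono) auto
 then show "\<bar>P k x * exp (ep * t * P k x)\<bar> \<le> 1 * exp 1" for x
 using P[of k x] unfolding abs_mult by (intro mult_mono) auto
 qed
 have vi: "(\<integral>x. P k x * exp (a sg x) \<partial>?G) = (if k \<in> sg then v 1 k else v 0 k)" if k: "k \<in> Lm" and "sg \<subseteq> Lm" for sg k
 proof -
 let ?t = "if k \<in> sg then 1 else 0 :: real"
 have "P k x * exp (a sg x) = P k x * exp (ep * ?t * P k x) / Z" for x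
 proof (cases "P k x = 0")
 case False
 have "(\<Sum>l\<in>Lm. R sg l x) = (\<Sum>l\<in>{k}. R sg l x)"
 proof (rule sum.mono_neutral_right[OF Lm(1)])
 show "{k} \<subseteq> Lm" using k by simp
 show "\<forall>l\<in>Lm - {k}. R sg l x = 0"
 proof
 fix l assume "l \<in> Lm - {k}"
 then show "R sg l x = 0" using dis[of k l "{k}" x sg] False RP[of "{k}" k x] by auto
 qed
 qed
 then have "b sg x = ep * ?t * P k x" using False PQ[of k x] by (simp add: b_def RP)
 then show ?thesis by (simp add: ea)
 qed simp
 then show ?thesis by (simp add: v_def)
 qed
 \<comment> \<open>From \<open>exp x \<ge> 1 + x\<close> the difference of means is at least
   \<open>ep\<close> times the second moment of \<open>P k\<close>, divided by \<open>Z\<close>, and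
   \<open>Z \<le> 3\<close>.\<close>
 define Dl where "Dl = ep * g * (bw ^ ?n * s2) / 3"
 have Dl: "Dl \<ge> 0" unfolding Dl_def using ep g(1) bw s2 by simp
 have gap: "Dl \<le> \<bar>v 1 k - v 0 k\<bar>" if k: "k \<in> Lm" for k
 proof -
 have i0: "integrable ?G (P k)" by (rule gi[of _ 1], rule Pc) (use P in simp)
 have i2: "integrable ?G (%x. (P k x)\<^sup>2)" by (rule gi[of _ 1]) (use P in \<open>auto intro!: continuous_intros simp: power_le_one\<close>)
 have "ep * (g * (bw ^ ?n * s2)) \<le> ep * (\<integral>x. (P k x)\<^sup>2 \<partial>?G)" using ep IP(2)[OF k] by (intro mult_left_mono) auto
 also have "... = (\<integral>x. ep * (P k x)\<^sup>2 \<partial>?G)" by simp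
 also have "... \<le> (\<integral>x. P k x * exp (ep * 1 * P k x) - P k x \<partial>?G)"
 proof (rule integral_mono)
 fix x
 have "P k x * (1 + ep * P k x) \<le> P k x * exp (ep * P k x)" by (intro mult_left_mono exp_ge_add_one_self P)
 then show "ep * (P k x)\<^sup>2 \<le> P k x * exp (ep * 1 * P k x) - P k x" by (simp add: power2_eq_square algebra_simps)
 qed (use i2 i0 iv[of 1 k] in simp_all)
 also have "... = Z * (v 1 k - v 0 k)" using i0 iv[of 1 k] Z1 by (simp add: v_def right_diff_distrib)
 finally have h: "ep * (g * (bw ^ ?n * s2)) \<le> Z * (v 1 k - v 0 k)" .
 have "0 \<le> ep * (g * (bw ^ ?n * s2))" using ep g(1) bw s2 by simp
 then have "0 \<le> v 1 k - v 0 k" using h Z1 by (smt (verit) mult_pos_neg)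
 then have "Z * (v 1 k - v 0 k) \<le> 3 * (v 1 k - v 0 k)" using Z3 by (intro mult_right_mono) auto
 with h have h2: "ep * (g * (bw ^ ?n * s2)) \<le> 3 * (v 1 k - v 0 k)" by (rule order_trans)
 have e: "ep * (g * (bw ^ ?n * s2)) = 3 * Dl" by (simp add: Dl_def)
 have "3 * Dl \<le> 3 * (v 1 k - v 0 k)" using h2 unfolding e .
 then have "Dl \<le> v 1 k - v 0 k" by simp
 then show ?thesis by (rule order_trans) (rule abs_ge_self)
 qed
 define kp where "kp = cg * bw powr \<gamma>"
 have kp: "kp \<ge> 0" unfolding kp_def using cg(1) by simp
 have test: "(%x. kp * (\<Sum>k\<in>Lm. s k * P k x)) \<in> holder_class \<gamma> 0 1" if s: "!!k. \<bar>s k\<bar> \<le> 1" for s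
 proof -
 \<comment> \<open>For \<open>sg = UNIV\<close> no centre is reflected, so the general statement on
   sums of bumps applies to the test functions as well.\<close>
 have "(%x :: real^'n. kp * (\<Sum>k\<in>Lm. s k * ps (inverse bw *\<^sub>R (x - xc UNIV k))) + 0) \<in> holder_class \<gamma> 0 1"
 proof (rule cg(2)[OF bw(1,2) Lm(1)])
 have "1 + ln (1 / bw) \<noteq> 0" using \<open>ln (1 / bw) \<ge> 0\<close> by linarith
 then show "kp \<le> cg * bw powr \<gamma> * (1 + ln (1 / bw)) powr (- 0)" by (simp add: kp_def)
 qed (use sep s kp cg(1) in auto)
 then show ?thesis by (simp add: xc_def P_def)
 qed
 have "ennreal (real (card Lm) * (kp * Dl) / 4) \<le> max_risk \<beta> K \<gamma> N \<theta>"
 by (rule assouad[where P = P and a = a and B = 1 and ?v1.0 = "v 1" and ?v0.0 = "v 0", OF Lm(1) K N \<gamma> \<theta>])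
 (use ac ab Ia ah chi Pc P test kp vi gap Dl in auto)
 moreover have "real (card Lm) * (kp * Dl) / 4 = c * (bw powr \<gamma> * ep)"
 proof -
 have "(4 * bw * real q) ^ ?n = 1" by (simp only: bw(3) power_one)
 then have "real q ^ ?n * bw ^ ?n = 1 / 4 ^ ?n" by (simp add: power_mult_distrib field_simps)
 moreover have "real (card Lm) * (kp * Dl) / 4 = (real q ^ ?n * bw ^ ?n) * (cg * g * s2 / 12 * (bw powr \<gamma> * ep))"
 by (simp add: Lm(2) kp_def Dl_def)
 ultimately show ?thesis by (simp add: c_def)
 qed
 ultimately show "ennreal (c * (bw powr \<gamma> * ep)) \<le> max_risk \<beta> K \<gamma> N \<theta>" by simp
 qed
qed

section \<open>Upper bound\<close>

text \<open>The number \<open>m\<close> is what both halves need: \<open>hidx \<gamma> + 1\<close>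
  differences stay on the test function and \<open>hidx \<beta> + 1\<close> are left for the
  density. By \<open>fdiff_pow_add\<close> the former are treated as a bounded function to which
  \<open>pushforward_smooth\<close> applies.\<close>

lemma highpass_pushforward:
 fixes \<beta> \<gamma> L C0 :: real
 assumes \<beta>: "\<beta> > 0" and L: "L > 0" and \<gamma>: "\<gamma> > 0" and N: "N \<ge> 1"
 defines "m \<equiv> (hidx \<beta> + 1) + (hidx \<gamma> + 1)"
 obtains C where "C > 0" "!!g f bw. g \<in> (generator_class \<beta> L C0 :: (real^'n::finite => real^'n) set) ==> f \<in> holder_class \<gamma> 0 1 ==> 0 < bw ==> bw \<le> 1 ==>
 \<bar>\<integral>x. f x - lowpass N m bw f x \<partial>distr gauss_measure borel g\<bar> \<le> C * (bw powr (\<beta> + \<gamma>) * (1 + ln (1 / bw)) ^ CARD('n))"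
proof -
 let ?H = "holder_class \<gamma> 0 1 :: (real^'n => real) set" let ?GC = "generator_class \<beta> L C0 :: (real^'n => real^'n) set"
 let ?n = "real CARD('n)"
 define b where "b = bump_mass N TYPE('n)"
 have b: "b > 0" unfolding b_def by (rule bump_mass_pos)
 define p where "p = pbump N (%_ :: 'n. 0)"
 have p: "p \<in> bmeas" "integrable lborel p" "!!z. 0 \<le> p z" "(LBINT z. \<bar>p z\<bar>) = b"
 unfolding p_def b_def by (rule pbump_meas, rule pbump_integrable, simp, rule pbump_0_nonneg) (simp add: bump_mass_def pbump_0_nonneg)
 note [measurable] = p(1)
 note sx = hidx_hexp[OF \<gamma>]
 note hb = holder_class_imp_holder_bdd[OF \<gamma>, of 1, where 'n = 'n]
 obtain B where B: "B > 0" "!!f x. f \<in> ?H ==> \<bar>f x\<bar> \<le> B" by (rule holder_bdd_bounded[OF hb], rule that)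
 have cont: "continuous_on UNIV f" if "f \<in> ?H" for f by (rule holder_bdd_continuous[OF hb sx(1,2) that])
 obtain D where D: "D > 0" "!!f u x. f \<in> ?H ==> \<bar>(fdiff u ^^ (hidx \<gamma> + 1)) f x\<bar> \<le> D * norm u powr \<gamma>"
 using holder_bdd_fdiff[OF sx(1,2) hb order_refl] unfolding sx(3) by blast
 obtain C where C: "C > 0" "!!g (bw :: real) (u :: real^'n) (b :: real) F. g \<in> ?GC ==> 0 < bw ==> bw \<le> 1 ==> norm u \<le> CARD('n) * bw ==>
 continuous_on UNIV F ==> (\<forall>y. \<bar>F y\<bar> \<le> b) ==>
 \<bar>\<integral>y. (fdiff u ^^ (hidx \<beta> + 1)) F y \<partial>distr gauss_measure borel g\<bar> \<le> C * b * bw powr \<beta> * (1 + ln (1 / bw)) ^ CARD('n)"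
 proof (rule pushforward_smooth[where ?C0.0 = C0 and 'n = 'n, OF \<beta> L order_refl])
 fix C :: real
 assume C: "C > 0" and a: "!!g (bw :: real) (u :: real^'n) (b :: real) F. g \<in> ?GC ==> 0 < bw ==> bw \<le> 1 ==> norm u \<le> CARD('n) * bw ==>
 continuous_on UNIV F ==> (!!y. \<bar>F y\<bar> \<le> b) ==>
 \<bar>\<integral>y. (fdiff u ^^ (hidx \<beta> + 1)) F y \<partial>distr gauss_measure borel g\<bar> \<le> C * b * bw powr \<beta> * (1 + ln (1 / bw)) ^ CARD('n)"
 show thesis
 proof (rule that[OF C])
 fix g and bw :: real and u :: "real^'n" and b :: real and F :: "real^'n => real"
 assume h: "g \<in> ?GC" "0 < bw" "bw \<le> 1" "norm u \<le> CARD('n) * bw" "continuous_on UNIV F" and F: "\<forall>y. \<bar>F y\<bar> \<le> b"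
 show "\<bar>\<integral>y. (fdiff u ^^ (hidx \<beta> + 1)) F y \<partial>distr gauss_measure borel g\<bar> \<le> C * b * bw powr \<beta> * (1 + ln (1 / bw)) ^ CARD('n)"
 by (rule a[OF h F[rule_format]])
 qed
 qed
 define E where "E = C * (D * ?n powr \<gamma>)"
 have E: "E > 0" unfolding E_def using C(1) D(1) by simp
 show thesis
 proof (rule that[OF E])
 fix g f and bw :: real assume g: "g \<in> ?GC" and f: "f \<in> ?H" and bw: "0 < bw" "bw \<le> 1"
 define mu where "mu = distr gauss_measure borel g"
 have gm: "g \<in> borel_measurable gauss_measure" using gen_meas[OF \<beta> L g] measurable_cong_sets[OF sets_gauss_measure refl] by blast
 have mu: "prob_space mu" unfolding mu_def by (rule prob_space.prob_space_distr[OF prob_space_gauss gm])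
 have smu[measurable_cong, simp]: "sets mu = sets borel" by (simp add: mu_def)
 interpret mu: prob_space mu by (rule mu)
 interpret P: pair_sigma_finite mu "lborel :: (real^'n) measure" by (rule pair_sigma_finite.intro, rule prob_space_imp_sigma_finite, rule mu, rule sigma_finite_lborel)
 have fm[measurable]: "f \<in> bmeas" by (rule borel_measurable_continuous_onI[OF cont[OF f]])
 define A where "A x z = (fdiff (bw *\<^sub>R z) ^^ m) f x * p z" for x z
 have Am: "case_prod A \<in> borel_measurable (mu \<Otimes>\<^sub>M lborel)"
 unfolding A_def fdiff_expand case_prod_beta' by measurable
 have Ab: "\<bar>A x z\<bar> \<le> 2 ^ m * B * p z" for x z
 unfolding A_def abs_mult using fdiff_bounded[where f = f and B = B, OF B(2)[OF f]] p(3) by (simp add: mult_right_mono)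
 have i1: "integrable (mu \<Otimes>\<^sub>M lborel) (%(x, z). 2 ^ m * B * p z)"
 proof (rule P.Fubini_integrable)
 show "(%(x, z). 2 ^ m * B * p z) \<in> borel_measurable (mu \<Otimes>\<^sub>M lborel)" by measurable
 qed (use p(2) in simp_all)
 have i2: "integrable (mu \<Otimes>\<^sub>M lborel) (case_prod A)"
 by (rule Bochner_Integration.integrable_bound[OF i1 Am]) (use Ab B(1) p(3) in \<open>auto intro!: AE_I2 order_trans[OF Ab] simp: abs_mult\<close>)
 let ?w = "bw powr (\<beta> + \<gamma>) * (1 + ln (1 / bw)) ^ CARD('n)"
 have inner: "\<bar>\<integral>x. (fdiff (bw *\<^sub>R z) ^^ m) f x \<partial>mu\<bar> \<le> E * ?w" if z: "p z \<noteq> 0" for z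
 proof -
 \<comment> \<open>This part is already of size \<open>bw powr \<gamma>\<close>; it only has to be
   bounded and continuous from here on.\<close>
 let ?F = "(fdiff (bw *\<^sub>R z) ^^ (hidx \<gamma> + 1)) f"
 have "norm z \<le> ?n" using pbump_supp_norm[of "%_::'n. 0" N z] z unfolding p_def by fastforce
 then have nz: "norm (bw *\<^sub>R z) \<le> ?n * bw" using bw by (simp add: mult.commute mult_right_mono)
 have Fb: "\<bar>?F y\<bar> \<le> D * (?n powr \<gamma> * bw powr \<gamma>)" for y
 proof -
 have "norm (bw *\<^sub>R z) powr \<gamma> \<le> (?n * bw) powr \<gamma>" using nz \<gamma> by (intro powr_mono2) auto
 then have "D * norm (bw *\<^sub>R z) powr \<gamma> \<le> D * (?n powr \<gamma> * bw powr \<gamma>)" using D(1) bw by (simp add: powr_mult)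
 then show ?thesis using D(2)[OF f, of "bw *\<^sub>R z" y] by linarith
 qed
 have Fc: "continuous_on UNIV ?F" unfolding fdiff_expand[abs_def]
 by (intro continuous_on_sum continuous_on_mult_left continuous_on_compose2[OF cont[OF f]] continuous_intros) auto
 have "\<bar>\<integral>y. (fdiff (bw *\<^sub>R z) ^^ (hidx \<beta> + 1)) ?F y \<partial>mu\<bar> \<le> C * (D * (?n powr \<gamma> * bw powr \<gamma>)) * bw powr \<beta> * (1 + ln (1 / bw)) ^ CARD('n)"
 unfolding mu_def by (rule C(2)[OF g bw nz Fc allI[OF Fb]])
 also have "... = E * ?w" by (simp add: E_def powr_add mult_ac)
 finally show ?thesis unfolding m_def fdiff_pow_add .
 qed
 have "(\<integral>x. f x - lowpass N m bw f x \<partial>mu) = (\<integral>x. (- 1) ^ m / b * (LBINT z. A x z) \<partial>mu)"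
 unfolding lowpass_error[OF cont[OF f] B(2)[OF f] bw(1)] b_def A_def p_def ..
 also have "... = (- 1) ^ m / b * (\<integral>x. (LBINT z. A x z) \<partial>mu)" by (rule integral_mult_right_zero)
 also have "(\<integral>x. (LBINT z. A x z) \<partial>mu) = (\<integral>z. (\<integral>x. A x z \<partial>mu) \<partial>lborel)" by (rule P.Fubini_integral[OF i2, symmetric])
 also have "... = (\<integral>z. (\<integral>x. (fdiff (bw *\<^sub>R z) ^^ m) f x \<partial>mu) * p z \<partial>lborel)" unfolding A_def by simp
 finally have "\<bar>\<integral>x. f x - lowpass N m bw f x \<partial>mu\<bar> = \<bar>\<integral>z. (\<integral>x. (fdiff (bw *\<^sub>R z) ^^ m) f x \<partial>mu) * p z \<partial>lborel\<bar> / b"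
 using b by (simp add: abs_mult power_abs)
 also have "... \<le> (E * ?w * (LBINT z. \<bar>p z\<bar>)) / b"
 proof (rule divide_right_mono[OF abs_integral_mult_le[OF p(2) _ inner]])
 have "(%z. \<integral>x. (fdiff (bw *\<^sub>R z) ^^ m) f x \<partial>mu) \<in> bmeas"
 unfolding fdiff_expand by (rule mu.borel_measurable_lebesgue_integral) measurable
 then show "(%z. \<integral>x. (fdiff (bw *\<^sub>R z) ^^ m) f x \<partial>mu) \<in> borel_measurable lborel" by simp
 qed (use b in auto)
 also have "... = E * ?w" using b by (simp add: p(4))
 finally show "\<bar>\<integral>x. f x - lowpass N m bw f x \<partial>distr gauss_measure borel g\<bar> \<le> E * ?w" unfolding mu_def .
 qed
qed

text \<open>Each mollification in \<open>lowpass\<close> is a multiple of a discriminator, so a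
  bound \<open>s\<close> on all discriminators transfers with the factor of
  \<open>moll_holder_class\<close>. A one-sided bound is enough because that lemma admits both
  signs.\<close>

lemma lowpass_ipm:
 fixes \<gamma> et :: real
 assumes \<gamma>: "\<gamma> > 0" and et: "et \<ge> 0" and N: "N \<ge> nat \<lfloor>et\<rfloor> + 1" and m: "m \<ge> 1"
 obtains C where "C > 0" "!!f bw s (mu :: (real^'n::finite) measure) nu. f \<in> holder_class \<gamma> 0 1 ==> 0 < bw ==> bw \<le> 1 ==>
 prob_space mu ==> sets mu = sets borel ==> prob_space nu ==> sets nu = sets borel ==>
 (\<forall>D\<in>holder_class et 0 1. (\<integral>x. D x \<partial>mu) - (\<integral>x. D x \<partial>nu) \<le> s) ==>
 \<bar>(\<integral>x. lowpass N m bw f x \<partial>mu) - (\<integral>x. lowpass N m bw f x \<partial>nu)\<bar> \<le> C * max 1 (bw powr (\<gamma> - et)) * s"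
proof -
 let ?H = "holder_class \<gamma> 0 1 :: (real^'n => real) set"
 note sx = hidx_hexp[OF \<gamma>]
 note hb = holder_class_imp_holder_bdd[OF \<gamma>, of 1, where 'n = 'n]
 obtain B where B: "B > 0" "!!f x. f \<in> ?H ==> \<bar>f x\<bar> \<le> B" by (rule holder_bdd_bounded[OF hb], rule that)
 have cont: "continuous_on UNIV f" if "f \<in> ?H" for f by (rule holder_bdd_continuous[OF hb sx(1,2) that])
 \<comment> \<open>The scales in \<open>lowpass\<close> are \<open>j * bw\<close> with
   \<open>j \<le> m\<close> and \<open>bw \<le> 1\<close>, so \<open>m\<close> is the bound on
   scales to ask for.\<close>
 have "real m > 0" using m by simp
 from moll_holder_class[OF sx(1,2) hb et N this]
 obtain C1 where C1: "C1 > 0" "\<forall>f\<in>?H. \<forall>bw a. 0 < bw --> bw \<le> real m --> \<bar>a\<bar> \<le> 1 -->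
 (%x. a / (C1 * max 1 (bw powr (\<gamma> - et))) * moll N (%_. 0) bw f x) \<in> holder_class et 0 1"
 unfolding sx(3) by (elim exE conjE)
 define e where "e = \<bar>\<gamma> - et\<bar>"
 define cs where "cs = (\<Sum>j\<in>{1..m}. \<bar>fdiff_coeff m j\<bar>)"
 define C where "C = (cs + 1) * (C1 * real m powr e)"
 have cs: "cs \<ge> 0" unfolding cs_def by (rule sum_nonneg) simp
 have C: "C > 0" unfolding C_def using C1(1) cs m by (intro mult_pos_pos) auto
 show thesis
 proof (rule that[OF C])
 fix f and bw s :: real and mu nu :: "(real^'n) measure"
 assume f: "f \<in> ?H" and bw: "0 < bw" "bw \<le> 1" and mu: "prob_space mu" "sets mu = sets borel" and nu: "prob_space nu" "sets nu = sets borel"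
 and s: "\<forall>D\<in>holder_class et 0 1. (\<integral>x. D x \<partial>mu) - (\<integral>x. D x \<partial>nu) \<le> s"
 have s0: "s \<ge> 0" using bspec[OF s holder_class_nonempty[of 1 et 0]] by simp
 have fm: "f \<in> bmeas" by (rule borel_measurable_continuous_onI[OF cont[OF f]])
 let ?W = "max 1 (bw powr (\<gamma> - et))"
 define M where "M j = moll N (%_ :: 'n. 0) (real j * bw) f" for j
 have Mi: "integrable rh (M j)" if "prob_space rh" "sets rh = sets borel" "j \<in> {1..m}" for rh j
 proof -
 interpret rh: prob_space rh by (rule that)
 have "continuous_on UNIV (M j)" unfolding M_def
 by (rule moll_0_cont[OF _ cont[OF f] B(2)[OF f]]) (use that bw N in auto)
 then have "M j \<in> borel_measurable rh" using borel_measurable_continuous_onI measurable_cong_sets[OF that(2) refl] by blast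
 then show ?thesis by (rule rh.integrable_const_bound[of _ B, rotated]) (simp add: M_def moll_0_bounded[OF fm B(2)[OF f]])
 qed
 have one: "\<bar>(\<integral>x. M j x \<partial>mu) - (\<integral>x. M j x \<partial>nu)\<bar> \<le> C1 * (real m powr e * ?W) * s" if j: "j \<in> {1..m}" for j
 proof -
 let ?V = "max 1 ((real j * bw) powr (\<gamma> - et))"
 have jbw: "0 < real j * bw" "real j * bw \<le> real m" using j bw mult_mono[of "real j" "real m" bw 1] by auto
 have K: "C1 * ?V > 0" using C1(1) by simp
 have ab: "a / (C1 * ?V) * ((\<integral>x. M j x \<partial>mu) - (\<integral>x. M j x \<partial>nu)) \<le> s" if "\<bar>a\<bar> \<le> 1" for a
 proof -
 have "(%x. a / (C1 * ?V) * M j x) \<in> holder_class et 0 1"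
 using bspec[OF C1(2) f] jbw that unfolding M_def by simp
 from bspec[OF s this] show ?thesis by (simp add: right_diff_distrib)
 qed
 have "((\<integral>x. M j x \<partial>mu) - (\<integral>x. M j x \<partial>nu)) / (C1 * ?V) \<le> s" "- (((\<integral>x. M j x \<partial>mu) - (\<integral>x. M j x \<partial>nu)) / (C1 * ?V)) \<le> s"
 using ab[of 1] ab[of "-1"] by simp_all
 then have "\<bar>((\<integral>x. M j x \<partial>mu) - (\<integral>x. M j x \<partial>nu)) / (C1 * ?V)\<bar> \<le> s" by (rule abs_leI)
 then have "\<bar>(\<integral>x. M j x \<partial>mu) - (\<integral>x. M j x \<partial>nu)\<bar> / (C1 * ?V) \<le> s" unfolding abs_divide abs_of_pos[OF K] .
 then have "\<bar>(\<integral>x. M j x \<partial>mu) - (\<integral>x. M j x \<partial>nu)\<bar> \<le> (C1 * ?V) * s"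
 using K by (simp only: pos_divide_le_eq mult.commute)
 also have "... \<le> C1 * (real m powr e * ?W) * s"
 proof (intro mult_right_mono mult_left_mono s0)
 \<comment> \<open>The exponent \<open>\<gamma> - et\<close> may have either sign; its modulus
   \<open>e\<close> bounds the effect of replacing the scale \<open>j * bw\<close> by
   \<open>bw\<close>.\<close>
 have m1: "1 \<le> real m powr e" using m by (intro ge_one_powr_ge_zero) (auto simp: e_def)
 have "real j powr (\<gamma> - et) \<le> real j powr e" using j by (intro powr_mono) (auto simp: e_def)
 also have "... \<le> real m powr e" using j by (intro powr_mono2) (auto simp: e_def)
 finally have "(real j * bw) powr (\<gamma> - et) \<le> real m powr e * bw powr (\<gamma> - et)"
 using bw by (simp add: powr_mult mult_right_mono)
 also have "... \<le> real m powr e * ?W" by (intro mult_left_mono) auto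
 finally have "(real j * bw) powr (\<gamma> - et) \<le> real m powr e * ?W" .
 moreover have "1 * 1 \<le> real m powr e * ?W" using m1 by (intro mult_mono) auto
 ultimately show "?V \<le> real m powr e * ?W" by simp
 qed (use C1 in auto)
 finally show ?thesis .
 qed
 have I: "(\<integral>x. lowpass N m bw f x \<partial>rh) = (\<Sum>j\<in>{1..m}. - ((- 1) ^ m * fdiff_coeff m j) * (\<integral>x. M j x \<partial>rh))"
 if "prob_space rh" "sets rh = sets borel" for rh
 unfolding lowpass_def M_def[symmetric]
 by (subst Bochner_Integration.integral_sum) (rule integrable_mult_right, rule Mi[OF that], simp_all)
 have "(\<integral>x. lowpass N m bw f x \<partial>mu) - (\<integral>x. lowpass N m bw f x \<partial>nu)
 = (\<Sum>j\<in>{1..m}. - ((- 1) ^ m * fdiff_coeff m j) * ((\<integral>x. M j x \<partial>mu) - (\<integral>x. M j x \<partial>nu)))"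
 unfolding I[OF mu] I[OF nu] sum_subtractf[symmetric] right_diff_distrib ..
 then have "\<bar>(\<integral>x. lowpass N m bw f x \<partial>mu) - (\<integral>x. lowpass N m bw f x \<partial>nu)\<bar>
 \<le> (\<Sum>j\<in>{1..m}. \<bar>- ((- 1) ^ m * fdiff_coeff m j) * ((\<integral>x. M j x \<partial>mu) - (\<integral>x. M j x \<partial>nu))\<bar>)"
 by (simp only: sum_abs)
 also have "... \<le> (\<Sum>j\<in>{1..m}. \<bar>fdiff_coeff m j\<bar> * (C1 * (real m powr e * ?W) * s))"
 proof (rule sum_mono)
 fix j assume j: "j \<in> {1..m}"
 have "\<bar>- ((- 1) ^ m * fdiff_coeff m j) * ((\<integral>x. M j x \<partial>mu) - (\<integral>x. M j x \<partial>nu))\<bar> = \<bar>fdiff_coeff m j\<bar> * \<bar>(\<integral>x. M j x \<partial>mu) - (\<integral>x. M j x \<partial>nu)\<bar>"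
 by (simp add: abs_mult power_abs)
 also have "... \<le> \<bar>fdiff_coeff m j\<bar> * (C1 * (real m powr e * ?W) * s)" by (intro mult_left_mono one[OF j]) simp
 finally show "\<bar>- ((- 1) ^ m * fdiff_coeff m j) * ((\<integral>x. M j x \<partial>mu) - (\<integral>x. M j x \<partial>nu))\<bar> \<le> ..." .
 qed
 also have "... = cs * (C1 * (real m powr e * ?W) * s)" by (simp add: cs_def sum_distrib_right)
 also have "... \<le> (cs + 1) * (C1 * (real m powr e * ?W) * s)" using C1(1) s0 by (intro mult_right_mono mult_nonneg_nonneg) auto
 also have "... = C * ?W * s" by (simp add: C_def)
 finally show "\<bar>(\<integral>x. lowpass N m bw f x \<partial>mu) - (\<integral>x. lowpass N m bw f x \<partial>nu)\<bar> \<le> C * ?W * s" .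
 qed
qed

section \<open>Risk of the estimator\<close>

lemma empirical_prob:
 fixes X :: "nat => real^'n::finite"
 assumes n: "n > 0"
 shows "prob_space (empirical n X)" "sets (empirical n X) = sets borel"
proof -
 have X: "X \<in> measurable (uniform_count_measure {..<n}) borel"
 by (auto simp: measurable_def space_uniform_count_measure sets_uniform_count_measure)
 show "prob_space (empirical n X)" unfolding empirical_def
 by (rule prob_space.prob_space_distr[OF prob_space_uniform_count_measure X]) (use n in auto)
 show "sets (empirical n X) = sets borel" by (simp add: empirical_def)
qed

text \<open>By minimality the estimator is no further from the empirical measure than the target is,
  so over discriminators it is within twice the empirical deviation of the target. This controls the
  smoothed part of a test function; the remainder is estimated separately under the estimator and
  under the target. The scale \<open>bw\<close> remains free.\<close>

lemma gan_risk_upper: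
 fixes \<beta> \<gamma> K L C0 :: real and g_hat :: "nat => (nat => real^'n::finite) => real^'n => real^'n"
 assumes \<beta>: "\<beta> > 0" and \<gamma>: "\<gamma> > 0" and adm: "admissible_constants TYPE('n) \<beta> K L C0"
 and gan: "!!n. n \<ge> 2 ==> is_gan_estimator \<beta> L C0 n (g_hat n)"
 obtains C where "C > 0" "!!n bw. n \<ge> 2 ==> 0 < bw ==> bw \<le> 1 ==>
 max_risk \<beta> K \<gamma> n (%X. distr gauss_measure borel (g_hat n X))
 \<le> ennreal (C * (max 1 (bw powr (\<gamma> - CARD('n) / 2)) * (n powr (- 1/2) * ln n) + bw powr (\<beta> + \<gamma>) * (1 + ln (1 / bw)) ^ CARD('n)))"
proof -
 define et where "et = real CARD('n) / 2"
 have et: "et > 0" by (simp add: et_def)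
 let ?GC = "generator_class \<beta> L C0 :: (real^'n => real^'n) set" let ?E = "holder_class et 0 1 :: (real^'n => real) set" let ?H = "holder_class \<gamma> 0 1 :: (real^'n => real) set"
 let ?T = "%g. distr gauss_measure borel g :: (real^'n) measure"
 have L: "L > 0" using adm by (simp add: admissible_constants_def)
 define N where "N = nat \<lfloor>et\<rfloor> + 1"
 have N: "N \<ge> 1" "N \<ge> nat \<lfloor>et\<rfloor> + 1" by (simp_all add: N_def)
 define m where "m = (hidx \<beta> + 1) + (hidx \<gamma> + 1)"
 have m: "m \<ge> 1" by (simp add: m_def)
 obtain Ch where Ch: "Ch > 0" "!!g f bw. g \<in> ?GC ==> f \<in> ?H ==> 0 < bw ==> bw \<le> 1 ==>
 \<bar>\<integral>x. f x - lowpass N m bw f x \<partial>?T g\<bar> \<le> Ch * (bw powr (\<beta> + \<gamma>) * (1 + ln (1 / bw)) ^ CARD('n))"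
 by (rule highpass_pushforward[OF \<beta> L \<gamma> N(1), where ?C0.0 = C0 and 'n = 'n, folded m_def], rule that)
 obtain Cl where Cl: "Cl > 0" "!!f bw s (mu :: (real^'n) measure) nu. f \<in> ?H ==> 0 < bw ==> bw \<le> 1 ==>
 prob_space mu ==> sets mu = sets borel ==> prob_space nu ==> sets nu = sets borel ==>
 (\<forall>D\<in>?E. (\<integral>x. D x \<partial>mu) - (\<integral>x. D x \<partial>nu) \<le> s) ==>
 \<bar>(\<integral>x. lowpass N m bw f x \<partial>mu) - (\<integral>x. lowpass N m bw f x \<partial>nu)\<bar> \<le> Cl * max 1 (bw powr (\<gamma> - et)) * s"
 by (rule lowpass_ipm[OF \<gamma> less_imp_le[OF et] N(2) m], rule that)
 obtain M where M: "M > 0" "!!g. g \<in> ?GC ==> integrable gauss_measure (%z. exp (l1norm (g z)))"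
 "!!g. g \<in> ?GC ==> (\<integral>z. exp (l1norm (g z)) \<partial>gauss_measure) \<le> M" by (rule pushforward_tail[OF \<beta> L], rule that)
 obtain Ce where Ce: "Ce > 0" "!!(mu :: (real^'n) measure) n. prob_space mu ==> sets mu = sets borel ==>
 (\<integral>\<^sup>+x. ennreal (exp (l1norm x)) \<partial>mu) \<le> ennreal M ==> n \<ge> 2 ==>
 \<exists>S. S \<in> borel_measurable (PiM {..<n} (%_. mu)) \<and>
 (\<forall>X. \<forall>f\<in>holder_class (real CARD('n) / 2) 0 1. ennreal \<bar>empdev n mu X f\<bar> \<le> S X) \<and>
 (\<integral>\<^sup>+X. S X \<partial>PiM {..<n} (%_. mu)) \<le> ennreal (Ce * n powr (- 1/2) * ln n)"
 by (rule empirical_process[OF less_imp_le[OF M(1)]], rule that)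
 obtain BE where BE: "!!f. f \<in> ?E ==> continuous_on UNIV f" "!!f x. f \<in> ?E ==> \<bar>f x\<bar> \<le> BE"
 by (rule holder_class_cont_bounded[OF et, of 1], rule that)
 obtain BH where BH: "!!f. f \<in> ?H ==> continuous_on UNIV f" "!!f x. f \<in> ?H ==> \<bar>f x\<bar> \<le> BH"
 by (rule holder_class_cont_bounded[OF \<gamma>, of 1], rule that)
 have Tp: "prob_space (?T g)" "sets (?T g) = sets borel" if g: "g \<in> ?GC" for g
 proof -
 have "g \<in> borel_measurable gauss_measure" using gen_meas[OF \<beta> L g] measurable_cong_sets[OF sets_gauss_measure refl] by blast
 then show "prob_space (?T g)" by (rule prob_space.prob_space_distr[OF prob_space_gauss])
 qed simp
 define C where "C = 2 * Cl * Ce + 2 * Ch"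
 have C: "C > 0" using Cl(1) Ce(1) Ch(1) by (simp add: C_def add_pos_pos)
 show thesis
 proof (rule that[OF C])
 fix n :: nat and bw :: real assume n: "n \<ge> 2" and bw: "0 < bw" "bw \<le> 1"
 let ?W = "max 1 (bw powr (\<gamma> - et))" let ?R = "bw powr (\<beta> + \<gamma>) * (1 + ln (1 / bw)) ^ CARD('n)"
 have R: "?R \<ge> 0" using bw by (intro mult_nonneg_nonneg zero_le_power add_nonneg_nonneg ln_ge_zero) auto
 have n0: "n > 0" using n by simp
 show "max_risk \<beta> K \<gamma> n (%X. ?T (g_hat n X))
 \<le> ennreal (C * (max 1 (bw powr (\<gamma> - CARD('n) / 2)) * (n powr (- 1/2) * ln n) + ?R))"
 unfolding max_risk_def
 proof (rule SUP_least)
 fix p :: "real^'n => real" assume "p \<in> density_class \<beta> K"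
 \<comment> \<open>The target as a generated law: \<open>T\<close> is both the competitor for
   minimality and a generator with a smooth density.\<close>
 then obtain T where T: "T \<in> ?GC" "prob_of_density p = ?T T" using adm unfolding admissible_constants_def by blast
 define mu where "mu = ?T T"
 have pe: "prob_of_density p = mu" using T(2) by (simp add: mu_def)
 have mu: "prob_space mu" "sets mu = sets borel" unfolding mu_def using Tp[OF T(1)] by auto
 have "(\<integral>\<^sup>+x. ennreal (exp (l1norm x)) \<partial>mu) \<le> ennreal M"
 proof -
 have gm: "T \<in> borel_measurable gauss_measure" using gen_meas[OF \<beta> L T(1)] measurable_cong_sets[OF sets_gauss_measure refl] by blast
 have "(\<integral>\<^sup>+x. ennreal (exp (l1norm x)) \<partial>mu) = (\<integral>\<^sup>+z. ennreal (exp (l1norm (T z))) \<partial>gauss_measure)"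
 unfolding mu_def by (rule nn_integral_distr[OF gm]) (unfold l1norm_def, measurable)
 also have "... = ennreal (\<integral>z. exp (l1norm (T z)) \<partial>gauss_measure)"
 by (rule nn_integral_eq_integral[OF M(2)[OF T(1)]]) simp
 also have "... \<le> ennreal M" by (rule ennreal_leI[OF M(3)[OF T(1)]])
 finally show ?thesis .
 qed
 from Ce(2)[OF mu this n] obtain S where S0: "S \<in> borel_measurable (PiM {..<n} (%_. mu)) \<and>
 (\<forall>X. \<forall>f\<in>holder_class (real CARD('n) / 2) 0 1. ennreal \<bar>empdev n mu X f\<bar> \<le> S X) \<and>
 (\<integral>\<^sup>+X. S X \<partial>PiM {..<n} (%_. mu)) \<le> ennreal (Ce * n powr (- 1/2) * ln n)" ..
 note S1 = conjunct1[OF S0] and S3 = conjunct2[OF conjunct2[OF S0]]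
 have S2: "ennreal \<bar>empdev n mu X f\<bar> \<le> S X" if "f \<in> ?E" for X f
 by (rule bspec[OF spec[OF conjunct1[OF conjunct2[OF S0]]]]) (use that in \<open>simp only: et_def\<close>)
 have sP: "sets (PiM {..<n} (%_. mu)) = sets (PiM {..<n} (%_. borel :: (real^'n) measure))" by (rule sets_PiM_cong) (auto simp: mu)
 have bound: "ennreal (ipm ?H (?T (g_hat n X)) mu) \<le> ennreal (2 * Cl * ?W) * S X + ennreal (2 * Ch * ?R)"
 if X: "X \<in> space (PiM {..<n} (%_. mu))" for X
 proof (cases "S X")
 case (real s)
 have "X \<in> space (PiM {..<n} (%_. borel))" using X sets_eq_imp_space_eq[OF sP] by simp
 then have "is_arg_min (%h. ipm ?E (empirical n X) (?T h)) (%h. h \<in> ?GC) (g_hat n X)"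
 using gan[OF n] unfolding is_gan_estimator_def et_def by blast
 then have g: "g_hat n X \<in> ?GC" "ipm ?E (empirical n X) (?T (g_hat n X)) \<le> ipm ?E (empirical n X) mu"
 using T(1) unfolding is_arg_min_def mu_def by (auto simp: not_less)
 let ?g = "g_hat n X"
 have dev: "\<bar>(\<integral>x. D x \<partial>empirical n X) - (\<integral>x. D x \<partial>mu)\<bar> \<le> s" if D: "D \<in> ?E" for D
 proof -
 have "ennreal \<bar>empdev n mu X D\<bar> \<le> ennreal s" using S2[OF D, of X] real by simp
 then have "\<bar>empdev n mu X D\<bar> \<le> s" using real by simp
 then show ?thesis unfolding empdev_def
 by (subst empirical_integral[OF borel_measurable_continuous_onI[OF BE(1)[OF D]] n0])
 qed
 have em: "ipm ?E (empirical n X) mu \<le> s"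
 unfolding ipm_def
 proof (rule cSUP_least)
 have ne: "(%_. 0) \<in> ?E" by (rule holder_class_nonempty) simp
 show "?E \<noteq> {}"
 proof (rule notI)
 assume "?E = {}"
 from equals0D[OF this, of "%_. 0"] ne show False by (rule notE)
 qed
 fix D assume "D \<in> ?E"
 from dev[OF this] show "(\<integral>x. D x \<partial>empirical n X) - (\<integral>x. D x \<partial>mu) \<le> s" by linarith
 qed
 \<comment> \<open>Triangle inequality through the empirical measure; one deviation comes from
   minimality, the other from comparing with the target directly.\<close>
 have low: "\<forall>D\<in>?E. (\<integral>x. D x \<partial>mu) - (\<integral>x. D x \<partial>?T ?g) \<le> 2 * s"
 proof
 fix D assume D: "D \<in> ?E"
 have "(\<integral>x. D x \<partial>empirical n X) - (\<integral>x. D x \<partial>?T ?g) \<le> ipm ?E (empirical n X) (?T ?g)"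
 by (rule ipm_ge[OF et empirical_prob[OF n0] Tp[OF g(1)] D])
 then show "(\<integral>x. D x \<partial>mu) - (\<integral>x. D x \<partial>?T ?g) \<le> 2 * s" using g(2) em dev[OF D] by linarith
 qed
 have "ipm ?H (?T ?g) mu \<le> 2 * Cl * ?W * s + 2 * Ch * ?R"
 unfolding ipm_def
 proof (rule cSUP_least)
 have ne: "(%_. 0) \<in> ?H" by (rule holder_class_nonempty) simp
 show "?H \<noteq> {}"
 proof (rule notI)
 assume "?H = {}"
 from equals0D[OF this, of "%_. 0"] ne show False by (rule notE)
 qed
 fix f assume f: "f \<in> ?H"
 note lc = lowpass_cont_bounded[OF bw(1) BH(1)[OF f] BH(2)[OF f] N(1), of m]
 have split: "(\<integral>x. f x \<partial>rh) = (\<integral>x. lowpass N m bw f x \<partial>rh) + (\<integral>x. f x - lowpass N m bw f x \<partial>rh)"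
 if "prob_space rh" "sets rh = sets borel" for rh
 using prob_integral_bound(1)[OF that BH(1)[OF f] BH(2)[OF f]] prob_integral_bound(1)[OF that lc] by simp
 have "\<bar>(\<integral>x. lowpass N m bw f x \<partial>mu) - (\<integral>x. lowpass N m bw f x \<partial>?T ?g)\<bar> \<le> Cl * ?W * (2 * s)"
 by (rule Cl(2)[OF f bw mu Tp[OF g(1)] low])
 moreover have "\<bar>\<integral>x. f x - lowpass N m bw f x \<partial>?T ?g\<bar> \<le> Ch * ?R" by (rule Ch(2)[OF g(1) f bw])
 moreover have "\<bar>\<integral>x. f x - lowpass N m bw f x \<partial>mu\<bar> \<le> Ch * ?R" unfolding mu_def by (rule Ch(2)[OF T(1) f bw])
 moreover have "Cl * ?W * (2 * s) = 2 * Cl * ?W * s" by simp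
 ultimately show "(\<integral>x. f x \<partial>?T ?g) - (\<integral>x. f x \<partial>mu) \<le> 2 * Cl * ?W * s + 2 * Ch * ?R"
 unfolding split[OF mu] split[OF Tp[OF g(1)]] by linarith
 qed
 then have "ennreal (ipm ?H (?T ?g) mu) \<le> ennreal (2 * Cl * ?W * s + 2 * Ch * ?R)" by (rule ennreal_leI)
 also have "... = ennreal (2 * Cl * ?W) * ennreal s + ennreal (2 * Ch * ?R)"
 using Cl(1) Ch(1) R real(1) by (subst ennreal_plus) (auto simp: ennreal_mult)
 finally show ?thesis using real by simp
 next
 \<comment> \<open>If the majorant is infinite so is the right side, because its factor is
   positive.\<close>
 case top
 have "?W \<noteq> 0" using max.cobounded1[of 1 "bw powr (\<gamma> - et)"] by linarith
 then have "ennreal (2 * Cl * ?W) * S X = \<infinity>" using top Cl(1) by (simp add: ennreal_mult_top)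
 then show ?thesis by simp
 qed
 interpret PP: prob_space "PiM {..<n} (%_. mu)" by (rule prob_space_PiM) (rule mu)
 have "(\<integral>\<^sup>+X. ennreal (ipm ?H (?T (g_hat n X)) (prob_of_density p)) \<partial>sample_law n p)
 \<le> (\<integral>\<^sup>+X. ennreal (2 * Cl * ?W) * S X + ennreal (2 * Ch * ?R) \<partial>PiM {..<n} (%_. mu))"
 unfolding sample_law_def pe by (rule nn_integral_mono) (rule bound)
 also have "... = ennreal (2 * Cl * ?W) * (\<integral>\<^sup>+X. S X \<partial>PiM {..<n} (%_. mu)) + ennreal (2 * Ch * ?R)"
 using S1 by (subst nn_integral_add, simp, simp) (simp only: nn_integral_cmult[OF S1] nn_integral_const PP.emeasure_space_1 mult_1_right)
 also have "... \<le> ennreal (2 * Cl * ?W) * ennreal (Ce * n powr (- 1/2) * ln n) + ennreal (2 * Ch * ?R)"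
 by (intro add_mono mult_left_mono S3) auto
 also have "... = ennreal (2 * Cl * ?W * (Ce * n powr (- 1/2) * ln n) + 2 * Ch * ?R)"
 using Cl(1) Ce(1) Ch(1) R n by (subst ennreal_plus) (auto simp: ennreal_mult)
 also have "... \<le> ennreal (C * (?W * (n powr (- 1/2) * ln n) + ?R))"
 proof (rule ennreal_leI)
 let ?A = "?W * (n powr (- 1/2) * ln n)"
 have A: "?A \<ge> 0" using n by (intro mult_nonneg_nonneg) auto
 have "2 * Cl * ?W * (Ce * n powr (- 1/2) * ln n) = (2 * Cl * Ce) * ?A" by simp
 moreover have "C * (?A + ?R) = (2 * Cl * Ce) * ?A + (2 * Ch) * ?A + (2 * Cl * Ce) * ?R + (2 * Ch) * ?R"
 by (simp only: C_def distrib_left distrib_right add.assoc)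
 moreover have "0 \<le> (2 * Ch) * ?A" by (rule mult_nonneg_nonneg[OF _ A]) (use Ch(1) in simp)
 moreover have "0 \<le> 2 * Cl * Ce" using Cl(1) Ce(1) by (intro mult_nonneg_nonneg) auto
 then have "0 \<le> (2 * Cl * Ce) * ?R" by (rule mult_nonneg_nonneg[OF _ R])
 ultimately show "2 * Cl * ?W * (Ce * n powr (- 1/2) * ln n) + 2 * Ch * ?R \<le> C * (?A + ?R)" by linarith
 qed
 finally show "(\<integral>\<^sup>+X. ennreal (ipm ?H (?T (g_hat n X)) (prob_of_density p)) \<partial>sample_law n p)
 \<le> ennreal (C * (max 1 (bw powr (\<gamma> - CARD('n) / 2)) * (n powr (- 1/2) * ln n) + ?R))" unfolding et_def .
 qed
 qed
qed

text \<open>Two instances of \<open>lower_core\<close>: one bump of fixed width and height of order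
  \<open>N powr (- 1/2)\<close> for the parametric rate, and width of order
  \<open>N powr (- a)\<close> with the largest height that the density class permits for the
  nonparametric one.\<close>

lemma lower_rate:
 fixes \<beta> \<gamma> K :: real
 assumes K: "K \<ge> 1" and \<beta>: "\<beta> > 0" and \<gamma>: "\<gamma> > 0"
 defines "a \<equiv> 1 / (2 * \<beta> + real CARD('n::finite))"
 obtains c :: real where "c > 0" "!!N (\<theta> :: (nat => real^'n) => (real^'n) measure). N \<ge> 2 ==> \<theta> \<in> estimators N ==>
 ennreal (c * max (real N powr (- 1/2)) (real N powr (- a * (\<beta> + \<gamma>)) * ln N powr (- 2))) \<le> max_risk \<beta> K \<gamma> N \<theta>"
proof -
 let ?d = "CARD('n)"
 have a: "a > 0" unfolding a_def using \<beta> by (simp add: add_pos_nonneg)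
 have ad: "a * (2 * \<beta> + real ?d) = 1" unfolding a_def using \<beta> by (simp add: add_pos_nonneg order_less_imp_not_eq2)
 obtain c c1 c2 :: real where c: "c > 0" "c1 > 0" "c2 > 0" and
 core: "!!N q (\<theta> :: (nat => real^'n) => (real^'n) measure) ep bw. N > 0 ==> \<theta> \<in> estimators N ==> q > 0 ==> bw = 1 / (4 * real q) ==> 0 < ep ==>
 ep \<le> c1 * bw powr \<beta> * (1 + ln (1 / bw)) powr (- 2) ==> ep\<^sup>2 * bw ^ ?d * real N \<le> c2 ==>
 ennreal (c * (bw powr \<gamma> * ep)) \<le> max_risk \<beta> K \<gamma> N \<theta>"
 proof (rule lower_core[OF K \<beta> \<gamma>, where 'n = 'n])
 fix c c1 c2 :: real
 assume "c > 0" "c1 > 0" "c2 > 0" "!!N q (\<theta> :: (nat => real^'n) => (real^'n) measure) ep bw. N > 0 ==> \<theta> \<in> estimators N ==> q > 0 ==> bw = 1 / (4 * real q) ==> 0 < ep ==>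
 ep \<le> c1 * bw powr \<beta> * (1 + ln (1 / bw)) powr (- 2) ==> ep\<^sup>2 * bw ^ ?d * real N \<le> c2 ==>
 ennreal (c * (bw powr \<gamma> * ep)) \<le> max_risk \<beta> K \<gamma> N \<theta>"
 then show thesis by (rule that)
 qed
 \<comment> \<open>Bounds \<open>1 + ln (8 * N powr a)\<close> by \<open>A * ln N\<close>; constants
   are absorbed by \<open>ln N \<ge> ln 2\<close>, which holds from \<open>N = 2\<close> on.\<close>
 define A where "A = (1 + ln 8) / ln 2 + a"
 have A: "A > 0" unfolding A_def using a by (intro add_nonneg_pos) auto
 define c3 where "c3 = min c1 (sqrt c2)"
 have c3: "c3 > 0" "c3 \<le> c1" "c3\<^sup>2 \<le> c2"
 proof -
 show c3: "c3 > 0" "c3 \<le> c1" unfolding c3_def using c by auto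
 have "c3\<^sup>2 \<le> (sqrt c2)\<^sup>2" by (rule power_mono) (use c3 in \<open>auto simp: c3_def\<close>)
 then show "c3\<^sup>2 \<le> c2" using c by simp
 qed
 define w4 where "w4 = (1/4) powr \<beta> * (1 + ln 4) powr (- 2 :: real)"
 have "ln (4 :: real) > 0" by simp
 then have "1 + ln (4 :: real) \<noteq> 0" by linarith
 then have w4: "w4 > 0" unfolding w4_def by simp
 define c4 where "c4 = min (c1 * w4) (sqrt c2)"
 have c4: "c4 > 0" "c4 \<le> c1 * w4" "c4\<^sup>2 \<le> c2"
 proof -
 show c4: "c4 > 0" "c4 \<le> c1 * w4" unfolding c4_def using c w4 by auto
 have "c4\<^sup>2 \<le> (sqrt c2)\<^sup>2" by (rule power_mono) (use c4 in \<open>auto simp: c4_def\<close>)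
 then show "c4\<^sup>2 \<le> c2" using c by simp
 qed
 define c5 where "c5 = c3 * (1/8) powr (\<beta> + \<gamma>) * A powr (- 2)"
 have c5: "c5 > 0" unfolding c5_def using c3 A by simp
 define c6 where "c6 = (1/4) powr \<gamma> * c4"
 have c6: "c6 > 0" unfolding c6_def using c4 by simp
 define cc where "cc = c * min c5 c6"
 have cc: "cc > 0" unfolding cc_def using c c5 c6 by simp
 show thesis
 proof (rule that[OF cc])
 fix N and \<theta> :: "(nat => real^'n) => (real^'n) measure" assume N: "N \<ge> 2" and \<theta>: "\<theta> \<in> estimators N"
 let ?R = "max_risk \<beta> K \<gamma> N \<theta>"
 have N0: "N > 0" and N1: "real N \<ge> 1" "real N > 0" using N by auto
 have l: "ln 2 \<le> ln (real N)" "ln (real N) > 0" using N by auto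
 have one: "ennreal (cc * real N powr (- 1/2)) \<le> ?R"
 proof -
 have h: "(real N powr (- 1/2))\<^sup>2 * real N = 1"
 using N1 by (simp add: power2_eq_square powr_minus_divide flip: powr_add)
 \<comment> \<open>With \<open>q = 1\<close> there is a single bump of width 1/4, and
   \<open>w4\<close> is the value of the class condition at that width.\<close>
 have f1: "ennreal (c * ((1/4) powr \<gamma> * (c4 * real N powr (- 1/2)))) \<le> ?R"
 proof (rule core[OF N0 \<theta>, of 1])
 have "c4 * real N powr (- 1/2) \<le> (c1 * w4) * 1"
 using c4 N1 by (intro mult_mono) (auto simp: powr_minus_divide divide_le_eq_1 ge_one_powr_ge_zero)
 then show "c4 * real N powr (- 1/2) \<le> c1 * (1/4) powr \<beta> * (1 + ln (1 / (1/4))) powr (- 2)" by (simp add: w4_def mult.assoc)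
 have "(1/4 :: real) ^ ?d \<le> 1" by (rule power_le_one) auto
 then have "c4\<^sup>2 * (1/4) ^ ?d \<le> c2 * 1" using c4 c by (intro mult_mono) auto
 moreover have "(c4 * real N powr (- 1/2))\<^sup>2 * (1/4) ^ ?d * real N = c4\<^sup>2 * (1/4) ^ ?d * ((real N powr (- 1/2))\<^sup>2 * real N)"
 by (simp only: power_mult_distrib mult_ac)
 ultimately show "(c4 * real N powr (- 1/2))\<^sup>2 * (1/4) ^ ?d * real N \<le> c2" unfolding h by linarith
 qed (use c4 N1 in auto)
 have "cc * real N powr (- 1/2) \<le> c * c6 * real N powr (- 1/2)" unfolding cc_def using c by (intro mult_right_mono mult_left_mono) auto
 also have "... = c * ((1/4) powr \<gamma> * (c4 * real N powr (- 1/2)))" by (simp only: c6_def mult.assoc)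
 finally have f0: "cc * real N powr (- 1/2) \<le> c * ((1/4) powr \<gamma> * (c4 * real N powr (- 1/2)))" .
 show ?thesis by (rule order_trans[OF ennreal_leI[OF f0] f1])
 qed
 have two: "ennreal (cc * (real N powr (- a * (\<beta> + \<gamma>)) * ln N powr (- 2))) \<le> ?R"
 proof -
 \<comment> \<open>With \<open>bw \<le> 1 / t\<close> this exponent gives
   \<open>bw powr (2 * \<beta> + d) * N \<le> 1\<close>, the condition for indistinguishability at
   height \<open>bw powr \<beta>\<close>. Rounding \<open>t\<close> up to the integer
   \<open>q\<close> costs a factor of at most 2.\<close>
 define t where "t = real N powr a"
 have t: "t \<ge> 1" unfolding t_def using N1 a by (intro ge_one_powr_ge_zero) auto
 define q where "q = nat \<lceil>t\<rceil>"
 have q: "t \<le> real q" "real q \<le> 2 * t" "q > 0"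
 proof -
 show "t \<le> real q" unfolding q_def by (rule real_nat_ceiling_ge)
 have "real q = of_int \<lceil>t\<rceil>" unfolding q_def using t by (simp add: ceiling_le_iff)
 then show "real q \<le> 2 * t" using t by linarith
 show "q > 0" using t \<open>t \<le> real q\<close> by (cases q) auto
 qed
 define bw where "bw = 1 / (4 * real q)"
 have bw: "0 < bw" "1 / (8 * t) \<le> bw" "bw \<le> 1 / t"
 unfolding bw_def using q t by (auto intro!: divide_left_mono)
 have bw1: "bw \<le> 1" using bw(3) t by (intro order_trans[OF bw(3)]) auto
 define w where "w = 1 + ln (1 / bw)"
 have w: "1 \<le> w" "w \<le> A * ln N"
 proof -
 show "1 \<le> w" unfolding w_def using bw bw1 by (simp add: ln_ge_zero)
 have "1 / bw \<le> 8 * t" using bw(1,2) t by (simp add: field_simps)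
 then have "ln (1 / bw) \<le> ln (8 * t)" using bw(1) by (intro ln_mono) auto
 also have "... = ln 8 + a * ln N" using t N1 by (simp add: ln_mult t_def ln_powr)
 finally have "w \<le> (1 + ln 8) * 1 + a * ln N" unfolding w_def by simp
 also have "... \<le> (1 + ln 8) * (ln N / ln 2) + a * ln N"
 using l by (intro add_right_mono mult_left_mono) auto
 also have "... = A * ln N" by (simp add: A_def distrib_right)
 finally show "w \<le> A * ln N" .
 qed
 define ep where "ep = c3 * bw powr \<beta> * w powr (- 2)"
 have f2: "ennreal (c * (bw powr \<gamma> * ep)) \<le> ?R"
 proof (rule core[OF N0 \<theta> q(3) bw_def])
 show "0 < ep" unfolding ep_def using c3 bw w by simp
 show "ep \<le> c1 * bw powr \<beta> * (1 + ln (1 / bw)) powr (- 2)"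
 unfolding ep_def w_def using c3 by (intro mult_right_mono) auto
 have "w powr (- 2) \<le> 1" using w powr_mono[of "-2" 0 w] by simp
 then have "ep \<le> c3 * bw powr \<beta> * 1" unfolding ep_def using c3 by (intro mult_left_mono) auto
 then have "ep\<^sup>2 \<le> (c3 * bw powr \<beta>)\<^sup>2" using \<open>0 < ep\<close> by (intro power_mono) auto
 also have "... = c3\<^sup>2 * (bw powr \<beta> * bw powr \<beta>)" by (simp only: power2_eq_square mult_ac)
 also have "bw powr \<beta> * bw powr \<beta> = bw powr (2 * \<beta>)" by (simp only: powr_add[symmetric] mult_2)
 also have "c3\<^sup>2 * bw powr (2 * \<beta>) \<le> c2 * bw powr (2 * \<beta>)" using c3(3) by (intro mult_right_mono) auto
 finally have e2: "ep\<^sup>2 \<le> c2 * bw powr (2 * \<beta>)" .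
 have "ep\<^sup>2 * bw ^ ?d * real N \<le> c2 * bw powr (2 * \<beta>) * bw ^ ?d * real N"
 using e2 bw by (intro mult_right_mono) auto
 also have "... = c2 * (bw powr (2 * \<beta> + real ?d) * real N)" using bw by (simp add: powr_add powr_realpow)
 also have "... \<le> c2 * 1"
 proof (rule mult_left_mono)
 have "bw powr (2 * \<beta> + real ?d) \<le> (1 / t) powr (2 * \<beta> + real ?d)" using bw \<beta> by (intro powr_mono2) auto
 also have "(1 / t) powr (2 * \<beta> + real ?d) = 1 / real N"
 using ad N1 by (simp add: t_def powr_divide powr_powr)
 finally show "bw powr (2 * \<beta> + real ?d) * real N \<le> 1" using N1 by (simp add: field_simps)
 qed (use c in auto)
 finally show "ep\<^sup>2 * bw ^ ?d * real N \<le> c2" by simp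
 qed
 have f3: "cc * (real N powr (- a * (\<beta> + \<gamma>)) * ln N powr (- 2)) \<le> c * (bw powr \<gamma> * ep)"
 proof -
 have "(1/8) powr (\<beta> + \<gamma>) * real N powr (- a * (\<beta> + \<gamma>)) = (1 / (8 * t)) powr (\<beta> + \<gamma>)"
 using N1 t by (simp add: t_def powr_divide powr_mult powr_powr powr_minus_divide)
 also have "... \<le> bw powr (\<beta> + \<gamma>)" using bw t \<beta> \<gamma> by (intro powr_mono2) auto
 finally have 1: "(1/8) powr (\<beta> + \<gamma>) * real N powr (- a * (\<beta> + \<gamma>)) \<le> bw powr (\<beta> + \<gamma>)" .
 have "A powr (- 2) * ln N powr (- 2) = (A * ln N) powr (- 2)" using A l by (simp add: powr_mult)
 also have "... \<le> w powr (- 2)" using w by (intro powr_mono2') auto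
 finally have 2: "A powr (- 2) * ln N powr (- 2) \<le> w powr (- 2)" .
 have "c5 * (real N powr (- a * (\<beta> + \<gamma>)) * ln N powr (- 2))
 = c3 * (((1/8) powr (\<beta> + \<gamma>) * real N powr (- a * (\<beta> + \<gamma>))) * (A powr (- 2) * ln N powr (- 2)))"
 by (simp add: c5_def)
 also have "... \<le> c3 * (bw powr (\<beta> + \<gamma>) * w powr (- 2))"
 using c3 1 2 by (intro mult_left_mono mult_mono) auto
 also have "... = bw powr \<gamma> * ep" by (simp add: ep_def powr_add)
 finally have "c * (c5 * (real N powr (- a * (\<beta> + \<gamma>)) * ln N powr (- 2))) \<le> c * (bw powr \<gamma> * ep)"
 using c by (intro mult_left_mono) auto
 moreover have "cc * (real N powr (- a * (\<beta> + \<gamma>)) * ln N powr (- 2)) \<le> c * c5 * (real N powr (- a * (\<beta> + \<gamma>)) * ln N powr (- 2))"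
 unfolding cc_def using c by (intro mult_right_mono mult_left_mono) auto
 ultimately show ?thesis by (simp add: mult.assoc)
 qed
 show ?thesis by (rule order_trans[OF ennreal_leI[OF f3] f2])
 qed
 show "ennreal (cc * max (real N powr (- 1/2)) (real N powr (- a * (\<beta> + \<gamma>)) * ln N powr (- 2))) \<le> ?R"
 using one two by (simp add: max_def)
 qed
qed

text \<open>A unit vector tested against the two Loewner bounds would give
  \<open>inverse K \<le> K\<close>.\<close>

lemma density_class_empty:
 assumes "K > 0" "K < 1"
 shows "(density_class \<beta> K :: (real^'n::finite => real) set) = {}"
proof -
 have "M \<notin> (sym_between K :: (real^'n^'n) set)" for M
 proof
 assume M: "M \<in> (sym_between K :: (real^'n^'n) set)"
 define x where "x = (axis undefined 1 :: real^'n)"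
 have x: "x \<bullet> x = 1" by (simp add: x_def inner_axis_axis)
 have m: "mat c *v x = c *\<^sub>R x" for c
 by (simp add: vec_eq_iff matrix_vector_mult_def mat_def if_distrib if_distribR cong: if_cong)
 have "x \<bullet> (mat (inverse K) *v x) \<le> x \<bullet> (M *v x)" "x \<bullet> (M *v x) \<le> x \<bullet> (mat K *v x)"
 using M unfolding sym_between_def loewner_le_def by auto
 then have "inverse K \<le> K" unfolding m by (simp add: x)
 moreover have "1 < inverse K" using assms by (simp add: one_less_inverse_iff)
 ultimately show False using assms by linarith
 qed
 then show ?thesis unfolding density_class_def by blast
qed

theorem theorem5:
 fixes \<beta> K L C0 :: real
 and g_hat :: "nat \<Rightarrow> (nat \<Rightarrow> real^'d::finite) \<Rightarrow> real^'d \<Rightarrow> real^'d"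
 assumes "\<beta> > 0" and "K > 0"
 and "admissible_constants TYPE('d) \<beta> K L C0"
 and "\<And>n. n \<ge> 2 \<Longrightarrow> is_gan_estimator \<beta> L C0 n (g_hat n)"
 shows "\<forall>\<gamma>>0. \<exists>C>0. \<exists>C2>0. \<forall>n\<ge>2.
 max_risk \<beta> K \<gamma> n (\<lambda>X. distr gauss_measure borel (g_hat n X))
 \<le> ennreal (C * ln (real n) powr C2)
 * (INF \<theta>\<in>(estimators n :: ((nat \<Rightarrow> real^'d) \<Rightarrow> (real^'d) measure) set).
 max_risk \<beta> K \<gamma> n \<theta>)"
proof (intro allI impI)
 fix \<gamma> :: real assume \<gamma>: "\<gamma> > 0"
 show "\<exists>C>0. \<exists>C2>0. \<forall>n\<ge>2.
 max_risk \<beta> K \<gamma> n (\<lambda>X. distr gauss_measure borel (g_hat n X))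
 \<le> ennreal (C * ln (real n) powr C2)
 * (INF \<theta>\<in>(estimators n :: ((nat \<Rightarrow> real^'d) \<Rightarrow> (real^'d) measure) set).
 max_risk \<beta> K \<gamma> n \<theta>)"
 proof (cases "K < 1")
 case True
 \<comment> \<open>The supremum over an empty set is 0 in \<open>ennreal\<close>, so both sides
   vanish.\<close>
 then have "max_risk \<beta> K \<gamma> n \<theta> = 0" for n and \<theta> :: "(nat \<Rightarrow> real^'d) \<Rightarrow> (real^'d) measure"
 using density_class_empty[OF assms(2), where 'n = 'd] by (simp add: max_risk_def bot_ennreal)
 then show ?thesis by (intro exI[of _ 1] conjI) auto
 next
 case False
 then have K: "K \<ge> 1" by simp
 let ?d = "CARD('d)"
 define a where "a = 1 / (2 * \<beta> + real ?d)"
 have a: "a > 0" unfolding a_def using assms(1) by (simp add: add_pos_nonneg)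
 have ad: "a * (2 * \<beta> + real ?d) = 1" unfolding a_def using assms(1) by (simp add: add_pos_nonneg order_less_imp_not_eq2)
 obtain c where c: "c > 0" and low: "\<And>N (\<theta> :: (nat \<Rightarrow> real^'d) \<Rightarrow> (real^'d) measure). N \<ge> 2 \<Longrightarrow> \<theta> \<in> estimators N \<Longrightarrow>
 ennreal (c * max (real N powr (- 1/2)) (real N powr (- a * (\<beta> + \<gamma>)) * ln N powr (- 2))) \<le> max_risk \<beta> K \<gamma> N \<theta>"
 by (rule lower_rate[OF K assms(1) \<gamma>, where 'n = 'd, folded a_def], rule that)
 obtain C where C: "C > 0" and up: "\<And>n bw. n \<ge> 2 \<Longrightarrow> 0 < bw \<Longrightarrow> bw \<le> 1 \<Longrightarrow>
 max_risk \<beta> K \<gamma> n (\<lambda>X. distr gauss_measure borel (g_hat n X))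
 \<le> ennreal (C * (max 1 (bw powr (\<gamma> - ?d / 2)) * (n powr (- 1/2) * ln n) + bw powr (\<beta> + \<gamma>) * (1 + ln (1 / bw)) ^ ?d))"
 by (rule gan_risk_upper[OF assms(1) \<gamma> assms(3) assms(4)], assumption, rule that)
 define b where "b = 1 / ln (2 :: real)"
 have b: "b \<ge> 1" unfolding b_def using ln_2_less_1 by simp
 define H where "H = 1 + (1 + a) ^ ?d"
 have H: "H > 0" unfolding H_def using a by (simp add: add_pos_pos)
 \<comment> \<open>The exponent \<open>d + 3\<close> covers both parts: one logarithm from the
   empirical process or \<open>d\<close> from the tails, and two more for the weight in the lower
   bound.\<close>
 define Cf where "Cf = C * H * b ^ (?d + 3) / c"
 have Cf: "Cf > 0" unfolding Cf_def using C H b c by simp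
 have "max_risk \<beta> K \<gamma> n (\<lambda>X. distr gauss_measure borel (g_hat n X))
 \<le> ennreal (Cf * ln (real n) powr real (?d + 3))
 * (INF \<theta>\<in>(estimators n :: ((nat \<Rightarrow> real^'d) \<Rightarrow> (real^'d) measure) set). max_risk \<beta> K \<gamma> n \<theta>)"
 if n: "n \<ge> 2" for n
 proof -
 define l where "l = ln (real n)"
 have n1: "real n \<ge> 1" "real n > 0" using n by auto
 have l: "ln 2 \<le> l" "l > 0" unfolding l_def using n by auto
 \<comment> \<open>\<open>ln n\<close> is below 1 for \<open>n = 2\<close>; after division by
   \<open>ln 2\<close> it is at least 1, so that lower powers may be replaced by higher
   ones.\<close>
 define y where "y = l * b"
 have y: "y \<ge> 1" "l \<le> y"
 proof -
 show "y \<ge> 1" unfolding y_def b_def using l by simp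
 show "l \<le> y" unfolding y_def using b l mult_left_mono[of 1 b l] by simp
 qed
 define s where "s = real n powr (- 1/2)"
 define r where "r = real n powr (- a * (\<beta> + \<gamma>))"
 define Mx where "Mx = max s (r * l powr (- 2))"
 have sr: "s > 0" "r > 0" unfolding s_def r_def using n1 by auto
 have Mx: "Mx > 0" unfolding Mx_def using sr by (simp add: less_max_iff_disj)
 have y2: "y\<^sup>2 \<ge> 1" using y by (simp add: one_le_power)
 have sM: "s \<le> Mx * y\<^sup>2"
 proof -
 have "s \<le> Mx * 1" by (simp add: Mx_def)
 also have "\<dots> \<le> Mx * y\<^sup>2" using Mx y2 by (intro mult_left_mono) auto
 finally show ?thesis .
 qed
 \<comment> \<open>The nonparametric lower bound is short of \<open>r\<close> by the square of the
   logarithm, which \<open>y\<close> restores.\<close>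
 have rM: "r \<le> Mx * y\<^sup>2"
 proof -
 have "r = (r * l powr (- 2)) * l\<^sup>2" using l by (simp add: powr_minus powr_numeral)
 also have "\<dots> \<le> Mx * l\<^sup>2" by (intro mult_right_mono) (auto simp: Mx_def)
 also have "\<dots> \<le> Mx * y\<^sup>2" using Mx y l by (intro mult_left_mono power_mono) auto
 finally show ?thesis .
 qed
 \<comment> \<open>This scale equates \<open>bw powr (\<beta> + \<gamma>)\<close> with the
   nonparametric rate \<open>r\<close>.\<close>
 define bw where "bw = real n powr (- a)"
 have bw: "bw > 0" "bw \<le> 1" unfolding bw_def using n1 a powr_mono[of "-a" 0 "real n"] by auto
 have dl: "ln (1 / bw) = a * l" using n1 by (simp add: bw_def l_def ln_div ln_powr)
 have dr: "bw powr (\<beta> + \<gamma>) = r" by (simp add: bw_def r_def powr_powr)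
 \<comment> \<open>At the same scale the cost of passing to discriminators, times the parametric
   rate, is again exactly \<open>r\<close>. Hence the maximum in the upper bound is
   \<open>max s r\<close>, whichever of \<gamma> and \<open>d / 2\<close> is larger.\<close>
 have ds: "bw powr (\<gamma> - ?d / 2) * s = r"
 proof -
 have "- a * (\<gamma> - ?d / 2) + - 1/2 = - a * (\<beta> + \<gamma>) + (a * (2 * \<beta> + real ?d) - 1) / 2" by (simp add: field_simps)
 then have e: "- a * (\<gamma> - ?d / 2) + - 1/2 = - a * (\<beta> + \<gamma>)" unfolding ad by simp
 have "bw powr (\<gamma> - ?d / 2) * s = real n powr (- a * (\<gamma> - ?d / 2)) * real n powr (- 1/2)"
 unfolding bw_def s_def powr_powr ..
 also have "\<dots> = r" unfolding powr_add[symmetric] e r_def ..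
 finally show ?thesis .
 qed
 have part1: "max 1 (bw powr (\<gamma> - ?d / 2)) * (s * l) \<le> Mx * y ^ (?d + 3)"
 proof -
 have "max 1 (bw powr (\<gamma> - ?d / 2)) * s = max s r"
 using ds sr max_mult_distrib_right[of 1 "bw powr (\<gamma> - ?d / 2)" s] by simp
 then have "max 1 (bw powr (\<gamma> - ?d / 2)) * (s * l) = max s r * l" by (simp only: mult.assoc[symmetric])
 also have "\<dots> \<le> (Mx * y\<^sup>2) * y" using sM rM y l Mx by (intro mult_mono) auto
 also have "\<dots> = Mx * y ^ 3" by (simp add: power2_eq_square power3_eq_cube)
 also have "\<dots> \<le> Mx * y ^ (?d + 3)" using Mx y by (intro mult_left_mono power_increasing) auto
 finally show ?thesis .
 qed
 have part2: "r * (1 + a * l) ^ ?d \<le> (1 + a) ^ ?d * (Mx * y ^ (?d + 3))"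
 proof -
 have "1 + a * l \<le> y + a * y" using y a by (intro add_mono mult_left_mono) auto
 then have "1 + a * l \<le> (1 + a) * y" by (simp add: distrib_right)
 then have "(1 + a * l) ^ ?d \<le> ((1 + a) * y) ^ ?d" using a l by (intro power_mono) auto
 then have "r * (1 + a * l) ^ ?d \<le> (Mx * y\<^sup>2) * ((1 + a) * y) ^ ?d"
 using rM a l y Mx by (intro mult_mono) auto
 also have "\<dots> = (1 + a) ^ ?d * (Mx * y ^ (?d + 2))" by (simp add: power_mult_distrib power_add power2_eq_square)
 also have "\<dots> \<le> (1 + a) ^ ?d * (Mx * y ^ (?d + 3))" using Mx y a by (intro mult_left_mono power_increasing) auto
 finally show ?thesis .
 qed
 have "max_risk \<beta> K \<gamma> n (\<lambda>X. distr gauss_measure borel (g_hat n X))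
 \<le> ennreal (C * (max 1 (bw powr (\<gamma> - ?d / 2)) * (s * l) + r * (1 + a * l) ^ ?d))"
 using up[OF n bw] unfolding dl dr s_def l_def .
 also have "\<dots> \<le> ennreal (Cf * l powr real (?d + 3) * (c * Mx))"
 proof (rule ennreal_leI)
 have "C * (max 1 (bw powr (\<gamma> - ?d / 2)) * (s * l) + r * (1 + a * l) ^ ?d) \<le> C * (Mx * y ^ (?d + 3) + (1 + a) ^ ?d * (Mx * y ^ (?d + 3)))"
 using C part1 part2 by (intro mult_left_mono add_mono) auto
 also have "\<dots> = C * H * (b ^ (?d + 3) * l ^ (?d + 3)) * Mx"
 unfolding H_def y_def power_mult_distrib by (simp only: distrib_left distrib_right mult_1_left mult_ac)
 also have "\<dots> = Cf * l ^ (?d + 3) * (c * Mx)" unfolding Cf_def using c by simp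
 also have "l ^ (?d + 3) = l powr real (?d + 3)" by (rule powr_realpow[symmetric]) (rule l)
 finally show "C * (max 1 (bw powr (\<gamma> - ?d / 2)) * (s * l) + r * (1 + a * l) ^ ?d) \<le> Cf * l powr real (?d + 3) * (c * Mx)" .
 qed
 also have "\<dots> = ennreal (Cf * l powr real (?d + 3)) * ennreal (c * Mx)"
 using Cf Mx c by (intro ennreal_mult) auto
 also have "\<dots> \<le> ennreal (Cf * l powr real (?d + 3))
 * (INF \<theta>\<in>(estimators n :: ((nat \<Rightarrow> real^'d) \<Rightarrow> (real^'d) measure) set). max_risk \<beta> K \<gamma> n \<theta>)"
 by (intro mult_left_mono INF_greatest) (use low[OF n] in \<open>simp_all add: Mx_def s_def r_def l_def\<close>)
 finally show ?thesis unfolding l_def .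
 qed
 then show ?thesis using Cf by (intro exI[of _ Cf] conjI exI[of _ "real (?d + 3)"]) auto
 qed
qed

end
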